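(* Let $X$ be a complex manifold of complex dimension $n$ endowed with a holomorphic principal $G$-bundle $P$. Assume that $(g,h)$, with $g$ a Hermitian metric on $X$ with Hermitian form $\omega$ and $h$ a reduction of $P$ to a maximal compact subgroup $K$ with Lie algebra $\mathfrak{k}$, solves the coupled Hermitian-Einstein system $$F_h\wedge\omega^{n-1}=\frac{z}{n}\omega^n,\qquad\rho_B+\langle z,F_h\rangle=0,\qquad dd^c\omega+\langle F_h\wedge F_h\rangle=0,$$ where $z$ is a central element of $\mathfrak{k}$. Consider the holomorphic vector bundle $\mathcal{Q}_{P,2i\partial\omega,\theta^h}$ endowed with the (possibly indefinite) Hermitian metric $$\mathbf{G}(V+r+\xi,V+r+\xi)=g(V,\overline V)+\tfrac14g^{-1}(\xi,\overline\xi)-\langle r,\overline r\rangle.$$ Then $\mathbf{G}$ solves the Hermitian-Einstein equation $F_{\mathbf{G}}\wedge\omega^{n-1}=0$.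
   Context: $G$ is a complex reductive Lie group with Lie algebra $\mathfrak{g}$ carrying a fixed non-degenerate bi-invariant symmetric bilinear form $\langle\,,\rangle:\mathfrak{g}\otimes\mathfrak{g}\to\mathbb{C}$ with $\langle\mathfrak{k},\mathfrak{k}\rangle\subset\mathbb{R}$ for every compact Lie subalgebra $\mathfrak{k}\subset\mathfrak{g}$. $P_h$ is the $K$-bundle defined by $h$, $\theta^h$ the Chern connection of $h$, $F_h$ its curvature; $\overline r$ is conjugation on $\operatorname{ad}P=\operatorname{ad}P_h\otimes\mathbb{C}$; the central element $z$ is viewed as a section of $\operatorname{ad}P_h$. $J$ is the complex structure, $\omega=g(J\cdot,\cdot)$, $d^c=i(\bar\partial-\partial)$ (so $dd^c=2i\partial\bar\partial$). The Bismut connection is $\nabla^B=\nabla-\frac12g^{-1}d^c\omega$, with $\nabla$ the Levi-Civita connection and $(g^{-1}d^c\omega)(V,W)=g^{-1}(d^c\omega(V,W,\cdot))$, and the Bismut Ricci form is $\rho_B(V,W)=\frac12\sum_{j=1}^{2n}g(R_{\nabla^B}(V,W)Je_j,e_j)$ for any $g$-orthonormal basis $e_1,\dots,e_{2n}$ of $T$. $\mathcal{Q}_{P,2i\partial\omega,\theta^h}$ has underlying smooth bundle $T^{1,0}\oplus\operatorname{ad}P\oplus T^*_{1,0}$ and Dolbeault operator $$\bar\partial_0(V+r+\xi)=\bar\partial V+i_VF_h+\bar\partial^{\theta^h}r+\bar\partial\xi-i_V(2i\partial\omega)+2\langle F_h,r\rangle,$$ where contracted with $\bar Z\in T^{0,1}$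 the mixed terms are $F_h(V,\bar Z)$, $-(2i\partial\omega)(V,\bar Z,\cdot)$ and $2\langle F_h(\bar Z,\cdot),r\rangle$. $F_{\mathbf{G}}$ is the curvature of the Chern connection of $\mathbf{G}$. *)

theory Defs
  imports
    "HOL-Analysis.Analysis"
    "HOL-Combinatorics.Permutations"
    "HOL-Algebra.Group"
begin

section \<open>Complex normed spaces\<close>

text \<open>
  Finite-dimensional complex vector spaces serve as model spaces of complex manifolds. A type class
  without a basis is used because the Lie algebra of the structure group may be zero, which
  \<^class>\<open>euclidean_space\<close> and \<^typ>\<open>complex^'m\<close> exclude. Finite-dimensionality is imposed in
  \<open>complex_manifold\<close> below.
\<close>

class complex_normed_vector = real_normed_vector +
  fixes scaleC :: "complex \<Rightarrow> 'a \<Rightarrow> 'a"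
  assumes scaleC_add_right: "scaleC a (x + y) = scaleC a x + scaleC a y"
    and scaleC_add_left: "scaleC (a + b) x = scaleC a x + scaleC b x"
    and scaleC_scaleC: "scaleC a (scaleC b x) = scaleC (a * b) x"
    and scaleC_of_real: "scaleC (complex_of_real r) x = r *\<^sub>R x"
    and norm_scaleC: "norm (scaleC a x) = cmod a * norm x"

instantiation complex :: complex_normed_vector
begin
definition scaleC_complex_def: "scaleC a (x::complex) = a * x"
instance
  by standard (auto simp: scaleC_complex_def algebra_simps norm_mult scaleR_conv_of_real)
end

instantiation vec :: (complex_normed_vector, finite) complex_normed_vector
begin
definition scaleC_vec_def: "scaleC a (x::'a^'b) = (\<chi> i. scaleC a (x $ i))"
instance
proof
  fix a :: complex and x :: "'a^'b"
  have "norm (scaleC a x) = L2_set (\<lambda>i. cmod a * norm (x $ i)) UNIV"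
    by (simp add: norm_vec_def scaleC_vec_def norm_scaleC)
  also have "\<dots> = cmod a * norm x"
    by (simp add: norm_vec_def L2_set_right_distrib)
  finally show "norm (scaleC a x) = cmod a * norm x" .
qed (auto simp: scaleC_vec_def vec_eq_iff scaleC_add_right scaleC_add_left scaleC_scaleC
      scaleC_of_real)
end

instantiation prod :: (complex_normed_vector, complex_normed_vector) complex_normed_vector
begin
definition scaleC_prod_def: "scaleC a (x::'a \<times> 'b) = (scaleC a (fst x), scaleC a (snd x))"
instance
proof
  fix a :: complex and x :: "'a \<times> 'b"
  have "norm (scaleC a x) = sqrt ((cmod a)\<^sup>2 * ((norm (fst x))\<^sup>2 + (norm (snd x))\<^sup>2))"
    by (simp add: norm_prod_def scaleC_prod_def norm_scaleC power_mult_distrib distrib_left)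
  also have "\<dots> = cmod a * norm x"
    by (simp add: norm_prod_def real_sqrt_mult)
  finally show "norm (scaleC a x) = cmod a * norm x" .
qed (auto simp: scaleC_prod_def scaleC_add_right scaleC_add_left scaleC_scaleC scaleC_of_real
      prod_eq_iff)
end

definition complex_linear :: "('a::complex_normed_vector \<Rightarrow> 'b::complex_normed_vector) \<Rightarrow> bool" where
  "complex_linear f \<longleftrightarrow>
    (\<forall>x y. f (x + y) = f x + f y) \<and> (\<forall>c x. f (scaleC c x) = scaleC c (f x))"

definition dd :: "('a::real_normed_vector \<Rightarrow> 'b::real_normed_vector) \<Rightarrow> 'a \<Rightarrow> 'a \<Rightarrow> 'b" where
  "dd f p u = frechet_derivative f (at p) u"

text \<open>
  A holomorphic local chart identifies the real tangent space with the model space, the complex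
  structure J being multiplication by \<open>\<i>\<close>. A vector \<open>v\<close> then gives the vector
  \<open>(v - \<i> J v)/2\<close> of type (1,0), whose components in the coordinate frame are those of \<open>v\<close>, and
  its conjugate \<open>(v + \<i> J v)/2\<close> of type (0,1). For a real-linear \<open>f\<close>, the numbers
  \<open>ex10 f v\<close> and \<open>ex01 f v\<close> are the values of the complex-linear extension of \<open>f\<close> on these.
\<close>

definition ex10 :: "('a::complex_normed_vector \<Rightarrow> 'b::complex_normed_vector) \<Rightarrow> 'a \<Rightarrow> 'b" where
  "ex10 f v = (1/2) *\<^sub>R (f v - scaleC \<i> (f (scaleC \<i> v)))"

definition ex01 :: "('a::complex_normed_vector \<Rightarrow> 'b::complex_normed_vector) \<Rightarrow> 'a \<Rightarrow> 'b" where
  "ex01 f v = (1/2) *\<^sub>R (f v + scaleC \<i> (f (scaleC \<i> v)))"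

section \<open>Smooth and holomorphic maps, complex manifolds\<close>

primrec Ck_on :: "nat \<Rightarrow> 'a::real_normed_vector set \<Rightarrow> ('a \<Rightarrow> 'b::real_normed_vector) \<Rightarrow> bool" where
  "Ck_on 0 S f = continuous_on S f"
| "Ck_on (Suc k) S f =
    ((\<forall>x\<in>S. f differentiable (at x)) \<and> (\<forall>v. Ck_on k S (\<lambda>x. dd f x v)))"

definition smooth_on :: "'a::real_normed_vector set \<Rightarrow> ('a \<Rightarrow> 'b::real_normed_vector) \<Rightarrow> bool" where
  "smooth_on S f \<longleftrightarrow> (\<forall>k. Ck_on k S f)"

definition holo_on ::
  "'a::complex_normed_vector set \<Rightarrow> ('a \<Rightarrow> 'b::complex_normed_vector) \<Rightarrow> bool" where
  "holo_on S f \<longleftrightarrow> (\<forall>x\<in>S. \<exists>L. (f has_derivative L) (at x) \<and> complex_linear L)"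

type_synonym ('x, 'v) chart = "'x set \<times> ('x \<Rightarrow> 'v)"

definition chart_inv :: "('x, 'v) chart \<Rightarrow> 'v \<Rightarrow> 'x" where
  "chart_inv c = inv_into (fst c) (snd c)"

definition complex_manifold ::
  "('x::{t2_space, second_countable_topology}, 'v::complex_normed_vector) chart set \<Rightarrow> bool" where
  "complex_manifold A \<longleftrightarrow>
     (\<exists>B::'v set. finite B \<and> span B = UNIV) \<and>
     (\<forall>c\<in>A. open (fst c) \<and> open (snd c ` fst c) \<and>
        homeomorphism (fst c) (snd c ` fst c) (snd c) (chart_inv c)) \<and>
     (\<Union>c\<in>A. fst c) = UNIV \<and>
     (\<forall>c\<in>A. \<forall>c'\<in>A. holo_on (snd c ` (fst c \<inter> fst c')) (snd c' \<circ> chart_inv c))"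

definition prod_atlas ::
  "('x, 'v) chart set \<Rightarrow> ('y, 'w) chart set \<Rightarrow> ('x \<times> 'y, 'v \<times> 'w) chart set" where
  "prod_atlas A B = {(fst c \<times> fst d, map_prod (snd c) (snd d)) | c d. c \<in> A \<and> d \<in> B}"

definition holo_map_on ::
  "('x::topological_space, 'v::complex_normed_vector) chart set \<Rightarrow>
   ('y::topological_space, 'w::complex_normed_vector) chart set \<Rightarrow> 'x set \<Rightarrow> ('x \<Rightarrow> 'y) \<Rightarrow> bool" where
  "holo_map_on A B W f \<longleftrightarrow> continuous_on W f \<and>
     (\<forall>c\<in>A. \<forall>d\<in>B. holo_on (snd c ` (fst c \<inter> W \<inter> f -` fst d)) (snd d \<circ> f \<circ> chart_inv c))"

definition smooth_map_on ::
  "('x::topological_space, 'v::complex_normed_vector) chart set \<Rightarrow>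
   ('y::topological_space, 'w::complex_normed_vector) chart set \<Rightarrow> 'x set \<Rightarrow> ('x \<Rightarrow> 'y) \<Rightarrow> bool" where
  "smooth_map_on A B W f \<longleftrightarrow> continuous_on W f \<and>
     (\<forall>c\<in>A. \<forall>d\<in>B. smooth_on (snd c ` (fst c \<inter> W \<inter> f -` fst d)) (snd d \<circ> f \<circ> chart_inv c))"

section \<open>Complex Lie groups\<close>

definition complex_lie_group ::
  "'g::{t2_space, second_countable_topology} monoid \<Rightarrow>
   ('g, 'l::complex_normed_vector) chart set \<Rightarrow> bool" where
  "complex_lie_group G A \<longleftrightarrow>
     group G \<and> carrier G = UNIV \<and> complex_manifold A \<and>
     holo_map_on (prod_atlas A A) A UNIV (\<lambda>(a, b). a \<otimes>\<^bsub>G\<^esub> b) \<and>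
     holo_map_on A A UNIV (\<lambda>a. inv\<^bsub>G\<^esub> a)"

text \<open>
  The Lie algebra is the tangent space at the unit, identified with the model space by means of a
  fixed chart \<open>e\<close> around the unit.
\<close>

definition lie_Ad ::
  "'g monoid \<Rightarrow> ('g, 'l::complex_normed_vector) chart \<Rightarrow> 'g \<Rightarrow> 'l \<Rightarrow> 'l" where
  "lie_Ad G e a \<xi> = dd (\<lambda>y. snd e (a \<otimes>\<^bsub>G\<^esub> chart_inv e y \<otimes>\<^bsub>G\<^esub> inv\<^bsub>G\<^esub> a)) (snd e \<one>\<^bsub>G\<^esub>) \<xi>"

definition lie_bracket ::
  "'g monoid \<Rightarrow> ('g, 'l::complex_normed_vector) chart \<Rightarrow> 'l \<Rightarrow> 'l \<Rightarrow> 'l" where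
  "lie_bracket G e \<xi> \<eta> = dd (\<lambda>y. lie_Ad G e (chart_inv e y) \<eta>) (snd e \<one>\<^bsub>G\<^esub>) \<xi>"

text \<open>The pullback \<open>b\<^sup>-\<^sup>1 db\<close> of the left Maurer--Cartan form.\<close>

definition log_deriv ::
  "'g monoid \<Rightarrow> ('g, 'l::complex_normed_vector) chart \<Rightarrow>
   ('v::real_normed_vector \<Rightarrow> 'g) \<Rightarrow> 'v \<Rightarrow> 'v \<Rightarrow> 'l" where
  "log_deriv G e b p u = dd (\<lambda>q. snd e (inv\<^bsub>G\<^esub> (b p) \<otimes>\<^bsub>G\<^esub> b q)) p u"

definition one_param_subgroup ::
  "'g::topological_space monoid \<Rightarrow> ('g, 'l::complex_normed_vector) chart \<Rightarrow>
   'l \<Rightarrow> (real \<Rightarrow> 'g) \<Rightarrow> bool" where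
  "one_param_subgroup G e \<xi> c \<longleftrightarrow>
     continuous_on UNIV c \<and> (\<forall>s t. c (s + t) = c s \<otimes>\<^bsub>G\<^esub> c t) \<and>
     ((\<lambda>t. snd e (c t)) has_vector_derivative \<xi>) (at 0)"

definition lie_exp ::
  "'g::topological_space monoid \<Rightarrow> ('g, 'l::complex_normed_vector) chart \<Rightarrow> 'l \<Rightarrow> 'g" where
  "lie_exp G e \<xi> = (THE c. one_param_subgroup G e \<xi> c) 1"

definition lie_alg ::
  "'g::topological_space monoid \<Rightarrow> ('g, 'l::complex_normed_vector) chart \<Rightarrow> 'g set \<Rightarrow> 'l set" where
  "lie_alg G e K = {\<xi>. \<exists>c. one_param_subgroup G e \<xi> c \<and> range c \<subseteq> K}"

definition maximal_compact_subgroup :: "'g::topological_space monoid \<Rightarrow> 'g set \<Rightarrow> bool" where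
  "maximal_compact_subgroup G K \<longleftrightarrow>
     subgroup K G \<and> compact K \<and> (\<forall>K'. subgroup K' G \<and> compact K' \<and> K \<subseteq> K' \<longrightarrow> K' = K)"

definition complexification_of ::
  "'g::topological_space monoid \<Rightarrow> ('g, 'l::complex_normed_vector) chart \<Rightarrow> 'g set \<Rightarrow> bool" where
  "complexification_of G e K \<longleftrightarrow>
     subgroup K G \<and> compact K \<and>
     (\<forall>\<zeta>. \<exists>!x. fst x \<in> lie_alg G e K \<and> snd x \<in> lie_alg G e K \<and> \<zeta> = fst x + scaleC \<i> (snd x)) \<and>
     (\<exists>q. homeomorphism (K \<times> lie_alg G e K) UNIV
        (\<lambda>(k, \<xi>). k \<otimes>\<^bsub>G\<^esub> lie_exp G e (scaleC \<i> \<xi>)) q)"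

text \<open>A complex Lie group is reductive if it is the complexification of a compact subgroup, in the
  sense of the polar decomposition \<open>G = K exp (\<i>\<kk>)\<close>. Such a subgroup is maximal compact and all maximal compact subgroups are conjugate, so that ``some'' and
  ``every'' maximal compact subgroup may be used interchangeably.\<close>

definition complex_reductive ::
  "'g::topological_space monoid \<Rightarrow> ('g, 'l::complex_normed_vector) chart \<Rightarrow> bool" where
  "complex_reductive G e \<longleftrightarrow>
     (\<exists>K. maximal_compact_subgroup G K) \<and>
     (\<forall>K. maximal_compact_subgroup G K \<longrightarrow> complexification_of G e K)"

definition conj_wrt :: "'l::complex_normed_vector set \<Rightarrow> 'l \<Rightarrow> 'l" where
  "conj_wrt k \<zeta> = (THE w. \<exists>\<xi>\<in>k. \<exists>\<eta>\<in>k. \<zeta> = \<xi> + scaleC \<i> \<eta> \<and> w = \<xi> - scaleC \<i> \<eta>)"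

text \<open>In the last clause, a compact Lie subalgebra is the Lie algebra of a compact subgroup.\<close>

definition invariant_form ::
  "'g::topological_space monoid \<Rightarrow> ('g, 'l::complex_normed_vector) chart \<Rightarrow>
   ('l \<Rightarrow> 'l \<Rightarrow> complex) \<Rightarrow> bool" where
  "invariant_form G e ip \<longleftrightarrow>
     (\<forall>\<xi>. complex_linear (ip \<xi>)) \<and> (\<forall>\<xi> \<eta>. ip \<xi> \<eta> = ip \<eta> \<xi>) \<and>
     (\<forall>\<xi>. (\<forall>\<eta>. ip \<xi> \<eta> = 0) \<longrightarrow> \<xi> = 0) \<and>
     (\<forall>a \<xi> \<eta>. ip (lie_Ad G e a \<xi>) (lie_Ad G e a \<eta>) = ip \<xi> \<eta>) \<and>
     (\<forall>K'. subgroup K' G \<and> compact K' \<longrightarrow>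
        (\<forall>\<xi>\<in>lie_alg G e K'. \<forall>\<eta>\<in>lie_alg G e K'. ip \<xi> \<eta> \<in> \<real>))"

section \<open>Principal bundles, reductions, Chern connection\<close>

definition gdiv :: "('p \<Rightarrow> 'g \<Rightarrow> 'p) \<Rightarrow> 'p \<Rightarrow> 'p \<Rightarrow> 'g" where
  "gdiv act p q = (THE a. q = act p a)"

text \<open>
  The holomorphic structure of a principal bundle is given by a bundle atlas \<open>S\<close>: a family of
  local sections \<open>(V, s)\<close>, declared to be holomorphic, with holomorphic transition functions.
\<close>

definition holomorphic_principal_bundle ::
  "('x::{t2_space, second_countable_topology}, 'v::complex_normed_vector) chart set \<Rightarrow>
   'g::{t2_space, second_countable_topology} monoid \<Rightarrow>
   ('g, 'l::complex_normed_vector) chart set \<Rightarrow>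
   ('p \<Rightarrow> 'x) \<Rightarrow> ('p \<Rightarrow> 'g \<Rightarrow> 'p) \<Rightarrow> ('x set \<times> ('x \<Rightarrow> 'p)) set \<Rightarrow> bool" where
  "holomorphic_principal_bundle AX G AG pr act S \<longleftrightarrow>
     (\<forall>p. act p \<one>\<^bsub>G\<^esub> = p) \<and> (\<forall>p a b. act (act p a) b = act p (a \<otimes>\<^bsub>G\<^esub> b)) \<and>
     (\<forall>p a. pr (act p a) = pr p) \<and> (\<forall>p q. pr p = pr q \<longrightarrow> (\<exists>!a. q = act p a)) \<and>
     (\<forall>(V, s)\<in>S. open V \<and> (\<forall>x\<in>V. pr (s x) = x)) \<and> (\<Union>(V, s)\<in>S. V) = UNIV \<and>
     (\<forall>(V, s)\<in>S. \<forall>(W, t)\<in>S. holo_map_on AX AG (V \<inter> W) (\<lambda>x. gdiv act (s x) (t x)))"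

definition local_sections ::
  "('x::{t2_space, second_countable_topology}, 'v::complex_normed_vector) chart set \<Rightarrow>
   ('g::{t2_space, second_countable_topology}, 'l::complex_normed_vector) chart set \<Rightarrow>
   ('p \<Rightarrow> 'x) \<Rightarrow> ('p \<Rightarrow> 'g \<Rightarrow> 'p) \<Rightarrow> ('x set \<times> ('x \<Rightarrow> 'p)) set \<Rightarrow> 'p set \<Rightarrow>
   ('x set \<times> ('x \<Rightarrow> 'p)) set" where
  "local_sections AX AG pr act S Ph =
     {(W, \<sigma>). open W \<and> (\<forall>x\<in>W. pr (\<sigma> x) = x \<and> \<sigma> x \<in> Ph) \<and>
        (\<forall>(V, s)\<in>S. smooth_map_on AX AG (V \<inter> W) (\<lambda>x. gdiv act (s x) (\<sigma> x)))}"

text \<open>A reduction \<open>h\<close> of \<open>P\<close> to \<open>K\<close>, given by its principal \<open>K\<close>-subbundle \<open>Ph\<close>.\<close>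

definition reduction ::
  "('x::{t2_space, second_countable_topology}, 'v::complex_normed_vector) chart set \<Rightarrow>
   ('g::{t2_space, second_countable_topology}, 'l::complex_normed_vector) chart set \<Rightarrow>
   ('p \<Rightarrow> 'x) \<Rightarrow> ('p \<Rightarrow> 'g \<Rightarrow> 'p) \<Rightarrow> ('x set \<times> ('x \<Rightarrow> 'p)) set \<Rightarrow> 'g set \<Rightarrow> 'p set \<Rightarrow> bool" where
  "reduction AX AG pr act S K Ph \<longleftrightarrow>
     (\<forall>p\<in>Ph. \<forall>k\<in>K. act p k \<in> Ph) \<and>
     (\<forall>p\<in>Ph. \<forall>q\<in>Ph. pr p = pr q \<longrightarrow> (\<exists>k\<in>K. q = act p k)) \<and>
     (\<forall>x. \<exists>(W, \<sigma>) \<in> local_sections AX AG pr act S Ph. x \<in> W)"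

definition cdom :: "('x, 'v) chart \<Rightarrow> ('x set \<times> ('x \<Rightarrow> 'p)) \<Rightarrow> 'v set" where
  "cdom c t = snd c ` (fst c \<inter> fst t)"

text \<open>If \<open>\<alpha>\<close> is the pullback of a connection form by the local section \<open>\<sigma>\<close>, then \<open>gauge G e \<alpha> b\<close>
  is its pullback by \<open>\<sigma> b\<close>.\<close>

definition gauge ::
  "'g monoid \<Rightarrow> ('g, 'l::complex_normed_vector) chart \<Rightarrow>
   ('v::real_normed_vector \<Rightarrow> 'v \<Rightarrow> 'l) \<Rightarrow> ('v \<Rightarrow> 'g) \<Rightarrow> 'v \<Rightarrow> 'v \<Rightarrow> 'l" where
  "gauge G e \<alpha> b p u = lie_Ad G e (inv\<^bsub>G\<^esub> (b p)) (\<alpha> p u) + log_deriv G e b p u"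

text \<open>A connection \<open>\<theta>\<close> on \<open>Ph\<close>, given by its pullbacks \<open>\<theta> c t\<close> by the local sections \<open>t\<close> of \<open>Ph\<close>,
  written in the charts \<open>c\<close>.\<close>

definition connection_on ::
  "('x::{t2_space, second_countable_topology}, 'v::complex_normed_vector) chart set \<Rightarrow>
   'g::{t2_space, second_countable_topology} monoid \<Rightarrow>
   ('g, 'l::complex_normed_vector) chart set \<Rightarrow> ('g, 'l) chart \<Rightarrow>
   ('p \<Rightarrow> 'x) \<Rightarrow> ('p \<Rightarrow> 'g \<Rightarrow> 'p) \<Rightarrow> ('x set \<times> ('x \<Rightarrow> 'p)) set \<Rightarrow> 'g set \<Rightarrow> 'p set \<Rightarrow>
   (('x, 'v) chart \<Rightarrow> ('x set \<times> ('x \<Rightarrow> 'p)) \<Rightarrow> 'v \<Rightarrow> 'v \<Rightarrow> 'l) \<Rightarrow> bool" where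
  "connection_on AX G AG e pr act S K Ph \<theta> \<longleftrightarrow>
     (\<forall>c\<in>AX. \<forall>t\<in>local_sections AX AG pr act S Ph.
        (\<forall>u. smooth_on (cdom c t) (\<lambda>p. \<theta> c t p u)) \<and>
        (\<forall>p\<in>cdom c t. linear (\<theta> c t p) \<and> (\<forall>u. \<theta> c t p u \<in> lie_alg G e K)) \<and>
        (\<forall>t'\<in>local_sections AX AG pr act S Ph. \<forall>p\<in>cdom c t \<inter> cdom c t'. \<forall>u.
           \<theta> c t' p u =
             gauge G e (\<theta> c t) (\<lambda>q. gdiv act (snd t (chart_inv c q)) (snd t' (chart_inv c q))) p u) \<and>
        (\<forall>c'\<in>AX. \<forall>p\<in>snd c ` (fst c \<inter> fst c' \<inter> fst t). \<forall>u.
           \<theta> c t p u = \<theta> c' t (snd c' (chart_inv c p)) (dd (snd c' \<circ> chart_inv c) p u)))"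

text \<open>The Chern connection is the connection on \<open>Ph\<close> whose extension to \<open>P\<close> pulls back to a form of
  type (1,0) along every holomorphic local section of \<open>P\<close>.\<close>

definition chern_connection_on ::
  "('x::{t2_space, second_countable_topology}, 'v::complex_normed_vector) chart set \<Rightarrow>
   'g::{t2_space, second_countable_topology} monoid \<Rightarrow>
   ('g, 'l::complex_normed_vector) chart set \<Rightarrow> ('g, 'l) chart \<Rightarrow>
   ('p \<Rightarrow> 'x) \<Rightarrow> ('p \<Rightarrow> 'g \<Rightarrow> 'p) \<Rightarrow> ('x set \<times> ('x \<Rightarrow> 'p)) set \<Rightarrow> 'g set \<Rightarrow> 'p set \<Rightarrow>
   (('x, 'v) chart \<Rightarrow> ('x set \<times> ('x \<Rightarrow> 'p)) \<Rightarrow> 'v \<Rightarrow> 'v \<Rightarrow> 'l) \<Rightarrow> bool" where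
  "chern_connection_on AX G AG e pr act S K Ph \<theta> \<longleftrightarrow>
     connection_on AX G AG e pr act S K Ph \<theta> \<and>
     (\<forall>c\<in>AX. \<forall>t\<in>local_sections AX AG pr act S Ph. \<forall>s\<in>S. \<forall>p\<in>cdom c t \<inter> cdom c s.
        complex_linear
          (gauge G e (\<theta> c t) (\<lambda>q. gdiv act (snd t (chart_inv c q)) (snd s (chart_inv c q))) p))"

definition conn_curvature ::
  "'g monoid \<Rightarrow> ('g, 'l::complex_normed_vector) chart \<Rightarrow>
   ('v::real_normed_vector \<Rightarrow> 'v \<Rightarrow> 'l) \<Rightarrow> 'v \<Rightarrow> 'v \<Rightarrow> 'v \<Rightarrow> 'l" where
  "conn_curvature G e \<alpha> p u v =
     dd (\<lambda>q. \<alpha> q v) p u - dd (\<lambda>q. \<alpha> q u) p v + lie_bracket G e (\<alpha> p u) (\<alpha> p v)"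

section \<open>Differential forms in a chart\<close>

text \<open>The value of a \<open>k\<close>-form on \<open>v 0, \<dots>, v (k - 1)\<close> is written as a function of
  \<open>v :: nat \<Rightarrow> 'v\<close>; the pairing \<open>B\<close> multiplies the values of the two factors.\<close>

definition wedge ::
  "nat \<Rightarrow> nat \<Rightarrow> ('a \<Rightarrow> 'b \<Rightarrow> 'c::real_vector) \<Rightarrow>
   ((nat \<Rightarrow> 'v) \<Rightarrow> 'a) \<Rightarrow> ((nat \<Rightarrow> 'v) \<Rightarrow> 'b) \<Rightarrow> (nat \<Rightarrow> 'v) \<Rightarrow> 'c" where
  "wedge p q B \<alpha> \<beta> v =
     (1 / (fact p * fact q)) *\<^sub>R
     (\<Sum>\<pi> | \<pi> permutes {..<p + q}.
        of_int (sign \<pi>) *\<^sub>R B (\<alpha> (\<lambda>i. v (\<pi> i))) (\<beta> (\<lambda>i. v (\<pi> (p + i)))))"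

primrec wedge_power :: "((nat \<Rightarrow> 'v) \<Rightarrow> real) \<Rightarrow> nat \<Rightarrow> (nat \<Rightarrow> 'v) \<Rightarrow> real" where
  "wedge_power \<omega> 0 = (\<lambda>v. 1)"
| "wedge_power \<omega> (Suc k) = wedge 2 (2 * k) (*) \<omega> (wedge_power \<omega> k)"

text \<open>\<open>ext_deriv D\<close> is \<open>\<partial>\<close> if \<open>D f p\<close> is the (1,0)-part of \<open>df\<close> at \<open>p\<close>, and the conjugate operator if it
  is the (0,1)-part. The constant vector fields \<open>v i\<close> commute.\<close>

definition ext_deriv ::
  "(('v \<Rightarrow> complex) \<Rightarrow> 'v \<Rightarrow> 'v \<Rightarrow> complex) \<Rightarrow> nat \<Rightarrow>
   ('v \<Rightarrow> (nat \<Rightarrow> 'v) \<Rightarrow> complex) \<Rightarrow> 'v \<Rightarrow> (nat \<Rightarrow> 'v) \<Rightarrow> complex" where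
  "ext_deriv D k \<alpha> p v =
     (\<Sum>i\<le>k. (-1) ^ i * D (\<lambda>q. \<alpha> q (\<lambda>j. v (if j < i then j else Suc j))) p (v i))"

definition d_form ::
  "nat \<Rightarrow> ('v::complex_normed_vector \<Rightarrow> (nat \<Rightarrow> 'v) \<Rightarrow> complex) \<Rightarrow> 'v \<Rightarrow> (nat \<Rightarrow> 'v) \<Rightarrow> complex" where
  "d_form = ext_deriv dd"

definition del_form ::
  "nat \<Rightarrow> ('v::complex_normed_vector \<Rightarrow> (nat \<Rightarrow> 'v) \<Rightarrow> complex) \<Rightarrow> 'v \<Rightarrow> (nat \<Rightarrow> 'v) \<Rightarrow> complex" where
  "del_form = ext_deriv (\<lambda>f p. ex10 (dd f p))"

definition delbar_form ::
  "nat \<Rightarrow> ('v::complex_normed_vector \<Rightarrow> (nat \<Rightarrow> 'v) \<Rightarrow> complex) \<Rightarrow> 'v \<Rightarrow> (nat \<Rightarrow> 'v) \<Rightarrow> complex" where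
  "delbar_form = ext_deriv (\<lambda>f p. ex01 (dd f p))"

definition dc_form ::
  "nat \<Rightarrow> ('v::complex_normed_vector \<Rightarrow> (nat \<Rightarrow> 'v) \<Rightarrow> complex) \<Rightarrow> 'v \<Rightarrow> (nat \<Rightarrow> 'v) \<Rightarrow> complex" where
  "dc_form k \<alpha> p v = \<i> * (delbar_form k \<alpha> p v - del_form k \<alpha> p v)"

section \<open>Hermitian metrics and the Bismut connection\<close>

text \<open>\<open>g c p\<close> is the Riemannian metric at the point with coordinates \<open>p\<close>, in the chart \<open>c\<close>.\<close>

definition hermitian_metric ::
  "('x, 'v::complex_normed_vector) chart set \<Rightarrow>
   (('x, 'v) chart \<Rightarrow> 'v \<Rightarrow> 'v \<Rightarrow> 'v \<Rightarrow> real) \<Rightarrow> bool" where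
  "hermitian_metric A g \<longleftrightarrow>
     (\<forall>c\<in>A. (\<forall>u v. smooth_on (snd c ` fst c) (\<lambda>p. g c p u v)) \<and>
        (\<forall>p\<in>snd c ` fst c.
           (\<forall>u. linear (g c p u)) \<and> (\<forall>u v. g c p u v = g c p v u) \<and>
           (\<forall>u. u \<noteq> 0 \<longrightarrow> g c p u u > 0) \<and>
           (\<forall>u v. g c p (scaleC \<i> u) (scaleC \<i> v) = g c p u v)) \<and>
        (\<forall>c'\<in>A. \<forall>p\<in>snd c ` (fst c \<inter> fst c'). \<forall>u v.
           g c p u v =
             g c' (snd c' (chart_inv c p))
               (dd (snd c' \<circ> chart_inv c) p u) (dd (snd c' \<circ> chart_inv c) p v)))"

text \<open>From here on \<open>m\<close> is a metric written in a chart.\<close>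

definition herm_form ::
  "('v::complex_normed_vector \<Rightarrow> 'v \<Rightarrow> 'v \<Rightarrow> real) \<Rightarrow> 'v \<Rightarrow> (nat \<Rightarrow> 'v) \<Rightarrow> real" where
  "herm_form m p v = m p (scaleC \<i> (v 0)) (v 1)"

abbreviation herm_form_c ::
  "('v::complex_normed_vector \<Rightarrow> 'v \<Rightarrow> 'v \<Rightarrow> real) \<Rightarrow> 'v \<Rightarrow> (nat \<Rightarrow> 'v) \<Rightarrow> complex" where
  "herm_form_c m \<equiv> (\<lambda>p v. complex_of_real (herm_form m p v))"

text \<open>The isomorphism \<open>g\<^sup>-\<^sup>1\<close> from real covectors to real vectors, and the complex bilinear extension
  of the dual metric to complex-valued covectors.\<close>

definition sharp :: "('v \<Rightarrow> 'v \<Rightarrow> real) \<Rightarrow> ('v \<Rightarrow> real) \<Rightarrow> 'v" where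
  "sharp gp \<alpha> = (THE w. \<forall>v. gp w v = \<alpha> v)"

definition dual_metric :: "('v \<Rightarrow> 'v \<Rightarrow> real) \<Rightarrow> ('v \<Rightarrow> complex) \<Rightarrow> ('v \<Rightarrow> complex) \<Rightarrow> complex" where
  "dual_metric gp \<alpha> \<beta> = \<beta> (sharp gp (\<lambda>v. Re (\<alpha> v))) + \<i> * \<beta> (sharp gp (\<lambda>v. Im (\<alpha> v)))"

definition levi_civita ::
  "('v::complex_normed_vector \<Rightarrow> 'v \<Rightarrow> 'v \<Rightarrow> real) \<Rightarrow> 'v \<Rightarrow> 'v \<Rightarrow> 'v \<Rightarrow> 'v" where
  "levi_civita m p u v =
     sharp (m p) (\<lambda>w. (1/2) * (dd (\<lambda>q. m q v w) p u + dd (\<lambda>q. m q u w) p v - dd (\<lambda>q. m q u v) p w))"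

definition bismut ::
  "('v::complex_normed_vector \<Rightarrow> 'v \<Rightarrow> 'v \<Rightarrow> real) \<Rightarrow> 'v \<Rightarrow> 'v \<Rightarrow> 'v \<Rightarrow> 'v" where
  "bismut m p u v =
     levi_civita m p u v -
     (1/2) *\<^sub>R sharp (m p) (\<lambda>w. Re (dc_form 2 (herm_form_c m) p ((!) [u, v, w])))"

text \<open>Curvature, on the constant vector fields \<open>u\<close> and \<open>v\<close>, of the connection \<open>d + A\<close> on a trivial
  vector bundle, where \<open>A p u\<close> is an endomorphism of the fibre.\<close>

definition vb_curvature ::
  "('v::real_normed_vector \<Rightarrow> 'v \<Rightarrow> 'w::real_normed_vector \<Rightarrow> 'w) \<Rightarrow> 'v \<Rightarrow> 'v \<Rightarrow> 'v \<Rightarrow> 'w \<Rightarrow> 'w" where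
  "vb_curvature A p u v w =
     dd (\<lambda>q. A q v w) p u - dd (\<lambda>q. A q u w) p v + A p u (A p v w) - A p v (A p u w)"

definition orthonormal_frame ::
  "('v \<Rightarrow> 'v \<Rightarrow> real) \<Rightarrow> nat \<Rightarrow> (nat \<Rightarrow> 'v) \<Rightarrow> bool" where
  "orthonormal_frame gp N E \<longleftrightarrow> (\<forall>i<N. \<forall>j<N. gp (E i) (E j) = (if i = j then 1 else 0))"

definition bismut_ricci ::
  "('v::complex_normed_vector \<Rightarrow> 'v \<Rightarrow> 'v \<Rightarrow> real) \<Rightarrow> nat \<Rightarrow> (nat \<Rightarrow> 'v) \<Rightarrow> 'v \<Rightarrow> 'v \<Rightarrow> 'v \<Rightarrow> real" where
  "bismut_ricci m N E p u v =
     (1/2) * (\<Sum>j<N. m p (vb_curvature (bismut m) p u v (scaleC \<i> (E j))) (E j))"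

section \<open>The coupled Hermitian-Einstein system\<close>

text \<open>
  Here \<open>F\<close> is the curvature of the Chern connection in the chart and local section at hand. The first
  equation is required for all local sections of \<open>Ph\<close> with the same \<open>z\<close>; this is where the central
  element is viewed as a section of \<open>ad Ph\<close>. The Bismut Ricci form does not depend on the orthonormal basis \<open>E\<close>.
\<close>

definition coupled_hermitian_einstein_at ::
  "('l \<Rightarrow> 'l \<Rightarrow> complex) \<Rightarrow> 'l::complex_normed_vector \<Rightarrow>
   (complex^'n \<Rightarrow> complex^'n \<Rightarrow> complex^'n \<Rightarrow> real) \<Rightarrow>
   (complex^'n \<Rightarrow> complex^'n \<Rightarrow> complex^'n \<Rightarrow> 'l) \<Rightarrow> complex^'n \<Rightarrow> bool" where
  "coupled_hermitian_einstein_at ip z m F p \<longleftrightarrow>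
     (\<forall>v. wedge 2 (2 * (CARD('n) - 1)) (\<lambda>a r. r *\<^sub>R a) (\<lambda>v. F p (v 0) (v 1))
            (wedge_power (herm_form m p) (CARD('n) - 1)) v
          = (wedge_power (herm_form m p) CARD('n) v / real CARD('n)) *\<^sub>R z) \<and>
     (\<forall>E. orthonormal_frame (m p) (2 * CARD('n)) E \<longrightarrow>
        (\<forall>u v. complex_of_real (bismut_ricci m (2 * CARD('n)) E p u v) + ip z (F p u v) = 0)) \<and>
     (\<forall>v. d_form 3 (dc_form 2 (herm_form_c m)) p v +
          wedge 2 2 ip (\<lambda>v. F p (v 0) (v 1)) (\<lambda>v. F p (v 0) (v 1)) v = 0)"

definition coupled_hermitian_einstein ::
  "('x::{t2_space, second_countable_topology}, complex^'n) chart set \<Rightarrow>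
   'g::{t2_space, second_countable_topology} monoid \<Rightarrow>
   ('g, 'l::complex_normed_vector) chart set \<Rightarrow> ('g, 'l) chart \<Rightarrow> ('l \<Rightarrow> 'l \<Rightarrow> complex) \<Rightarrow>
   ('p \<Rightarrow> 'x) \<Rightarrow> ('p \<Rightarrow> 'g \<Rightarrow> 'p) \<Rightarrow> ('x set \<times> ('x \<Rightarrow> 'p)) set \<Rightarrow> 'p set \<Rightarrow>
   (('x, complex^'n) chart \<Rightarrow> complex^'n \<Rightarrow> complex^'n \<Rightarrow> complex^'n \<Rightarrow> real) \<Rightarrow>
   (('x, complex^'n) chart \<Rightarrow> ('x set \<times> ('x \<Rightarrow> 'p)) \<Rightarrow> complex^'n \<Rightarrow> complex^'n \<Rightarrow> 'l) \<Rightarrow>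
   'l \<Rightarrow> bool" where
  "coupled_hermitian_einstein AX G AG e ip pr act S Ph g \<theta> z \<longleftrightarrow>
     (\<forall>c\<in>AX. \<forall>t\<in>local_sections AX AG pr act S Ph. \<forall>p\<in>cdom c t.
        coupled_hermitian_einstein_at ip z (g c) (conn_curvature G e (\<theta> c t)) p)"

section \<open>The holomorphic vector bundle \<open>\<Q>\<close>\<close>

text \<open>
  A chart of \<open>X\<close> and a local section of \<open>Ph\<close> trivialise the smooth bundle
  \<open>T\<^sup>1\<^sup>,\<^sup>0 \<oplus> ad P \<oplus> T\<^sup>*\<^sub>1\<^sub>,\<^sub>0\<close>, with fibre \<open>complex^'n \<times> 'l \<times> complex^'n\<close>: components with respect to
  the frames \<open>\<partial>/\<partial>z\<^sub>i\<close> and \<open>dz\<^sub>i\<close>, and the Lie algebra for \<open>ad P\<close>. \<open>dolbeault_Q \<dots> s p w\<close> is the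
  contraction of the Dolbeault operator applied to \<open>s\<close> with the vector of type (0,1) conjugate to
  the one with components \<open>w\<close>.
\<close>

type_synonym ('n, 'l) Q_fibre = "(complex^'n) \<times> 'l \<times> (complex^'n)"

definition dolbeault_Q ::
  "'g monoid \<Rightarrow> ('g, 'l::complex_normed_vector) chart \<Rightarrow> ('l \<Rightarrow> 'l \<Rightarrow> complex) \<Rightarrow>
   (complex^'n \<Rightarrow> complex^'n \<Rightarrow> complex^'n \<Rightarrow> real) \<Rightarrow> (complex^'n \<Rightarrow> complex^'n \<Rightarrow> 'l) \<Rightarrow>
   (complex^'n \<Rightarrow> ('n, 'l) Q_fibre) \<Rightarrow> complex^'n \<Rightarrow> complex^'n \<Rightarrow> ('n, 'l) Q_fibre" where
  "dolbeault_Q G e ip m \<alpha> s p w =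
    (let F = conn_curvature G e \<alpha> p;
         V = (\<lambda>q. fst (s q)); r = (\<lambda>q. fst (snd (s q))); \<xi> = (\<lambda>q. snd (snd (s q)))
     in
      (ex01 (dd V p) w,
       ex10 (\<lambda>a. ex01 (\<lambda>b. F a b) w) (V p) +
         ex01 (\<lambda>b. dd r p b + lie_bracket G e (\<alpha> p b) (r p)) w,
       \<chi> i. ex01 (dd \<xi> p) w $ i
         - 2 * \<i> * ex10 (\<lambda>a. ex01 (\<lambda>b. ex10 (\<lambda>k.
             del_form 2 (herm_form_c m) p ((!) [a, b, k])) (axis i 1)) w) (V p)
         + 2 * ip (ex01 (\<lambda>b. ex10 (\<lambda>k. F b k) (axis i 1)) w) (r p)))"

text \<open>The Hermitian metric is the sesquilinear form obtained by polarisation from the given quadratic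
  expression; \<open>k\<close> is the Lie algebra of \<open>K\<close>.\<close>

definition metric_Q ::
  "('l::complex_normed_vector \<Rightarrow> 'l \<Rightarrow> complex) \<Rightarrow> 'l set \<Rightarrow>
   (complex^'n \<Rightarrow> complex^'n \<Rightarrow> complex^'n \<Rightarrow> real) \<Rightarrow> complex^'n \<Rightarrow>
   ('n, 'l) Q_fibre \<Rightarrow> ('n, 'l) Q_fibre \<Rightarrow> complex" where
  "metric_Q ip k m p = (\<lambda>(V, r, \<xi>) (V', r', \<xi>').
     ex10 (\<lambda>a. ex01 (\<lambda>b. complex_of_real (m p a b)) V') V
     + 1/4 * dual_metric (m p) (\<lambda>v. \<Sum>i\<in>UNIV. \<xi> $ i * v $ i) (\<lambda>v. cnj (\<Sum>i\<in>UNIV. \<xi>' $ i * v $ i))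
     - ip r (conj_wrt k r'))"

text \<open>\<open>d + A\<close> is the Chern connection, over the coordinate domain \<open>U\<close>, of a trivialised complex vector
  bundle with Dolbeault operator \<open>dbar\<close> and Hermitian metric \<open>H\<close>: it induces \<open>dbar\<close> and
  preserves \<open>H\<close>. For nondegenerate \<open>H\<close> this determines \<open>A\<close> on \<open>U\<close>.\<close>

definition chern_connection_form ::
  "'v::complex_normed_vector set \<Rightarrow>
   (('v \<Rightarrow> 'w::complex_normed_vector) \<Rightarrow> 'v \<Rightarrow> 'v \<Rightarrow> 'w) \<Rightarrow>
   ('v \<Rightarrow> 'w \<Rightarrow> 'w \<Rightarrow> complex) \<Rightarrow> ('v \<Rightarrow> 'v \<Rightarrow> 'w \<Rightarrow> 'w) \<Rightarrow> bool" where
  "chern_connection_form U dbar H A \<longleftrightarrow>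
     (\<forall>u w. smooth_on U (\<lambda>p. A p u w)) \<and>
     (\<forall>p\<in>U. (\<forall>w. linear (\<lambda>u. A p u w)) \<and> (\<forall>u. complex_linear (A p u))) \<and>
     (\<forall>s. smooth_on U s \<longrightarrow> (\<forall>p\<in>U. \<forall>u. ex01 (\<lambda>b. dd s p b + A p b (s p)) u = dbar s p u)) \<and>
     (\<forall>s t. smooth_on U s \<and> smooth_on U t \<longrightarrow> (\<forall>p\<in>U. \<forall>u.
        dd (\<lambda>q. H q (s q) (t q)) p u =
          H p (dd s p u + A p u (s p)) (t p) + H p (s p) (dd t p u + A p u (t p))))"

end

theory Submission
  imports Defs "HOL-Complex_Analysis.Complex_Analysis"
begin

text \<open>
  The statement is local, and pointwise a matter of traces. On a Hermitian vector space of complex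
  dimension \<open>n\<close>, a 2-form \<open>\<Phi>\<close> satisfies \<open>\<Phi> \<and> \<omega>\<^sup>n\<^sup>-\<^sup>1 = (\<omega>\<^sup>n/n) \<Lambda>\<Phi>\<close>, where \<open>\<Lambda>\<Phi>\<close> is its contraction with the
  fundamental form (\<open>wedge_omega_power\<close>). So the first equation of the system says that the trace of the
  curvature \<open>F\<close> of the principal connection is constant, equal to \<open>z\<close>, and the claim is that
  \<open>\<Sigma>\<^sub>k R(E\<^sub>k, J E\<^sub>k) = 0\<close> for the curvature \<open>R\<close> of the Chern connection of the bundle and a frame \<open>E\<close> that is
  unitary at the point considered.

  Write \<open>D' + D''\<close> for the Chern connection. Its curvature of type (1,1) is the commutator of \<open>D'\<close> and
  \<open>D''\<close>; pairing it with a section and moving \<open>D'\<close> across the metric by compatibility expresses all its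
  matrix entries by the Dolbeault operator and by derivatives of the metric (\<open>H_curv11\<close>). This is applied
  to constant sections, paired with constant sections of the first two summands and, in the third one,
  with the sections metrically dual to constant vectors. Writing \<open>h\<close> for the components of the metric on
  \<open>X\<close> and \<open>T\<close> for those of \<open>\<partial>\<omega>\<close>, the traces of the blocks vanish for the following reasons.

    \<^item> Vectors against vectors, and covectors against covectors: the trace is
      \<open>\<Sigma>\<^sub>i (- \<partial>\<^sub>i\<^sup>* \<partial>\<^sub>i h + \<partial>h \<partial>h\<^sup>* - \<langle>F, F\<rangle> - T T\<^sup>*)\<close>, the star denoting conjugates. The trace of
      \<open>dd\<^sup>c\<omega> + \<langle>F \<and> F\<rangle> = 0\<close>, the (1,1)-part of \<open>\<rho>\<^sub>B + \<langle>z, F\<rangle> = 0\<close> and the trace of \<open>F\<close> combine to show that it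
      is zero (\<open>ricci_anomaly_identity\<close>).
    \<^item> Vectors or covectors against \<open>ad P\<close>: the trace is a divergence of \<open>F\<close> with torsion terms. The Bianchi
      identity turns it into the derivative of the trace of \<open>F\<close>, which is constant
      (\<open>curvature_divergence_identity\<close>).
    \<^item> Vectors against covectors: the trace is the (2,0)-part of the Ricci form, and \<open>F\<close> has none
      (\<open>ricci_20_identity\<close>).
    \<^item> \<open>ad P\<close> against \<open>ad P\<close>: by the Jacobi identity the curvature of \<open>ad P\<close> contributes the bracket with the
      trace of \<open>F\<close>, and \<open>z\<close> is central; the other terms are \<open>\<langle>F\<^sub>i\<^sub>j, r\<rangle> \<langle>F\<^sub>j\<^sub>i, s\<rangle>\<close> and its transpose, which cancel in
      the trace.

  The remaining blocks follow because the curvature is skew-Hermitian.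

  Two facts about the principal bundle enter. The curvature \<open>F\<close> has type (1,1): along a holomorphic section
  of \<open>P\<close> the connection form has type (1,0), so by the Maurer--Cartan equation \<open>F\<close> has no part of type (0,2),
  and it has no part of type (2,0) because it takes values in the real form \<open>\<kk>\<close>. And \<open>\<kk>\<close>, the set of
  velocities of one-parameter subgroups of \<open>K\<close>, is a real Lie subalgebra on which the form is real. The Lie
  bracket, the Jacobi identity and the Maurer--Cartan equation are obtained from second derivatives of the
  multiplication in a chart, which exist because derivatives of holomorphic maps are holomorphic.
\<close>

section \<open>Finite-dimensional normed spaces\<close>

text \<open>
  All norms on a finite-dimensional space are equivalent, without assuming a Euclidean structure. In the
  inductive step the span of the previous vectors is closed, since Cauchy sequences in it have Cauchy
  coordinates; the new vector therefore has positive distance \<open>d\<close> from it, which bounds its coefficient.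
\<close>

lemma finite_independent_coords_bounded:
  fixes B :: "'a::real_normed_vector set"
  assumes "finite B" "independent B"
  shows "\<exists>K>0. \<forall>c. \<forall>b\<in>B. \<bar>c b\<bar> \<le> K * norm (\<Sum>b\<in>B. c b *\<^sub>R b)"
  using assms
proof (induction B rule: finite_induct)
  case empty
  then show ?case by (auto intro: exI[of _ 1])
next
  case (insert a B)
  then have ind: "independent B" and a: "a \<notin> span B"
    by (auto simp: independent_insert)
  obtain K where K: "K > 0" "\<And>c b. b \<in> B \<Longrightarrow> \<bar>c b\<bar> \<le> K * norm (\<Sum>b\<in>B. c b *\<^sub>R b)"
    using insert.IH[OF ind] by blast
  have "a \<notin> closure (span B)"
  proof
    assume "a \<in> closure (span B)"
    then obtain y where y: "\<And>n. y n \<in> span B" "y \<longlonglongrightarrow> a"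
      by (auto simp: closure_sequential)
    have "\<exists>c. y n = (\<Sum>b\<in>B. c b *\<^sub>R b)" for n
      using y(1)[of n] span_finite[OF insert(1)] by auto
    then obtain c where c: "\<And>n. y n = (\<Sum>b\<in>B. c n b *\<^sub>R b)" by metis
    have "\<exists>l. (\<lambda>n. c n b) \<longlonglongrightarrow> l" if b: "b \<in> B" for b
    proof -
      have "Cauchy (\<lambda>n. c n b)"
      proof (rule CauchyI)
        fix e :: real assume "e > 0"
        then obtain M where M: "\<And>m n. m \<ge> M \<Longrightarrow> n \<ge> M \<Longrightarrow> norm (y m - y n) < e / K"
          using LIMSEQ_imp_Cauchy[OF y(2)] K(1) by (metis CauchyD divide_pos_pos)
        show "\<exists>M. \<forall>m\<ge>M. \<forall>n\<ge>M. norm (c m b - c n b) < e"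
        proof (intro exI allI impI)
          fix m n assume "m \<ge> M" "n \<ge> M"
          have "\<bar>c m b - c n b\<bar> \<le> K * norm (y m - y n)"
            using K(2)[OF b, of "\<lambda>b. c m b - c n b"] by (simp add: c scaleR_diff_left sum_subtractf)
          also have "\<dots> < e"
            using M[OF \<open>m \<ge> M\<close> \<open>n \<ge> M\<close>] K(1) by (simp add: field_simps)
          finally show "norm (c m b - c n b) < e" by simp
        qed
      qed
      then show ?thesis by (simp add: Cauchy_convergent_iff convergent_def)
    qed
    then obtain l where l: "\<And>b. b \<in> B \<Longrightarrow> (\<lambda>n. c n b) \<longlonglongrightarrow> l b" by metis
    have "y \<longlonglongrightarrow> (\<Sum>b\<in>B. l b *\<^sub>R b)"
      unfolding c by (intro tendsto_sum tendsto_scaleR l tendsto_const)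
    then have "a = (\<Sum>b\<in>B. l b *\<^sub>R b)"
      using y(2) LIMSEQ_unique by blast
    moreover have "(\<Sum>b\<in>B. l b *\<^sub>R b) \<in> span B"
      by (intro span_sum span_scale span_base)
    ultimately show False using a by simp
  qed
  then obtain d where d: "d > 0" "ball a d \<subseteq> - closure (span B)"
    by (meson ComplI closed_closure open_Compl openE)
  have dist: "d \<le> norm (a - y)" if "y \<in> span B" for y
  proof (rule ccontr)
    assume "\<not> ?thesis"
    then have "y \<in> ball a d" by (simp add: dist_norm)
    then show False using d(2) that closure_subset by blast
  qed
  have bound_a: "\<bar>c a\<bar> * d \<le> norm (\<Sum>b\<in>insert a B. c b *\<^sub>R b)" for c
  proof (cases "c a = 0")
    case False
    define y where "y = - (1 / c a) *\<^sub>R (\<Sum>b\<in>B. c b *\<^sub>R b)"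
    have "y \<in> span B"
      unfolding y_def by (intro span_scale span_sum span_base) auto
    then have "\<bar>c a\<bar> * d \<le> \<bar>c a\<bar> * norm (a - y)"
      using dist by (intro mult_left_mono) auto
    also have "\<dots> = norm (c a *\<^sub>R (a - y))" by simp
    also have "c a *\<^sub>R (a - y) = (\<Sum>b\<in>insert a B. c b *\<^sub>R b)"
      using insert False by (simp add: y_def scaleR_add_right)
    finally show ?thesis .
  qed auto
  define K' where "K' = max (1 / d) (K * (1 + norm a / d))"
  have "\<bar>c b\<bar> \<le> K' * norm (\<Sum>b\<in>insert a B. c b *\<^sub>R b)" if b: "b \<in> insert a B" for c b
  proof -
    let ?s = "\<Sum>b\<in>insert a B. c b *\<^sub>R b"
    have ca: "\<bar>c a\<bar> \<le> (1/d) * norm ?s"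
      using bound_a[of c] d(1) by (simp add: field_simps)
    show ?thesis
    proof (cases "b = a")
      case True
      then show ?thesis
        using ca by (smt (verit) K'_def max.cobounded1 mult_right_mono norm_ge_zero)
    next
      case False
      then have "\<bar>c b\<bar> \<le> K * norm (\<Sum>b\<in>B. c b *\<^sub>R b)" using K(2) b by auto
      also have "(\<Sum>b\<in>B. c b *\<^sub>R b) = ?s - c a *\<^sub>R a" using insert by simp
      also have "norm \<dots> \<le> norm ?s + \<bar>c a\<bar> * norm a"
        by (metis norm_triangle_ineq4 norm_scaleR)
      also have "\<dots> \<le> norm ?s + (1/d) * norm ?s * norm a"
        using ca by (intro add_left_mono mult_right_mono) auto
      finally have "\<bar>c b\<bar> \<le> (K * (1 + norm a / d)) * norm ?s"
        using K(1) by (simp add: algebra_simps)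
      then show ?thesis
        by (smt (verit) K'_def max.cobounded2 mult_right_mono norm_ge_zero)
    qed
  qed
  moreover have "K' > 0" using d(1) by (simp add: K'_def less_max_iff_disj)
  ultimately show ?case by blast
qed

lemma finite_span_coords:
  fixes B :: "'a::real_normed_vector set"
  assumes "finite B" "span B = UNIV"
  obtains C and r :: "'a \<Rightarrow> 'a \<Rightarrow> real"
  where "finite C" "\<And>b. b \<in> C \<Longrightarrow> bounded_linear (r b)" "\<And>x. (\<Sum>b\<in>C. r b x *\<^sub>R b) = x"
proof -
  obtain C where C: "C \<subseteq> B" "independent C" "B \<subseteq> span C"
    using maximal_independent_subset[of B] by blast
  have fin: "finite C" using C(1) assms(1) finite_subset by blast
  have sp: "span C = UNIV"
    using C(3) assms(2) by (metis span_mono span_span top.extremum_uniqueI)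
  define r where "r b x = representation C x b" for b x
  have eq: "(\<Sum>b\<in>C. r b x *\<^sub>R b) = x" for x
    unfolding r_def using sum_representation_eq[OF C(2) _ fin, of x] sp by auto
  obtain K where K: "K > 0" "\<And>c b. b \<in> C \<Longrightarrow> \<bar>c b\<bar> \<le> K * norm (\<Sum>b\<in>C. c b *\<^sub>R b)"
    using finite_independent_coords_bounded[OF fin C(2)] by blast
  have "bounded_linear (r b)" if "b \<in> C" for b
  proof (rule bounded_linear_intro[where K = K])
    show "r b (x + y) = r b x + r b y" for x y
      using representation_add[OF C(2), of y x] sp by (simp add: r_def)
    show "r b (c *\<^sub>R x) = c *\<^sub>R r b x" for c x
      using representation_scale[OF C(2), of x c] sp by (simp add: r_def)
    show "norm (r b x) \<le> norm x * K" for x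
      using K(2)[OF that, of "\<lambda>b. r b x"] by (simp add: eq mult.commute)
  qed
  then show thesis using that fin eq by blast
qed

text \<open>
  A predicate on the type, since the Lie algebra may be zero and so belongs to no class of spaces
  with a nonempty basis.
\<close>

definition findim :: "'a::real_normed_vector itself \<Rightarrow> bool" where
  "findim _ \<longleftrightarrow> (\<exists>B::'a set. finite B \<and> span B = UNIV)"

lemma findim_coords:
  assumes "findim TYPE('a::real_normed_vector)"
  obtains C and r :: "'a::real_normed_vector \<Rightarrow> 'a \<Rightarrow> real"
  where "finite C" "\<And>b. b \<in> C \<Longrightarrow> bounded_linear (r b)" "\<And>x. (\<Sum>b\<in>C. r b x *\<^sub>R b) = x"
  using assms finite_span_coords unfolding findim_def by metis

lemma findim_euclidean: "findim TYPE('a::euclidean_space)"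
  unfolding findim_def by (rule exI[of _ Basis]) auto

lemma findim_linear_bounded:
  fixes f :: "'a::real_normed_vector \<Rightarrow> 'b::real_normed_vector"
  assumes "findim TYPE('a)" "linear f"
  shows "bounded_linear f"
proof -
  obtain C and r :: "'a \<Rightarrow> 'a \<Rightarrow> real"
    where C: "finite C" "\<And>b. b \<in> C \<Longrightarrow> bounded_linear (r b)" "\<And>x. (\<Sum>b\<in>C. r b x *\<^sub>R b) = x"
    using findim_coords[OF assms(1)] by metis
  have "f = (\<lambda>x. \<Sum>b\<in>C. r b x *\<^sub>R f b)"
  proof
    fix x
    have "f x = f (\<Sum>b\<in>C. r b x *\<^sub>R b)" by (simp add: C(3))
    then show "f x = (\<Sum>b\<in>C. r b x *\<^sub>R f b)"
      by (simp add: linear_sum[OF assms(2)] linear_scale[OF assms(2)])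
  qed
  moreover have "bounded_linear (\<lambda>x. \<Sum>b\<in>C. r b x *\<^sub>R f b)"
    by (intro bounded_linear_sum bounded_linear_scaleR_const C(2))
  ultimately show ?thesis by simp
qed

lemma findim_bilinear_bounded:
  fixes B :: "'a::real_normed_vector \<Rightarrow> 'b::real_normed_vector \<Rightarrow> 'c::real_normed_vector"
  assumes fd: "findim TYPE('a)" "findim TYPE('b)"
    and B: "\<And>y. linear (\<lambda>x. B x y)" "\<And>x. linear (B x)"
  shows "bounded_bilinear B"
proof -
  obtain C and r :: "'a \<Rightarrow> 'a \<Rightarrow> real"
    where C: "finite C" "\<And>b. b \<in> C \<Longrightarrow> bounded_linear (r b)" "\<And>x. (\<Sum>b\<in>C. r b x *\<^sub>R b) = x"
    using findim_coords[OF fd(1)] by metis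
  have "\<exists>K. \<forall>x. norm (r b x) \<le> norm x * K" if "b \<in> C" for b
    using bounded_linear.bounded[OF C(2)[OF that]] .
  then obtain K where K: "\<And>b x. b \<in> C \<Longrightarrow> norm (r b x) \<le> norm x * K b" by metis
  have "\<exists>L\<ge>0. \<forall>y. norm (B b y) \<le> norm y * L" for b
    using bounded_linear.nonneg_bounded[OF findim_linear_bounded[OF fd(2) B(2)]] .
  then obtain L where L: "\<And>b. L b \<ge> 0" "\<And>b y. norm (B b y) \<le> norm y * L b" by metis
  show ?thesis
  proof
    show "B (a + a') b = B a b + B a' b" for a a' b by (rule linear_add[OF B(1)])
    show "B a (b + b') = B a b + B a b'" for a b b' by (rule linear_add[OF B(2)])
    show "B (s *\<^sub>R a) b = s *\<^sub>R B a b" for s a b by (rule linear_scale[OF B(1)])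
    show "B a (s *\<^sub>R b) = s *\<^sub>R B a b" for s a b by (rule linear_scale[OF B(2)])
    show "\<exists>M. \<forall>a b. norm (B a b) \<le> norm a * norm b * M"
    proof (intro exI allI)
      fix x y
      have "B x y = B (\<Sum>b\<in>C. r b x *\<^sub>R b) y" by (simp add: C(3))
      also have "\<dots> = (\<Sum>b\<in>C. r b x *\<^sub>R B b y)"
        by (simp add: linear_sum[OF B(1)] linear_scale[OF B(1)])
      also have "norm \<dots> \<le> (\<Sum>b\<in>C. norm x * norm y * (K b * L b))"
      proof (rule sum_norm_le)
        fix b assume b: "b \<in> C"
        have "norm (r b x *\<^sub>R B b y) = norm (r b x) * norm (B b y)" by simp
        also have "\<dots> \<le> (norm x * K b) * (norm y * L b)"
          using K[OF b, of x] L by (intro mult_mono) (auto intro: order_trans[OF norm_ge_zero])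
        finally show "norm (r b x *\<^sub>R B b y) \<le> norm x * norm y * (K b * L b)" by (simp add: mult_ac)
      qed
      finally show "norm (B x y) \<le> norm x * norm y * (\<Sum>b\<in>C. K b * L b)"
        by (simp add: sum_distrib_left)
    qed
  qed
qed

lemma findim_subspace_closed:
  fixes S :: "'a::real_normed_vector set"
  assumes fd: "findim TYPE('a)" and S: "subspace S"
  shows "closed S"
proof -
  obtain B where B: "B \<subseteq> S" "independent B" "S \<subseteq> span B"
    using maximal_independent_subset[of S] by blast
  have sp: "span B = S" using B S span_minimal[of B S] by blast
  obtain C :: "'a set" where C: "finite C" "span C = UNIV" using fd unfolding findim_def by blast
  have "finite B" using independent_span_bound[OF C(1) B(2)] C(2) by auto
  obtain f :: "'a \<Rightarrow> 'a" where f: "linear f" "\<And>x. x \<in> S \<Longrightarrow> f x = x" "range f \<subseteq> S"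
  proof -
    obtain g :: "'a \<Rightarrow> 'a" where g: "\<forall>x\<in>B. g x = x" "range g = span (id ` B)" "linear g"
      using linear_independent_extend_subspace[OF B(2), of id] by auto
    have "g x = x" if "x \<in> S" for x
      using that linear_eq_on[OF g(3) linear_id, of x B] sp g(1) by auto
    then show thesis using that g sp by auto
  qed
  have "S = {x. f x = x}" using f(2,3) by (auto simp: image_subset_iff) (metis)
  moreover have "closed {x. f x = x}"
    using findim_linear_bounded[OF fd f(1)]
    by (intro closed_Collect_eq) (auto intro: linear_continuous_on)
  ultimately show ?thesis by simp
qed

section \<open>Derivatives\<close>

lemma dd_eq: "(f has_derivative f') (at p) \<Longrightarrow> dd f p u = f' u"
  unfolding dd_def using frechet_derivative_at by metis

lemma has_derivative_dd: "f differentiable (at p) \<Longrightarrow> (f has_derivative dd f p) (at p)"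
  unfolding dd_def[abs_def] using frechet_derivative_works by blast

lemma bounded_linear_dd: "f differentiable (at p) \<Longrightarrow> bounded_linear (dd f p)"
  using has_derivative_dd has_derivative_bounded_linear by blast

lemma linear_dd: "f differentiable (at p) \<Longrightarrow> linear (dd f p)"
  using bounded_linear_dd bounded_linear.linear by blast

lemma has_derivative_cong_open:
  assumes "open S" "p \<in> S" "\<And>x. x \<in> S \<Longrightarrow> f x = g x"
  shows "(f has_derivative D) (at p) \<longleftrightarrow> (g has_derivative D) (at p)"
  using assms has_derivative_transform_within_open[of f D p UNIV S g]
    has_derivative_transform_within_open[of g D p UNIV S f] by metis

lemma dd_cong_open:
  assumes "open S" "p \<in> S" "\<And>x. x \<in> S \<Longrightarrow> f x = g x"
  shows "dd f p = dd g p"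
  unfolding dd_def frechet_derivative_def
  using has_derivative_cong_open[OF assms] by presburger

lemma differentiable_cong_open:
  assumes "open S" "p \<in> S" "\<And>x. x \<in> S \<Longrightarrow> f x = g x"
  shows "f differentiable (at p) \<longleftrightarrow> g differentiable (at p)"
  unfolding differentiable_def using has_derivative_cong_open[OF assms] by presburger

lemma dd_const [simp]: "dd (\<lambda>_. c) p u = 0"
  by (rule dd_eq) (auto intro!: derivative_eq_intros)

lemma dd_add:
  "f differentiable (at p) \<Longrightarrow> g differentiable (at p) \<Longrightarrow>
    dd (\<lambda>x. f x + g x) p u = dd f p u + dd g p u"
  by (rule dd_eq) (auto intro!: derivative_eq_intros has_derivative_dd)

lemma dd_diff:
  "f differentiable (at p) \<Longrightarrow> g differentiable (at p) \<Longrightarrow>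
    dd (\<lambda>x. f x - g x) p u = dd f p u - dd g p u"
  by (rule dd_eq) (auto intro!: derivative_eq_intros has_derivative_dd)

lemma dd_sum:
  "(\<And>i. i \<in> I \<Longrightarrow> f i differentiable (at p)) \<Longrightarrow>
    dd (\<lambda>x. \<Sum>i\<in>I. f i x) p u = (\<Sum>i\<in>I. dd (f i) p u)"
  by (rule dd_eq) (auto intro!: derivative_eq_intros has_derivative_dd)

lemma dd_bounded_linear:
  assumes "bounded_linear L" "f differentiable (at p)"
  shows "dd (\<lambda>x. L (f x)) p u = L (dd f p u)"
  by (rule dd_eq) (intro bounded_linear.has_derivative[OF assms(1)] has_derivative_dd assms)

lemma differentiable_bounded_linear:
  assumes "bounded_linear L" "f differentiable (at p)"
  shows "(\<lambda>x. L (f x)) differentiable (at p)"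
  using bounded_linear.has_derivative[OF assms(1) has_derivative_dd[OF assms(2)]] by (auto simp: differentiable_def)

lemma dd_bounded_bilinear:
  assumes "bounded_bilinear B" "f differentiable (at p)" "g differentiable (at p)"
  shows "dd (\<lambda>x. B (f x) (g x)) p u = B (dd f p u) (g p) + B (f p) (dd g p u)"
  by (rule dd_eq[OF bounded_bilinear.FDERIV[OF assms(1) assms(2,3)[THEN has_derivative_dd]], THEN trans])
     simp

lemma differentiable_bounded_bilinear:
  assumes "bounded_bilinear B" "f differentiable (at p)" "g differentiable (at p)"
  shows "(\<lambda>x. B (f x) (g x)) differentiable (at p)"
  using bounded_bilinear.FDERIV[OF assms(1) assms(2,3)[THEN has_derivative_dd]] by (auto simp: differentiable_def)

lemma dd_parameter_linear:
  fixes f :: "'q::real_normed_vector \<Rightarrow> 'a::real_vector \<Rightarrow> 'b::real_normed_vector"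
  assumes S: "open S" "p \<in> S" and f: "\<And>q. q \<in> S \<Longrightarrow> linear (f q)" and d: "\<And>x. (\<lambda>q. f q x) differentiable (at p)"
  shows "linear (\<lambda>x. dd (\<lambda>q. f q x) p u)"
proof (rule linearI)
  fix x y and r :: real
  have "dd (\<lambda>q. f q (x + y)) p = dd (\<lambda>q. f q x + f q y) p"
    by (rule dd_cong_open[OF S]) (rule linear_add[OF f])
  then show "dd (\<lambda>q. f q (x + y)) p u = dd (\<lambda>q. f q x) p u + dd (\<lambda>q. f q y) p u" by (simp add: dd_add[OF d d])
  have "dd (\<lambda>q. f q (r *\<^sub>R x)) p = dd (\<lambda>q. r *\<^sub>R f q x) p"
    by (rule dd_cong_open[OF S]) (rule linear_scale[OF f])
  then show "dd (\<lambda>q. f q (r *\<^sub>R x)) p u = r *\<^sub>R dd (\<lambda>q. f q x) p u"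
    by (simp add: dd_bounded_linear[OF bounded_linear_scaleR_right d])
qed

lemma differentiable_sum_fun:
  "(\<And>i. i \<in> I \<Longrightarrow> f i differentiable (at p)) \<Longrightarrow> (\<lambda>x. \<Sum>i\<in>I. f i x) differentiable (at p)"
  using has_derivative_sum[of I f "\<lambda>i. dd (f i) p" "at p"] has_derivative_dd
  unfolding differentiable_def by blast

text \<open>
  The product rule for \<open>G (x t) (y t)\<close> with \<open>G q\<close> linear. Expanding \<open>y t\<close> in a basis makes it sufficient that \<open>G\<close>
  is differentiable in \<open>q\<close> for each fixed vector.
\<close>

lemma has_derivative_parametrised_linear:
  fixes G :: "'q::real_normed_vector \<Rightarrow> 'w::real_normed_vector \<Rightarrow> 'b::real_normed_vector"
  assumes fd: "findim TYPE('w)"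
    and S: "open S" "x p \<in> S" "\<And>q. q \<in> S \<Longrightarrow> linear (G q)"
    and G: "\<And>w. (\<lambda>q. G q w) differentiable (at (x p))"
    and x: "(x has_derivative x') (at p)" and y: "(y has_derivative y') (at p)"
  shows "((\<lambda>t. G (x t) (y t)) has_derivative
    (\<lambda>u. dd (\<lambda>q. G q (y p)) (x p) (x' u) + G (x p) (y' u))) (at p)"
proof -
  obtain C and r :: "'w \<Rightarrow> 'w \<Rightarrow> real"
    where C: "finite C" "\<And>b. b \<in> C \<Longrightarrow> bounded_linear (r b)" "\<And>w. (\<Sum>b\<in>C. r b w *\<^sub>R b) = w"
    using findim_coords[OF fd] by metis
  have exp: "G q w = (\<Sum>b\<in>C. r b w *\<^sub>R G q b)" if "q \<in> S" for q w
  proof -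
    have "G q w = G q (\<Sum>b\<in>C. r b w *\<^sub>R b)" by (simp add: C(3))
    then show ?thesis by (simp add: linear_sum[OF S(3)[OF that]] linear_scale[OF S(3)[OF that]])
  qed
  define V where "V = x -` S"
  have "\<forall>\<^sub>F t in at p. x t \<in> S"
    using has_derivative_continuous[OF x] S(1,2)
    by (metis continuous_within topological_tendstoD)
  moreover have "x p \<in> S" by fact
  ultimately have ev: "\<forall>\<^sub>F t in nhds p. x t \<in> S"
    by (simp add: eventually_nhds_conv_at)
  then obtain W where W: "open W" "p \<in> W" "\<And>t. t \<in> W \<Longrightarrow> x t \<in> S"
    by (auto simp: eventually_nhds)
  have Gx: "((\<lambda>t. G (x t) b) has_derivative (\<lambda>u. dd (\<lambda>q. G q b) (x p) (x' u))) (at p)" for b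
    using diff_chain_at[OF x has_derivative_dd[OF G[of b]]] by (simp add: o_def)
  have "((\<lambda>t. \<Sum>b\<in>C. r b (y t) *\<^sub>R G (x t) b) has_derivative
      (\<lambda>u. \<Sum>b\<in>C. r b (y p) *\<^sub>R dd (\<lambda>q. G q b) (x p) (x' u) + r b (y' u) *\<^sub>R G (x p) b)) (at p)"
    by (intro has_derivative_sum has_derivative_scaleR bounded_linear.has_derivative[OF C(2)] y Gx)
  also have "(\<lambda>u. \<Sum>b\<in>C. r b (y p) *\<^sub>R dd (\<lambda>q. G q b) (x p) (x' u) + r b (y' u) *\<^sub>R G (x p) b)
     = (\<lambda>u. dd (\<lambda>q. G q (y p)) (x p) (x' u) + G (x p) (y' u))"
  proof
    fix u
    have "dd (\<lambda>q. G q (y p)) (x p) = dd (\<lambda>q. \<Sum>b\<in>C. r b (y p) *\<^sub>R G q b) (x p)"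
      by (rule dd_cong_open[OF S(1,2) exp])
    then have "dd (\<lambda>q. G q (y p)) (x p) (x' u) = dd (\<lambda>q. \<Sum>b\<in>C. r b (y p) *\<^sub>R G q b) (x p) (x' u)" by simp
    also have "\<dots> = (\<Sum>b\<in>C. dd (\<lambda>q. r b (y p) *\<^sub>R G q b) (x p) (x' u))"
      using G by (intro dd_sum) (auto intro!: differentiable_bounded_linear bounded_linear_scaleR_right)
    also have "\<dots> = (\<Sum>b\<in>C. r b (y p) *\<^sub>R dd (\<lambda>q. G q b) (x p) (x' u))"
      using G by (intro sum.cong refl dd_bounded_linear bounded_linear_scaleR_right)
    finally show "(\<Sum>b\<in>C. r b (y p) *\<^sub>R dd (\<lambda>q. G q b) (x p) (x' u) + r b (y' u) *\<^sub>R G (x p) b)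
      = dd (\<lambda>q. G q (y p)) (x p) (x' u) + G (x p) (y' u)"
      by (simp add: sum.distrib exp[OF S(2), of "y' u"])
  qed
  finally show ?thesis
    by (subst has_derivative_cong_open[OF W(1,2) exp[OF W(3)]]) auto
qed

text \<open>
  The second difference is \<open>t\<^sup>2\<close> times the mixed derivative up to \<open>o(t\<^sup>2)\<close>, by the mean value inequality for
  the difference of \<open>f\<close> along two parallel segments in the direction of \<open>u\<close>.
\<close>

lemma mixed_difference_estimate:
  fixes f :: "'a::real_normed_vector \<Rightarrow> 'b::real_normed_vector"
  assumes S: "open S" "p \<in> S" and f: "\<And>x. x \<in> S \<Longrightarrow> f differentiable (at x)"
    and D: "((\<lambda>q. dd f q u) has_derivative L) (at p)" and "e > 0"
  shows "\<exists>d>0. \<forall>t. 0 < t \<and> t < d \<longrightarrow>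
    norm (f (p + t *\<^sub>R u + t *\<^sub>R v) - f (p + t *\<^sub>R u) - f (p + t *\<^sub>R v) + f p - (t * t) *\<^sub>R L v) \<le> e * (t * t)"
proof -
  define N where "N = norm u + norm v + 1"
  have N: "N > 0" by (simp add: N_def add_nonneg_pos)
  define e' where "e' = e / (2 * N)"
  have e': "e' > 0" using \<open>e > 0\<close> N by (simp add: e'_def)
  obtain d1 where d1: "d1 > 0" "\<And>y. norm (y - p) < d1 \<Longrightarrow>
      norm (dd f y u - dd f p u - L (y - p)) \<le> e' * norm (y - p)"
    using D e' unfolding has_derivative_at_alt by blast
  obtain d2 where d2: "d2 > 0" "ball p d2 \<subseteq> S" using S openE by blast
  have L: "linear L" using D has_derivative_linear by blast
  define d where "d = min d1 d2 / N"
  have "norm (f (p + t *\<^sub>R u + t *\<^sub>R v) - f (p + t *\<^sub>R u) - f (p + t *\<^sub>R v) + f p - (t * t) *\<^sub>R L v) \<le> e * (t * t)"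
    if t: "0 < t" "t < d" for t
  proof -
    have tN: "t * N < d1" "t * N < d2"
      using t(2) N by (auto simp: d_def field_simps)
    have near: "norm (s *\<^sub>R u + r *\<^sub>R v) \<le> t * N" if "0 \<le> s" "s \<le> t" "0 \<le> r" "r \<le> t" for s r
    proof -
      have "norm (s *\<^sub>R u + r *\<^sub>R v) \<le> s * norm u + r * norm v"
        using norm_triangle_ineq[of "s *\<^sub>R u" "r *\<^sub>R v"] that by simp
      also have "\<dots> \<le> t * norm u + t * norm v"
        using that by (intro add_mono mult_right_mono) auto
      also have "\<dots> \<le> t * N" using t by (simp add: N_def algebra_simps)
      finally show ?thesis .
    qed
    define \<phi> where "\<phi> s = f (p + (s *\<^sub>R u + t *\<^sub>R v)) - f (p + (s *\<^sub>R u + 0 *\<^sub>R v)) - s *\<^sub>R (t *\<^sub>R L v)" for s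
    have inS: "p + (s *\<^sub>R u + r *\<^sub>R v) \<in> S" if "0 \<le> s" "s \<le> t" "0 \<le> r" "r \<le> t" for s r
    proof -
      have "dist p (p + (s *\<^sub>R u + r *\<^sub>R v)) < d2"
        using near[OF that] tN by (subst dist_commute) (simp add: dist_norm)
      then show ?thesis using d2(2) by auto
    qed
    have der: "(\<phi> has_derivative (\<lambda>h. h *\<^sub>R (dd f (p + (s *\<^sub>R u + t *\<^sub>R v)) u - dd f (p + (s *\<^sub>R u + 0 *\<^sub>R v)) u - t *\<^sub>R L v)))
        (at s within {0..t})" if "s \<in> {0..t}" for s
    proof -
      have *: "((\<lambda>s. f (p + (s *\<^sub>R u + r *\<^sub>R v))) has_derivative (\<lambda>h. h *\<^sub>R dd f (p + (s *\<^sub>R u + r *\<^sub>R v)) u)) (at s)"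
        if "0 \<le> r" "r \<le> t" for r
      proof -
        have fd: "(f has_derivative dd f (p + (s *\<^sub>R u + r *\<^sub>R v))) (at (p + (s *\<^sub>R u + r *\<^sub>R v)))"
          using \<open>s \<in> {0..t}\<close> that by (intro has_derivative_dd f inS) auto
        have "((\<lambda>s. p + (s *\<^sub>R u + r *\<^sub>R v)) has_derivative (\<lambda>h. h *\<^sub>R u)) (at s)"
          by (auto intro!: derivative_eq_intros)
        from diff_chain_at[OF this fd] show ?thesis
          using linear_scale[OF has_derivative_linear[OF fd]] by (simp add: o_def)
      qed
      show ?thesis
        unfolding \<phi>_def scaleR_diff_right
        using t by (intro has_derivative_diff has_derivative_at_withinI[OF *]) (auto intro!: derivative_eq_intros)
    qed
    have bnd: "onorm (\<lambda>h. h *\<^sub>R (dd f (p + (s *\<^sub>R u + t *\<^sub>R v)) u - dd f (p + (s *\<^sub>R u + 0 *\<^sub>R v)) u - t *\<^sub>R L v)) \<le> e * t"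
      if "s \<in> {0..t}" for s
    proof (rule onorm_le)
      fix h
      have est: "norm (dd f (p + (s *\<^sub>R u + r *\<^sub>R v)) u - dd f p u - L (s *\<^sub>R u + r *\<^sub>R v)) \<le> e' * (t * N)"
        if "0 \<le> r" "r \<le> t" for r
      proof -
        have "norm (p + (s *\<^sub>R u + r *\<^sub>R v) - p) < d1"
          using near[of s r] \<open>s \<in> {0..t}\<close> that tN by auto
        from d1(2)[OF this] have "norm (dd f (p + (s *\<^sub>R u + r *\<^sub>R v)) u - dd f p u - L (s *\<^sub>R u + r *\<^sub>R v))
            \<le> e' * norm (s *\<^sub>R u + r *\<^sub>R v)" by simp
        also have "\<dots> \<le> e' * (t * N)"
          using near[of s r] \<open>s \<in> {0..t}\<close> that e' by (intro mult_left_mono) auto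
        finally show ?thesis .
      qed
      have "dd f (p + (s *\<^sub>R u + t *\<^sub>R v)) u - dd f (p + (s *\<^sub>R u + 0 *\<^sub>R v)) u - t *\<^sub>R L v
          = (dd f (p + (s *\<^sub>R u + t *\<^sub>R v)) u - dd f p u - L (s *\<^sub>R u + t *\<^sub>R v))
          - (dd f (p + (s *\<^sub>R u + 0 *\<^sub>R v)) u - dd f p u - L (s *\<^sub>R u + 0 *\<^sub>R v))"
        using linear_add[OF L] linear_scale[OF L] linear_0[OF L] by (simp add: algebra_simps)
      also have "norm \<dots> \<le> e' * (t * N) + e' * (t * N)"
        using t by (intro order_trans[OF norm_triangle_ineq4] add_mono est) auto
      also have "\<dots> = e * t" using N by (simp add: e'_def)
      finally show "norm (h *\<^sub>R (dd f (p + (s *\<^sub>R u + t *\<^sub>R v)) u - dd f (p + (s *\<^sub>R u + 0 *\<^sub>R v)) u - t *\<^sub>R L v)) \<le> e * t * norm h"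
        by (simp add: mult.commute mult_left_mono)
    qed
    have "norm (\<phi> t - \<phi> 0) \<le> (e * t) * norm (t - 0)"
      using t by (intro differentiable_bound[where S = "{0..t}", OF _ der bnd]) auto
    then show ?thesis using t by (simp add: \<phi>_def algebra_simps)
  qed
  moreover have "d > 0" using d1(1) d2(1) N by (simp add: d_def)
  ultimately show ?thesis by blast
qed

text \<open>
  Schwarz's theorem under the weak hypothesis that the two first derivatives are differentiable at the
  point only: the second difference is symmetric in \<open>u\<close> and \<open>v\<close>.
\<close>

theorem symmetric_mixed_derivatives:
  fixes f :: "'a::real_normed_vector \<Rightarrow> 'b::real_normed_vector"
  assumes S: "open S" "p \<in> S" and f: "\<And>x. x \<in> S \<Longrightarrow> f differentiable (at x)"
    and u: "(\<lambda>q. dd f q u) differentiable (at p)" and v: "(\<lambda>q. dd f q v) differentiable (at p)"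
  shows "dd (\<lambda>q. dd f q u) p v = dd (\<lambda>q. dd f q v) p u"
proof -
  let ?a = "dd (\<lambda>q. dd f q u) p v" and ?b = "dd (\<lambda>q. dd f q v) p u"
  have "norm (?a - ?b) \<le> e" if e: "e > 0" for e
  proof -
    obtain d1 where d1: "d1 > 0" "\<And>t. 0 < t \<Longrightarrow> t < d1 \<Longrightarrow>
      norm (f (p + t *\<^sub>R u + t *\<^sub>R v) - f (p + t *\<^sub>R u) - f (p + t *\<^sub>R v) + f p - (t * t) *\<^sub>R ?a) \<le> e/2 * (t * t)"
      using mixed_difference_estimate[OF S f has_derivative_dd[OF u] half_gt_zero[OF e], of v] by blast
    obtain d2 where d2: "d2 > 0" "\<And>t. 0 < t \<Longrightarrow> t < d2 \<Longrightarrow>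
      norm (f (p + t *\<^sub>R v + t *\<^sub>R u) - f (p + t *\<^sub>R v) - f (p + t *\<^sub>R u) + f p - (t * t) *\<^sub>R ?b) \<le> e/2 * (t * t)"
      using mixed_difference_estimate[OF S f has_derivative_dd[OF v] half_gt_zero[OF e], of u] by blast
    define t where "t = min d1 d2 / 2"
    have t: "0 < t" "t < d1" "t < d2" using d1(1) d2(1) by (auto simp: t_def)
    let ?D = "f (p + t *\<^sub>R u + t *\<^sub>R v) - f (p + t *\<^sub>R u) - f (p + t *\<^sub>R v) + f p"
    have "f (p + t *\<^sub>R v + t *\<^sub>R u) - f (p + t *\<^sub>R v) - f (p + t *\<^sub>R u) + f p = ?D"
      by (simp add: algebra_simps)
    then have b: "norm (?D - (t * t) *\<^sub>R ?b) \<le> e/2 * (t * t)" using d2(2)[OF t(1,3)] by metis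
    have "(t * t) * norm (?a - ?b) = norm ((?D - (t * t) *\<^sub>R ?b) - (?D - (t * t) *\<^sub>R ?a))"
      using t(1) by (simp flip: scaleR_diff_right)
    also have "\<dots> \<le> e/2 * (t * t) + e/2 * (t * t)"
      by (intro order_trans[OF norm_triangle_ineq4] add_mono b d1(2)[OF t(1,2)])
    also have "\<dots> = (t * t) * e" by simp
    finally show ?thesis using t(1) by (simp add: mult_le_cancel_left_pos)
  qed
  then have "norm (?a - ?b) \<le> 0" by (rule field_le_epsilon) simp
  then show ?thesis by simp
qed

section \<open>Smooth maps\<close>

lemma Ck_on_cong:
  assumes "open S" "\<And>x. x \<in> S \<Longrightarrow> f x = g x"
  shows "Ck_on k S f \<longleftrightarrow> Ck_on k S g"
  using assms(2)
proof (induction k arbitrary: f g)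
  case 0
  then show ?case using continuous_on_cong[OF refl 0] by simp
next
  case (Suc k)
  have "Ck_on k S (\<lambda>x. dd f x v) \<longleftrightarrow> Ck_on k S (\<lambda>x. dd g x v)" for v
    by (rule Suc.IH) (simp add: dd_cong_open[OF assms(1) _ Suc.prems])
  moreover have "(\<forall>x\<in>S. f differentiable (at x)) \<longleftrightarrow> (\<forall>x\<in>S. g differentiable (at x))"
    by (intro ball_cong refl differentiable_cong_open[OF assms(1)] Suc.prems)
  ultimately show ?case by simp
qed

lemma Ck_on_const: "Ck_on k S (\<lambda>_. c)"
  by (induction k arbitrary: c) auto

lemma Ck_on_bounded_linear:
  assumes "open S" "bounded_linear L"
  shows "Ck_on k S f \<Longrightarrow> Ck_on k S (\<lambda>x. L (f x))"
proof (induction k arbitrary: f)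
  case 0
  then show ?case using assms(2) by (simp add: bounded_linear.continuous_on)
next
  case (Suc k)
  then have d: "\<And>x. x \<in> S \<Longrightarrow> f differentiable at x" and "\<And>v. Ck_on k S (\<lambda>x. dd f x v)" by auto
  have "Ck_on k S (\<lambda>x. dd (\<lambda>x. L (f x)) x v)" for v
    using Ck_on_cong[OF assms(1), of "\<lambda>x. dd (\<lambda>x. L (f x)) x v" "\<lambda>x. L (dd f x v)" k]
      dd_bounded_linear[OF assms(2) d] Suc.IH[of "\<lambda>x. dd f x v"] Suc.prems by auto
  then show ?case using d assms(2) by (auto intro: differentiable_bounded_linear)
qed

lemma Ck_on_add:
  assumes "open S"
  shows "Ck_on k S f \<Longrightarrow> Ck_on k S g \<Longrightarrow> Ck_on k S (\<lambda>x. f x + g x)"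
proof (induction k arbitrary: f g)
  case 0
  then show ?case by (simp add: continuous_on_add)
next
  case (Suc k)
  then have d: "\<And>x. x \<in> S \<Longrightarrow> f differentiable at x" "\<And>x. x \<in> S \<Longrightarrow> g differentiable at x" by auto
  have "Ck_on k S (\<lambda>x. dd (\<lambda>x. f x + g x) x v)" for v
    using Ck_on_cong[OF assms(1), of "\<lambda>x. dd (\<lambda>x. f x + g x) x v" "\<lambda>x. dd f x v + dd g x v" k]
      dd_add[OF d] Suc by auto
  then show ?case using d by auto
qed

lemma smooth_on_const: "smooth_on S (\<lambda>_. c)"
  by (simp add: smooth_on_def Ck_on_const)

lemma smooth_on_bounded_linear:
  "open S \<Longrightarrow> bounded_linear L \<Longrightarrow> smooth_on S f \<Longrightarrow> smooth_on S (\<lambda>x. L (f x))"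
  by (simp add: smooth_on_def Ck_on_bounded_linear)

lemma smooth_on_add:
  "open S \<Longrightarrow> smooth_on S f \<Longrightarrow> smooth_on S g \<Longrightarrow> smooth_on S (\<lambda>x. f x + g x)"
  by (simp add: smooth_on_def Ck_on_add)

lemma smooth_on_diff:
  "open S \<Longrightarrow> smooth_on S f \<Longrightarrow> smooth_on S g \<Longrightarrow> smooth_on S (\<lambda>x. f x - g x)"
  using smooth_on_add[of S f "\<lambda>x. - g x"] smooth_on_bounded_linear[of S uminus g]
  by (simp add: bounded_linear_minus[OF bounded_linear_ident])

lemma smooth_on_sum:
  "open S \<Longrightarrow> (\<And>i. i \<in> I \<Longrightarrow> smooth_on S (f i)) \<Longrightarrow> smooth_on S (\<lambda>x. \<Sum>i\<in>I. f i x)"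
  by (induction I rule: infinite_finite_induct) (auto simp: smooth_on_const smooth_on_add)

lemma smooth_on_dd: "smooth_on S f \<Longrightarrow> smooth_on S (\<lambda>x. dd f x v)"
  unfolding smooth_on_def
proof
  fix k assume "\<forall>k. Ck_on k S f"
  then have "Ck_on (Suc k) S f" by blast
  then show "Ck_on k S (\<lambda>x. dd f x v)" by simp
qed

lemma smooth_on_differentiable:
  assumes "smooth_on S f" "x \<in> S"
  shows "f differentiable (at x)"
proof -
  have "Ck_on (Suc 0) S f" using assms(1) unfolding smooth_on_def by blast
  then show ?thesis using assms(2) by simp
qed

lemma smooth_on_subset: "smooth_on S f \<Longrightarrow> T \<subseteq> S \<Longrightarrow> smooth_on T f"
proof -
  have "Ck_on k S f \<Longrightarrow> T \<subseteq> S \<Longrightarrow> Ck_on k T f" for k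
    by (induction k arbitrary: f) (auto intro: continuous_on_subset)
  then show "smooth_on S f \<Longrightarrow> T \<subseteq> S \<Longrightarrow> smooth_on T f" by (auto simp: smooth_on_def)
qed

section \<open>Complex linearity\<close>

lemma scaleC_zero_right [simp]: "scaleC c (0::'a::complex_normed_vector) = 0"
  using scaleC_add_right[of c 0 "0::'a"] by simp

lemma scaleC_zero_left [simp]: "scaleC 0 (x::'a::complex_normed_vector) = 0"
  using scaleC_of_real[of 0 x] by simp

lemma scaleC_one [simp]: "scaleC 1 (x::'a::complex_normed_vector) = x"
  using scaleC_of_real[of 1 x] by simp

lemma scaleC_minus_right: "scaleC c (- x::'a::complex_normed_vector) = - scaleC c x"
  using scaleC_add_right[of c x "- x"] by (simp add: eq_neg_iff_add_eq_0 add.commute)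

lemma scaleC_minus_left: "scaleC (- c) (x::'a::complex_normed_vector) = - scaleC c x"
  using scaleC_add_left[of c "- c" x] by (simp add: eq_neg_iff_add_eq_0 add.commute)

lemma scaleC_diff_right: "scaleC c (x - y::'a::complex_normed_vector) = scaleC c x - scaleC c y"
  using scaleC_add_right[of c x "- y"] by (simp add: scaleC_minus_right)

lemma scaleC_diff_left: "scaleC (a - b) (x::'a::complex_normed_vector) = scaleC a x - scaleC b x"
  using scaleC_add_left[of a "- b" x] by (simp add: scaleC_minus_left)

lemma scaleC_sum_right: "scaleC c (\<Sum>i\<in>I. f i :: 'a::complex_normed_vector) = (\<Sum>i\<in>I. scaleC c (f i))"
  by (induction I rule: infinite_finite_induct) (auto simp: scaleC_add_right)

lemma scaleC_scaleR: "scaleC c (r *\<^sub>R (x::'a::complex_normed_vector)) = r *\<^sub>R scaleC c x"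
  by (simp flip: scaleC_of_real add: scaleC_scaleC mult.commute)

lemma scaleC_ii [simp]: "scaleC \<i> (scaleC \<i> (x::'a::complex_normed_vector)) = - x"
  using scaleC_minus_left[of 1 x] by (simp add: scaleC_scaleC)

lemma scaleC_eq: "scaleC c (x::'a::complex_normed_vector) = Re c *\<^sub>R x + Im c *\<^sub>R scaleC \<i> x"
proof -
  have "scaleC c x = scaleC (complex_of_real (Re c) + \<i> * complex_of_real (Im c)) x"
    by (simp add: complex_eq[symmetric])
  then show ?thesis
    by (simp add: scaleC_add_left scaleC_of_real scaleC_scaleR flip: scaleC_scaleC)
qed

lemma scaleC_eq_0_iff [simp]: "scaleC c (x::'a::complex_normed_vector) = 0 \<longleftrightarrow> c = 0 \<or> x = 0"
  by (metis mult_eq_0_iff norm_eq_zero norm_scaleC)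

lemma bounded_linear_scaleC: "bounded_linear (scaleC c :: 'a::complex_normed_vector \<Rightarrow> 'a)"
  by (rule bounded_linear_intro[where K = "cmod c"])
     (auto simp: scaleC_add_right scaleC_scaleR norm_scaleC mult.commute)

lemma bounded_linear_scaleC_left: "bounded_linear (\<lambda>c. scaleC c (x :: 'a::complex_normed_vector))"
  by (rule bounded_linear_intro[where K = "norm x"])
     (simp_all add: scaleC_add_left norm_scaleC scaleR_conv_of_real scaleC_of_real flip: scaleC_scaleC)

lemma complex_linear_linear: "complex_linear f \<Longrightarrow> linear f"
  unfolding complex_linear_def
  by (intro linearI) (auto simp flip: scaleC_of_real)

lemma complex_linearD:
  assumes "complex_linear f"
  shows "f (x + y) = f x + f y" "f (scaleC c x) = scaleC c (f x)" "f 0 = 0" "f (- x) = - f x"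
    "f (x - y) = f x - f y" "f (r *\<^sub>R x) = r *\<^sub>R f x" "f (sum g I) = (\<Sum>i\<in>I. f (g i))"
proof -
  show "f (x + y) = f x + f y" "f (scaleC c x) = scaleC c (f x)"
    using assms unfolding complex_linear_def by auto
qed (use complex_linear_linear[OF assms] in \<open>auto simp: linear_0 linear_neg linear_diff linear_scale linear_sum\<close>)

lemma complex_linearI_ii:
  assumes "linear f" "\<And>x. f (scaleC \<i> x) = scaleC \<i> (f x)"
  shows "complex_linear f"
  unfolding complex_linear_def
proof (intro conjI allI)
  show "f (x + y) = f x + f y" for x y by (rule linear_add[OF assms(1)])
  show "f (scaleC c x) = scaleC c (f x)" for c x
    by (subst (1 2) scaleC_eq) (simp add: linear_add[OF assms(1)] linear_scale[OF assms(1)] assms(2))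
qed

lemma complex_linear_comp:
  "complex_linear f \<Longrightarrow> complex_linear g \<Longrightarrow> complex_linear (\<lambda>x. f (g x))"
  by (simp add: complex_linear_def)

section \<open>Derivatives of holomorphic maps are holomorphic\<close>

text \<open>
  Differential calculus of the group multiplication needs second derivatives, whereas holomorphy only
  provides one complex-linear derivative. The directional difference quotients of a holomorphic
  function converge locally uniformly with an error bound from Taylor's formula on complex lines, and
  Cauchy's estimate on complex lines turns this into uniform convergence of their derivatives.
\<close>

lemma holo_onD:
  assumes "holo_on S f" "x \<in> S"
  shows "f differentiable (at x)" "(f has_derivative dd f x) (at x)" "complex_linear (dd f x)"
proof -
  obtain L where L: "(f has_derivative L) (at x)" "complex_linear L"
    using assms unfolding holo_on_def by blast
  then show d: "f differentiable (at x)" unfolding differentiable_def by blast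
  show "(f has_derivative dd f x) (at x)" using has_derivative_dd[OF d] .
  have "dd f x = L" using dd_eq[OF L(1)] by auto
  then show "complex_linear (dd f x)" using L(2) by simp
qed

lemma holo_onI:
  assumes "\<And>x. x \<in> S \<Longrightarrow> f differentiable (at x)" "\<And>x. x \<in> S \<Longrightarrow> complex_linear (dd f x)"
  shows "holo_on S f"
  using assms has_derivative_dd unfolding holo_on_def by blast

lemma holo_on_line:
  fixes f :: "'a::complex_normed_vector \<Rightarrow> complex"
  assumes f: "holo_on S f" and z: "x + scaleC z h \<in> S"
  shows "((\<lambda>z. f (x + scaleC z h)) has_field_derivative dd f (x + scaleC z h) h) (at z)"
proof -
  have "((\<lambda>z. x + scaleC z h) has_derivative (\<lambda>w. scaleC w h)) (at z)"
    by (auto intro!: derivative_eq_intros bounded_linear_imp_has_derivative bounded_linear_scaleC_left)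
  from diff_chain_at[OF this holo_onD(2)[OF f z]]
  show ?thesis
    using complex_linearD(2)[OF holo_onD(3)[OF f z]]
    by (simp add: has_field_derivative_def o_def scaleC_complex_def mult_commute_abs)
qed

lemma line_in_ball:
  fixes x :: "'a::complex_normed_vector"
  assumes "cmod z < R / (norm h + 1)"
  shows "x + scaleC z h \<in> ball x R"
proof -
  have "cmod z * norm h \<le> cmod z * (norm h + 1)" by (simp add: algebra_simps)
  also have "\<dots> < R" using assms by (simp add: pos_less_divide_eq add_nonneg_pos)
  finally show ?thesis by (simp add: dist_norm norm_scaleC)
qed

lemma cauchy_estimate_line:
  fixes f :: "'a::complex_normed_vector \<Rightarrow> complex"
  assumes f: "holo_on (ball x R) f" and B: "\<And>y. y \<in> ball x R \<Longrightarrow> cmod (f y) < B" and "R > 0"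
  shows "cmod (dd f x h) \<le> 2 * B * norm h / R"
proof (cases "h = 0")
  case True
  then show ?thesis
    using complex_linearD(3)[OF holo_onD(3)[OF f]] \<open>R > 0\<close> by simp
next
  case False
  define \<rho> where "\<rho> = R / (2 * norm h)"
  have \<rho>: "\<rho> > 0" using False \<open>R > 0\<close> by (simp add: \<rho>_def)
  have inb: "x + scaleC z h \<in> ball x R" if "cmod z \<le> \<rho>" for z
  proof -
    have "cmod z * norm h \<le> \<rho> * norm h" using that by (simp add: mult_right_mono)
    also have "\<dots> < R" using False \<open>R > 0\<close> by (simp add: \<rho>_def)
    finally show ?thesis by (simp add: dist_norm norm_scaleC)
  qed
  let ?\<phi> = "\<lambda>z. f (x + scaleC z h)"
  have der: "(?\<phi> has_field_derivative dd f (x + scaleC z h) h) (at z)" if "cmod z \<le> \<rho>" for z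
    by (rule holo_on_line[OF f inb[OF that]])
  have "?\<phi> holomorphic_on ball 0 \<rho>"
    unfolding holomorphic_on_def field_differentiable_def
    using der by (metis has_field_derivative_at_within less_imp_le mem_ball_0)
  moreover have "continuous_on (cball 0 \<rho>) ?\<phi>"
    using der by (metis DERIV_isCont continuous_at_imp_continuous_on mem_cball_0)
  ultimately have "cmod ((deriv ^^ 1) ?\<phi> 0) \<le> fact 1 * B / \<rho> ^ 1"
    by (rule Cauchy_higher_deriv_bound[where y = 0]) (use B inb \<rho> in auto)
  moreover have "deriv ?\<phi> 0 = dd f x h"
    using DERIV_imp_deriv[OF der[of 0]] \<rho> by simp
  ultimately show ?thesis using False by (simp add: \<rho>_def field_simps)
qed

lemma taylor_estimate_line:
  fixes f :: "'a::complex_normed_vector \<Rightarrow> complex"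
  assumes f: "holo_on (ball x R) f" and B: "\<And>y. y \<in> ball x R \<Longrightarrow> cmod (f y) < B" and "R > 0"
    and t: "cmod t \<le> R / (4 * (norm v + 1))"
  shows "cmod (f (x + scaleC t v) - f x - t * dd f x v) \<le> 32 * B * (norm v + 1)\<^sup>2 / R\<^sup>2 * (cmod t)\<^sup>2"
proof -
  define N where "N = norm v + 1"
  have N: "N > 0" by (simp add: N_def add_nonneg_pos)
  define \<rho> where "\<rho> = R / (4 * N)"
  have \<rho>: "\<rho> > 0" using N \<open>R > 0\<close> by (simp add: \<rho>_def)
  have inb: "x + scaleC z v \<in> ball x R" if "cmod z < 4 * \<rho>" for z
    using that N by (intro line_in_ball) (simp add: \<rho>_def flip: N_def)
  let ?\<phi> = "\<lambda>z. f (x + scaleC z v)"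
  have der: "(?\<phi> has_field_derivative dd f (x + scaleC z v) v) (at z)" if "cmod z < 4 * \<rho>" for z
    by (rule holo_on_line[OF f inb[OF that]])
  have hol: "?\<phi> holomorphic_on ball 0 (4 * \<rho>)"
    unfolding holomorphic_on_def field_differentiable_def
    using der by (metis has_field_derivative_at_within mem_ball_0)
  define F where "F i = (deriv ^^ i) ?\<phi>" for i
  have F: "(F i has_field_derivative F (Suc i) z) (at z within cball 0 \<rho>)" if "z \<in> cball 0 \<rho>" for i z
  proof -
    have "F i holomorphic_on ball 0 (4 * \<rho>)"
      unfolding F_def by (intro holomorphic_higher_deriv hol) auto
    moreover have "z \<in> ball 0 (4 * \<rho>)" using that \<rho> by auto
    ultimately have "(F i has_field_derivative deriv (F i) z) (at z)"
      by (intro holomorphic_derivI) auto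
    then show ?thesis by (simp add: F_def has_field_derivative_at_within)
  qed
  have bnd: "cmod (F (Suc 1) z) \<le> 2 * B / \<rho>\<^sup>2" if "z \<in> cball 0 \<rho>" for z
  proof -
    have sub: "cball z \<rho> \<subseteq> ball 0 (4 * \<rho>)"
    proof
      fix w assume "w \<in> cball z \<rho>"
      then have "cmod w \<le> cmod z + \<rho>"
        using norm_triangle_sub[of w z] by (simp add: dist_norm norm_minus_commute)
      then show "w \<in> ball 0 (4 * \<rho>)" using that \<rho> by simp
    qed
    have "cmod ((deriv ^^ 2) ?\<phi> z) \<le> fact 2 * B / \<rho> ^ 2"
    proof (rule Cauchy_higher_deriv_bound[where y = 0])
      show "?\<phi> holomorphic_on ball z \<rho>"
        using hol sub by (meson ball_subset_cball holomorphic_on_subset order_trans)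
      show "continuous_on (cball z \<rho>) ?\<phi>"
        using hol sub holomorphic_on_imp_continuous_on continuous_on_subset by blast
      fix w assume "w \<in> ball z \<rho>"
      then have "w \<in> ball 0 (4 * \<rho>)" using sub ball_subset_cball by blast
      then show "?\<phi> w \<in> ball 0 B" using B[OF inb, of w] by simp
    qed (use \<rho> in auto)
    then show ?thesis by (simp add: F_def numeral_2_eq_2)
  qed
  have "cmod (F 0 t - (\<Sum>i\<le>1. F i 0 * (t - 0) ^ i / fact i)) \<le> 2 * B / \<rho>\<^sup>2 * cmod (t - 0) ^ Suc 1 / fact 1"
    by (rule complex_Taylor[where f = F and n = 1 and S = "cball 0 \<rho>", OF convex_cball _ bnd]) (use F t \<rho> in \<open>auto simp: \<rho>_def N_def\<close>)
  moreover have "F 1 0 = dd f x v"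
    using DERIV_imp_deriv[OF der[of 0]] \<rho> by (simp add: F_def)
  moreover have "F 0 = ?\<phi>" by (simp add: F_def)
  ultimately have *: "cmod (f (x + scaleC t v) - f x - t * dd f x v) \<le> 2 * B / \<rho>\<^sup>2 * (cmod t)\<^sup>2"
    by (simp add: power2_eq_square diff_diff_eq mult.commute)
  have "2 * B / \<rho>\<^sup>2 = 32 * B * N\<^sup>2 / R\<^sup>2"
    by (simp add: \<rho>_def power_divide power_mult_distrib)
  with * show ?thesis by (simp only: N_def)
qed

lemma holo_on_subset: "holo_on S f \<Longrightarrow> T \<subseteq> S \<Longrightarrow> holo_on T f"
  unfolding holo_on_def by blast

text \<open>
  Cauchy's estimate makes the derivatives at \<open>p\<close> converge. Passing to the limit in Taylor's estimate, whose
  error term is uniform in \<open>n\<close>, shows that their limit is the derivative of the limit function.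
\<close>

lemma has_derivative_uniform_limit_holo:
  fixes g :: "nat \<Rightarrow> 'a::complex_normed_vector \<Rightarrow> complex"
  assumes g: "\<And>n. holo_on (ball p R) (g n)" and R: "R > 0" and B: "\<And>n y. y \<in> ball p R \<Longrightarrow> cmod (g n y) < B"
    and l: "\<And>n y. y \<in> ball p R \<Longrightarrow> cmod (g n y - l y) \<le> \<epsilon> n" and \<epsilon>: "\<epsilon> \<longlonglongrightarrow> 0"
  shows "\<exists>L. (l has_derivative L) (at p) \<and> complex_linear L"
proof -
  have pR: "p \<in> ball p R" using R by simp
  have lim: "(\<lambda>n. g n y) \<longlonglongrightarrow> l y" if "y \<in> ball p R" for y
    by (rule LIM_zero_cancel, rule Lim_null_comparison[OF _ \<epsilon>]) (use l[OF that] in simp)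
  have "Cauchy (\<lambda>n. dd (g n) p h)" for h
  proof (rule metric_CauchyI)
    fix e :: real assume e: "e > 0"
    define b where "b = e * R / (4 * (norm h + 1))"
    have h1: "norm h + 1 > 0" by (simp add: add_nonneg_pos)
    then have "norm h / (2 * (norm h + 1)) < 1" using norm_ge_zero[of h] by (simp add: divide_less_eq del: norm_ge_zero)
    moreover have "2 * b * norm h / R = e * (norm h / (2 * (norm h + 1)))" using R h1 by (simp add: b_def divide_simps)
    ultimately have "2 * b * norm h / R < e" using mult_strict_left_mono[OF _ e, of "norm h / (2 * (norm h + 1))" 1] by simp
    moreover have "b > 0" using e R h1 by (simp add: b_def)
    ultimately have b: "b > 0" "2 * b * norm h / R < e" by simp_all
    obtain N where N: "\<And>n. n \<ge> N \<Longrightarrow> \<epsilon> n < b / 2"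
      using order_tendstoD(2)[OF \<epsilon>, of "b / 2"] b by (auto simp: eventually_sequentially)
    have "dist (dd (g n) p h) (dd (g k) p h) < e" if "n \<ge> N" "k \<ge> N" for n k
    proof -
      have "cmod (dd (\<lambda>x. g n x - g k x) p h) \<le> 2 * b * norm h / R"
      proof (rule cauchy_estimate_line[OF _ _ R])
        show "holo_on (ball p R) (\<lambda>x. g n x - g k x)"
        proof (rule holo_onI)
          fix x assume x: "x \<in> ball p R"
          note d = holo_onD(1)[OF g x]
          show "(\<lambda>x. g n x - g k x) differentiable (at x)" by (rule differentiable_diff[OF d d])
          show "complex_linear (dd (\<lambda>x. g n x - g k x) x)"
            using holo_onD(3)[OF g x] by (simp add: complex_linear_def dd_diff[OF d d] scaleC_diff_right)
        qed
        fix y assume y: "y \<in> ball p R"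
        have "cmod (g n y - g k y) \<le> \<epsilon> n + \<epsilon> k"
          using norm_triangle_le_diff[OF add_mono[OF l[OF y] l[OF y]], of n k] by simp
        then show "cmod (g n y - g k y) < b" using N[OF that(1)] N[OF that(2)] by linarith
      qed
      then show ?thesis using b(2) by (simp add: dist_norm dd_diff[OF holo_onD(1)[OF g pR] holo_onD(1)[OF g pR]])
    qed
    then show "\<exists>M. \<forall>m\<ge>M. \<forall>n\<ge>M. dist (dd (g m) p h) (dd (g n) p h) < e" by blast
  qed
  then have "\<exists>a. (\<lambda>n. dd (g n) p h) \<longlonglongrightarrow> a" for h by (simp add: Cauchy_convergent_iff convergent_def)
  then obtain L where L: "\<And>h. (\<lambda>n. dd (g n) p h) \<longlonglongrightarrow> L h" by metis
  note gl = complex_linearD[OF holo_onD(3)[OF g pR]]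
  have "L (x + y) = L x + L y" "L (scaleC c x) = scaleC c (L x)" for x y c
  proof -
    show "L (x + y) = L x + L y"
      by (rule LIMSEQ_unique[OF L]) (use tendsto_add[OF L L, of x y] in \<open>simp add: gl\<close>)
    show "L (scaleC c x) = scaleC c (L x)"
      by (rule LIMSEQ_unique[OF L]) (use tendsto_mult_left[OF L, of c x] in \<open>simp add: gl scaleC_complex_def\<close>)
  qed
  then have Lc: "complex_linear L" by (simp add: complex_linear_def)
  have "cmod (L h) \<le> norm h * (2 * B / R)" for h
    by (rule LIMSEQ_le_const2[OF tendsto_norm[OF L]])
       (use cauchy_estimate_line[OF g B R] in \<open>auto simp: mult_ac\<close>)
  then have bl: "bounded_linear L"
    using complex_linearD(1,6)[OF Lc] by (intro bounded_linear_intro)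
  define C where "C = 32 * B * 2\<^sup>2 / R\<^sup>2"
  have "B > 0" using B[OF pR, of 0] norm_ge_zero[of "g 0 p"] by linarith
  then have C: "C \<ge> 0" by (simp add: C_def)
  have quad: "cmod (l (p + h) - l p - L h) \<le> C * (norm h)\<^sup>2" if h: "norm h \<le> R / 8" for h
  proof (cases "h = 0")
    case False
    define v where "v = (1 / norm h) *\<^sub>R h"
    have v: "norm v = 1" "scaleC (complex_of_real (norm h)) v = h" using False by (simp_all add: v_def scaleC_of_real)
    have in_ball: "p + h \<in> ball p R" using h R by (simp add: dist_norm)
    show ?thesis
    proof (rule LIMSEQ_le_const2)
      show "(\<lambda>n. cmod (g n (p + h) - g n p - dd (g n) p h)) \<longlonglongrightarrow> cmod (l (p + h) - l p - L h)"
        by (intro tendsto_intros lim in_ball pR L)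
      show "\<exists>N. \<forall>n\<ge>N. cmod (g n (p + h) - g n p - dd (g n) p h) \<le> C * (norm h)\<^sup>2"
        using taylor_estimate_line[OF g B R, of "complex_of_real (norm h)" v] h
        by (simp add: v C_def gl(2)[of _ "complex_of_real (norm h)" v, unfolded v, symmetric] scaleC_complex_def)
           (simp add: gl(2)[of _ "complex_of_real (norm h)" v, unfolded v] scaleC_complex_def)
    qed
  qed (simp add: complex_linearD(3)[OF Lc])
  have "(l has_derivative L) (at p)"
    unfolding has_derivative_at_alt
  proof (intro conjI allI impI bl)
    fix e :: real assume e: "e > 0"
    show "\<exists>d>0. \<forall>y. norm (y - p) < d \<longrightarrow> norm (l y - l p - L (y - p)) \<le> e * norm (y - p)"
    proof (intro exI[of _ "min (R / 8) (e / (C + 1))"] conjI allI impI)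
      show "0 < min (R / 8) (e / (C + 1))" using R e C by simp
      fix y assume y: "norm (y - p) < min (R / 8) (e / (C + 1))"
      then have "(C + 1) * norm (y - p) \<le> e" using C by (simp add: field_simps)
      then have "C * norm (y - p) \<le> e" using norm_ge_zero[of "y - p"] unfolding distrib_right by linarith
      then have "C * (norm (y - p))\<^sup>2 \<le> e * norm (y - p)" by (simp add: power2_eq_square mult_right_mono flip: mult.assoc)
      then show "norm (l y - l p - L (y - p)) \<le> e * norm (y - p)" using quad[of "y - p"] y by simp
    qed
  qed
  with Lc show ?thesis by blast
qed

lemma holo_on_dd_complex:
  fixes f :: "'a::complex_normed_vector \<Rightarrow> complex"
  assumes S: "open S" and f: "holo_on S f"
  shows "holo_on S (\<lambda>x. dd f x v)"
  unfolding holo_on_def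
proof
  fix p assume p: "p \<in> S"
  have "isCont f p" using holo_onD(1)[OF f p] by (rule differentiable_imp_continuous_within)
  then have "\<forall>\<^sub>F x in nhds p. cmod (f x - f p) < 1 \<and> x \<in> S"
    using tendstoD[of f "f p" "nhds p" 1] S p
    by (auto simp: isCont_def tendsto_at_iff_tendsto_nhds dist_norm eventually_conj_iff eventually_nhds)
  then obtain R0 where R0: "R0 > 0" "\<And>x. dist x p < R0 \<Longrightarrow> cmod (f x - f p) < 1 \<and> x \<in> S"
    unfolding eventually_nhds_metric by blast
  define R B N where "R = R0 / 4" and "B = cmod (f p) + 1" and "N = norm v + 1"
  have pos: "R > 0" "B > 0" "N > 0" "norm v < N" using R0(1) by (simp_all add: R_def B_def N_def add_nonneg_pos)
  have hS: "holo_on (ball y R) f" and fB: "z \<in> ball y R \<Longrightarrow> cmod (f z) < B" if y: "y \<in> ball p (3 * R)" for y z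
  proof -
    have "dist z p < R0" if "z \<in> ball y R" for z
      using y that dist_triangle[of z p y] by (simp add: R_def dist_commute)
    note in_R0 = R0(2)[OF this]
    show "holo_on (ball y R) f" by (rule holo_on_subset[OF f]) (use in_R0 in blast)
    show "cmod (f z) < B" if "z \<in> ball y R"
      using in_R0[OF that] norm_triangle_sub[of "f z" "f p"] by (simp add: B_def)
  qed
  define \<tau> where "\<tau> n = R / (8 * N) * inverse (real (Suc n))" for n
  have \<tau>: "\<tau> n > 0" "\<tau> n \<le> R / (8 * N)" for n
    using mult_left_mono[of "inverse (real (Suc n))" 1 "R / (8 * N)"] pos
    by (simp_all add: \<tau>_def inverse_le_1_iff del: of_nat_Suc)
  have \<tau>0: "\<tau> \<longlonglongrightarrow> 0"
    unfolding \<tau>_def[abs_def] using tendsto_mult_right_zero[OF LIMSEQ_inverse_real_of_nat] by blast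
  \<comment> \<open>The difference quotients of \<open>f\<close> along \<open>v\<close> with step \<open>\<tau> n\<close> are holomorphic; the step is small
    enough for the shifted points to remain in the balls on which \<open>f\<close> is bounded by \<open>B\<close>.\<close>
  define w where "w n = scaleC (complex_of_real (\<tau> n)) v" for n
  have "norm (w n) < R" for n
  proof -
    have "\<tau> n * norm v \<le> R / (8 * N) * N" using \<tau>[of n] pos by (intro mult_mono) auto
    also have "\<dots> < R" using pos by simp
    finally show ?thesis using \<tau>(1)[of n] by (simp add: w_def norm_scaleC)
  qed
  then have shift: "x + w n \<in> ball x R" for x n by (simp add: dist_norm)
  define g where "g n x = complex_of_real (inverse (\<tau> n)) * (f (x + w n) - f x)" for n x
  define K where "K = 32 * B * N\<^sup>2 / R\<^sup>2"
  have approx: "cmod (g n x - dd f x v) \<le> K * \<tau> n" if x: "x \<in> ball p (3 * R)" for n x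
  proof -
    have t: "cmod (complex_of_real (\<tau> n)) \<le> R / (4 * (norm v + 1))"
    proof -
      have "R / (8 * N) \<le> R / (4 * N)" using pos by (simp add: field_simps)
      then show ?thesis using \<tau>[of n] by (simp add: N_def)
    qed
    have "cmod (f (x + w n) - f x - complex_of_real (\<tau> n) * dd f x v) \<le> K * (\<tau> n)\<^sup>2"
      using taylor_estimate_line[OF hS[OF x] fB[OF x] pos(1) t] \<tau>(1)[of n] unfolding w_def K_def N_def by simp
    moreover have "f (x + w n) - f x - complex_of_real (\<tau> n) * dd f x v = complex_of_real (\<tau> n) * (g n x - dd f x v)"
      using \<tau>(1)[of n] by (simp add: g_def field_simps)
    ultimately have "\<tau> n * cmod (g n x - dd f x v) \<le> \<tau> n * (K * \<tau> n)"
      using \<tau>(1)[of n] by (simp add: norm_mult power2_eq_square mult_ac)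
    then show ?thesis using \<tau>(1)[of n] by simp
  qed
  have sub: "y \<in> ball p (3 * R)" if "y \<in> ball p R" for y using that pos(1) by simp
  have K: "K \<ge> 0" using pos by (simp add: K_def)
  show "\<exists>L. ((\<lambda>x. dd f x v) has_derivative L) (at p) \<and> complex_linear L"
  proof (rule has_derivative_uniform_limit_holo[OF _ pos(1)])
    show "holo_on (ball p R) (g n)" for n
    proof (rule holo_onI)
      fix x assume "x \<in> ball p R"
      then have xR: "x \<in> ball x R" "x \<in> ball p (3 * R)" using pos(1) sub by auto
      note fx = holo_onD[OF hS[OF xR(2)] xR(1)] and fw = holo_onD[OF hS[OF xR(2)] shift[of x n]]
      have "((\<lambda>x. x + w n) has_derivative (\<lambda>h. h)) (at x)" by (auto intro!: derivative_eq_intros)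
      from diff_chain_at[OF this fw(2)]
      have "((\<lambda>x. f (x + w n)) has_derivative dd f (x + w n)) (at x)" by (simp add: o_def)
      then have "(g n has_derivative (\<lambda>h. complex_of_real (inverse (\<tau> n)) * (dd f (x + w n) h - dd f x h))) (at x)"
        unfolding g_def[abs_def] by (intro has_derivative_mult_right has_derivative_diff fx(2))
      then show "g n differentiable (at x)" "complex_linear (dd (g n) x)"
        using complex_linearD(1,2)[OF fx(3)] complex_linearD(1,2)[OF fw(3)]
        by (auto simp: differentiable_def complex_linear_def dd_eq scaleC_complex_def algebra_simps)
    qed
    show "cmod (g n y - dd f y v) \<le> K * \<tau> n" if "y \<in> ball p R" for n y by (rule approx[OF sub[OF that]])
    show "cmod (g n y) < 2 * B * norm v / R + K * (R / (8 * N)) + 1" if y: "y \<in> ball p R" for n y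
    proof -
      have "cmod (g n y) \<le> cmod (dd f y v) + cmod (g n y - dd f y v)" by (rule norm_triangle_sub)
      also have "\<dots> \<le> 2 * B * norm v / R + K * \<tau> n"
        using sub[OF y] by (intro add_mono cauchy_estimate_line[OF hS fB pos(1)] approx)
      finally show ?thesis using mult_left_mono[OF \<tau>(2)[of n] K] by linarith
    qed
    show "(\<lambda>n. K * \<tau> n) \<longlonglongrightarrow> 0" by (rule tendsto_mult_right_zero[OF \<tau>0])
  qed
qed

text \<open>
  A real coordinate is the real part of a complex-linear functional; this reduces holomorphic maps into a
  finite-dimensional space to holomorphic functions.
\<close>

lemma complexified_coordinate:
  fixes r :: "'b::complex_normed_vector \<Rightarrow> real"
  assumes "bounded_linear r"
  defines "l \<equiv> (\<lambda>x. Complex (r x) (- r (scaleC \<i> x)))"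
  shows "bounded_linear l" "complex_linear l"
proof -
  interpret r: bounded_linear r by fact
  have eq: "l x = complex_of_real (r x) + \<i> * complex_of_real (- r (scaleC \<i> x))" for x
    by (simp add: assms(2) complex_eq_iff)
  have "bounded_linear (\<lambda>x. complex_of_real (r x))"
    by (rule bounded_linear_compose[OF bounded_linear_of_real assms(1)])
  moreover have "bounded_linear (\<lambda>x. \<i> * complex_of_real (- r (scaleC \<i> x)))"
    by (intro bounded_linear_const_mult bounded_linear_compose[OF bounded_linear_of_real]
        bounded_linear_minus bounded_linear_compose[OF assms(1)] bounded_linear_scaleC)
  ultimately show "bounded_linear l"
    unfolding eq[abs_def] by (rule bounded_linear_add)
  then show "complex_linear l"
    by (intro complex_linearI_ii bounded_linear.linear)
       (simp_all add: assms(2) scaleC_complex_def complex_eq_iff r.neg)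
qed

lemma holo_on_dd:
  fixes f :: "'a::complex_normed_vector \<Rightarrow> 'b::complex_normed_vector"
  assumes fd: "findim TYPE('b)" and S: "open S" and f: "holo_on S f"
  shows "holo_on S (\<lambda>x. dd f x v)"
proof -
  obtain C and r :: "'b \<Rightarrow> 'b \<Rightarrow> real"
    where C: "finite C" "\<And>b. b \<in> C \<Longrightarrow> bounded_linear (r b)" "\<And>x. (\<Sum>b\<in>C. r b x *\<^sub>R b) = x"
    using findim_coords[OF fd] by metis
  define l where "l b x = Complex (r b x) (- r b (scaleC \<i> x))" for b x
  have l: "bounded_linear (l b)" "complex_linear (l b)" if "b \<in> C" for b
    using complexified_coordinate[OF C(2)[OF that]] by (simp_all add: l_def[abs_def])
  have sep: "x = y" if "\<And>b. b \<in> C \<Longrightarrow> l b x = l b y" for x y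
  proof -
    have "(\<Sum>b\<in>C. r b x *\<^sub>R b) = (\<Sum>b\<in>C. r b y *\<^sub>R b)"
      using that by (intro sum.cong) (auto simp: l_def)
    then show ?thesis by (simp only: C(3))
  qed
  have hl: "holo_on S (\<lambda>x. l b (f x))" if "b \<in> C" for b
  proof (rule holo_onI)
    fix x assume x: "x \<in> S"
    show "(\<lambda>x. l b (f x)) differentiable (at x)"
      by (rule differentiable_bounded_linear[OF l(1)[OF that] holo_onD(1)[OF f x]])
    have "dd (\<lambda>x. l b (f x)) x = (\<lambda>v. l b (dd f x v))"
      using dd_bounded_linear[OF l(1)[OF that] holo_onD(1)[OF f x]] by blast
    then show "complex_linear (dd (\<lambda>x. l b (f x)) x)"
      using complex_linear_comp[OF l(2)[OF that] holo_onD(3)[OF f x]] by simp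
  qed
  have ddl: "dd (\<lambda>x. l b (f x)) x v = l b (dd f x v)" if "b \<in> C" "x \<in> S" for b x
    using dd_bounded_linear[OF l(1)[OF that(1)] holo_onD(1)[OF f that(2)]] .
  have hd: "holo_on S (\<lambda>x. l b (dd f x v))" if "b \<in> C" for b
  proof -
    have "holo_on S (\<lambda>x. dd (\<lambda>x. l b (f x)) x v)" by (rule holo_on_dd_complex[OF S hl[OF that]])
    then show ?thesis
      unfolding holo_on_def
      using has_derivative_cong_open[OF S, of _ "\<lambda>x. dd (\<lambda>x. l b (f x)) x v"] ddl[OF that] by metis
  qed
  have diff: "(\<lambda>x. dd f x v) differentiable (at x)" if "x \<in> S" for x
  proof -
    have "(\<lambda>x. \<Sum>b\<in>C. Re (l b (dd f x v)) *\<^sub>R b) differentiable (at x)"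
      using holo_onD(1)[OF hd that]
      by (intro differentiable_sum_fun)
         (auto intro!: differentiable_bounded_linear[OF bounded_linear_scaleR_left]
            differentiable_bounded_linear[OF bounded_linear_Re])
    then show ?thesis by (simp add: l_def C(3))
  qed
  show ?thesis
  proof (rule holo_onI[OF diff])
    fix x assume x: "x \<in> S"
    show "complex_linear (dd (\<lambda>x. dd f x v) x)"
    proof (rule complex_linearI_ii[OF linear_dd[OF diff[OF x]]], rule sep)
      fix h b assume b: "b \<in> C"
      have "l b (dd (\<lambda>x. dd f x v) x h) = dd (\<lambda>x. l b (dd f x v)) x h" for h
        using dd_bounded_linear[OF l(1)[OF b] diff[OF x]] by simp
      then show "l b (dd (\<lambda>x. dd f x v) x (scaleC \<i> h)) = l b (scaleC \<i> (dd (\<lambda>x. dd f x v) x h))"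
        by (simp add: complex_linearD(2)[OF l(2)[OF b]] complex_linearD(2)[OF holo_onD(3)[OF hd[OF b] x]])
    qed
  qed
qed

section \<open>Complex Lie groups in a chart\<close>

lemma chart_facts:
  assumes "complex_manifold A" "d \<in> A"
  shows "open (fst d)" "open (snd d ` fst d)"
    "continuous_on (fst d) (snd d)" "continuous_on (snd d ` fst d) (chart_inv d)"
    "\<And>x. x \<in> fst d \<Longrightarrow> chart_inv d (snd d x) = x"
    "\<And>y. y \<in> snd d ` fst d \<Longrightarrow> snd d (chart_inv d y) = y"
    "\<And>y. y \<in> snd d ` fst d \<Longrightarrow> chart_inv d y \<in> fst d"
    "inj_on (snd d) (fst d)"
proof -
  have "open (fst d) \<and> open (snd d ` fst d) \<and>
    homeomorphism (fst d) (snd d ` fst d) (snd d) (chart_inv d)"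
    using assms unfolding complex_manifold_def by blast
  then have *: "open (fst d)" "open (snd d ` fst d)"
    "homeomorphism (fst d) (snd d ` fst d) (snd d) (chart_inv d)" by auto
  then show "open (fst d)" "open (snd d ` fst d)"
    "continuous_on (fst d) (snd d)" "continuous_on (snd d ` fst d) (chart_inv d)"
    "\<And>x. x \<in> fst d \<Longrightarrow> chart_inv d (snd d x) = x"
    "\<And>y. y \<in> snd d ` fst d \<Longrightarrow> snd d (chart_inv d y) = y"
    "\<And>y. y \<in> snd d ` fst d \<Longrightarrow> chart_inv d y \<in> fst d"
    unfolding homeomorphism_def by auto
  show "inj_on (snd d) (fst d)"
    using *(3) unfolding homeomorphism_def by (metis inj_onI)
qed

lemma chart_cover:
  assumes "complex_manifold A"
  obtains d where "d \<in> A" "x \<in> fst d"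
  using assms unfolding complex_manifold_def by blast

lemma complex_manifold_findim:
  "complex_manifold (A :: ('x::{t2_space, second_countable_topology}, 'v::complex_normed_vector) chart set)
    \<Longrightarrow> findim TYPE('v)"
  unfolding complex_manifold_def findim_def by blast

lemma chart_image_open:
  assumes "complex_manifold A" "d \<in> A" "open W" "W \<subseteq> fst d"
  shows "open (snd d ` W)"
proof -
  note c = chart_facts[OF assms(1,2)]
  have "snd d ` W = snd d ` fst d \<inter> chart_inv d -` W"
    using c(5,6,7) assms(4) by force
  then show ?thesis using continuous_open_preimage[OF c(4,2) assms(3)] by simp
qed

locale lie_group_chart =
  fixes G :: "'g::{t2_space, second_countable_topology} monoid" (structure)
    and AG :: "('g, 'l::complex_normed_vector) chart set" and e :: "('g, 'l) chart"
  assumes lie: "complex_lie_group G AG" and e: "e \<in> AG" and one_e: "\<one> \<in> fst e"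
begin

lemma grp: "group G" and carrier [simp]: "carrier G = UNIV" and mfd: "complex_manifold AG"
  and mult_holo: "holo_map_on (prod_atlas AG AG) AG UNIV (\<lambda>(a, b). a \<otimes> b)"
  and inv_holo: "holo_map_on AG AG UNIV (\<lambda>a. inv a)"
  using lie unfolding complex_lie_group_def by auto

sublocale group G by (rule grp)

lemma carrier_in [simp, intro]: "x \<in> carrier G" by simp

lemma fd: "findim TYPE('l)" by (rule complex_manifold_findim[OF mfd])

definition e0 :: 'l where "e0 = snd e \<one>"

abbreviation "ei \<equiv> chart_inv e"
abbreviation "E \<equiv> snd e ` fst e"

lemmas chart_e = chart_facts[OF mfd e]

lemma e0_in: "e0 \<in> E" unfolding e0_def using one_e by blast

lemma ei_e0 [simp]: "ei e0 = \<one>" unfolding e0_def using chart_e(5)[OF one_e] .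

text \<open>
  Holomorphic maps from a vector space into the group, tested in all charts of the group. Products, inverses
  and compositions of such maps are then handled without choosing charts.
\<close>

definition gholo :: "'v::complex_normed_vector set \<Rightarrow> ('v \<Rightarrow> 'g) \<Rightarrow> bool" where
  "gholo W F \<longleftrightarrow> open W \<and> continuous_on W F \<and>
    (\<forall>d\<in>AG. holo_on (W \<inter> F -` fst d) (\<lambda>w. snd d (F w)))"

lemma gholo_open_preimage:
  "gholo W F \<Longrightarrow> open A \<Longrightarrow> open (W \<inter> F -` A)"
  unfolding gholo_def using continuous_open_preimage by blast

lemma gholoI:
  assumes "open W" "continuous_on W F"
    and "\<And>d w. d \<in> AG \<Longrightarrow> w \<in> W \<Longrightarrow> F w \<in> fst d \<Longrightarrow>
      \<exists>L. ((\<lambda>w. snd d (F w)) has_derivative L) (at w) \<and> complex_linear L"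
  shows "gholo W F"
  using assms unfolding gholo_def holo_on_def by auto

lemma gholoD:
  assumes "gholo W F" "d \<in> AG" "w \<in> W" "F w \<in> fst d"
  obtains L where "((\<lambda>w. snd d (F w)) has_derivative L) (at w)" "complex_linear L"
  using assms unfolding gholo_def holo_on_def by auto

lemma gholo_const: "open W \<Longrightarrow> gholo W (\<lambda>_. a)"
  by (rule gholoI) (auto intro!: exI[of _ "\<lambda>_. 0"] simp: complex_linear_def)

lemma gholo_chart_inv: "d \<in> AG \<Longrightarrow> gholo (snd d ` fst d) (chart_inv d)"
proof -
  assume d: "d \<in> AG"
  note cd = chart_facts[OF mfd d]
  show "gholo (snd d ` fst d) (chart_inv d)"
  proof (rule gholoI[OF cd(2,4)])
    fix d' w assume d': "d' \<in> AG" and w: "w \<in> snd d ` fst d" "chart_inv d w \<in> fst d'"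
    have h: "holo_on (snd d ` (fst d \<inter> fst d')) (snd d' \<circ> chart_inv d)"
      using mfd d d' unfolding complex_manifold_def by blast
    have "w \<in> snd d ` (fst d \<inter> fst d')"
      using w cd(5) by auto
    then show "\<exists>L. ((\<lambda>w. snd d' (chart_inv d w)) has_derivative L) (at w) \<and> complex_linear L"
      using h unfolding holo_on_def o_def by blast
  qed
qed

lemma gholo_comp:
  assumes F: "gholo W F" and \<phi>: "holo_on V \<phi>" and V: "open V" "\<phi> ` V \<subseteq> W"
  shows "gholo V (\<lambda>v. F (\<phi> v))"
proof (rule gholoI[OF V(1)])
  have c\<phi>: "continuous_on V \<phi>"
    using holo_onD(1)[OF \<phi>] differentiable_imp_continuous_on[OF differentiable_at_imp_differentiable_on]
    by blast
  then show "continuous_on V (\<lambda>v. F (\<phi> v))"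
    using F V(2) continuous_on_compose2 unfolding gholo_def by blast
  fix d v assume d: "d \<in> AG" and v: "v \<in> V" "F (\<phi> v) \<in> fst d"
  obtain L where L: "((\<lambda>w. snd d (F w)) has_derivative L) (at (\<phi> v))" "complex_linear L"
    using gholoD[OF F d, of "\<phi> v"] v V(2) by blast
  have "((\<lambda>v. snd d (F (\<phi> v))) has_derivative L \<circ> dd \<phi> v) (at v)"
    using diff_chain_at[OF holo_onD(2)[OF \<phi> v(1)] L(1)] by (simp add: o_def)
  moreover have "complex_linear (L \<circ> dd \<phi> v)"
    using complex_linear_comp[OF L(2) holo_onD(3)[OF \<phi> v(1)]] by (simp add: o_def)
  ultimately show "\<exists>L. ((\<lambda>v. snd d (F (\<phi> v))) has_derivative L) (at v) \<and> complex_linear L" by blast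
qed

lemma continuous_on_gmult:
  assumes "continuous_on W F" "continuous_on W F'"
  shows "continuous_on W (\<lambda>w. F w \<otimes> F' w)"
proof -
  have "continuous_on UNIV (\<lambda>(a, b). a \<otimes> b)" using mult_holo unfolding holo_map_on_def by blast
  from continuous_on_compose2[OF this continuous_on_Pair[OF assms]] show ?thesis by simp
qed

lemma continuous_on_ginv:
  assumes "continuous_on W F"
  shows "continuous_on W (\<lambda>w. inv (F w))"
proof -
  have "continuous_on UNIV (\<lambda>a. inv a)" using inv_holo unfolding holo_map_on_def by blast
  from continuous_on_compose2[OF this assms] show ?thesis by simp
qed

lemma gholo_mult:
  assumes F: "gholo W F" and F': "gholo W F'"
  shows "gholo W (\<lambda>w. F w \<otimes> F' w)"
proof (rule gholoI)
  show W: "open W" using F unfolding gholo_def by blast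
  show "continuous_on W (\<lambda>w. F w \<otimes> F' w)"
    using F F' unfolding gholo_def by (blast intro: continuous_on_gmult)
  fix d w assume d: "d \<in> AG" and w: "w \<in> W" "F w \<otimes> F' w \<in> fst d"
  obtain d1 where d1: "d1 \<in> AG" "F w \<in> fst d1" using chart_cover[OF mfd] .
  obtain d2 where d2: "d2 \<in> AG" "F' w \<in> fst d2" using chart_cover[OF mfd] .
  note c1 = chart_facts[OF mfd d1(1)] and c2 = chart_facts[OF mfd d2(1)]
  define c where "c = (fst d1 \<times> fst d2, map_prod (snd d1) (snd d2))"
  have cin: "c \<in> prod_atlas AG AG" unfolding c_def prod_atlas_def using d1 d2 by blast
  have "inj_on (map_prod (snd d1) (snd d2)) (fst d1 \<times> fst d2)"
    using c1(8) c2(8) by (auto simp: inj_on_def)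
  then have cinv: "chart_inv c (snd d1 a, snd d2 b) = (a, b)" if "a \<in> fst d1" "b \<in> fst d2" for a b
    unfolding chart_inv_def using inv_into_f_f[of "snd c" "fst c" "(a, b)"] that by (simp add: c_def)
  have "holo_on (snd c ` (fst c \<inter> UNIV \<inter> (\<lambda>(a, b). a \<otimes> b) -` fst d))
      (snd d \<circ> (\<lambda>(a, b). a \<otimes> b) \<circ> chart_inv c)"
    using mult_holo cin d unfolding holo_map_on_def by blast
  moreover have "(snd d1 (F w), snd d2 (F' w)) \<in> snd c ` (fst c \<inter> UNIV \<inter> (\<lambda>(a, b). a \<otimes> b) -` fst d)"
    by (rule image_eqI[of _ _ "(F w, F' w)"]) (use d1 d2 w in \<open>auto simp: c_def\<close>)
  ultimately obtain L where
    L: "((snd d \<circ> (\<lambda>(a, b). a \<otimes> b) \<circ> chart_inv c) has_derivative L) (at (snd d1 (F w), snd d2 (F' w)))"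
      "complex_linear L"
    unfolding holo_on_def by blast
  obtain L1 where L1: "((\<lambda>w. snd d1 (F w)) has_derivative L1) (at w)" "complex_linear L1"
    using gholoD[OF F d1(1) w(1) d1(2)] .
  obtain L2 where L2: "((\<lambda>w. snd d2 (F' w)) has_derivative L2) (at w)" "complex_linear L2"
    using gholoD[OF F' d2(1) w(1) d2(2)] .
  define V where "V = (W \<inter> F -` fst d1) \<inter> (W \<inter> F' -` fst d2)"
  have V: "open V" "w \<in> V"
    unfolding V_def using gholo_open_preimage[OF F c1(1)] gholo_open_preimage[OF F' c2(1)] d1 d2 w by auto
  have "((\<lambda>w. (snd d \<circ> (\<lambda>(a, b). a \<otimes> b) \<circ> chart_inv c) (snd d1 (F w), snd d2 (F' w)))
      has_derivative (\<lambda>h. L (L1 h, L2 h))) (at w)"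
    using diff_chain_at[OF has_derivative_Pair[OF L1(1) L2(1)] L(1)] by (simp add: o_def)
  then have "((\<lambda>w. snd d (F w \<otimes> F' w)) has_derivative (\<lambda>h. L (L1 h, L2 h))) (at w)"
    by (subst has_derivative_cong_open[OF V]) (auto simp: V_def cinv)
  moreover have "complex_linear (\<lambda>h. L (L1 h, L2 h))"
    using L(2) L1(2) L2(2) unfolding complex_linear_def
    by (auto simp: scaleC_prod_def simp flip: add_Pair)
  ultimately show "\<exists>L. ((\<lambda>w. snd d (F w \<otimes> F' w)) has_derivative L) (at w) \<and> complex_linear L"
    by blast
qed

lemma gholo_inv:
  assumes F: "gholo W F"
  shows "gholo W (\<lambda>w. inv (F w))"
proof (rule gholoI)
  show W: "open W" using F unfolding gholo_def by blast
  show "continuous_on W (\<lambda>w. inv (F w))"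
    using F unfolding gholo_def by (blast intro: continuous_on_ginv)
  fix d w assume d: "d \<in> AG" and w: "w \<in> W" "inv (F w) \<in> fst d"
  obtain d1 where d1: "d1 \<in> AG" "F w \<in> fst d1" using chart_cover[OF mfd] .
  note c1 = chart_facts[OF mfd d1(1)]
  have "holo_on (snd d1 ` (fst d1 \<inter> UNIV \<inter> (\<lambda>a. inv a) -` fst d)) (snd d \<circ> (\<lambda>a. inv a) \<circ> chart_inv d1)"
    using inv_holo d1(1) d unfolding holo_map_on_def by blast
  moreover have "snd d1 (F w) \<in> snd d1 ` (fst d1 \<inter> UNIV \<inter> (\<lambda>a. inv a) -` fst d)"
    using d1 w by auto
  ultimately obtain L where
    L: "((snd d \<circ> (\<lambda>a. inv a) \<circ> chart_inv d1) has_derivative L) (at (snd d1 (F w)))" "complex_linear L"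
    unfolding holo_on_def by blast
  obtain L1 where L1: "((\<lambda>w. snd d1 (F w)) has_derivative L1) (at w)" "complex_linear L1"
    using gholoD[OF F d1(1) w(1) d1(2)] .
  define V where "V = (W \<inter> F -` fst d1)"
  have V: "open V" "w \<in> V"
    unfolding V_def using gholo_open_preimage[OF F c1(1)] d1 w by auto
  have "((\<lambda>w. (snd d \<circ> (\<lambda>a. inv a) \<circ> chart_inv d1) (snd d1 (F w))) has_derivative (\<lambda>h. L (L1 h))) (at w)"
    using diff_chain_at[OF L1(1) L(1)] by (simp add: o_def)
  then have "((\<lambda>w. snd d (inv (F w))) has_derivative (\<lambda>h. L (L1 h))) (at w)"
    by (subst has_derivative_cong_open[OF V]) (auto simp: V_def c1(5))
  then show "\<exists>L. ((\<lambda>w. snd d (inv (F w))) has_derivative L) (at w) \<and> complex_linear L"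
    using complex_linear_comp[OF L(2) L1(2)] by blast
qed

lemma complex_linear_fst: "complex_linear fst" and complex_linear_snd: "complex_linear snd"
  by (auto simp: complex_linear_def scaleC_prod_def)

lemma holo_on_complex_linear:
  assumes "complex_linear f" "bounded_linear f"
  shows "holo_on S f"
  unfolding holo_on_def using assms bounded_linear_imp_has_derivative by blast

lemma gholo_fst: "gholo W F \<Longrightarrow> open V \<Longrightarrow> gholo (W \<times> V) (\<lambda>p. F (fst p))"
  by (rule gholo_comp[OF _ holo_on_complex_linear[OF complex_linear_fst bounded_linear_fst]])
     (auto simp: gholo_def open_Times)

lemma gholo_snd: "gholo W F \<Longrightarrow> open V \<Longrightarrow> gholo (V \<times> W) (\<lambda>p. F (snd p))"
  by (rule gholo_comp[OF _ holo_on_complex_linear[OF complex_linear_snd bounded_linear_snd]])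
     (auto simp: gholo_def open_Times)

lemma gholo_chart:
  assumes "gholo W F" "d \<in> AG"
  shows "open (W \<inter> F -` fst d)" "holo_on (W \<inter> F -` fst d) (\<lambda>w. snd d (F w))"
    "holo_on (W \<inter> F -` fst d) (\<lambda>w. dd (\<lambda>w. snd d (F w)) w v)"
proof -
  show o: "open (W \<inter> F -` fst d)"
    using gholo_open_preimage[OF assms(1) chart_facts(1)[OF mfd assms(2)]] .
  show h: "holo_on (W \<inter> F -` fst d) (\<lambda>w. snd d (F w))"
    using assms unfolding gholo_def by blast
  show "holo_on (W \<inter> F -` fst d) (\<lambda>w. dd (\<lambda>w. snd d (F w)) w v)" by (rule holo_on_dd[OF fd o h])
qed

subsection \<open>Multiplication near the unit\<close>

text \<open>The group multiplication in the chart, defined on the open set \<open>gmO\<close> below.\<close>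

definition gm :: "'l \<times> 'l \<Rightarrow> 'l" where "gm p = snd e (ei (fst p) \<otimes> ei (snd p))"

definition gmO :: "('l \<times> 'l) set" where
  "gmO = (E \<times> E) \<inter> (\<lambda>p. ei (fst p) \<otimes> ei (snd p)) -` fst e"

lemma gholo_gm: "gholo (E \<times> E) (\<lambda>p. ei (fst p) \<otimes> ei (snd p))"
  by (intro gholo_mult gholo_fst gholo_snd gholo_chart_inv e chart_e(2))

lemma gmO: "open gmO" and gm_holo: "holo_on gmO gm"
  and gm_dd_holo: "holo_on gmO (\<lambda>w. dd gm w v)"
  unfolding gmO_def gm_def[abs_def] by (rule gholo_chart[OF gholo_gm e])+

lemma gm_right [simp]: "x \<in> E \<Longrightarrow> gm (x, e0) = x" and gm_left [simp]: "x \<in> E \<Longrightarrow> gm (e0, x) = x"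
  by (auto simp: gm_def chart_e(6) chart_e(5) r_one l_one)

lemma gmO_right [simp]: "x \<in> E \<Longrightarrow> (x, e0) \<in> gmO" and gmO_left [simp]: "x \<in> E \<Longrightarrow> (e0, x) \<in> gmO"
  using e0_in chart_e(7) by (auto simp: gmO_def)

lemma ei_gm: "p \<in> gmO \<Longrightarrow> ei (gm p) = ei (fst p) \<otimes> ei (snd p)"
  by (auto simp: gmO_def gm_def chart_e(5))

lemma dd_gm_right:
  assumes "x \<in> E" shows "dd gm (x, e0) (\<xi>, 0) = \<xi>"
proof -
  have "((\<lambda>x. gm (x, e0)) has_derivative (\<lambda>\<xi>. dd gm (x, e0) (\<xi>, 0))) (at x)"
  proof -
    have "((\<lambda>x. (x, e0)) has_derivative (\<lambda>\<xi>. (\<xi>, 0))) (at x)" by (auto intro!: derivative_eq_intros)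
    from diff_chain_at[OF this holo_onD(2)[OF gm_holo gmO_right[OF assms]]] show ?thesis by (simp add: o_def)
  qed
  then have "((\<lambda>x. x) has_derivative (\<lambda>\<xi>. dd gm (x, e0) (\<xi>, 0))) (at x)"
    by (subst has_derivative_cong_open[OF chart_e(2) assms]) simp_all
  from has_derivative_unique[OF this has_derivative_ident] show ?thesis by metis
qed

lemma dd_gm_left:
  assumes "x \<in> E" shows "dd gm (e0, x) (0, \<xi>) = \<xi>"
proof -
  have "((\<lambda>x. gm (e0, x)) has_derivative (\<lambda>\<xi>. dd gm (e0, x) (0, \<xi>))) (at x)"
  proof -
    have "((\<lambda>x. (e0, x)) has_derivative (\<lambda>\<xi>. (0, \<xi>))) (at x)" by (auto intro!: derivative_eq_intros)
    from diff_chain_at[OF this holo_onD(2)[OF gm_holo gmO_left[OF assms]]] show ?thesis by (simp add: o_def)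
  qed
  then have "((\<lambda>x. x) has_derivative (\<lambda>\<xi>. dd gm (e0, x) (0, \<xi>))) (at x)"
    by (subst has_derivative_cong_open[OF chart_e(2) assms]) simp_all
  from has_derivative_unique[OF this has_derivative_ident] show ?thesis by metis
qed

text \<open>The bilinear term of the Taylor expansion \<open>x + y + B(x, y) + \<dots>\<close> of the multiplication at the unit.\<close>

definition gmB :: "'l \<Rightarrow> 'l \<Rightarrow> 'l" where
  "gmB \<xi> \<eta> = dd (\<lambda>w. dd gm w (0, \<eta>)) (e0, e0) (\<xi>, 0)"

lemma gmB_sym: "gmB \<xi> \<eta> = dd (\<lambda>w. dd gm w (\<xi>, 0)) (e0, e0) (0, \<eta>)"
  unfolding gmB_def
  by (rule symmetric_mixed_derivatives[OF gmO gmO_right[OF e0_in]])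
     (use holo_onD(1)[OF gm_holo] holo_onD(1)[OF gm_dd_holo] e0_in in auto)

lemma gmB_complex_linear: "complex_linear (\<lambda>\<xi>. gmB \<xi> \<eta>)" "complex_linear (gmB \<xi>)"
proof -
  note l = holo_onD(3)[OF gm_dd_holo gmO_right[OF e0_in]]
  have "complex_linear (\<lambda>\<xi>. (\<xi>, 0) :: 'l \<times> 'l)" "complex_linear (\<lambda>\<xi>. (0, \<xi>) :: 'l \<times> 'l)"
    by (auto simp: complex_linear_def scaleC_prod_def)
  note c = complex_linear_comp[OF l this(1)] complex_linear_comp[OF l this(2)]
  show "complex_linear (\<lambda>\<xi>. gmB \<xi> \<eta>)" unfolding gmB_def by (rule c(1))
  show "complex_linear (gmB \<xi>)" unfolding gmB_sym[abs_def] by (rule c(2))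
qed

subsection \<open>The adjoint representation and the bracket\<close>

text \<open>Conjugation in the chart; \<open>Ad\<close> is its derivative at the unit.\<close>

definition gc :: "'g \<Rightarrow> 'l \<Rightarrow> 'l" where "gc a y = snd e (a \<otimes> ei y \<otimes> inv a)"

abbreviation "Ad \<equiv> lie_Ad G e"
abbreviation "br \<equiv> lie_bracket G e"

definition gcO :: "'g \<Rightarrow> 'l set" where
  "gcO a = E \<inter> (\<lambda>y. a \<otimes> ei y \<otimes> inv a) -` fst e"

lemma gholo_gc: "gholo E (\<lambda>y. a \<otimes> ei y \<otimes> inv a)"
  by (intro gholo_mult gholo_const gholo_chart_inv e chart_e(2))

lemma gcO: "open (gcO a)" and gc_holo: "holo_on (gcO a) (gc a)"
  unfolding gcO_def gc_def[abs_def] by (rule gholo_chart[OF gholo_gc e])+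

lemma e0_gcO [simp]: "e0 \<in> gcO a"
  using e0_in one_e by (simp add: gcO_def r_inv)

lemma gc_e0 [simp]: "gc a e0 = e0"
  using one_e by (simp add: gc_def r_inv flip: e0_def)

lemma ei_gc: "y \<in> gcO a \<Longrightarrow> ei (gc a y) = a \<otimes> ei y \<otimes> inv a"
  by (simp add: gcO_def gc_def chart_e(5))

lemma Ad_eq: "Ad a \<xi> = dd (gc a) e0 \<xi>"
  unfolding lie_Ad_def gc_def[abs_def] e0_def ..

lemma gc_has_derivative: "(gc a has_derivative Ad a) (at e0)"
  using holo_onD(2)[OF gc_holo e0_gcO, of a] by (simp add: Ad_eq[abs_def])

lemma Ad_complex_linear: "complex_linear (Ad a)"
  using holo_onD(3)[OF gc_holo e0_gcO, of a] by (simp add: Ad_eq[abs_def])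

lemma Ad_bounded_linear: "bounded_linear (Ad a)"
  using gc_has_derivative has_derivative_bounded_linear by blast

lemma Ad_mult: "Ad (a \<otimes> b) \<xi> = Ad a (Ad b \<xi>)"
proof -
  have "(gc b has_derivative Ad b) (at e0)" by (rule gc_has_derivative)
  moreover have "(gc a has_derivative Ad a) (at (gc b e0))" by (simp add: gc_has_derivative)
  ultimately have "((\<lambda>y. gc a (gc b y)) has_derivative (\<lambda>\<xi>. Ad a (Ad b \<xi>))) (at e0)"
    using diff_chain_at[of "gc b" "Ad b" e0 "gc a" "Ad a"] by (simp add: o_def)
  then have "(gc (a \<otimes> b) has_derivative (\<lambda>\<xi>. Ad a (Ad b \<xi>))) (at e0)"
    by (subst has_derivative_cong_open[OF gcO[of b] e0_gcO])
       (simp_all add: gc_def[of a] ei_gc, simp add: gc_def m_assoc inv_mult_group)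
  from has_derivative_unique[OF this gc_has_derivative] show ?thesis by metis
qed

lemma Ad_one [simp]: "Ad \<one> \<xi> = \<xi>"
proof -
  have "((\<lambda>y. y) has_derivative (\<lambda>y. y)) (at e0)" by (rule has_derivative_ident)
  then have "(gc \<one> has_derivative (\<lambda>y. y)) (at e0)"
    by (subst has_derivative_cong_open[OF chart_e(2) e0_in]) (auto simp: gc_def l_one r_one chart_e(6) intro: has_derivative_ident)
  from has_derivative_unique[OF this gc_has_derivative] show ?thesis by metis
qed

text \<open>Conjugation is jointly holomorphic in both arguments, so \<open>Ad\<close> is holomorphic near the unit.\<close>

lemma Ad_ei_holo: "\<exists>W. open W \<and> e0 \<in> W \<and> W \<subseteq> E \<and> holo_on W (\<lambda>x. Ad (ei x) \<eta>)"
proof -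
  let ?F = "\<lambda>p. ei (fst p) \<otimes> ei (snd p) \<otimes> inv ei (fst p)"
  have gF: "gholo (E \<times> E) ?F"
    by (intro gholo_mult gholo_inv gholo_fst gholo_snd gholo_chart_inv e chart_e(2))
  let ?O = "(E \<times> E) \<inter> ?F -` fst e"
  note O = gholo_chart[OF gF e]
  define W where "W = {x. (x, e0) \<in> ?O}"
  have "open ((\<lambda>x. (x, e0)) -` ?O)"
    by (rule open_vimage[OF O(1)]) (intro continuous_intros)
  then have Wo: "open W" by (simp add: W_def vimage_def)
  have eW: "e0 \<in> W" using e0_in one_e by (simp add: W_def)
  have WE: "W \<subseteq> E" by (auto simp: W_def)
  have Ad: "Ad (ei x) \<eta> = dd (\<lambda>p. snd e (?F p)) (x, e0) (0, \<eta>)" if "x \<in> W" for x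
  proof -
    have "(x, e0) \<in> ?O" using that by (simp add: W_def)
    from holo_onD(2)[OF O(2) this]
    have "((\<lambda>p. snd e (?F p)) has_derivative dd (\<lambda>p. snd e (?F p)) (x, e0)) (at (x, e0))" .
    moreover have "((\<lambda>y. (x, y)) has_derivative (\<lambda>\<xi>. (0, \<xi>))) (at e0)" by (auto intro!: derivative_eq_intros)
    ultimately have "(gc (ei x) has_derivative (\<lambda>\<xi>. dd (\<lambda>p. snd e (?F p)) (x, e0) (0, \<xi>))) (at e0)"
      using diff_chain_at[of "\<lambda>y. (x, y)" _ e0] by (fastforce simp: o_def gc_def[abs_def])
    from fun_cong[OF has_derivative_unique[OF this gc_has_derivative], of \<eta>] show ?thesis by simp
  qed
  have "holo_on W (\<lambda>x. Ad (ei x) \<eta>)"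
    unfolding holo_on_def
  proof
    fix x assume x: "x \<in> W"
    let ?g = "\<lambda>w. dd (\<lambda>p. snd e (?F p)) w (0, \<eta>)"
    have "(x, e0) \<in> ?O" using x by (simp add: W_def)
    note g = holo_onD(2,3)[OF O(3) this, of "(0, \<eta>)"]
    have "((\<lambda>x. (x, e0)) has_derivative (\<lambda>\<xi>. (\<xi>, 0))) (at x)" by (auto intro!: derivative_eq_intros)
    from diff_chain_at[OF this g(1)]
    have "((\<lambda>x. ?g (x, e0)) has_derivative (\<lambda>\<xi>. dd ?g (x, e0) (\<xi>, 0))) (at x)" by (simp add: o_def)
    then have "((\<lambda>x. Ad (ei x) \<eta>) has_derivative (\<lambda>\<xi>. dd ?g (x, e0) (\<xi>, 0))) (at x)"
      by (subst has_derivative_cong_open[OF Wo x Ad]) auto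
    moreover have "complex_linear (\<lambda>\<xi>. dd ?g (x, e0) (\<xi>, 0))"
      using complex_linear_comp[OF g(2), of "\<lambda>\<xi>. (\<xi>, 0)"] by (simp add: complex_linear_def scaleC_prod_def)
    ultimately show "\<exists>L. ((\<lambda>x. Ad (ei x) \<eta>) has_derivative L) (at x) \<and> complex_linear L" by blast
  qed
  then show ?thesis using Wo eW WE by blast
qed

lemma Ad_ei_has_derivative: "((\<lambda>x. Ad (ei x) \<eta>) has_derivative (\<lambda>\<xi>. br \<xi> \<eta>)) (at e0)"
proof -
  obtain W where W: "e0 \<in> W" "holo_on W (\<lambda>x. Ad (ei x) \<eta>)" using Ad_ei_holo by blast
  show ?thesis
    using holo_onD(2)[OF W(2,1)] unfolding lie_bracket_def[abs_def] by (simp flip: e0_def)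
qed

text \<open>Differentiating \<open>(x y x\<^sup>-\<^sup>1) x = x y\<close> in \<open>y\<close> and then in \<open>x\<close> at the unit expresses the bracket
  through the mixed second derivative of the multiplication.\<close>

lemma bracket_eq: "br \<xi> \<eta> = gmB \<xi> \<eta> - gmB \<eta> \<xi>"
proof -
  obtain W where W: "open W" "e0 \<in> W" "W \<subseteq> E" using Ad_ei_holo by blast
  have key: "dd gm (e0, x) (Ad (ei x) \<eta>, 0) = dd gm (x, e0) (0, \<eta>)" if x: "x \<in> E" for x
  proof -
    let ?a = "ei x"
    define V where "V = gcO ?a \<inter> {y. (x, y) \<in> gmO} \<inter> {y. y \<in> gcO ?a \<and> (gc ?a y, x) \<in> gmO}"
    have o1: "open {y. (x, y) \<in> gmO}"
      using open_vimage[OF gmO, of "\<lambda>y. (x, y)"] by (simp add: vimage_def continuous_on_Pair)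
    have "continuous_on (gcO ?a) (gc ?a)"
      using holo_onD(1)[OF gc_holo] differentiable_imp_continuous_on[OF differentiable_at_imp_differentiable_on] by blast
    then have "continuous_on (gcO ?a) (\<lambda>y. (gc ?a y, x))" by (intro continuous_intros)
    from continuous_open_preimage[OF this gcO gmO]
    have o2: "open {y. y \<in> gcO ?a \<and> (gc ?a y, x) \<in> gmO}" by (simp add: vimage_def Int_def)
    have V: "open V" "e0 \<in> V"
      unfolding V_def using o1 o2 gcO x by (auto intro!: open_Int)
    have eq: "gm (gc ?a y, x) = gm (x, y)" if "y \<in> V" for y
    proof -
      have "ei (gc ?a y) = ?a \<otimes> ei y \<otimes> inv ?a" using that ei_gc by (simp add: V_def)
      then show ?thesis by (simp add: gm_def m_assoc l_inv r_one)
    qed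
    have d1: "((\<lambda>y. gm (x, y)) has_derivative (\<lambda>\<eta>. dd gm (x, e0) (0, \<eta>))) (at e0)"
    proof -
      have "((\<lambda>y. (x, y)) has_derivative (\<lambda>\<xi>. (0, \<xi>))) (at e0)" by (auto intro!: derivative_eq_intros)
      from diff_chain_at[OF this holo_onD(2)[OF gm_holo gmO_right[OF x]]] show ?thesis by (simp add: o_def)
    qed
    have "((\<lambda>y. gm (gc ?a y, x)) has_derivative (\<lambda>\<eta>. dd gm (e0, x) (Ad ?a \<eta>, 0))) (at e0)"
    proof -
      have "((\<lambda>y. (gc ?a y, x)) has_derivative (\<lambda>\<xi>. (Ad ?a \<xi>, 0))) (at e0)"
        by (auto intro!: derivative_eq_intros gc_has_derivative)
      moreover have "(gm has_derivative dd gm (e0, x)) (at (gc ?a e0, x))"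
        using holo_onD(2)[OF gm_holo gmO_left[OF x]] by simp
      ultimately show ?thesis
        using diff_chain_at[of "\<lambda>y. (gc ?a y, x)" _ e0 gm] by (fastforce simp: o_def)
    qed
    then have "((\<lambda>y. gm (x, y)) has_derivative (\<lambda>\<eta>. dd gm (e0, x) (Ad ?a \<eta>, 0))) (at e0)"
      by (subst (asm) has_derivative_cong_open[OF V eq]) auto
    from has_derivative_unique[OF this d1] show ?thesis by metis
  qed
  have pl: "((\<lambda>x. (\<lambda>w v. dd gm w (v, 0)) (e0, x) (Ad (ei x) \<eta>)) has_derivative
      (\<lambda>\<xi>. dd (\<lambda>w. dd gm w (Ad (ei e0) \<eta>, 0)) (e0, e0) (0, \<xi>) + dd gm (e0, e0) (br \<xi> \<eta>, 0))) (at e0)"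
  proof (rule has_derivative_parametrised_linear[OF fd gmO, where x = "\<lambda>x. (e0, x)"])
    show "(e0, e0) \<in> gmO" using e0_in by simp
    show "linear (\<lambda>v. dd gm q (v, 0))" if "q \<in> gmO" for q
      using linear_compose[of "\<lambda>v. (v, 0)" "dd gm q"] linear_dd[OF holo_onD(1)[OF gm_holo that]]
      by (simp add: o_def linear_iff)
    show "(\<lambda>q. dd gm q (w, 0)) differentiable at (e0, e0)" for w
      using holo_onD(1)[OF gm_dd_holo] e0_in by simp
    show "((\<lambda>x. (e0, x)) has_derivative (\<lambda>\<xi>. (0, \<xi>))) (at e0)" by (auto intro!: derivative_eq_intros)
    show "((\<lambda>x. Ad (ei x) \<eta>) has_derivative (\<lambda>\<xi>. br \<xi> \<eta>)) (at e0)" by (rule Ad_ei_has_derivative)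
  qed
  have pr: "((\<lambda>x. dd gm (x, e0) (0, \<eta>)) has_derivative (\<lambda>\<xi>. gmB \<xi> \<eta>)) (at e0)"
  proof -
    have "((\<lambda>x. (x, e0)) has_derivative (\<lambda>\<xi>. (\<xi>, 0))) (at e0)" by (auto intro!: derivative_eq_intros)
    from diff_chain_at[OF this holo_onD(2)[OF gm_dd_holo gmO_right[OF e0_in]]]
    show ?thesis by (simp add: o_def gmB_def)
  qed
  have "((\<lambda>x. dd gm (x, e0) (0, \<eta>)) has_derivative
      (\<lambda>\<xi>. dd (\<lambda>w. dd gm w (Ad (ei e0) \<eta>, 0)) (e0, e0) (0, \<xi>) + dd gm (e0, e0) (br \<xi> \<eta>, 0))) (at e0)"
    using pl by (subst (asm) has_derivative_cong_open[OF chart_e(2) e0_in key]) auto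
  from has_derivative_unique[OF this pr]
  have "dd (\<lambda>w. dd gm w (\<eta>, 0)) (e0, e0) (0, \<xi>) + br \<xi> \<eta> = gmB \<xi> \<eta>"
    by (auto simp: fun_eq_iff dd_gm_right[OF e0_in])
  then show ?thesis by (simp add: gmB_sym[of \<eta> \<xi>] eq_diff_eq add.commute)
qed

lemma br_complex_linear: "complex_linear (\<lambda>\<xi>. br \<xi> \<eta>)" "complex_linear (br \<xi>)"
  using gmB_complex_linear unfolding complex_linear_def bracket_eq by (auto simp: scaleC_diff_right)

lemma br_antisym: "br \<xi> \<eta> = - br \<eta> \<xi>"
  by (simp add: bracket_eq)

lemma br_bounded_bilinear: "bounded_bilinear br"
  by (rule findim_bilinear_bounded[OF fd fd]) (intro complex_linear_linear br_complex_linear)+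

lemma Ad_br: "Ad a (br \<xi> \<eta>) = br (Ad a \<xi>) (Ad a \<eta>)"
proof -
  have "((\<lambda>y. Ad (ei y) (Ad a \<eta>)) has_derivative (\<lambda>\<xi>. br \<xi> (Ad a \<eta>))) (at (gc a e0))"
    using Ad_ei_has_derivative by simp
  from diff_chain_at[OF gc_has_derivative this]
  have "((\<lambda>y. Ad (ei (gc a y)) (Ad a \<eta>)) has_derivative (\<lambda>\<xi>. br (Ad a \<xi>) (Ad a \<eta>))) (at e0)"
    by (simp add: o_def)
  moreover have "Ad (ei (gc a y)) (Ad a \<eta>) = Ad a (Ad (ei y) \<eta>)" if "y \<in> gcO a" for y
    by (simp add: ei_gc[OF that] m_assoc l_inv r_one flip: Ad_mult)
  ultimately have "((\<lambda>y. Ad a (Ad (ei y) \<eta>)) has_derivative (\<lambda>\<xi>. br (Ad a \<xi>) (Ad a \<eta>))) (at e0)"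
    by (subst (asm) has_derivative_cong_open[OF gcO[of a] e0_gcO]) auto
  from has_derivative_unique[OF this bounded_linear.has_derivative[OF Ad_bounded_linear Ad_ei_has_derivative]]
  show ?thesis by metis
qed

text \<open>The derivative at the unit of the invariance of the bracket under \<open>Ad\<close>.\<close>

lemma br_jacobi: "br \<zeta> (br \<xi> \<eta>) = br (br \<zeta> \<xi>) \<eta> + br \<xi> (br \<zeta> \<eta>)"
proof -
  have "((\<lambda>x. br (Ad (ei x) \<xi>) (Ad (ei x) \<eta>)) has_derivative
      (\<lambda>\<zeta>. br (Ad (ei e0) \<xi>) (br \<zeta> \<eta>) + br (br \<zeta> \<xi>) (Ad (ei e0) \<eta>))) (at e0)"
    by (rule bounded_bilinear.FDERIV[OF br_bounded_bilinear Ad_ei_has_derivative Ad_ei_has_derivative])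
  then have "((\<lambda>x. Ad (ei x) (br \<xi> \<eta>)) has_derivative (\<lambda>\<zeta>. br \<xi> (br \<zeta> \<eta>) + br (br \<zeta> \<xi>) \<eta>)) (at e0)"
    by (simp add: Ad_br)
  from has_derivative_unique[OF this Ad_ei_has_derivative] show ?thesis by (metis add.commute)
qed

lemma invariant_form_br:
  assumes ip: "invariant_form G e ip"
  shows "bounded_bilinear ip" "ip (br \<zeta> \<xi>) \<eta> = - ip \<xi> (br \<zeta> \<eta>)"
proof -
  have *: "(\<forall>\<xi>. complex_linear (ip \<xi>)) \<and> (\<forall>\<xi> \<eta>. ip \<xi> \<eta> = ip \<eta> \<xi>) \<and>
      (\<forall>a \<xi> \<eta>. ip (Ad a \<xi>) (Ad a \<eta>) = ip \<xi> \<eta>)"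
    using ip unfolding invariant_form_def by (elim conjE) (intro conjI; assumption)
  then have l: "complex_linear (ip \<xi>)" and s: "ip \<xi> \<eta> = ip \<eta> \<xi>" for \<xi> \<eta> by blast+
  have inv: "ip (Ad a \<xi>) (Ad a \<eta>) = ip \<xi> \<eta>" for \<xi> \<eta> a using * by (elim conjE allE)
  have "linear (\<lambda>\<xi>. ip \<xi> \<eta>)" for \<eta>
  proof -
    have "(\<lambda>\<xi>. ip \<xi> \<eta>) = ip \<eta>" using s by blast
    then show ?thesis using complex_linear_linear[OF l[of \<eta>]] by simp
  qed
  then show bb: "bounded_bilinear ip"
    by (intro findim_bilinear_bounded[OF fd fd]) (auto intro: complex_linear_linear l)
  have "((\<lambda>x. ip (Ad (ei x) \<xi>) (Ad (ei x) \<eta>)) has_derivative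
      (\<lambda>\<zeta>. ip (Ad (ei e0) \<xi>) (br \<zeta> \<eta>) + ip (br \<zeta> \<xi>) (Ad (ei e0) \<eta>))) (at e0)"
    by (rule bounded_bilinear.FDERIV[OF bb Ad_ei_has_derivative Ad_ei_has_derivative])
  then have "((\<lambda>x. ip \<xi> \<eta>) has_derivative (\<lambda>\<zeta>. ip \<xi> (br \<zeta> \<eta>) + ip (br \<zeta> \<xi>) \<eta>)) (at e0)"
    by (simp add: inv)
  from has_derivative_unique[OF this has_derivative_const]
  have "ip \<xi> (br \<zeta> \<eta>) + ip (br \<zeta> \<xi>) \<eta> = 0" by metis
  then show "ip (br \<zeta> \<xi>) \<eta> = - ip \<xi> (br \<zeta> \<eta>)" by (simp add: add_eq_0_iff2)
qed

end

section \<open>The Lie algebra of a compact subgroup\<close>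

text \<open>Tychonoff's theorem in the function topology.\<close>

lemma compact_PiE_UNIV:
  fixes S :: "'i \<Rightarrow> 'a::topological_space set"
  assumes "\<And>i. compact (S i)"
  shows "compact (PiE UNIV S)"
proof -
  have "compactin (product_topology (\<lambda>i::'i. euclidean :: 'a topology) UNIV) (PiE UNIV S)"
    using assms by (simp add: compactin_PiE)
  then show ?thesis by (simp add: euclidean_product_topology)
qed

lemma findim_compact_cball:
  assumes "findim TYPE('a::real_normed_vector)"
  shows "compact (cball (x::'a) R)"
proof -
  obtain C and r :: "'a \<Rightarrow> 'a \<Rightarrow> real"
    where C: "finite C" "\<And>b. b \<in> C \<Longrightarrow> bounded_linear (r b)" "\<And>x. (\<Sum>b\<in>C. r b x *\<^sub>R b) = x"
    using findim_coords[OF assms] by metis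
  have "\<exists>K. \<forall>x. norm (r b x) \<le> norm x * K" if "b \<in> C" for b
    using bounded_linear.bounded[OF C(2)[OF that]] .
  then obtain K where K: "\<And>b x. b \<in> C \<Longrightarrow> norm (r b x) \<le> norm x * K b" by metis
  define P :: "('a \<Rightarrow> real) set" where
    "P = PiE UNIV (\<lambda>b. if b \<in> C then {- ((norm x + \<bar>R\<bar>) * \<bar>K b\<bar>) .. (norm x + \<bar>R\<bar>) * \<bar>K b\<bar>} else {0})"
  have "compact P" unfolding P_def by (rule compact_PiE_UNIV) auto
  moreover have "continuous_on P (\<lambda>c. \<Sum>b\<in>C. c b *\<^sub>R b)"
    by (intro continuous_on_sum continuous_on_scaleR continuous_on_const
        continuous_on_subset[OF continuous_on_product_coordinates]) auto
  ultimately have "compact ((\<lambda>c. \<Sum>b\<in>C. c b *\<^sub>R b) ` P)" by (rule compact_continuous_image[rotated])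
  moreover have "cball x R \<subseteq> (\<lambda>c. \<Sum>b\<in>C. c b *\<^sub>R b) ` P"
  proof
    fix y assume "y \<in> cball x R"
    then have ny: "norm y \<le> norm x + \<bar>R\<bar>"
      using norm_triangle_sub[of y x] by (simp add: dist_norm norm_minus_commute)
    have "\<bar>r b y\<bar> \<le> (norm x + \<bar>R\<bar>) * \<bar>K b\<bar>" if "b \<in> C" for b
    proof -
      have "norm y * K b \<le> norm y * \<bar>K b\<bar>" by (intro mult_left_mono) auto
      then have "\<bar>r b y\<bar> \<le> norm y * \<bar>K b\<bar>" using K[OF that, of y] by simp
      also have "\<dots> \<le> (norm x + \<bar>R\<bar>) * \<bar>K b\<bar>" using ny by (intro mult_right_mono) auto
      finally show ?thesis .
    qed
    then have "(\<lambda>b. if b \<in> C then r b y else 0) \<in> P"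
      by (auto simp: P_def abs_le_iff minus_le_iff)
    moreover have "(\<Sum>b\<in>C. (if b \<in> C then r b y else 0) *\<^sub>R b) = y"
      using C(3)[of y] by simp
    ultimately show "y \<in> (\<lambda>c. \<Sum>b\<in>C. c b *\<^sub>R b) ` P" by (intro image_eqI[OF sym])
  qed
  ultimately show ?thesis
    using compact_Int_closed[OF \<open>compact ((\<lambda>c. \<Sum>b\<in>C. c b *\<^sub>R b) ` P)\<close> closed_cball, of x R]
    by (simp add: inf.absorb2)
qed

text \<open>A derivative along a sequence rather than a curve: only the velocity of the sequence matters.\<close>

lemma has_derivative_scaled_sequence:
  fixes h :: "'a::real_normed_vector \<Rightarrow> 'b::real_normed_vector"
  assumes h: "(h has_derivative L) (at p)" and x: "(\<lambda>n. real n *\<^sub>R x n) \<longlonglongrightarrow> \<zeta>"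
  shows "(\<lambda>n. real n *\<^sub>R (h (p + x n) - h p)) \<longlonglongrightarrow> L \<zeta>"
proof (rule Lim_transform2)
  have L: "bounded_linear L" using h has_derivative_bounded_linear by blast
  have "(\<lambda>n. inverse (real n) *\<^sub>R (real n *\<^sub>R x n)) \<longlonglongrightarrow> 0"
    using tendsto_scaleR[OF lim_inverse_n[where 'a = real] x] by simp
  then have "x \<longlonglongrightarrow> 0"
    by (rule Lim_transform_eventually)
       (use eventually_gt_at_top[of 0] in \<open>eventually_elim, simp\<close>)
  then have px: "(\<lambda>n. p + x n) \<longlonglongrightarrow> p" using tendsto_add[OF tendsto_const, of x 0] by simp
  show "(\<lambda>n. L (real n *\<^sub>R x n)) \<longlonglongrightarrow> L \<zeta>" by (rule bounded_linear.tendsto[OF L x])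
  let ?\<rho> = "\<lambda>y. norm (h y - h p - L (y - p)) / norm (y - p)"
  have "(?\<rho> \<longlongrightarrow> ?\<rho> p) (nhds p)"
    using h tendsto_at_iff_tendsto_nhds[of ?\<rho> p] unfolding has_derivative_iff_norm by simp
  from filterlim_compose[OF this px] have "(\<lambda>n. norm (real n *\<^sub>R x n) * ?\<rho> (p + x n)) \<longlonglongrightarrow> norm \<zeta> * ?\<rho> p"
    by (intro tendsto_mult tendsto_norm x)
  moreover have "norm (real n *\<^sub>R x n) * ?\<rho> (p + x n) = norm (L (real n *\<^sub>R x n) - real n *\<^sub>R (h (p + x n) - h p))" for n
  proof -
    have "L (real n *\<^sub>R x n) - real n *\<^sub>R (h (p + x n) - h p) = - (real n *\<^sub>R (h (p + x n) - h p - L (x n)))"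
      by (simp add: linear_scale[OF bounded_linear.linear[OF L]] scaleR_diff_right)
    then show ?thesis
      using linear_0[OF bounded_linear.linear[OF L]] by (cases "x n = 0") (simp_all only: norm_minus_cancel norm_scaleR, simp_all)
  qed
  ultimately show "(\<lambda>n. L (real n *\<^sub>R x n) - real n *\<^sub>R (h (p + x n) - h p)) \<longlonglongrightarrow> 0"
    by (simp add: tendsto_norm_zero_iff)
qed

lemma vector_derivative_scaled_sequence:
  assumes "(\<gamma> has_vector_derivative \<zeta>) (at 0)"
  shows "(\<lambda>n. real n *\<^sub>R (\<gamma> (inverse (real n)) - \<gamma> 0)) \<longlonglongrightarrow> \<zeta>"
proof -
  have "(\<lambda>n. real n *\<^sub>R inverse (real n)) \<longlonglongrightarrow> 1"
    by (rule Lim_transform_eventually[OF tendsto_const])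
       (use eventually_gt_at_top[of 0] in \<open>eventually_elim, simp\<close>)
  from has_derivative_scaled_sequence[OF assms[unfolded has_vector_derivative_def] this]
  show ?thesis by simp
qed

lemma dd_in_subspace:
  assumes fd: "findim TYPE('b::real_normed_vector)"
    and f: "(f has_derivative D) (at p)" and S: "subspace (S :: 'b set)"
    and U: "open U" "p \<in> U" "\<And>q. q \<in> U \<Longrightarrow> f q \<in> S"
  shows "D u \<in> S"
proof -
  have "((\<lambda>t. p + t *\<^sub>R u) has_derivative (\<lambda>t. t *\<^sub>R u)) (at 0)"
    by (auto intro!: derivative_eq_intros)
  moreover have "(f has_derivative D) (at (p + 0 *\<^sub>R u))" using f by simp
  ultimately have "((\<lambda>t. f (p + t *\<^sub>R u)) has_derivative (\<lambda>t. D (t *\<^sub>R u))) (at 0)"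
    using diff_chain_at[of "\<lambda>t. p + t *\<^sub>R u" _ 0 f D] by (simp add: o_def)
  moreover have "(\<lambda>t. D (t *\<^sub>R u)) = (\<lambda>t. t *\<^sub>R D u)"
    using linear_scale[OF has_derivative_linear[OF f]] by auto
  ultimately have v: "((\<lambda>t. f (p + t *\<^sub>R u)) has_vector_derivative D u) (at 0)"
    by (simp add: has_vector_derivative_def)
  have "(\<lambda>n. p + inverse (real n) *\<^sub>R u) \<longlonglongrightarrow> p + 0 *\<^sub>R u"
    by (intro tendsto_intros lim_inverse_n)
  then have "\<forall>\<^sub>F n in sequentially. p + inverse (real n) *\<^sub>R u \<in> U"
    using topological_tendstoD U(1,2) by fastforce
  then have ev: "\<forall>\<^sub>F n in sequentially. real n *\<^sub>R (f (p + inverse (real n) *\<^sub>R u) - f (p + 0 *\<^sub>R u)) \<in> S"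
    by eventually_elim (use U S in \<open>auto intro!: subspace_scale subspace_diff\<close>)
  show ?thesis
    by (rule Lim_in_closed_set[OF findim_subspace_closed[OF fd S] ev _ vector_derivative_scaled_sequence[OF v]]) simp
qed

context lie_group_chart
begin

lemma tendsto_gmult:
  assumes "(f \<longlongrightarrow> a) F" "(g \<longlongrightarrow> b) F"
  shows "((\<lambda>x. f x \<otimes> g x) \<longlongrightarrow> a \<otimes> b) F"
proof -
  have "continuous_on UNIV (\<lambda>(a, b). a \<otimes> b)" using mult_holo unfolding holo_map_on_def by blast
  then have "isCont (\<lambda>(a, b). a \<otimes> b) (a, b)" by (simp add: continuous_on_eq_continuous_at)
  from isCont_tendsto_compose[OF this tendsto_Pair[OF assms]] show ?thesis by simp
qed

lemma tendsto_ginv: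
  assumes "(f \<longlongrightarrow> a) F"
  shows "((\<lambda>x. inv (f x)) \<longlongrightarrow> inv a) F"
proof -
  have "continuous_on UNIV (\<lambda>a. inv a)" using inv_holo unfolding holo_map_on_def by blast
  then have "isCont (\<lambda>a. inv a) a" by (simp add: continuous_on_eq_continuous_at)
  from isCont_tendsto_compose[OF this assms] show ?thesis .
qed

lemma tendsto_chart:
  assumes "(f \<longlongrightarrow> a) F" "a \<in> fst e"
  shows "((\<lambda>x. snd e (f x)) \<longlongrightarrow> snd e a) F"
  using isCont_tendsto_compose[OF _ assms(1), of "snd e"] chart_e(1,3) assms(2)
  by (simp add: continuous_on_eq_continuous_at)

lemma tendsto_ei:
  assumes "(f \<longlongrightarrow> y) F" "y \<in> E"
  shows "((\<lambda>x. ei (f x)) \<longlongrightarrow> ei y) F"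
proof -
  have "isCont ei y" using chart_e(2,4) assms(2) continuous_on_eq_continuous_at by blast
  from isCont_tendsto_compose[OF this assms(1)] show ?thesis .
qed

lemma ginv_has_derivative: "((\<lambda>y. snd e (inv (ei y))) has_derivative (\<lambda>h. - h)) (at e0)"
proof -
  let ?O = "E \<inter> (\<lambda>y. inv (ei y)) -` fst e"
  let ?i = "\<lambda>y. snd e (inv (ei y))"
  have g: "gholo E (\<lambda>y. inv (ei y))" by (intro gholo_inv gholo_chart_inv e)
  have O: "open ?O" "e0 \<in> ?O" using gholo_chart(1)[OF g e] e0_in one_e by auto
  have d: "(?i has_derivative dd ?i e0) (at e0)"
    using holo_onD(2)[OF gholo_chart(2)[OF g e] O(2)] .
  have i0: "?i e0 = e0" using one_e by (simp flip: e0_def)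
  have "((\<lambda>y. (y, ?i y)) has_derivative (\<lambda>h. (h, dd ?i e0 h))) (at e0)"
    by (intro has_derivative_Pair d has_derivative_ident)
  moreover have "(gm has_derivative dd gm (e0, e0)) (at (e0, ?i e0))"
    unfolding i0 using holo_onD(2)[OF gm_holo gmO_right[OF e0_in]] .
  ultimately have "((\<lambda>y. gm (y, ?i y)) has_derivative (\<lambda>h. dd gm (e0, e0) (h, dd ?i e0 h))) (at e0)"
    using diff_chain_at[of "\<lambda>y. (y, ?i y)" _ e0 gm] by (fastforce simp: o_def)
  moreover have "gm (y, ?i y) = e0" if "y \<in> ?O" for y
    using that chart_e(5) by (simp add: gm_def r_inv flip: e0_def)
  ultimately have "((\<lambda>y. e0) has_derivative (\<lambda>h. dd gm (e0, e0) (h, dd ?i e0 h))) (at e0)"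
    using has_derivative_cong_open[OF O, of "\<lambda>y. gm (y, ?i y)" "\<lambda>y. e0"] by blast
  from has_derivative_unique[OF this has_derivative_const]
  have z: "dd gm (e0, e0) (h, dd ?i e0 h) = 0" for h by metis
  have "dd gm (e0, e0) (h, k) = h + k" for h k
  proof -
    have "dd gm (e0, e0) ((h, 0) + (0, k)) = dd gm (e0, e0) (h, 0) + dd gm (e0, e0) (0, k)"
      by (rule complex_linearD(1)[OF holo_onD(3)[OF gm_holo gmO_right[OF e0_in]]])
    then show ?thesis by (simp add: dd_gm_left[OF e0_in] dd_gm_right[OF e0_in])
  qed
  then have "dd ?i e0 h = - h" for h using z[of h] by (simp add: eq_neg_iff_add_eq_0 add.commute)
  then have "dd ?i e0 = (\<lambda>h. - h)" by blast
  then show ?thesis using d by simp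
qed

text \<open>
  Near the unit the multiplication is addition up to an error of first order in the second factor
  alone, because \<open>gm (x, e0) = x\<close>. This linear bound lets errors add up in \<open>power_estimate\<close>.
\<close>

lemma gm_near:
  assumes "\<epsilon> > 0"
  shows "\<exists>\<delta>>0. cball e0 \<delta> \<subseteq> E \<and> (\<forall>u v. norm u \<le> \<delta> \<longrightarrow> norm v \<le> \<delta> \<longrightarrow> (e0 + u, e0 + v) \<in> gmO \<and>
    norm (gm (e0 + u, e0 + v) - e0 - u - v) \<le> \<epsilon> * norm v)"
proof -
  obtain C and r :: "'l \<Rightarrow> 'l \<Rightarrow> real"
    where C: "finite C" "\<And>b. b \<in> C \<Longrightarrow> bounded_linear (r b)" "\<And>x. (\<Sum>b\<in>C. r b x *\<^sub>R b) = x"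
    using findim_coords[OF fd] by metis
  have "\<exists>K>0. \<forall>x. norm (r b x) \<le> norm x * K" if "b \<in> C" for b
    using bounded_linear.pos_bounded[OF C(2)[OF that]] by blast
  then obtain K where K: "\<And>b. b \<in> C \<Longrightarrow> K b > 0" "\<And>b x. b \<in> C \<Longrightarrow> norm (r b x) \<le> norm x * K b" by metis
  define \<kappa> where "\<kappa> = sum K C + 1"
  have \<kappa>: "\<kappa> > 0" unfolding \<kappa>_def using K(1) by (intro add_nonneg_pos sum_nonneg) (auto intro: less_imp_le)
  have "\<forall>\<^sub>F w in nhds (e0, e0). norm (dd gm w (0, b) - b) < \<epsilon> / \<kappa>" for b
  proof -
    have "continuous (at (e0, e0)) (\<lambda>w. dd gm w (0, b))"
      using holo_onD(1)[OF gm_dd_holo gmO_right[OF e0_in]] differentiable_imp_continuous_within by blast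
    then have "((\<lambda>w. dd gm w (0, b)) \<longlongrightarrow> dd gm (e0, e0) (0, b)) (nhds (e0, e0))"
      using tendsto_at_iff_tendsto_nhds[of "\<lambda>w. dd gm w (0, b)"] unfolding isCont_def by blast
    then have "((\<lambda>w. dd gm w (0, b)) \<longlongrightarrow> b) (nhds (e0, e0))"
      by (simp add: dd_gm_left[OF e0_in])
    from tendstoD[OF this, of "\<epsilon> / \<kappa>"] show ?thesis using assms \<kappa> by (simp add: dist_norm)
  qed
  then have "\<forall>\<^sub>F w in nhds (e0, e0). \<forall>b\<in>C. norm (dd gm w (0, b) - b) < \<epsilon> / \<kappa>"
    by (intro eventually_ball_finite C) auto
  moreover have "\<forall>\<^sub>F w in nhds (e0, e0). w \<in> gmO"
    using gmO gmO_right[OF e0_in] eventually_nhds by blast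
  ultimately have "\<forall>\<^sub>F w in nhds (e0, e0). w \<in> gmO \<and> (\<forall>b\<in>C. norm (dd gm w (0, b) - b) < \<epsilon> / \<kappa>)"
    by eventually_elim auto
  then obtain \<rho> where \<rho>: "\<rho> > 0" "\<And>w. dist w (e0, e0) < \<rho> \<Longrightarrow> w \<in> gmO \<and> (\<forall>b\<in>C. norm (dd gm w (0, b) - b) < \<epsilon> / \<kappa>)"
    unfolding eventually_nhds_metric by blast
  obtain \<rho>' where \<rho>': "\<rho>' > 0" "cball e0 \<rho>' \<subseteq> E"
    using chart_e(2) e0_in open_contains_cball_eq by blast
  define \<delta> where "\<delta> = min \<rho>' (\<rho> / 3)"
  have \<delta>: "\<delta> > 0" "\<delta> \<le> \<rho>'" "\<delta> \<le> \<rho> / 3" using \<rho> \<rho>' by (auto simp: \<delta>_def)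
  have near: "dist (e0 + u, e0 + v) (e0, e0) < \<rho>" if "norm u \<le> \<delta>" "norm v \<le> \<delta>" for u v
  proof -
    have "dist (e0 + u, e0 + v) (e0, e0) = norm (u, v)" by (simp add: dist_norm)
    also have "\<dots> \<le> norm u + norm v" by (rule norm_Pair_le)
    finally show ?thesis using that \<delta> \<rho>(1) by simp
  qed
  have est: "norm (gm (e0 + u, e0 + v) - e0 - u - v) \<le> \<epsilon> * norm v" if u: "norm u \<le> \<delta>" and v: "norm v \<le> \<delta>" for u v
  proof -
    let ?f = "\<lambda>y. gm (e0 + u, e0 + y) - y"
    have der: "(?f has_derivative (\<lambda>h. dd gm (e0 + u, e0 + y) (0, h) - h)) (at y within cball 0 \<delta>)"
      if "y \<in> cball 0 \<delta>" for y
    proof -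
      have "(e0 + u, e0 + y) \<in> gmO" using \<rho>(2)[OF near[OF u]] that by simp
      from holo_onD(2)[OF gm_holo this]
      have "(gm has_derivative dd gm (e0 + u, e0 + y)) (at (e0 + u, e0 + y))" .
      moreover have "((\<lambda>y. (e0 + u, e0 + y)) has_derivative (\<lambda>h. (0, h))) (at y)"
        by (auto intro!: derivative_eq_intros)
      ultimately have "((\<lambda>y. gm (e0 + u, e0 + y)) has_derivative (\<lambda>h. dd gm (e0 + u, e0 + y) (0, h))) (at y)"
        using diff_chain_at[of "\<lambda>y. (e0 + u, e0 + y)" "\<lambda>h. (0, h)" y gm] by (simp add: o_def)
      then show ?thesis
        by (rule has_derivative_diff[OF has_derivative_at_withinI has_derivative_ident])
    qed
    have bnd: "onorm (\<lambda>h. dd gm (e0 + u, e0 + y) (0, h) - h) \<le> \<epsilon>" if "y \<in> cball 0 \<delta>" for y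
    proof (rule onorm_bound)
      show "0 \<le> \<epsilon>" using assms by simp
      fix h
      let ?w = "(e0 + u, e0 + y)"
      have w: "?w \<in> gmO" "\<And>b. b \<in> C \<Longrightarrow> norm (dd gm ?w (0, b) - b) < \<epsilon> / \<kappa>"
        using \<rho>(2)[OF near[OF u]] that by auto
      have lin: "linear (\<lambda>h. dd gm ?w (0, h) - h)"
        using complex_linearD(1,6)[OF holo_onD(3)[OF gm_holo w(1)]]
        by (intro linearI) (metis (no_types, lifting) add_Pair add.right_neutral add_diff_add,
           metis (no_types, lifting) scaleR_Pair scaleR_zero_right scaleR_diff_right)
      have "dd gm ?w (0, h) - h = (\<lambda>h. dd gm ?w (0, h) - h) (\<Sum>b\<in>C. r b h *\<^sub>R b)" by (simp add: C(3))
      also have "\<dots> = (\<Sum>b\<in>C. r b h *\<^sub>R (dd gm ?w (0, b) - b))"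
        by (simp only: linear_sum[OF lin] linear_scale[OF lin])
      also have "norm \<dots> \<le> (\<Sum>b\<in>C. norm h * K b * (\<epsilon> / \<kappa>))"
      proof (rule sum_norm_le)
        fix b assume b: "b \<in> C"
        have "norm (r b h *\<^sub>R (dd gm ?w (0, b) - b)) = norm (r b h) * norm (dd gm ?w (0, b) - b)" by simp
        also have "\<dots> \<le> (norm h * K b) * (\<epsilon> / \<kappa>)"
          using K(2)[OF b, of h] K(1)[OF b] w(2)[OF b] by (intro mult_mono) auto
        finally show "norm (r b h *\<^sub>R (dd gm ?w (0, b) - b)) \<le> norm h * K b * (\<epsilon> / \<kappa>)" .
      qed
      also have "\<dots> = norm h * \<epsilon> * (sum K C / \<kappa>)"
        by (simp add: sum_distrib_left sum_distrib_right sum_divide_distrib mult_ac)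
      also have "\<dots> \<le> norm h * \<epsilon> * 1"
        using \<kappa> assms by (intro mult_left_mono) (auto simp: \<kappa>_def)
      finally show "norm (dd gm ?w (0, h) - h) \<le> \<epsilon> * norm h" by (simp add: mult.commute)
    qed
    have "norm (?f v - ?f 0) \<le> \<epsilon> * norm (v - 0)"
      by (rule differentiable_bound[OF convex_cball der bnd]) (use v \<delta> in auto)
    moreover have "e0 + u \<in> E" using u \<delta> \<rho>'(2) by (auto simp: dist_norm subset_iff)
    ultimately show ?thesis by (simp add: algebra_simps)
  qed
  show ?thesis
    using est \<delta>(1) \<rho>(2)[OF near] \<rho>'(2) \<delta>(2) by (intro exI[of _ \<delta>]) (auto simp: subset_iff)
qed

lemma power_estimate:
  assumes \<epsilon>: "0 < \<epsilon>" "\<epsilon> \<le> 1"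
  shows "\<exists>\<delta>>0. cball e0 \<delta> \<subseteq> E \<and> (\<forall>a k. a \<in> fst e \<longrightarrow> 2 * real k * norm (snd e a - e0) \<le> \<delta> \<longrightarrow>
    a [^] (k::nat) \<in> fst e \<and>
    norm (snd e (a [^] k) - e0 - real k *\<^sub>R (snd e a - e0)) \<le> \<epsilon> * (real k * norm (snd e a - e0)))"
proof -
  obtain \<delta> where \<delta>: "\<delta> > 0" "cball e0 \<delta> \<subseteq> E"
    "\<And>u v. norm u \<le> \<delta> \<Longrightarrow> norm v \<le> \<delta> \<Longrightarrow> (e0 + u, e0 + v) \<in> gmO \<and> norm (gm (e0 + u, e0 + v) - e0 - u - v) \<le> \<epsilon> * norm v"
    using gm_near[OF \<epsilon>(1)] by blast
  have "a [^] k \<in> fst e \<and> norm (snd e (a [^] k) - e0 - real k *\<^sub>R (snd e a - e0)) \<le> \<epsilon> * (real k * norm (snd e a - e0))"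
    if a: "a \<in> fst e" and k: "2 * real k * norm (snd e a - e0) \<le> \<delta>" for a k
    using k
  proof (induction k)
    case 0
    then show ?case using one_e by (simp flip: e0_def)
  next
    case (Suc k)
    define x where "x = snd e a - e0"
    have le: "2 * real k * norm x \<le> \<delta>" "norm x \<le> \<delta>"
    proof -
      have "2 * real k * norm x \<le> 2 * real (Suc k) * norm x" by (intro mult_right_mono) auto
      moreover have "1 * norm x \<le> 2 * real (Suc k) * norm x" by (intro mult_right_mono) auto
      ultimately show "2 * real k * norm x \<le> \<delta>" "norm x \<le> \<delta>" using Suc.prems by (auto simp: x_def)
    qed
    define u where "u = snd e (a [^] k) - e0"
    have IH: "a [^] k \<in> fst e" "norm (u - real k *\<^sub>R x) \<le> \<epsilon> * (real k * norm x)"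
      using Suc.IH le by (auto simp: u_def x_def)
    have "norm u \<le> norm (real k *\<^sub>R x) + norm (u - real k *\<^sub>R x)" by (rule norm_triangle_sub)
    also have "\<dots> \<le> real k * norm x + \<epsilon> * (real k * norm x)" using IH(2) by simp
    also have "\<dots> \<le> real k * norm x + 1 * (real k * norm x)"
      using \<epsilon>(2) by (intro add_left_mono mult_right_mono) auto
    also have "\<dots> \<le> \<delta>" using le by simp
    finally have nu: "norm u \<le> \<delta>" .
    note s = \<delta>(3)[OF nu le(2)]
    have eq: "ei (e0 + u) = a [^] k" "ei (e0 + x) = a"
      using IH(1) a chart_e(5) by (auto simp: u_def x_def)
    have m: "a [^] Suc k = ei (gm (e0 + u, e0 + x))"
      using ei_gm[of "(e0 + u, e0 + x)"] s eq by simp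
    have inE: "gm (e0 + u, e0 + x) \<in> E" using s by (auto simp: gmO_def gm_def)
    have "snd e (a [^] Suc k) - e0 - real (Suc k) *\<^sub>R x = (gm (e0 + u, e0 + x) - e0 - u - x) + (u - real k *\<^sub>R x)"
      unfolding m using chart_e(6)[OF inE] by (simp add: algebra_simps)
    also have "norm \<dots> \<le> \<epsilon> * norm x + \<epsilon> * (real k * norm x)"
      using s IH(2) by (intro order_trans[OF norm_triangle_ineq] add_mono) auto
    also have "\<dots> = \<epsilon> * (real (Suc k) * norm x)" by (simp add: algebra_simps)
    finally show ?case using chart_e(7)[OF inE] m by (simp add: x_def)
  qed
  then show ?thesis using \<delta>(1,2) by blast
qed

text \<open>
  With \<open>k = \<lfloor>n t\<rfloor>\<close>, the power \<open>f n ^ k\<close> has coordinates close to \<open>k\<close> times those of \<open>f n\<close>, which converge to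
  \<open>t \<zeta>\<close>. The filter \<open>F\<close> is finer than the sequential one because compactness of an uncountable product only
  provides cluster points, not convergent subsequences.
\<close>

lemma limit_power_estimate:
  assumes f: "\<forall>\<^sub>F n in sequentially. f n \<in> fst e" "(\<lambda>n. real n *\<^sub>R (snd e (f n) - e0)) \<longlonglongrightarrow> \<zeta>"
    and F: "F \<le> sequentially" "F \<noteq> bot" and \<epsilon>: "0 < \<epsilon>"
  shows "\<exists>d>0. \<forall>t y. 0 \<le> t \<longrightarrow> t \<le> d \<longrightarrow> ((\<lambda>n. f n [^] nat \<lfloor>real n * t\<rfloor>) \<longlongrightarrow> y) F \<longrightarrow>
    y \<in> fst e \<and> norm (snd e y - e0 - t *\<^sub>R \<zeta>) \<le> \<epsilon> * t"
proof -
  define c where "c = norm \<zeta> + 1"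
  have c: "c > 0" by (simp add: c_def add_nonneg_pos)
  define \<epsilon>' where "\<epsilon>' = min 1 (\<epsilon> / c)"
  have \<epsilon>': "0 < \<epsilon>'" "\<epsilon>' \<le> 1" "\<epsilon>' * c \<le> \<epsilon>"
  proof -
    have "\<epsilon>' * c \<le> (\<epsilon> / c) * c" using c by (intro mult_right_mono) (auto simp: \<epsilon>'_def)
    then show "\<epsilon>' * c \<le> \<epsilon>" using c by simp
  qed (use \<epsilon> c in \<open>auto simp: \<epsilon>'_def\<close>)
  obtain \<delta> where \<delta>: "\<delta> > 0" "cball e0 \<delta> \<subseteq> E"
    "\<And>a k. a \<in> fst e \<Longrightarrow> 2 * real k * norm (snd e a - e0) \<le> \<delta> \<Longrightarrow> a [^] (k::nat) \<in> fst e \<and>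
    norm (snd e (a [^] k) - e0 - real k *\<^sub>R (snd e a - e0)) \<le> \<epsilon>' * (real k * norm (snd e a - e0))"
    using power_estimate[OF \<epsilon>'(1,2)] by blast
  define d where "d = \<delta> / (2 * c)"
  have "y \<in> fst e \<and> norm (snd e y - e0 - t *\<^sub>R \<zeta>) \<le> \<epsilon> * t"
    if t: "0 \<le> t" "t \<le> d" and y: "((\<lambda>n. f n [^] nat \<lfloor>real n * t\<rfloor>) \<longlongrightarrow> y) F" for t y
  proof -
    define k where "k n = nat \<lfloor>real n * t\<rfloor>" for n
    define x where "x n = snd e (f n) - e0" for n
    have k: "real (k n) \<le> real n * t" "real n * t < real (k n) + 1" for n
      using t(1) by (simp_all add: k_def)
    have kn: "(\<lambda>n. real (k n) / real n) \<longlonglongrightarrow> t"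
    proof (rule tendsto_sandwich)
      show "(\<lambda>n. t - inverse (real n)) \<longlonglongrightarrow> t"
        using tendsto_diff[OF tendsto_const lim_inverse_n[where 'a = real], of t] by simp
      show "\<forall>\<^sub>F n in sequentially. t - inverse (real n) \<le> real (k n) / real n"
        using eventually_gt_at_top[of 0]
      proof eventually_elim
        case (elim n)
        have "(real n * t - 1) / real n \<le> real (k n) / real n" using k(2)[of n] by (intro divide_right_mono) auto
        then show ?case using elim by (simp add: field_simps)
      qed
      show "\<forall>\<^sub>F n in sequentially. real (k n) / real n \<le> t"
        using eventually_gt_at_top[of 0]
      proof eventually_elim
        case (elim n)
        then show ?case using k(1)[of n] by (simp add: field_simps)
      qed
    qed simp
    have kx: "(\<lambda>n. real (k n) *\<^sub>R x n) \<longlonglongrightarrow> t *\<^sub>R \<zeta>"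
    proof (rule Lim_transform_eventually)
      show "(\<lambda>n. (real (k n) / real n) *\<^sub>R (real n *\<^sub>R x n)) \<longlonglongrightarrow> t *\<^sub>R \<zeta>"
        using tendsto_scaleR[OF kn f(2)] by (simp add: x_def)
      show "\<forall>\<^sub>F n in sequentially. (real (k n) / real n) *\<^sub>R (real n *\<^sub>R x n) = real (k n) *\<^sub>R x n"
        using eventually_gt_at_top[of 0] by eventually_elim simp
    qed
    have "\<forall>\<^sub>F n in sequentially. norm (real n *\<^sub>R x n) < c"
      using order_tendstoD(2)[OF tendsto_norm[OF f(2)], of c] by (simp add: c_def x_def)
    then have ev: "\<forall>\<^sub>F n in sequentially. f n [^] k n \<in> ei ` cball e0 \<delta> \<and>
        norm (snd e (f n [^] k n) - e0 - real (k n) *\<^sub>R x n) \<le> \<epsilon> * t"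
      using f(1)
    proof eventually_elim
      case (elim n)
      have "real (k n) * norm (x n) \<le> (real n * t) * norm (x n)"
        using k(1) by (intro mult_right_mono) auto
      also have "\<dots> = t * norm (real n *\<^sub>R x n)" by simp
      also have "\<dots> \<le> t * c" using elim(1) t(1) by (intro mult_left_mono) auto
      finally have kt: "real (k n) * norm (x n) \<le> t * c" .
      also have "\<dots> \<le> d * c" using t c by (intro mult_right_mono) auto
      also have "\<dots> = \<delta> / 2" using c by (simp add: d_def)
      finally have k2: "2 * real (k n) * norm (x n) \<le> \<delta>" by simp
      note p = \<delta>(3)[OF elim(2) k2[unfolded x_def], folded x_def]
      have "\<epsilon>' * (real (k n) * norm (x n)) \<le> \<epsilon>' * (t * c)" using kt \<epsilon>' by (intro mult_left_mono) auto
      also have "\<dots> = (\<epsilon>' * c) * t" by simp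
      also have "\<dots> \<le> \<epsilon> * t" using \<epsilon>'(3) t(1) by (rule mult_right_mono)
      finally have b: "norm (snd e (f n [^] k n) - e0 - real (k n) *\<^sub>R x n) \<le> \<epsilon> * t" using p by simp
      have "norm (snd e (f n [^] k n) - e0)
          \<le> norm (real (k n) *\<^sub>R x n) + norm (snd e (f n [^] k n) - e0 - real (k n) *\<^sub>R x n)"
        by (rule norm_triangle_sub)
      also have "\<dots> \<le> real (k n) * norm (x n) + \<epsilon>' * (real (k n) * norm (x n))" using p by simp
      also have "\<dots> \<le> real (k n) * norm (x n) + 1 * (real (k n) * norm (x n))"
        using \<epsilon>' by (intro add_left_mono mult_right_mono) auto
      also have "\<dots> \<le> \<delta>" using k2 by simp
      finally have "snd e (f n [^] k n) \<in> cball e0 \<delta>" by (simp add: dist_norm norm_minus_commute)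
      moreover have "f n [^] k n = ei (snd e (f n [^] k n))" using p chart_e(5) by simp
      ultimately show ?case using b by blast
    qed
    \<comment> \<open>Compactness keeps the limit \<open>y\<close> inside the domain of the chart.\<close>
    have "compact (ei ` cball e0 \<delta>)"
      using findim_compact_cball[OF fd] chart_e(4) \<delta>(2) by (intro compact_continuous_image) (auto intro: continuous_on_subset)
    then have "closed (ei ` cball e0 \<delta>)" by (rule compact_imp_closed)
    moreover have "\<forall>\<^sub>F n in F. f n [^] k n \<in> ei ` cball e0 \<delta>"
      using filter_leD[OF F(1) ev] by eventually_elim auto
    ultimately have "y \<in> ei ` cball e0 \<delta>"
      by (rule Lim_in_closed_set[OF _ _ F(2) y[folded k_def]])
    then have ye: "y \<in> fst e" using chart_e(7) \<delta>(2) by auto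
    have "((\<lambda>n. norm (snd e (f n [^] k n) - e0 - real (k n) *\<^sub>R x n)) \<longlongrightarrow> norm (snd e y - e0 - t *\<^sub>R \<zeta>)) F"
      by (intro tendsto_norm tendsto_diff tendsto_const tendsto_mono[OF F(1) kx] tendsto_chart[OF y[folded k_def] ye])
    moreover have "\<forall>\<^sub>F n in F. norm (snd e (f n [^] k n) - e0 - real (k n) *\<^sub>R x n) \<le> \<epsilon> * t"
      using filter_leD[OF F(1) ev] by eventually_elim auto
    ultimately have "norm (snd e y - e0 - t *\<^sub>R \<zeta>) \<le> \<epsilon> * t"
      by (rule tendsto_upperbound[OF _ _ F(2)])
    then show ?thesis using ye by blast
  qed
  moreover have "d > 0" using \<delta>(1) c by (simp add: d_def)
  ultimately show ?thesis by blast
qed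

lemma one_param_subgroupD:
  assumes "one_param_subgroup G e \<xi> c"
  shows "c 0 = \<one>" "isCont c t" "c (s + t) = c s \<otimes> c t"
    "((\<lambda>t. snd e (c t)) has_vector_derivative \<xi>) (at 0)"
proof -
  have *: "continuous_on UNIV c" "\<And>s t. c (s + t) = c s \<otimes> c t"
    "((\<lambda>t. snd e (c t)) has_vector_derivative \<xi>) (at 0)"
    using assms unfolding one_param_subgroup_def by blast+
  show "c (s + t) = c s \<otimes> c t" "((\<lambda>t. snd e (c t)) has_vector_derivative \<xi>) (at 0)" by fact+
  show "isCont c t" using *(1) by (simp add: continuous_on_eq_continuous_at)
  have "c 0 \<otimes> c 0 = c 0" using *(2)[of 0 0] by simp
  then show "c 0 = \<one>" using l_cancel_one by (metis carrier_in)
qed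

text \<open>
  The tangent vectors at the unit of curves in a compact subgroup are velocities of one-parameter
  subgroups: with \<open>f n = c (1/n)\<close>, the maps \<open>t \<mapsto> f n ^ \<lfloor>n t\<rfloor>\<close> have a cluster point in the compact space of
  all maps from the reals to the subgroup, and the estimate on powers shows that it has the prescribed
  velocity.
\<close>

lemma sequence_lie_alg:
  assumes K: "subgroup K G" "compact K" and fK: "\<And>n. f n \<in> K"
    and f: "\<forall>\<^sub>F n in sequentially. f n \<in> fst e" "(\<lambda>n. real n *\<^sub>R (snd e (f n) - e0)) \<longlonglongrightarrow> \<zeta>"
  shows "\<zeta> \<in> lie_alg G e K"
proof -
  define \<Phi> :: "nat \<Rightarrow> real \<Rightarrow> 'g" where "\<Phi> n t = f n [^] \<lfloor>real n * t\<rfloor>" for n t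
  have pK: "f n [^] (k::nat) \<in> K" for n k
    by (induction k) (use fK subgroup.one_closed[OF K(1)] subgroup.m_closed[OF K(1)] in auto)
  then have \<Phi>K: "\<Phi> n t \<in> K" for n t
    unfolding \<Phi>_def int_pow_def2
    by (split if_split) (blast intro: subgroup.m_inv_closed[OF K(1)])
  let ?P = "PiE UNIV (\<lambda>_. K) :: (real \<Rightarrow> 'g) set"
  have "compact ?P" by (rule compact_PiE_UNIV[OF K(2)])
  moreover have "filtermap \<Phi> sequentially \<noteq> bot" by (simp add: filtermap_bot_iff)
  moreover have "eventually (\<lambda>x. x \<in> ?P) (filtermap \<Phi> sequentially)"
    by (simp add: eventually_filtermap PiE_UNIV_domain \<Phi>K)
  ultimately obtain \<phi> where \<phi>: "\<phi> \<in> ?P" "inf (nhds \<phi>) (filtermap \<Phi> sequentially) \<noteq> bot"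
    unfolding compact_filter by blast
  define F where "F = inf (filtercomap \<Phi> (nhds \<phi>)) sequentially"
  have F: "F \<le> sequentially" by (simp add: F_def)
  have Fb: "F \<noteq> bot"
  proof
    assume "F = bot"
    then have "eventually (\<lambda>_. False) F" by simp
    then obtain P Q where P: "eventually P (filtercomap \<Phi> (nhds \<phi>))" and Q: "eventually Q sequentially"
      and PQ: "\<And>n. P n \<Longrightarrow> Q n \<Longrightarrow> False"
      unfolding F_def eventually_inf by blast
    obtain P' where P': "eventually P' (nhds \<phi>)" "\<And>n. P' (\<Phi> n) \<Longrightarrow> P n"
      using P unfolding eventually_filtercomap by blast
    have "\<forall>\<^sub>F n in sequentially. \<not> P' (\<Phi> n)"
      using Q by eventually_elim (use P'(2) PQ in blast)
    then have "eventually (\<lambda>x. \<not> P' x) (filtermap \<Phi> sequentially)" by (simp add: eventually_filtermap)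
    then have "eventually (\<lambda>_. False) (inf (nhds \<phi>) (filtermap \<Phi> sequentially))"
      using P'(1) unfolding eventually_inf by blast
    then show False using \<phi>(2) by (simp add: trivial_limit_def)
  qed
  have lim: "((\<lambda>n. \<Phi> n t) \<longlongrightarrow> \<phi> t) F" for t
  proof -
    have "filterlim \<Phi> (nhds \<phi>) F"
      unfolding F_def by (rule filterlim_mono[OF filterlim_filtercomap order_refl inf_le1])
    then show ?thesis
      using continuous_on_tendsto_compose[OF continuous_on_product_coordinates[of t], of \<Phi> \<phi> F] by simp
  qed
  have f1: "f \<longlonglongrightarrow> \<one>"
  proof -
    have "(\<lambda>n. inverse (real n) *\<^sub>R (real n *\<^sub>R (snd e (f n) - e0))) \<longlonglongrightarrow> 0 *\<^sub>R \<zeta>"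
      by (intro tendsto_scaleR lim_inverse_n f(2))
    moreover have "\<forall>\<^sub>F n in sequentially. inverse (real n) *\<^sub>R (real n *\<^sub>R (snd e (f n) - e0)) = snd e (f n) - e0"
      using eventually_gt_at_top[of 0] by eventually_elim simp
    ultimately have "(\<lambda>n. snd e (f n) - e0) \<longlonglongrightarrow> 0" using Lim_transform_eventually by fastforce
    then have "(\<lambda>n. snd e (f n)) \<longlonglongrightarrow> e0" by (simp add: LIM_zero_cancel)
    from tendsto_ei[OF this e0_in]
    have "(\<lambda>n. ei (snd e (f n))) \<longlonglongrightarrow> \<one>" by simp
    then show ?thesis
      by (rule Lim_transform_eventually) (use f(1) in \<open>eventually_elim, simp add: chart_e(5)\<close>)
  qed
  have hom: "\<phi> (s + t) = \<phi> s \<otimes> \<phi> t" for s t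
  proof -
    \<comment> \<open>Rounding costs at most one factor \<open>f n\<close>, which tends to the unit; so the cluster point is a
      homomorphism although the maps \<open>\<Phi> n\<close> are not.\<close>
    define j where "j n = \<lfloor>real n * (s + t)\<rfloor> - \<lfloor>real n * s\<rfloor> - \<lfloor>real n * t\<rfloor>" for n
    have j: "j n = 0 \<or> j n = 1" for n
      unfolding j_def distrib_left by linarith
    have eq: "\<Phi> n (s + t) = \<Phi> n s \<otimes> \<Phi> n t \<otimes> (f n [^] j n)" for n
    proof -
      have "\<lfloor>real n * (s + t)\<rfloor> = \<lfloor>real n * s\<rfloor> + \<lfloor>real n * t\<rfloor> + j n" by (simp add: j_def)
      then show ?thesis by (simp add: \<Phi>_def int_pow_mult)
    qed
    have "(\<lambda>n. f n [^] j n) \<longlonglongrightarrow> \<one>"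
    proof (rule topological_tendstoI)
      fix A :: "'g set" assume A: "open A" "\<one> \<in> A"
      from topological_tendstoD[OF f1 this] show "\<forall>\<^sub>F n in sequentially. f n [^] j n \<in> A"
      proof eventually_elim
        case (elim n)
        then show ?case using j[of n] A(2) by (auto simp: int_pow_1)
      qed
    qed
    then have "((\<lambda>n. \<Phi> n (s + t)) \<longlongrightarrow> \<phi> s \<otimes> \<phi> t \<otimes> \<one>) F"
      unfolding eq by (intro tendsto_gmult lim tendsto_mono[OF F])
    from tendsto_unique[OF Fb lim this] show ?thesis by (simp add: r_one)
  qed
  have \<phi>0: "\<phi> 0 = \<one>"
    using hom[of 0 0] l_cancel_one by (metis add_0 carrier_in)
  have \<phi>m: "\<phi> (- t) = inv (\<phi> t)" for t
    using hom[of "- t" t] \<phi>0 inv_equality by (metis add.left_inverse carrier_in)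
  \<comment> \<open>Negative times are reduced to positive ones for the inverse sequence, of velocity \<open>- \<zeta>\<close>.\<close>
  define g where "g n = inv (f n)" for n
  have g: "\<forall>\<^sub>F n in sequentially. g n \<in> fst e" "(\<lambda>n. real n *\<^sub>R (snd e (g n) - e0)) \<longlonglongrightarrow> - \<zeta>"
  proof -
    have "g \<longlonglongrightarrow> inv \<one>" unfolding g_def by (intro tendsto_ginv f1)
    then show "\<forall>\<^sub>F n in sequentially. g n \<in> fst e"
      using topological_tendstoD chart_e(1) one_e by fastforce
    have "(\<lambda>n. real n *\<^sub>R (snd e (inv (ei (e0 + (snd e (f n) - e0)))) - snd e (inv (ei e0)))) \<longlonglongrightarrow> - \<zeta>"
      by (rule has_derivative_scaled_sequence[OF ginv_has_derivative f(2)])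
    then show "(\<lambda>n. real n *\<^sub>R (snd e (g n) - e0)) \<longlonglongrightarrow> - \<zeta>"
      by (rule Lim_transform_eventually)
         (use f(1) in \<open>eventually_elim, simp add: g_def chart_e(5) flip: e0_def\<close>)
  qed
  have est: "\<exists>d>0. \<forall>t. \<bar>t\<bar> \<le> d \<longrightarrow> \<phi> t \<in> fst e \<and> norm (snd e (\<phi> t) - e0 - t *\<^sub>R \<zeta>) \<le> \<epsilon> * \<bar>t\<bar>" if \<epsilon>: "\<epsilon> > 0" for \<epsilon>
  proof -
    obtain d1 where d1: "d1 > 0" "\<And>t y. 0 \<le> t \<Longrightarrow> t \<le> d1 \<Longrightarrow> ((\<lambda>n. f n [^] nat \<lfloor>real n * t\<rfloor>) \<longlongrightarrow> y) F \<Longrightarrow>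
      y \<in> fst e \<and> norm (snd e y - e0 - t *\<^sub>R \<zeta>) \<le> \<epsilon> * t"
      using limit_power_estimate[OF f F Fb \<epsilon>] by blast
    obtain d2 where d2: "d2 > 0" "\<And>t y. 0 \<le> t \<Longrightarrow> t \<le> d2 \<Longrightarrow> ((\<lambda>n. g n [^] nat \<lfloor>real n * t\<rfloor>) \<longlongrightarrow> y) F \<Longrightarrow>
      y \<in> fst e \<and> norm (snd e y - e0 - t *\<^sub>R (- \<zeta>)) \<le> \<epsilon> * t"
      using limit_power_estimate[OF g F Fb \<epsilon>] by blast
    have pos: "\<Phi> n t = f n [^] nat \<lfloor>real n * t\<rfloor>" if "t \<ge> 0" for n t
      using that by (simp add: \<Phi>_def int_pow_def2)
    have "\<phi> t \<in> fst e \<and> norm (snd e (\<phi> t) - e0 - t *\<^sub>R \<zeta>) \<le> \<epsilon> * \<bar>t\<bar>" if "\<bar>t\<bar> \<le> min d1 d2" for t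
    proof (cases "t \<ge> 0")
      case True
      then show ?thesis using d1(2)[OF True, of "\<phi> t"] that lim[of t] pos[OF True] by simp
    next
      case False
      then have t: "0 \<le> - t" "- t \<le> d2" using that by auto
      have "((\<lambda>n. inv (\<Phi> n (- t))) \<longlongrightarrow> inv (\<phi> (- t))) F" by (intro tendsto_ginv lim)
      then have "((\<lambda>n. g n [^] nat \<lfloor>real n * - t\<rfloor>) \<longlongrightarrow> \<phi> t) F"
        by (simp only: pos[OF t(1)] g_def nat_pow_inv[OF carrier_in] flip: \<phi>m) simp
      from d2(2)[OF t this] show ?thesis using False by simp
    qed
    then show ?thesis using d1(1) d2(1) by (intro exI[of _ "min d1 d2"]) auto
  qed
  have "((\<lambda>t. snd e (\<phi> t)) has_vector_derivative \<zeta>) (at 0)"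
    unfolding has_vector_derivative_def has_derivative_at_alt
  proof (intro conjI allI impI bounded_linear_scaleR_left)
    fix \<epsilon> :: real assume "0 < \<epsilon>"
    from est[OF this] show "\<exists>d>0. \<forall>y. norm (y - 0) < d \<longrightarrow>
        norm (snd e (\<phi> y) - snd e (\<phi> 0) - (y - 0) *\<^sub>R \<zeta>) \<le> \<epsilon> * norm (y - 0)"
      by (auto simp: \<phi>0 simp flip: e0_def)
  qed
  moreover have "continuous_on UNIV \<phi>"
  proof -
    have "((\<lambda>t. snd e (\<phi> t)) \<longlongrightarrow> e0) (at 0)"
      using calculation has_vector_derivative_continuous[of "\<lambda>t. snd e (\<phi> t)" \<zeta> 0 UNIV]
      by (simp add: isCont_def \<phi>0 flip: e0_def)
    from tendsto_ei[OF this e0_in]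
    have "((\<lambda>t. ei (snd e (\<phi> t))) \<longlongrightarrow> \<one>) (at 0)" by simp
    moreover have "\<forall>\<^sub>F t in at 0. ei (snd e (\<phi> t)) = \<phi> t"
    proof -
      obtain d where d: "d > 0" "\<And>t. \<bar>t\<bar> \<le> d \<Longrightarrow> \<phi> t \<in> fst e" using est[of 1] by auto
      show ?thesis unfolding eventually_at
        using d chart_e(5) by (intro exI[of _ d]) (auto simp: dist_real_def)
    qed
    ultimately have c0: "(\<phi> \<longlongrightarrow> \<one>) (at 0)" by (rule Lim_transform_eventually)
    have "isCont \<phi> t" for t
    proof -
      have "((\<lambda>h. \<phi> t \<otimes> \<phi> h) \<longlongrightarrow> \<phi> t \<otimes> \<one>) (at 0)"
        by (intro tendsto_gmult tendsto_const c0)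
      then have "((\<lambda>h. \<phi> (t + h)) \<longlongrightarrow> \<phi> t) (at 0)" by (simp add: hom r_one)
      then show ?thesis unfolding isCont_def by (simp add: LIM_offset_zero_iff[of t])
    qed
    then show ?thesis by (simp add: continuous_on_eq_continuous_at)
  qed
  ultimately have "one_param_subgroup G e \<zeta> \<phi>"
    unfolding one_param_subgroup_def using hom by blast
  moreover have "range \<phi> \<subseteq> K" using \<phi>(1) by auto
  ultimately show ?thesis unfolding lie_alg_def by blast
qed

text \<open>
  The product of two one-parameter subgroups is only a curve in \<open>K\<close>, with velocity the sum of the velocities;
  \<open>sequence_lie_alg\<close> replaces it by a one-parameter subgroup.
\<close>

lemma lie_alg_subspace:
  assumes K: "subgroup K G" "compact K"
  shows "subspace (lie_alg G e K)"
proof (rule subspaceI)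
  have "one_param_subgroup G e 0 (\<lambda>_. \<one>)"
    unfolding one_param_subgroup_def by (auto simp: r_one)
  moreover have "\<one> \<in> K" using subgroup.one_closed[OF K(1)] .
  ultimately show "0 \<in> lie_alg G e K" unfolding lie_alg_def by fastforce
next
  fix \<xi> \<eta> assume "\<xi> \<in> lie_alg G e K" "\<eta> \<in> lie_alg G e K"
  then obtain c d where c: "one_param_subgroup G e \<xi> c" "range c \<subseteq> K"
    and d: "one_param_subgroup G e \<eta> d" "range d \<subseteq> K" unfolding lie_alg_def by blast
  note c' = one_param_subgroupD[OF c(1)] and d' = one_param_subgroupD[OF d(1)]
  define f where "f n = c (inverse (real n)) \<otimes> d (inverse (real n))" for n
  have f1: "f \<longlonglongrightarrow> \<one>"
  proof -
    have "f \<longlonglongrightarrow> c 0 \<otimes> d 0"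
      unfolding f_def[abs_def]
      by (intro tendsto_gmult isCont_tendsto_compose[OF c'(2)] isCont_tendsto_compose[OF d'(2)] lim_inverse_n)
    then show ?thesis by (simp add: c' d' r_one)
  qed
  have cd0: "snd e (c 0) = e0" "snd e (d 0) = e0" by (simp_all add: c' d' e0_def)
  have "((\<lambda>t. (snd e (c t), snd e (d t))) has_derivative (\<lambda>t. (t *\<^sub>R \<xi>, t *\<^sub>R \<eta>))) (at 0)"
    using c'(4) d'(4) unfolding has_vector_derivative_def by (intro has_derivative_Pair)
  moreover have "(gm has_derivative dd gm (e0, e0)) (at (snd e (c 0), snd e (d 0)))"
    unfolding cd0 using holo_onD(2)[OF gm_holo gmO_right[OF e0_in]] .
  ultimately have "((\<lambda>t. gm (snd e (c t), snd e (d t))) has_derivative (\<lambda>t. dd gm (e0, e0) (t *\<^sub>R \<xi>, t *\<^sub>R \<eta>))) (at 0)"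
    using diff_chain_at[of "\<lambda>t. (snd e (c t), snd e (d t))" _ 0 gm] by (fastforce simp: o_def)
  moreover have "dd gm (e0, e0) (t *\<^sub>R \<xi>, t *\<^sub>R \<eta>) = t *\<^sub>R (\<xi> + \<eta>)" for t
  proof -
    have "dd gm (e0, e0) ((t *\<^sub>R \<xi>, 0) + (0, t *\<^sub>R \<eta>)) = dd gm (e0, e0) (t *\<^sub>R \<xi>, 0) + dd gm (e0, e0) (0, t *\<^sub>R \<eta>)"
      by (rule complex_linearD(1)[OF holo_onD(3)[OF gm_holo gmO_right[OF e0_in]]])
    then show ?thesis by (simp add: dd_gm_left[OF e0_in] dd_gm_right[OF e0_in] scaleR_add_right)
  qed
  ultimately have "((\<lambda>t. gm (snd e (c t), snd e (d t))) has_vector_derivative \<xi> + \<eta>) (at 0)"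
    by (simp add: has_vector_derivative_def)
  from vector_derivative_scaled_sequence[OF this]
  have lim: "(\<lambda>n. real n *\<^sub>R (gm (snd e (c (inverse (real n))), snd e (d (inverse (real n)))) - e0)) \<longlonglongrightarrow> \<xi> + \<eta>"
    by (simp add: cd0 e0_in)
  have ce: "\<forall>\<^sub>F n in sequentially. c (inverse (real n)) \<in> fst e" "\<forall>\<^sub>F n in sequentially. d (inverse (real n)) \<in> fst e"
    using topological_tendstoD[OF isCont_tendsto_compose[OF c'(2) lim_inverse_n] chart_e(1)]
      topological_tendstoD[OF isCont_tendsto_compose[OF d'(2) lim_inverse_n] chart_e(1)] one_e c'(1) d'(1) by auto
  show "\<xi> + \<eta> \<in> lie_alg G e K"
  proof (rule sequence_lie_alg[OF K, of f])
    show "f n \<in> K" for n unfolding f_def using c(2) d(2) subgroup.m_closed[OF K(1)] by blast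
    show "\<forall>\<^sub>F n in sequentially. f n \<in> fst e" using topological_tendstoD[OF f1 chart_e(1) one_e] .
    show "(\<lambda>n. real n *\<^sub>R (snd e (f n) - e0)) \<longlonglongrightarrow> \<xi> + \<eta>"
      by (rule Lim_transform_eventually[OF lim])
         (use ce in \<open>eventually_elim, simp add: gm_def f_def chart_e(5)\<close>)
  qed
next
  fix r \<xi> assume "\<xi> \<in> lie_alg G e K"
  then obtain c where c: "one_param_subgroup G e \<xi> c" "range c \<subseteq> K" unfolding lie_alg_def by blast
  have "one_param_subgroup G e (r *\<^sub>R \<xi>) (\<lambda>t. c (r * t))"
    unfolding one_param_subgroup_def
  proof (intro conjI allI)
    show "continuous_on UNIV (\<lambda>t. c (r * t))"
      using c(1) unfolding one_param_subgroup_def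
      by (auto intro!: continuous_on_compose2[of UNIV c] continuous_intros)
    show "c (r * (s + t)) = c (r * s) \<otimes> c (r * t)" for s t
      using one_param_subgroupD(3)[OF c(1)] by (simp add: distrib_left)
    have "((\<lambda>t. snd e (c t)) has_derivative (\<lambda>t. t *\<^sub>R \<xi>)) (at (r * 0))"
      using one_param_subgroupD(4)[OF c(1)] by (simp add: has_vector_derivative_def)
    moreover have "((\<lambda>t. r * t) has_derivative (\<lambda>t. r * t)) (at 0)" by (auto intro!: derivative_eq_intros)
    ultimately show "((\<lambda>t. snd e (c (r * t))) has_vector_derivative r *\<^sub>R \<xi>) (at 0)"
      using diff_chain_at[of "\<lambda>t. r * t" "\<lambda>t. r * t" 0 "\<lambda>t. snd e (c t)"]
      by (fastforce simp: o_def has_vector_derivative_def mult.commute)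
  qed
  then show "r *\<^sub>R \<xi> \<in> lie_alg G e K" unfolding lie_alg_def using c(2) by blast
qed

lemma curve_has_derivative_comp:
  assumes c: "one_param_subgroup G e \<xi> c" and h: "(h has_derivative L) (at e0)"
  shows "((\<lambda>t. h (snd e (c t))) has_vector_derivative L \<xi>) (at 0)"
proof -
  have "(h has_derivative L) (at (snd e (c 0)))" using h one_param_subgroupD(1)[OF c] by (simp flip: e0_def)
  from diff_chain_at[OF one_param_subgroupD(4)[OF c, unfolded has_vector_derivative_def] this]
  show ?thesis using linear_scale[OF has_derivative_linear[OF h]] by (simp add: o_def has_vector_derivative_def)
qed

lemma curve_eventually_chart:
  assumes c: "one_param_subgroup G e \<xi> c"
  shows "\<exists>V. open V \<and> 0 \<in> V \<and> c ` V \<subseteq> fst e"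
proof -
  have "continuous_on UNIV c" using c unfolding one_param_subgroup_def by blast
  from continuous_open_preimage[OF this open_UNIV chart_e(1)]
  show ?thesis using one_param_subgroupD(1)[OF c] one_e by (intro exI[of _ "c -` fst e"]) auto
qed

lemma Ad_lie_alg:
  assumes K: "subgroup K G" and k: "k \<in> K" and \<xi>: "\<xi> \<in> lie_alg G e K"
  shows "Ad k \<xi> \<in> lie_alg G e K"
proof -
  obtain c where c: "one_param_subgroup G e \<xi> c" "range c \<subseteq> K" using \<xi> unfolding lie_alg_def by blast
  let ?d = "\<lambda>t. k \<otimes> c t \<otimes> inv k"
  have "one_param_subgroup G e (Ad k \<xi>) ?d"
    unfolding one_param_subgroup_def
  proof (intro conjI allI)
    show "continuous_on UNIV ?d"
      using c(1) unfolding one_param_subgroup_def by (intro continuous_on_gmult continuous_on_const) auto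
    show "?d (s + t) = ?d s \<otimes> ?d t" for s t
      using one_param_subgroupD(3)[OF c(1)] by (simp add: m_assoc inv_solve_left)
    obtain V where V: "open V" "0 \<in> V" "c ` V \<subseteq> fst e" using curve_eventually_chart[OF c(1)] by blast
    show "((\<lambda>t. snd e (?d t)) has_vector_derivative Ad k \<xi>) (at 0)"
      using curve_has_derivative_comp[OF c(1) gc_has_derivative[of k]]
      unfolding has_vector_derivative_def
      by (subst (asm) has_derivative_cong_open[OF V(1,2), where g = "\<lambda>t. snd e (?d t)"])
         (use V(3) chart_e(5) in \<open>auto simp: gc_def image_subset_iff\<close>)
  qed
  moreover have "range ?d \<subseteq> K"
    using c(2) k subgroup.m_closed[OF K] subgroup.m_inv_closed[OF K] by blast
  ultimately show ?thesis unfolding lie_alg_def by blast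
qed

text \<open>The bracket is the derivative of \<open>t \<mapsto> Ad (c t) \<eta>\<close>, a curve in the closed subspace \<open>lie_alg G e K\<close>.\<close>

lemma br_lie_alg:
  assumes K: "subgroup K G" "compact K" and "\<xi> \<in> lie_alg G e K" "\<eta> \<in> lie_alg G e K"
  shows "br \<xi> \<eta> \<in> lie_alg G e K"
proof -
  obtain c where c: "one_param_subgroup G e \<xi> c" "range c \<subseteq> K" using assms(3) unfolding lie_alg_def by blast
  obtain V where V: "open V" "0 \<in> V" "c ` V \<subseteq> fst e" using curve_eventually_chart[OF c(1)] by blast
  have "((\<lambda>t. Ad (ei (snd e (c t))) \<eta>) has_derivative (\<lambda>t. t *\<^sub>R br \<xi> \<eta>)) (at 0)"
    using curve_has_derivative_comp[OF c(1) Ad_ei_has_derivative[of \<eta>]] unfolding has_vector_derivative_def .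
  from dd_in_subspace[OF fd this lie_alg_subspace[OF K] V(1,2), of 1]
  show ?thesis using V(3) chart_e(5) c(2) Ad_lie_alg[OF K(1) _ assms(4)] by (auto simp: image_subset_iff)
qed

end

section \<open>The curvature of the Chern connection has type (1,1)\<close>

context lie_group_chart
begin

definition gsmooth :: "'v::real_normed_vector set \<Rightarrow> ('v \<Rightarrow> 'g) \<Rightarrow> bool" where
  "gsmooth U a \<longleftrightarrow> (\<forall>d\<in>AG. open (U \<inter> a -` fst d) \<and> smooth_on (U \<inter> a -` fst d) (\<lambda>p. snd d (a p)))"

text \<open>
  The map \<open>(x, y) \<mapsto> x\<^sup>-\<^sup>1 y\<close>, with arguments in an arbitrary chart \<open>d\<close> and value in the chart \<open>e\<close> at the unit. Its
  derivative in the second argument along the diagonal is the Maurer--Cartan form in the chart \<open>d\<close>.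
\<close>

definition gk :: "('g, 'l) chart \<Rightarrow> 'l \<times> 'l \<Rightarrow> 'l" where
  "gk d w = snd e (inv (chart_inv d (fst w)) \<otimes> chart_inv d (snd w))"

definition gkO :: "('g, 'l) chart \<Rightarrow> ('l \<times> 'l) set" where
  "gkO d = (snd d ` fst d \<times> snd d ` fst d) \<inter>
    (\<lambda>w. inv (chart_inv d (fst w)) \<otimes> chart_inv d (snd w)) -` fst e"

lemma gk:
  assumes "d \<in> AG"
  shows "open (gkO d)" "holo_on (gkO d) (gk d)" "holo_on (gkO d) (\<lambda>w. dd (gk d) w v)"
proof -
  have "gholo (snd d ` fst d \<times> snd d ` fst d)
      (\<lambda>w. inv (chart_inv d (fst w)) \<otimes> chart_inv d (snd w))"
    by (intro gholo_mult gholo_inv gholo_fst gholo_snd gholo_chart_inv assms chart_facts(2)[OF mfd assms])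
  from gholo_chart[OF this e] show "open (gkO d)" "holo_on (gkO d) (gk d)" "holo_on (gkO d) (\<lambda>w. dd (gk d) w v)"
    unfolding gkO_def gk_def[abs_def] by auto
qed

lemma gk_diag:
  assumes "d \<in> AG" "x \<in> snd d ` fst d"
  shows "gk d (x, x) = e0" "(x, x) \<in> gkO d"
  using assms one_e by (auto simp: gk_def gkO_def l_inv simp flip: e0_def)

lemma gk_cocycle:
  assumes "(x, x0) \<in> gkO d" "(x0, z) \<in> gkO d" "(x, z) \<in> gkO d"
  shows "gk d (x, z) = gm (gk d (x, x0), gk d (x0, z))"
proof -
  have "ei (gk d (x, x0)) = inv (chart_inv d x) \<otimes> chart_inv d x0"
    "ei (gk d (x0, z)) = inv (chart_inv d x0) \<otimes> chart_inv d z"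
    using assms by (auto simp: gkO_def gk_def chart_e(5))
  moreover have "x \<otimes> y \<otimes> (inv y \<otimes> z) = x \<otimes> z" for x y z
    using m_assoc[of y "inv y" z] by (simp add: m_assoc[of x] r_inv l_one)
  ultimately show ?thesis by (simp add: gm_def gk_def)
qed

lemma dd_pair_slices:
  fixes f :: "'a::real_normed_vector \<times> 'b::real_normed_vector \<Rightarrow> 'c::real_normed_vector"
  assumes "f differentiable (at (x, y))"
  shows "((\<lambda>x. f (x, y)) has_derivative (\<lambda>u. dd f (x, y) (u, 0))) (at x)"
    "((\<lambda>y. f (x, y)) has_derivative (\<lambda>v. dd f (x, y) (0, v))) (at y)"
    "dd f (x, y) (u, v) = dd f (x, y) (u, 0) + dd f (x, y) (0, v)"
proof -
  have "((\<lambda>x. (x, y)) has_derivative (\<lambda>u. (u, 0))) (at x)" by (auto intro!: derivative_eq_intros)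
  from diff_chain_at[OF this has_derivative_dd[OF assms]]
  show "((\<lambda>x. f (x, y)) has_derivative (\<lambda>u. dd f (x, y) (u, 0))) (at x)" by (simp add: o_def)
  have "((\<lambda>y. (x, y)) has_derivative (\<lambda>u. (0, u))) (at y)" by (auto intro!: derivative_eq_intros)
  from diff_chain_at[OF this has_derivative_dd[OF assms]]
  show "((\<lambda>y. f (x, y)) has_derivative (\<lambda>v. dd f (x, y) (0, v))) (at y)" by (simp add: o_def)
  show "dd f (x, y) (u, v) = dd f (x, y) (u, 0) + dd f (x, y) (0, v)"
    using linear_add[OF linear_dd[OF assms], of "(u, 0)" "(0, v)"] by simp
qed

lemma gk_first_derivatives:
  assumes d: "d \<in> AG" and x: "x \<in> snd d ` fst d"
  shows "dd (gk d) (x, x) (u, 0) = - dd (gk d) (x, x) (0, u)"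
proof -
  note D = holo_onD(1)[OF gk(2)[OF d] gk_diag(2)[OF d x]]
  have "((\<lambda>x. (x, x)) has_derivative (\<lambda>u. (u, u))) (at x)" by (auto intro!: derivative_eq_intros)
  from diff_chain_at[OF this has_derivative_dd[OF D]]
  have "((\<lambda>x. gk d (x, x)) has_derivative (\<lambda>u. dd (gk d) (x, x) (u, u))) (at x)" by (simp add: o_def)
  then have "((\<lambda>x. e0) has_derivative (\<lambda>u. dd (gk d) (x, x) (u, u))) (at x)"
    using has_derivative_cong_open[OF chart_facts(2)[OF mfd d] x gk_diag(1)[OF d]] by auto
  from has_derivative_unique[OF this has_derivative_const]
  have "dd (gk d) (x, x) (u, u) = 0" by metis
  then show ?thesis using dd_pair_slices(3)[OF D, of u u] by (simp add: add_eq_0_iff2)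
qed

text \<open>
  Differentiating the cocycle identity \<open>x\<^sup>-\<^sup>1 z = (x\<^sup>-\<^sup>1 x\<^sub>0) (x\<^sub>0\<^sup>-\<^sup>1 z)\<close> in \<open>z\<close> and \<open>x\<close> at \<open>x\<^sub>0\<close> reduces the mixed derivative
  in any chart to that of the multiplication at the unit.
\<close>

lemma gk_mixed_derivative:
  assumes d: "d \<in> AG" and x0: "x0 \<in> snd d ` fst d"
  defines "l \<equiv> (\<lambda>u. dd (gk d) (x0, x0) (0, u))"
  shows "dd (\<lambda>w. dd (gk d) w (0, b)) (x0, x0) (a, 0) = - gmB (l a) (l b)"
proof -
  let ?O = "gkO d"
  note O = gk[OF d] and diag = gk_diag[OF d x0]
  define W where "W = {x. (x, x0) \<in> ?O}"
  have W: "open W" "x0 \<in> W"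
    using open_vimage[OF O(1), of "\<lambda>x. (x, x0)"] diag by (auto simp: W_def vimage_def continuous_on_Pair)
  have key: "dd (gk d) (x, x0) (0, b) = dd gm (gk d (x, x0), e0) (0, l b)" if x: "x \<in> W" for x
  proof -
    have xO: "(x, x0) \<in> ?O" using x by (simp add: W_def)
    define V where "V = {z. (x0, z) \<in> ?O} \<inter> {z. (x, z) \<in> ?O}"
    have V: "open V" "x0 \<in> V"
      using open_vimage[OF O(1), of "\<lambda>z. (x0, z)"] open_vimage[OF O(1), of "\<lambda>z. (x, z)"] diag xO
      by (auto simp: V_def vimage_def continuous_on_Pair)
    have inE: "gk d (x, x0) \<in> E" using xO by (auto simp: gkO_def gk_def)
    have "((\<lambda>z. (gk d (x, x0), gk d (x0, z))) has_derivative (\<lambda>v. (0, l v))) (at x0)"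
      using dd_pair_slices(2)[OF holo_onD(1)[OF O(2) diag(2)]] unfolding l_def
      by (intro has_derivative_Pair has_derivative_const)
    moreover have "(gm has_derivative dd gm (gk d (x, x0), e0)) (at (gk d (x, x0), gk d (x0, x0)))"
      unfolding diag(1) using holo_onD(2)[OF gm_holo gmO_right[OF inE]] .
    ultimately have "((\<lambda>z. gm (gk d (x, x0), gk d (x0, z))) has_derivative (\<lambda>v. dd gm (gk d (x, x0), e0) (0, l v))) (at x0)"
      using diff_chain_at[of "\<lambda>z. (gk d (x, x0), gk d (x0, z))" "\<lambda>v. (0, l v)" x0 gm] by (simp add: o_def)
    then have "((\<lambda>z. gk d (x, z)) has_derivative (\<lambda>v. dd gm (gk d (x, x0), e0) (0, l v))) (at x0)"
      by (subst has_derivative_cong_open[OF V gk_cocycle[OF xO]]) (auto simp: V_def)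
    from fun_cong[OF has_derivative_unique[OF this dd_pair_slices(2)[OF holo_onD(1)[OF O(2) xO]]], of b]
    show ?thesis by simp
  qed
  have lhs: "((\<lambda>x. dd (gk d) (x, x0) (0, b)) has_derivative
      (\<lambda>a. dd (\<lambda>w. dd (gk d) w (0, b)) (x0, x0) (a, 0))) (at x0)"
    by (rule dd_pair_slices(1)[OF holo_onD(1)[OF O(3) diag(2)]])
  have "((\<lambda>x. (gk d (x, x0), e0)) has_derivative (\<lambda>a. (- l a, 0))) (at x0)"
    using dd_pair_slices(1)[OF holo_onD(1)[OF O(2) diag(2)]] gk_first_derivatives[OF d x0] unfolding l_def
    by (intro has_derivative_Pair has_derivative_const) simp
  moreover have "((\<lambda>w. dd gm w (0, l b)) has_derivative dd (\<lambda>w. dd gm w (0, l b)) (e0, e0)) (at (gk d (x0, x0), e0))"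
    unfolding diag(1) using holo_onD(2)[OF gm_dd_holo gmO_right[OF e0_in]] .
  ultimately have "((\<lambda>x. dd gm (gk d (x, x0), e0) (0, l b)) has_derivative (\<lambda>a. gmB (- l a) (l b))) (at x0)"
    using diff_chain_at[of "\<lambda>x. (gk d (x, x0), e0)" "\<lambda>a. (- l a, 0)" x0 "\<lambda>w. dd gm w (0, l b)"]
    by (simp add: o_def gmB_def)
  then have "((\<lambda>x. dd (gk d) (x, x0) (0, b)) has_derivative (\<lambda>a. gmB (- l a) (l b))) (at x0)"
    by (subst has_derivative_cong_open[OF W key]) auto
  from fun_cong[OF has_derivative_unique[OF this lhs], of a]
  show ?thesis using complex_linearD(4)[OF gmB_complex_linear(1)] by simp
qed

abbreviation "mc \<equiv> log_deriv G e"

lemma mc_local: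
  assumes a: "gsmooth U a" and d: "d \<in> AG" and q: "q \<in> U" "a q \<in> fst d"
  shows "((\<lambda>q'. snd e (inv (a q) \<otimes> a q')) has_derivative
      (\<lambda>v. dd (gk d) (snd d (a q), snd d (a q)) (0, dd (\<lambda>p. snd d (a p)) q v))) (at q)"
    "mc a q v = dd (gk d) (snd d (a q), snd d (a q)) (0, dd (\<lambda>p. snd d (a p)) q v)"
proof -
  let ?x = "\<lambda>p. snd d (a p)" and ?U = "U \<inter> a -` fst d"
  note cd = chart_facts[OF mfd d]
  have U: "open ?U" "smooth_on ?U ?x" "q \<in> ?U" using a d q unfolding gsmooth_def by auto
  have xq: "?x q \<in> snd d ` fst d" using q by simp
  have "((\<lambda>q'. (?x q, ?x q')) has_derivative (\<lambda>v. (0, dd ?x q v))) (at q)"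
    using has_derivative_dd[OF smooth_on_differentiable[OF U(2,3)]]
    by (intro has_derivative_Pair has_derivative_const)
  moreover have "(gk d has_derivative dd (gk d) (?x q, ?x q)) (at (?x q, ?x q))"
    using holo_onD(2)[OF gk(2)[OF d] gk_diag(2)[OF d xq]] .
  ultimately have "((\<lambda>q'. gk d (?x q, ?x q')) has_derivative (\<lambda>v. dd (gk d) (?x q, ?x q) (0, dd ?x q v))) (at q)"
    using diff_chain_at[of "\<lambda>q'. (?x q, ?x q')" "\<lambda>v. (0, dd ?x q v)" q "gk d"] by (simp add: o_def)
  then show der: "((\<lambda>q'. snd e (inv (a q) \<otimes> a q')) has_derivative
      (\<lambda>v. dd (gk d) (?x q, ?x q) (0, dd ?x q v))) (at q)"
    by (subst has_derivative_cong_open[OF U(1,3)]) (use q in \<open>auto simp: gk_def cd(5)\<close>)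
  show "mc a q v = dd (gk d) (?x q, ?x q) (0, dd ?x q v)"
    unfolding log_deriv_def by (rule dd_eq[OF der])
qed

text \<open>
  In \<open>d\<mu>(u, v)\<close> all second derivatives of \<open>a\<close> and of the map \<open>x\<^sup>-\<^sup>1 y\<close> in its second argument are symmetric; what
  remains is the mixed derivative of \<open>x\<^sup>-\<^sup>1 y\<close>, antisymmetrised, which is the bracket by \<open>bracket_eq\<close>.
\<close>

theorem maurer_cartan:
  assumes a: "gsmooth U a" and p: "p \<in> U"
  shows "(\<lambda>q. mc a q v) differentiable (at p)"
    "dd (\<lambda>q. mc a q v) p u - dd (\<lambda>q. mc a q u) p v = - br (mc a p u) (mc a p v)"
proof -
  obtain d where d: "d \<in> AG" "a p \<in> fst d" using chart_cover[OF mfd] .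
  let ?x = "\<lambda>p. snd d (a p)" and ?U = "U \<inter> a -` fst d"
  have U: "open ?U" "smooth_on ?U ?x" "p \<in> ?U" using a d p unfolding gsmooth_def by auto
  have xp: "?x p \<in> snd d ` fst d" using d by simp
  note O = gk[OF d(1)] and diag = gk_diag[OF d(1) xp]
  define D where "D b a = dd (\<lambda>w. dd (gk d) w (0, b)) (?x p, ?x p) a" for b a
  have x: "(?x has_derivative dd ?x q) (at q)" if "q \<in> ?U" for q
    using has_derivative_dd[OF smooth_on_differentiable[OF U(2) that]] .
  have x2: "(\<lambda>q. dd ?x q v) differentiable (at p)" for v
    using smooth_on_differentiable[OF smooth_on_dd[OF U(2)] U(3)] .
  have der: "((\<lambda>q. mc a q v) has_derivative
      (\<lambda>u. D (dd ?x p v) (dd ?x p u, dd ?x p u) + dd (gk d) (?x p, ?x p) (0, dd (\<lambda>q. dd ?x q v) p u))) (at p)" for v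
  proof -
    have "((\<lambda>q. dd (gk d) (?x q, ?x q) (0, dd ?x q v)) has_derivative
      (\<lambda>u. dd (\<lambda>w. dd (gk d) w (0, dd ?x p v)) (?x p, ?x p) (dd ?x p u, dd ?x p u)
        + dd (gk d) (?x p, ?x p) (0, dd (\<lambda>q. dd ?x q v) p u))) (at p)"
    proof (rule has_derivative_parametrised_linear[OF fd O(1), where x = "\<lambda>q. (?x q, ?x q)" and G = "\<lambda>w \<eta>. dd (gk d) w (0, \<eta>)"])
      show "(?x p, ?x p) \<in> gkO d" by (rule diag(2))
      show "linear (\<lambda>\<eta>. dd (gk d) q (0, \<eta>))" if "q \<in> gkO d" for q
        using linear_compose[of "\<lambda>v. (0, v)" "dd (gk d) q"] linear_dd[OF holo_onD(1)[OF O(2) that]]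
        by (simp add: o_def linear_iff)
      show "(\<lambda>q. dd (gk d) q (0, w)) differentiable (at (?x p, ?x p))" for w
        by (rule holo_onD(1)[OF O(3) diag(2)])
      show "((\<lambda>q. (?x q, ?x q)) has_derivative (\<lambda>u. (dd ?x p u, dd ?x p u))) (at p)"
        by (intro has_derivative_Pair x U(3))
      show "((\<lambda>q. dd ?x q v) has_derivative dd (\<lambda>q. dd ?x q v) p) (at p)"
        by (rule has_derivative_dd[OF x2])
    qed
    then show ?thesis unfolding D_def
      by (subst has_derivative_cong_open[OF U(1,3)]) (use mc_local(2)[OF a d(1)] in auto)
  qed
  from der[of v] show "(\<lambda>q. mc a q v) differentiable (at p)" unfolding differentiable_def by blast
  have sym: "D b (0, c) = D c (0, b)" for b c
    unfolding D_def
    by (rule symmetric_mixed_derivatives[OF O(1) diag(2)])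
       (auto intro: holo_onD(1)[OF O(2)] holo_onD(1)[OF O(3) diag(2)])
  have split: "D b (c, c) = - gmB (dd (gk d) (?x p, ?x p) (0, c)) (dd (gk d) (?x p, ?x p) (0, b)) + D b (0, c)" for b c
    unfolding D_def dd_pair_slices(3)[OF holo_onD(1)[OF O(3) diag(2)], of _ c c]
    using gk_mixed_derivative[OF d(1) xp] by simp
  have symx: "dd (\<lambda>q. dd ?x q v) p u = dd (\<lambda>q. dd ?x q u) p v"
    by (rule symmetric_mixed_derivatives[OF U(1,3)])
       (auto intro: smooth_on_differentiable[OF U(2)] x2)
  show "dd (\<lambda>q. mc a q v) p u - dd (\<lambda>q. mc a q u) p v = - br (mc a p u) (mc a p v)"
    by (simp add: dd_eq[OF der] split sym[of "dd ?x p v"] symx bracket_eq mc_local(2)[OF a d(1) p d(2)])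
qed

text \<open>Inversion has derivative \<open>-1\<close> at the unit, so the Maurer--Cartan form of \<open>a\<^sup>-\<^sup>1\<close> is \<open>- Ad(a) (a\<^sup>-\<^sup>1 da)\<close>.\<close>

lemma gauge_inverse:
  assumes a: "gsmooth U a" and p: "p \<in> U" and b: "\<And>q. q \<in> U \<Longrightarrow> b q = inv (a q)" and U: "open U"
  shows "gauge G e \<alpha> b p u = Ad (a p) (\<alpha> p u - mc a p u)"
proof -
  obtain d where d: "d \<in> AG" "a p \<in> fst d" using chart_cover[OF mfd] .
  let ?Y = "\<lambda>q. snd e (inv (a p) \<otimes> a q)"
  have xp: "snd d (a p) \<in> snd d ` fst d" using d by simp
  have Y: "(?Y has_derivative (\<lambda>v. mc a p v)) (at p)"
    using mc_local(1)[OF a d(1) p d(2)] by (simp add: mc_local(2)[OF a d(1) p d(2)])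
  let ?U = "U \<inter> a -` fst d"
  have oU: "open ?U" and sU: "smooth_on ?U (\<lambda>p. snd d (a p))" using a d unfolding gsmooth_def by auto
  have "continuous_on ?U (\<lambda>q. (snd d (a p), snd d (a q)))"
    using differentiable_imp_continuous_on[OF differentiable_at_imp_differentiable_on[OF smooth_on_differentiable[OF sU]]]
    by (intro continuous_intros) auto
  from continuous_open_preimage[OF this oU gk(1)[OF d(1)]]
  have V: "open (?U \<inter> (\<lambda>q. (snd d (a p), snd d (a q))) -` gkO d)" (is "open ?V") .
  have pV: "p \<in> ?V" using p d gk_diag(2)[OF d(1) xp] by auto
  have Ye: "inv (a p) \<otimes> a q \<in> fst e" if "q \<in> ?V" for q
  proof -
    have "chart_inv d (snd d (a p)) = a p" "chart_inv d (snd d (a q)) = a q"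
      using that d(2) by (auto intro: chart_facts(5)[OF mfd d(1)])
    then show ?thesis using that by (simp add: gkO_def)
  qed
  have Yp: "?Y p = e0" by (simp add: l_inv flip: e0_def)
  let ?i = "\<lambda>y. snd e (inv (ei y))"
  have i0: "?i e0 = e0" by (simp flip: e0_def)
  have "((\<lambda>q. ?i (?Y q)) has_derivative (\<lambda>v. - mc a p v)) (at p)"
    using diff_chain_at[OF Y, of ?i "\<lambda>h. - h"] ginv_has_derivative unfolding Yp by (simp add: o_def)
  moreover have "(gc (a p) has_derivative Ad (a p)) (at (?i (?Y p)))" unfolding Yp i0 by (rule gc_has_derivative)
  ultimately have D: "((\<lambda>q. gc (a p) (?i (?Y q))) has_derivative (\<lambda>v. Ad (a p) (- mc a p v))) (at p)"
    using diff_chain_at[of "\<lambda>q. ?i (?Y q)" "\<lambda>v. - mc a p v" p "gc (a p)" "Ad (a p)"] by (simp add: o_def)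
  have inve: "\<exists>W. open W \<and> p \<in> W \<and> W \<subseteq> ?V \<and> (\<forall>q\<in>W. inv (inv (a p) \<otimes> a q) \<in> fst e)"
  proof -
    have "continuous_on ?V (\<lambda>q. chart_inv d (snd d (a q)))"
    proof (rule continuous_on_compose2[OF chart_facts(4)[OF mfd d(1)]])
      have "continuous_on ?U (\<lambda>q. snd d (a q))"
        by (rule differentiable_imp_continuous_on[OF differentiable_at_imp_differentiable_on[OF smooth_on_differentiable[OF sU]]])
      then show "continuous_on ?V (\<lambda>q. snd d (a q))"
        by (rule continuous_on_subset) auto
    qed auto
    then have "continuous_on ?V a"
      by (rule continuous_on_eq) (auto simp: chart_facts(5)[OF mfd d(1)])
    then have "continuous_on ?V (\<lambda>q. inv (inv (a p) \<otimes> a q))"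
      by (intro continuous_on_ginv continuous_on_gmult continuous_on_const)
    from continuous_open_preimage[OF this V chart_e(1)]
    show ?thesis using pV one_e
      by (intro exI[of _ "?V \<inter> (\<lambda>q. inv (inv (a p) \<otimes> a q)) -` fst e"]) (auto simp: l_inv)
  qed
  then obtain W where W: "open W" "p \<in> W" "W \<subseteq> ?V" "\<And>q. q \<in> W \<Longrightarrow> inv (inv (a p) \<otimes> a q) \<in> fst e"
    by blast
  have eq: "gc (a p) (?i (?Y q)) = snd e (inv (b p) \<otimes> b q)" if q: "q \<in> W" for q
  proof -
    have qV: "q \<in> ?V" using q W(3) by blast
    have "ei (?i (?Y q)) = inv (inv (a p) \<otimes> a q)"
      using Ye[OF qV] W(4)[OF q] by (simp add: chart_e(5))
    moreover have "b q = inv (a q)" "b p = inv (a p)" using b p qV by auto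
    ultimately show ?thesis
      by (simp add: gc_def inv_mult_group m_assoc r_inv r_one)
  qed
  have "((\<lambda>q. snd e (inv (b p) \<otimes> b q)) has_derivative (\<lambda>v. Ad (a p) (- mc a p v))) (at p)"
    by (rule has_derivative_transform_within_open[OF D W(1,2) eq])
  from dd_eq[OF this] have "mc b p u = Ad (a p) (- mc a p u)" unfolding log_deriv_def .
  then show ?thesis
    using p b complex_linearD[OF Ad_complex_linear] by (simp add: gauge_def)
qed

text \<open>
  If the gauge transform of \<open>\<alpha>\<close> has type (1,0), then \<open>\<alpha> = \<beta> + a\<^sup>-\<^sup>1 da\<close> with \<open>\<beta>\<close> of type (1,0). The flat part \<open>a\<^sup>-\<^sup>1 da\<close>
  contributes nothing to the curvature, and every other term has a factor \<open>\<beta>\<close> or \<open>d\<beta>\<close> with one complex-linear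
  argument. The expression in the conclusion is four times the (0,2)-part of \<open>F\<close>.
\<close>

lemma curvature_02:
  fixes \<alpha> :: "'v::complex_normed_vector \<Rightarrow> 'v \<Rightarrow> 'l"
  assumes a: "gsmooth U a" and p: "p \<in> U" and b: "\<And>q. q \<in> U \<Longrightarrow> b q = inv (a q)" and U: "open U"
    and \<alpha>: "\<And>u. (\<lambda>q. \<alpha> q u) differentiable (at p)" "\<And>q. q \<in> U \<Longrightarrow> linear (\<alpha> q)"
    and type: "\<And>q. q \<in> U \<Longrightarrow> complex_linear (gauge G e \<alpha> b q)"
  defines "F \<equiv> conn_curvature G e \<alpha> p"
  shows "F u v - F (scaleC \<i> u) (scaleC \<i> v) + scaleC \<i> (F (scaleC \<i> u) v + F u (scaleC \<i> v)) = 0"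
proof -
  define \<beta> where "\<beta> q u = \<alpha> q u - mc a q u" for q u
  have \<beta>lin: "complex_linear (\<beta> q)" if q: "q \<in> U" for q
  proof -
    have "gauge G e \<alpha> b q = (\<lambda>u. Ad (a q) (\<beta> q u))"
      using gauge_inverse[OF a q b U, of \<alpha>] by (auto simp: \<beta>_def)
    then have "complex_linear (\<lambda>u. Ad (a q) (\<beta> q u))" using type[OF q] by simp
    from complex_linear_comp[OF Ad_complex_linear this]
    have "complex_linear (\<lambda>u. Ad (inv (a q)) (Ad (a q) (\<beta> q u)))" .
    then show ?thesis by (simp add: l_inv flip: Ad_mult)
  qed
  note mc = maurer_cartan[OF a p]
  have \<beta>d: "(\<lambda>q. \<beta> q u) differentiable (at p)" for u
    unfolding \<beta>_def using \<alpha>(1) mc(1) by simp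
  have \<beta>dd: "dd (\<lambda>q. \<beta> q u) p v = dd (\<lambda>q. \<alpha> q u) p v - dd (\<lambda>q. mc a q u) p v" for u v
    unfolding \<beta>_def using \<alpha>(1) mc(1) by (rule dd_diff)
  have \<beta>i: "dd (\<lambda>q. \<beta> q (scaleC \<i> u)) p v = scaleC \<i> (dd (\<lambda>q. \<beta> q u) p v)" for u v
  proof -
    have "dd (\<lambda>q. \<beta> q (scaleC \<i> u)) p = dd (\<lambda>q. scaleC \<i> (\<beta> q u)) p"
      by (rule dd_cong_open[OF U p]) (rule complex_linearD(2)[OF \<beta>lin])
    then show ?thesis by (simp add: dd_bounded_linear[OF bounded_linear_scaleC \<beta>d])
  qed
  have \<beta>il: "\<beta> p (scaleC \<i> u) = scaleC \<i> (\<beta> p u)" for u by (rule complex_linearD(2)[OF \<beta>lin[OF p]])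
  note bl = complex_linearD[OF br_complex_linear(1)] and br = complex_linearD[OF br_complex_linear(2)]
  have F: "F u v = dd (\<lambda>q. \<beta> q v) p u - dd (\<lambda>q. \<beta> q u) p v
      + br (\<beta> p u) (\<beta> p v) + br (\<beta> p u) (mc a p v) + br (mc a p u) (\<beta> p v)" for u v
  proof -
    have "\<alpha> p u = \<beta> p u + mc a p u" "\<alpha> p v = \<beta> p v + mc a p v" by (simp_all add: \<beta>_def)
    then show ?thesis
      using mc(2)[of v u] by (simp add: F_def conn_curvature_def \<beta>dd bl(1) br(1) algebra_simps)
  qed
  show ?thesis
    unfolding F \<beta>i \<beta>il bl(2) br(2)
    by (simp add: scaleC_add_right scaleC_diff_right scaleC_minus_right)
qed

end

section \<open>Two-forms wedged with powers of the fundamental form\<close>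

definition alternation :: "nat \<Rightarrow> ((nat \<Rightarrow> 'v) \<Rightarrow> 'w::real_vector) \<Rightarrow> (nat \<Rightarrow> 'v) \<Rightarrow> 'w" where
  "alternation N f v = (\<Sum>\<pi> | \<pi> permutes {..<N}. of_int (sign \<pi>) *\<^sub>R f (\<lambda>i. v (\<pi> i)))"

lemma permutation_lessThan: "\<pi> permutes {..<(N::nat)} \<Longrightarrow> permutation \<pi>"
  unfolding permutation_permutes using finite_lessThan by blast

lemma alternation_permute:
  assumes t: "\<tau> permutes {..<N}"
  shows "alternation N f (\<lambda>i. v (\<tau> i)) = of_int (sign \<tau>) *\<^sub>R alternation N f v"
proof -
  have p: "permutation \<tau>" using permutation_lessThan[OF t] .
  have "alternation N f v = (\<Sum>\<pi> | \<pi> permutes {..<N}. of_int (sign (\<tau> \<circ> \<pi>)) *\<^sub>R f (\<lambda>i. v ((\<tau> \<circ> \<pi>) i)))"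
    unfolding alternation_def by (rule setum_permutations_compose_left[OF t, of "\<lambda>\<pi>. of_int (sign \<pi>) *\<^sub>R f (\<lambda>i. v (\<pi> i))"])
  also have "\<dots> = (\<Sum>\<pi> | \<pi> permutes {..<N}. of_int (sign \<tau>) *\<^sub>R (of_int (sign \<pi>) *\<^sub>R f (\<lambda>i. v (\<tau> (\<pi> i)))))"
    by (rule sum.cong) (auto simp: sign_compose[OF p] permutation_lessThan)
  also have "\<dots> = of_int (sign \<tau>) *\<^sub>R alternation N f (\<lambda>i. v (\<tau> i))"
    by (simp add: alternation_def scaleR_sum_right)
  finally have "of_int (sign \<tau>) *\<^sub>R alternation N f v
      = of_int (sign \<tau> * sign \<tau>) *\<^sub>R alternation N f (\<lambda>i. v (\<tau> i))"
    by (simp only: scaleR_scaleR of_int_mult)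
  then show ?thesis by (simp only: sign_idempotent of_int_1 scaleR_one)
qed

lemma alternation_precompose:
  assumes r: "\<rho> permutes {..<N}"
  shows "alternation N (\<lambda>v. f (\<lambda>i. v (\<rho> i))) v = of_int (sign \<rho>) *\<^sub>R alternation N f v"
proof -
  have p: "permutation \<rho>" using permutation_lessThan[OF r] .
  have "alternation N f v = (\<Sum>\<pi> | \<pi> permutes {..<N}. of_int (sign (\<pi> \<circ> \<rho>)) *\<^sub>R f (\<lambda>i. v ((\<pi> \<circ> \<rho>) i)))"
    unfolding alternation_def by (rule sum_permutations_compose_right[OF r, of "\<lambda>\<pi>. of_int (sign \<pi>) *\<^sub>R f (\<lambda>i. v (\<pi> i))"])
  also have "\<dots> = (\<Sum>\<pi> | \<pi> permutes {..<N}. of_int (sign \<rho>) *\<^sub>R (of_int (sign \<pi>) *\<^sub>R f (\<lambda>i. v (\<pi> (\<rho> i)))))"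
    by (rule sum.cong) (auto simp: sign_compose[OF _ p] permutation_lessThan mult.commute)
  also have "\<dots> = of_int (sign \<rho>) *\<^sub>R alternation N (\<lambda>v. f (\<lambda>i. v (\<rho> i))) v"
    by (simp add: alternation_def scaleR_sum_right)
  finally have "of_int (sign \<rho>) *\<^sub>R alternation N f v
      = of_int (sign \<rho> * sign \<rho>) *\<^sub>R alternation N (\<lambda>v. f (\<lambda>i. v (\<rho> i))) v"
    by (simp only: scaleR_scaleR of_int_mult)
  then show ?thesis by (simp only: sign_idempotent of_int_1 scaleR_one)
qed

lemma alternation_repeated:
  assumes "i < N" "j < N" "i \<noteq> j" "v i = v j"
  shows "alternation N f v = 0"
proof -
  have t: "Transposition.transpose i j permutes {..<N}" using assms by (auto intro: permutes_swap_id)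
  have "(\<lambda>k. v (Transposition.transpose i j k)) = v"
    using assms(4) by (auto simp: Transposition.transpose_def)
  then have "alternation N f v = - alternation N f v"
    using alternation_permute[OF t, of f v] assms(3) by (simp add: sign_swap_id)
  then show ?thesis by (metis equation_minus_iff eq_neg_iff_add_eq_0 scaleR_2 scaleR_eq_0_iff zero_neq_numeral)
qed

lemma alternation_linear_slot:
  assumes f: "\<And>v i. i < N \<Longrightarrow> linear (\<lambda>x. f (v(i := x)))" and i: "i < N"
  shows "linear (\<lambda>x. alternation N f (v(i := x)))"
  unfolding alternation_def
proof (rule linear_compose_sum, intro ballI)
  fix \<pi> :: "nat \<Rightarrow> nat" assume "\<pi> \<in> {\<pi>. \<pi> permutes {..<N}}"
  then have pi: "\<pi> permutes {..<N}" by simp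
  define l where "l = inv_into UNIV \<pi> i"
  have l: "l < N" "\<pi> l = i" using permutes_in_image[OF permutes_inv[OF pi], of i] i permutes_inverses(1)[OF pi]
    by (auto simp: l_def)
  have "(\<lambda>k. (v(i := x)) (\<pi> k)) = (\<lambda>k. v (\<pi> k))(l := x)" for x
    using l(2) permutes_inj[OF pi] by (auto simp: fun_eq_iff inj_def)
  then show "linear (\<lambda>x. of_int (sign \<pi>) *\<^sub>R f (\<lambda>k. (v(i := x)) (\<pi> k)))"
    using linear_compose_scale_right[OF f[OF l(1)]] by simp
qed

lemma alternation_update:
  assumes f: "\<And>v i. i < N \<Longrightarrow> linear (\<lambda>x. f (v(i := x)))" and i: "i < N" and I: "I \<subseteq> {..<N}"
  shows "alternation N f (v(i := (\<Sum>j\<in>I. c j *\<^sub>R v j))) = (if i \<in> I then c i *\<^sub>R alternation N f v else 0)"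
proof -
  have l: "linear (\<lambda>x. alternation N f (v(i := x)))" by (rule alternation_linear_slot[OF f i])
  have z: "alternation N f (v(i := v j)) = 0" if "j \<in> I" "j \<noteq> i" for j
    using alternation_repeated[of i N j "v(i := v j)" f] that i I by auto
  have "alternation N f (v(i := (\<Sum>j\<in>I. c j *\<^sub>R v j))) = (\<Sum>j\<in>I. c j *\<^sub>R alternation N f (v(i := v j)))"
    using linear_sum[OF l, of "\<lambda>j. c j *\<^sub>R v j" I] by (simp only: linear_scale[OF l])
  also have "\<dots> = (\<Sum>j\<in>I. if j = i then c i *\<^sub>R alternation N f v else 0)"
    by (rule sum.cong) (auto simp: z)
  finally show ?thesis using finite_subset[OF I] by simp
qed

lemma alternation_dependent:
  assumes f: "\<And>v i. i < N \<Longrightarrow> linear (\<lambda>x. f (v(i := x)))" and i: "i < N" and v: "v i \<in> span (v ` ({..<N} - {i}))"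
  shows "alternation N f v = 0"
proof -
  have "\<exists>c. v i = (\<Sum>j\<in>{..<N} - {i}. c j *\<^sub>R v j)"
  proof -
    have "v i \<in> range (\<lambda>u. \<Sum>x\<in>v ` ({..<N} - {i}). u x *\<^sub>R x)" using v span_finite[of "v ` ({..<N} - {i})"] by simp
    then obtain u where u: "v i = (\<Sum>x\<in>v ` ({..<N} - {i}). u x *\<^sub>R x)" by blast
    obtain J where J: "J \<subseteq> {..<N} - {i}" "inj_on v J" "v ` J = v ` ({..<N} - {i})"
      by (metis subset_image_inj order_refl)
    have "v i = (\<Sum>j\<in>J. u (v j) *\<^sub>R v j)" unfolding u J(3)[symmetric] by (rule sum.reindex_cong[OF J(2)]) auto
    also have "\<dots> = (\<Sum>j\<in>{..<N} - {i}. (if j \<in> J then u (v j) else 0) *\<^sub>R v j)"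
      by (rule sum.mono_neutral_cong_left) (use J in auto)
    finally show ?thesis by (rule exI[of _ "\<lambda>j. if j \<in> J then u (v j) else 0"])
  qed
  then obtain c where c: "v i = (\<Sum>j\<in>{..<N} - {i}. c j *\<^sub>R v j)" by blast
  show ?thesis
    using alternation_update[OF f i, of "{..<N} - {i}" v c] unfolding c[symmetric] by auto
qed

subsection \<open>Iterated wedge products as alternations\<close>

text \<open>
  The extension of a permutation by the identity on two new initial indices. Summing over it absorbs the
  permutations of the second factor of a wedge product with a 2-form into those of the whole product.
\<close>

definition shift2 :: "(nat \<Rightarrow> nat) \<Rightarrow> nat \<Rightarrow> nat" where
  "shift2 \<sigma> j = (if j < 2 then j else Suc (Suc (\<sigma> (j - 2))))"

lemma shift2_simps [simp]:
  "shift2 \<sigma> 0 = 0" "shift2 \<sigma> (Suc 0) = Suc 0" "shift2 \<sigma> (Suc (Suc j)) = Suc (Suc (\<sigma> j))"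
  by (simp_all add: shift2_def)

lemma shift2_permutes:
  assumes "\<sigma> permutes {..<m}"
  shows "shift2 \<sigma> permutes {..<2 + m} \<and> sign (shift2 \<sigma>) = sign \<sigma>"
  using assms finite_lessThan
proof (induction rule: permutes_induct)
  case id
  have "shift2 id = id" by (auto simp: shift2_def fun_eq_iff)
  then show ?case by (simp only: permutes_id sign_id)
next
  case (swap a b p)
  have eq: "shift2 (Transposition.transpose a b \<circ> p) = Transposition.transpose (a + 2) (b + 2) \<circ> shift2 p"
    by (auto simp: shift2_def fun_eq_iff Transposition.transpose_def)
  have t: "Transposition.transpose (a + 2) (b + 2) permutes {..<2 + m}"
    using swap by (auto intro: permutes_swap_id)
  have pm: "permutation p" "permutation (shift2 p)"
    using swap permutation_lessThan by blast+
  have "sign (shift2 (Transposition.transpose a b \<circ> p)) = sign (Transposition.transpose a b \<circ> p)"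
    using swap.IH swap.hyps
    by (simp only: eq sign_compose[OF permutation_swap_id pm(1)] sign_compose[OF permutation_swap_id pm(2)] sign_swap_id) simp
  then show ?case
    using permutes_compose[OF conjunct1[OF swap.IH] t] by (simp only: eq)
qed

definition pairprod :: "('v \<Rightarrow> 'v \<Rightarrow> real) \<Rightarrow> nat set \<Rightarrow> (nat \<Rightarrow> 'v) \<Rightarrow> real" where
  "pairprod om I v = (\<Prod>i\<in>I. om (v (2 * i)) (v (Suc (2 * i))))"

lemma wedge_pairprod:
  assumes ih: "\<And>v. \<beta> v = (1 / 2 ^ k) * alternation (2 * k) (pairprod om {..<k}) v"
  shows "wedge 2 (2 * k) (\<lambda>a r. r *\<^sub>R a) (\<lambda>v. \<phi> (v 0) (v 1)) \<beta> v
    = (1 / 2 ^ Suc k) *\<^sub>R alternation (2 * Suc k) (\<lambda>v. pairprod om {1..<Suc k} v *\<^sub>R \<phi> (v 0) (v 1)) v"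
proof -
  let ?S = "{\<pi>. \<pi> permutes {..<2 + 2 * k}}"
  let ?R = "{\<sigma>. \<sigma> permutes {..<2 * k}}"
  let ?f = "\<lambda>v. pairprod om {1..<Suc k} v *\<^sub>R \<phi> (v 0) (v 1)"
  have inner: "pairprod om {..<k} (\<lambda>i. v (\<pi> (2 + \<sigma> i))) = pairprod om {1..<Suc k} (\<lambda>i. v ((\<pi> \<circ> shift2 \<sigma>) i))" for \<pi> \<sigma>
    unfolding pairprod_def
    by (rule prod.reindex_bij_witness[where i = "\<lambda>i. i - 1" and j = Suc]) (auto simp: shift2_def)
  have one: "(\<Sum>\<pi>\<in>?S. of_int (sign \<pi>) *\<^sub>R (of_int (sign \<sigma>) *\<^sub>R (pairprod om {..<k} (\<lambda>i. v (\<pi> (2 + \<sigma> i))) *\<^sub>R \<phi> (v (\<pi> 0)) (v (\<pi> 1)))))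
      = alternation (2 + 2 * k) ?f v" if "\<sigma> \<in> ?R" for \<sigma>
  proof -
    have s: "shift2 \<sigma> permutes {..<2 + 2 * k}" "sign (shift2 \<sigma>) = sign \<sigma>"
      using shift2_permutes[of \<sigma> "2 * k"] that by auto
    have ps: "permutation (shift2 \<sigma>)" using s(1) by (auto simp: permutation_permutes)
    have "alternation (2 + 2 * k) ?f v = (\<Sum>\<pi>\<in>?S. of_int (sign (\<pi> \<circ> shift2 \<sigma>)) *\<^sub>R ?f (\<lambda>i. v ((\<pi> \<circ> shift2 \<sigma>) i)))"
      unfolding alternation_def
      by (rule sum_permutations_compose_right[OF s(1), of "\<lambda>\<pi>. of_int (sign \<pi>) *\<^sub>R ?f (\<lambda>i. v (\<pi> i))"])
    also have "\<dots> = (\<Sum>\<pi>\<in>?S. of_int (sign \<pi>) *\<^sub>R (of_int (sign \<sigma>) *\<^sub>R (pairprod om {..<k} (\<lambda>i. v (\<pi> (2 + \<sigma> i))) *\<^sub>R \<phi> (v (\<pi> 0)) (v (\<pi> 1)))))"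
    proof (rule sum.cong[OF refl])
      fix \<pi> :: "nat \<Rightarrow> nat" assume "\<pi> \<in> ?S"
      then have "permutation \<pi>" by (auto simp: permutation_permutes)
      then have "sign (\<pi> \<circ> shift2 \<sigma>) = sign \<pi> * sign \<sigma>" using sign_compose[OF _ ps] s(2) by simp
      then show "of_int (sign (\<pi> \<circ> shift2 \<sigma>)) *\<^sub>R ?f (\<lambda>i. v ((\<pi> \<circ> shift2 \<sigma>) i)) =
        of_int (sign \<pi>) *\<^sub>R (of_int (sign \<sigma>) *\<^sub>R (pairprod om {..<k} (\<lambda>i. v (\<pi> (2 + \<sigma> i))) *\<^sub>R \<phi> (v (\<pi> 0)) (v (\<pi> 1))))"
        unfolding inner by simp
    qed
    finally show ?thesis by simp
  qed
  have card: "card ?R = fact (2 * k)" by (rule card_permutations) auto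
  have "wedge 2 (2 * k) (\<lambda>a r. r *\<^sub>R a) (\<lambda>v. \<phi> (v 0) (v 1)) \<beta> v
    = (1 / (fact 2 * fact (2 * k))) *\<^sub>R (\<Sum>\<pi>\<in>?S. of_int (sign \<pi>) *\<^sub>R (\<beta> (\<lambda>i. v (\<pi> (2 + i))) *\<^sub>R \<phi> (v (\<pi> 0)) (v (\<pi> 1))))"
    by (simp add: wedge_def)
  also have "(\<Sum>\<pi>\<in>?S. of_int (sign \<pi>) *\<^sub>R (\<beta> (\<lambda>i. v (\<pi> (2 + i))) *\<^sub>R \<phi> (v (\<pi> 0)) (v (\<pi> 1))))
    = (1 / 2 ^ k) *\<^sub>R (\<Sum>\<pi>\<in>?S. \<Sum>\<sigma>\<in>?R. of_int (sign \<pi>) *\<^sub>R (of_int (sign \<sigma>) *\<^sub>R (pairprod om {..<k} (\<lambda>i. v (\<pi> (2 + \<sigma> i))) *\<^sub>R \<phi> (v (\<pi> 0)) (v (\<pi> 1)))))"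
    unfolding ih alternation_def scaleR_sum_right
    by (rule sum.cong[OF refl]) (simp add: scaleR_sum_left scaleR_sum_right sum_distrib_left mult_ac)
  also have "\<dots> = (1 / 2 ^ k) *\<^sub>R (\<Sum>\<sigma>\<in>?R. alternation (2 + 2 * k) ?f v)"
    by (subst sum.swap) (intro arg_cong[where f = "\<lambda>x. (1 / 2 ^ k) *\<^sub>R x"] sum.cong refl one)
  also have "\<dots> = (1 / 2 ^ k) *\<^sub>R (fact (2 * k) *\<^sub>R alternation (2 + 2 * k) ?f v)"
    by (simp add: card scaleR_conv_of_real sum_constant_scaleR)
  finally show ?thesis by (simp add: fact_2)
qed

lemma wedge_power_alternation:
  "wedge_power (\<lambda>v. om (v 0) (v 1)) k v = (1 / 2 ^ k) * alternation (2 * k) (pairprod om {..<k}) v"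
proof (induction k arbitrary: v)
  case 0
  have "{\<pi>::nat \<Rightarrow> nat. \<pi> permutes {}} = {id}" by auto
  then show ?case by (simp add: alternation_def pairprod_def)
next
  case (Suc k)
  have "wedge_power (\<lambda>v. om (v 0) (v 1)) (Suc k) v
    = wedge 2 (2 * k) (\<lambda>a r. r *\<^sub>R a) (\<lambda>v. om (v 0) (v 1)) (wedge_power (\<lambda>v. om (v 0) (v 1)) k) v"
    by (simp add: wedge_def mult.commute)
  also have "\<dots> = (1 / 2 ^ Suc k) *\<^sub>R alternation (2 * Suc k) (\<lambda>v. pairprod om {1..<Suc k} v *\<^sub>R om (v 0) (v 1)) v"
    by (rule wedge_pairprod[OF Suc])
  also have "(\<lambda>v. pairprod om {1..<Suc k} v *\<^sub>R om (v 0) (v 1)) = pairprod om {..<Suc k}"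
  proof
    fix v
    have "{..<Suc k} = insert 0 {1..<Suc k}" by auto
    then show "pairprod om {1..<Suc k} v *\<^sub>R om (v 0) (v 1) = pairprod om {..<Suc k} v"
      by (simp add: pairprod_def mult.commute)
  qed
  finally show ?case by simp
qed

text \<open>Exchanging two pairs of indices is an even permutation, so all pairs in \<open>\<phi> \<and> \<omega>\<^sup>n\<^sup>-\<^sup>1\<close> play the same role.\<close>

lemma block_swap:
  fixes j n :: nat
  assumes "j < n"
  defines "\<rho> \<equiv> Transposition.transpose 0 (2 * j) \<circ> Transposition.transpose 1 (Suc (2 * j))"
  shows "\<rho> permutes {..<2 * n}" "sign \<rho> = 1" "\<rho> (2 * i) = 2 * Transposition.transpose 0 j i"
    "\<rho> (Suc (2 * i)) = Suc (2 * Transposition.transpose 0 j i)"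
    "\<rho> (\<rho> l) = l"
proof -
  show "\<rho> permutes {..<2 * n}" unfolding \<rho>_def
    using assms(1) by (intro permutes_compose permutes_swap_id) auto
  show "sign \<rho> = 1" unfolding \<rho>_def by (simp add: sign_compose permutation_swap_id sign_swap_id)
  show "\<rho> (2 * i) = 2 * Transposition.transpose 0 j i" "\<rho> (Suc (2 * i)) = Suc (2 * Transposition.transpose 0 j i)"
    unfolding \<rho>_def by (auto simp: Transposition.transpose_def; presburger)+
  show "\<rho> (\<rho> l) = l" unfolding \<rho>_def by (auto simp: Transposition.transpose_def; presburger)
qed

lemma paired_product_linear_slot:
  assumes om: "\<And>l x. linear (om l x)" "\<And>l y. linear (\<lambda>x. om l x y)" and i: "i < 2 * n"
  shows "linear (\<lambda>x. \<Prod>l<n. om l ((v(i := x)) (2 * l)) ((v(i := x)) (Suc (2 * l))) :: real)"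
proof -
  define j where "j = i div 2"
  have j: "j < n" using i by (auto simp: j_def)
  let ?c = "\<Prod>l\<in>{..<n} - {j}. om l (v (2 * l)) (v (Suc (2 * l)))"
  have r: "(\<Prod>l<n. om l ((v(i := x)) (2 * l)) ((v(i := x)) (Suc (2 * l))))
      = ?c *\<^sub>R om j ((v(i := x)) (2 * j)) ((v(i := x)) (Suc (2 * j)))" for x
  proof -
    have "(\<Prod>l\<in>{..<n} - {j}. om l ((v(i := x)) (2 * l)) ((v(i := x)) (Suc (2 * l)))) = ?c"
      by (rule prod.cong[OF refl]) (auto simp: j_def)
    then show ?thesis using prod.remove[of "{..<n}" j "\<lambda>l. om l ((v(i := x)) (2 * l)) ((v(i := x)) (Suc (2 * l)))"] j
      by (simp add: mult.commute)
  qed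
  have "i = 2 * j \<or> i = Suc (2 * j)" by (auto simp: j_def)
  then have "linear (\<lambda>x. om j ((v(i := x)) (2 * j)) ((v(i := x)) (Suc (2 * j))))" using om by auto
  from linear_compose_scale_right[OF this] show ?thesis unfolding r .
qed

text \<open>
  The left-hand side is the action of \<open>B\<close> as a derivation on the product of the \<open>\<omega>(v\<^sub>2\<^sub>j, v\<^sub>2\<^sub>j\<^sub>+\<^sub>1)\<close>; each factor is
  hit twice, with the same result.
\<close>

lemma pairprod_derivation:
  fixes om :: "'v::real_vector \<Rightarrow> 'v \<Rightarrow> real"
  assumes B: "\<And>x y. om (B x) y = \<phi> x y" "\<And>x y. om x (B y) = \<phi> x y"
  shows "(\<Sum>i<2 * n. pairprod om {..<n} (v(i := B (v i))))
    = 2 * (\<Sum>j<n. pairprod om ({..<n} - {j}) v * \<phi> (v (2 * j)) (v (Suc (2 * j))))"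
proof -
  have t: "pairprod om {..<n} (v(i := B (v i))) = pairprod om ({..<n} - {j}) v * \<phi> (v (2 * j)) (v (Suc (2 * j)))"
    if j: "j < n" and i: "i = 2 * j \<or> i = Suc (2 * j)" for i j
  proof -
    have "pairprod om {..<n} (v(i := B (v i))) = om ((v(i := B (v i))) (2 * j)) ((v(i := B (v i))) (Suc (2 * j))) *
        (\<Prod>l\<in>{..<n} - {j}. om ((v(i := B (v i))) (2 * l)) ((v(i := B (v i))) (Suc (2 * l))))"
      unfolding pairprod_def by (rule prod.remove) (use j in auto)
    also have "(\<Prod>l\<in>{..<n} - {j}. om ((v(i := B (v i))) (2 * l)) ((v(i := B (v i))) (Suc (2 * l)))) = pairprod om ({..<n} - {j}) v"
      unfolding pairprod_def by (rule prod.cong[OF refl]) (use i in \<open>auto; presburger\<close>)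
    also have "om ((v(i := B (v i))) (2 * j)) ((v(i := B (v i))) (Suc (2 * j))) = \<phi> (v (2 * j)) (v (Suc (2 * j)))"
      using i B by auto
    finally show ?thesis by (simp only: mult.commute)
  qed
  have "(\<Sum>i<2 * n. g i) = (\<Sum>j<n. g (2 * j) + g (Suc (2 * j)))" for g :: "nat \<Rightarrow> real"
    by (induction n) auto
  then have "(\<Sum>i<2 * n. pairprod om {..<n} (v(i := B (v i)))) =
      (\<Sum>j<n. pairprod om {..<n} (v(2 * j := B (v (2 * j)))) + pairprod om {..<n} (v(Suc (2 * j) := B (v (Suc (2 * j))))))" .
  also have "\<dots> = (\<Sum>j<n. 2 * (pairprod om ({..<n} - {j}) v * \<phi> (v (2 * j)) (v (Suc (2 * j)))))"
    by (rule sum.cong[OF refl]) (simp add: t)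
  finally show ?thesis by (simp add: sum_distrib_left)
qed

lemma alternation_block:
  assumes j: "j < n"
  shows "alternation (2 * n) (\<lambda>v. pairprod om ({..<n} - {j}) v * \<phi> (v (2 * j)) (v (Suc (2 * j)))) v
    = alternation (2 * n) (\<lambda>v. pairprod om {1..<n} v * \<phi> (v 0) (v 1)) v"
proof -
  define \<rho> where "\<rho> = Transposition.transpose 0 (2 * j) \<circ> Transposition.transpose 1 (Suc (2 * j))"
  note r = block_swap[OF j, folded \<rho>_def]
  have "pairprod om {1..<n} (\<lambda>i. v (\<rho> i)) = pairprod om ({..<n} - {j}) v" for v
    unfolding pairprod_def r(3,4)
    by (rule prod.reindex_bij_witness[where i = "Transposition.transpose 0 j" and j = "Transposition.transpose 0 j"])
       (use j in \<open>auto simp: Transposition.transpose_def split: if_splits\<close>)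
  moreover have "\<rho> 0 = 2 * j" "\<rho> 1 = Suc (2 * j)" using r(3)[of 0] r(4)[of 0] by simp_all
  ultimately show ?thesis
    using alternation_precompose[OF r(1), of "\<lambda>v. pairprod om {1..<n} v * \<phi> (v 0) (v 1)" v] r(2) by simp
qed

text \<open>
  Symplectic bases: \<open>a j\<close> and \<open>b j\<close> for \<open>j\<close> in a finite index set. The trace of the endomorphism \<open>B\<close> with
  \<open>\<phi> = \<omega>(B\<cdot>, \<cdot>)\<close> is twice the contraction of \<open>\<phi>\<close> with \<open>\<omega>\<close>; letting \<open>B\<close> act as a derivation on the top
  form \<open>\<omega>\<^sup>n\<close> gives \<open>tr B \<omega>\<^sup>n = 2 n \<phi> \<and> \<omega>\<^sup>n\<^sup>-\<^sup>1\<close>.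
\<close>

locale symplectic_frame =
  fixes om :: "'v::euclidean_space \<Rightarrow> 'v \<Rightarrow> real" and J :: "'j set" and a b :: "'j \<Rightarrow> 'v" and n :: nat
  assumes om_linear: "\<And>x. linear (om x)" "\<And>y. linear (\<lambda>x. om x y)" and om_alt: "\<And>x y. om x y = - om y x"
    and J: "finite J" "card J = n" and dim: "DIM('v) = 2 * n" and n: "n > 0"
    and expand: "\<And>x. x = (\<Sum>j\<in>J. om x (b j) *\<^sub>R a j - om x (a j) *\<^sub>R b j)"
begin

text \<open>
  If the arguments are dependent, both sides vanish. Otherwise they form a basis, in which the action of \<open>B\<close>
  as a derivation on the top form is multiplication by the trace of \<open>B\<close>.
\<close>

lemma wedge_trace_real:
  fixes \<phi> :: "'v \<Rightarrow> 'v \<Rightarrow> real"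
  assumes phi: "\<And>x. linear (\<phi> x)" "\<And>y. linear (\<lambda>x. \<phi> x y)" "\<And>x y. \<phi> x y = - \<phi> y x"
  shows "real n * alternation (2 * n) (\<lambda>v. pairprod om {1..<n} v * \<phi> (v 0) (v 1)) v
    = (\<Sum>j\<in>J. \<phi> (a j) (b j)) * alternation (2 * n) (pairprod om {..<n}) v"
proof -
  define B where "B x = (\<Sum>j\<in>J. \<phi> x (b j) *\<^sub>R a j - \<phi> x (a j) *\<^sub>R b j)" for x
  have B1: "om (B x) y = \<phi> x y" for x y
  proof -
    have "om (B x) y = (\<Sum>j\<in>J. \<phi> x (b j) * om (a j) y - \<phi> x (a j) * om (b j) y)"
      unfolding B_def by (simp add: linear_sum[OF om_linear(2)] linear_diff[OF om_linear(2)] linear_scale[OF om_linear(2)])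
    also have "\<dots> = (\<Sum>j\<in>J. om y (b j) * \<phi> x (a j) - om y (a j) * \<phi> x (b j))"
      by (rule sum.cong[OF refl]) (simp add: om_alt[of _ y])
    also have "\<dots> = \<phi> x (\<Sum>j\<in>J. om y (b j) *\<^sub>R a j - om y (a j) *\<^sub>R b j)"
      by (simp add: linear_sum[OF phi(1)] linear_diff[OF phi(1)] linear_scale[OF phi(1)])
    finally show ?thesis using expand[of y] by simp
  qed
  have B2: "om x (B y) = \<phi> x y" for x y
    using B1[of y x] om_alt[of x "B y"] phi(3)[of y x] by simp
  have lin: "\<And>v i. i < 2 * n \<Longrightarrow> linear (\<lambda>x. pairprod om {..<n} (v(i := x)))"
    unfolding pairprod_def by (rule paired_product_linear_slot[OF om_linear])
  have lin2: "\<And>v i. i < 2 * n \<Longrightarrow> linear (\<lambda>x. (\<lambda>v. pairprod om {1..<n} v * \<phi> (v 0) (v 1)) (v(i := x)))"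
  proof -
    fix v :: "nat \<Rightarrow> 'v" and i assume i: "i < 2 * n"
    let ?om = "\<lambda>l. if l = 0 then \<phi> else om"
    have "{..<n} = insert 0 {1..<n}" using n by auto
    then have e: "pairprod om {1..<n} v * \<phi> (v 0) (v 1) = (\<Prod>l<n. ?om l (v (2 * l)) (v (Suc (2 * l))))" for v
      by (simp add: pairprod_def)
    have "linear (\<lambda>x. \<Prod>l<n. ?om l ((v(i := x)) (2 * l)) ((v(i := x)) (Suc (2 * l))))"
      by (rule paired_product_linear_slot[OF _ _ i]) (simp_all add: phi(1,2) om_linear)
    then show "linear (\<lambda>x. (\<lambda>v. pairprod om {1..<n} v * \<phi> (v 0) (v 1)) (v(i := x)))" unfolding e .
  qed
  show ?thesis
  proof (cases "inj_on v {..<2 * n} \<and> independent (v ` {..<2 * n})")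
    case False
    have "\<exists>i<2 * n. v i \<in> span (v ` ({..<2 * n} - {i}))"
    proof (cases "inj_on v {..<2 * n}")
      case False
      then obtain i j where "i < 2 * n" "j < 2 * n" "i \<noteq> j" "v i = v j" by (auto simp: inj_on_def)
      then have "v i \<in> v ` ({..<2 * n} - {i})" by auto
      then have "v i \<in> span (v ` ({..<2 * n} - {i}))" by (rule span_base)
      with \<open>i < 2 * n\<close> show ?thesis by (intro exI[of _ i] conjI)
    next
      case True
      with \<open>\<not> _\<close> have "dependent (v ` {..<2 * n})" by blast
      then obtain i where i: "i < 2 * n" "v i \<in> span (v ` {..<2 * n} - {v i})"
        unfolding dependent_def by auto
      have "v ` {..<2 * n} - {v i} = v ` ({..<2 * n} - {i})"
        using inj_on_image_set_diff[OF True, of "{..<2 * n}" "{i}"] i(1) by simp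
      then show ?thesis using i by auto
    qed
    then show ?thesis using alternation_dependent[OF lin] alternation_dependent[OF lin2] by auto
  next
    case True
    let ?V = "v ` {..<2 * n}"
    have card: "card ?V = 2 * n" using True by (simp add: card_image)
    have sp: "span ?V = UNIV"
      using card_ge_dim_independent[of ?V UNIV] True card dim by auto
    define c where "c i x = representation ?V x (v i)" for i x
    have ex: "x = (\<Sum>i<2 * n. c i x *\<^sub>R v i)" for x
    proof -
      have "(\<Sum>y\<in>?V. representation ?V x y *\<^sub>R y) = x"
        using True sp by (intro sum_representation_eq) auto
      then show ?thesis unfolding c_def using True by (simp add: sum.reindex)
    qed
    have clin: "linear (c i)" for i
      using representation_add[of ?V] representation_scale[of ?V] True sp
      by (intro linearI) (auto simp: c_def add.commute)
    let ?T = "alternation (2 * n) (\<lambda>v. pairprod om {1..<n} v * \<phi> (v 0) (v 1)) v"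
    let ?A = "alternation (2 * n) (pairprod om {..<n}) v"
    have "(\<Sum>i<2 * n. alternation (2 * n) (pairprod om {..<n}) (v(i := B (v i)))) = 2 * (real n * ?T)"
    proof -
      have "(\<Sum>i<2 * n. alternation (2 * n) (pairprod om {..<n}) (v(i := B (v i))))
          = (\<Sum>\<pi> | \<pi> permutes {..<2 * n}. of_int (sign \<pi>) * (\<Sum>i<2 * n. pairprod om {..<n} (\<lambda>k. (v(i := B (v i))) (\<pi> k))))"
        unfolding alternation_def by (subst sum.swap) (simp add: sum_distrib_left)
      also have "\<dots> = (\<Sum>\<pi> | \<pi> permutes {..<2 * n}. of_int (sign \<pi>) * (2 * (\<Sum>j<n. pairprod om ({..<n} - {j}) (\<lambda>k. v (\<pi> k)) * \<phi> (v (\<pi> (2 * j))) (v (\<pi> (Suc (2 * j)))))))"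
      proof (rule sum.cong[OF refl])
        fix \<pi> :: "nat \<Rightarrow> nat" assume "\<pi> \<in> {\<pi>. \<pi> permutes {..<2 * n}}"
        then have pi: "\<pi> permutes {..<2 * n}" by simp
        have "(\<Sum>i<2 * n. pairprod om {..<n} (\<lambda>k. (v(i := B (v i))) (\<pi> k)))
            = (\<Sum>l<2 * n. pairprod om {..<n} (\<lambda>k. (v(\<pi> l := B (v (\<pi> l)))) (\<pi> k)))"
          using sum.permute[OF pi, of "\<lambda>i. pairprod om {..<n} (\<lambda>k. (v(i := B (v i))) (\<pi> k))"] by (simp add: o_def)
        also have "\<dots> = (\<Sum>l<2 * n. pairprod om {..<n} ((\<lambda>k. v (\<pi> k))(l := B (v (\<pi> l)))))"
          using permutes_inj[OF pi] by (intro sum.cong refl arg_cong[where f = "pairprod om {..<n}"]) (auto simp: inj_def)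
        also have "\<dots> = 2 * (\<Sum>j<n. pairprod om ({..<n} - {j}) (\<lambda>k. v (\<pi> k)) * \<phi> (v (\<pi> (2 * j))) (v (\<pi> (Suc (2 * j)))))"
          using pairprod_derivation[where om = om and B = B and \<phi> = \<phi> and n = n and v = "\<lambda>k. v (\<pi> k)", OF B1 B2] by simp
        finally show "of_int (sign \<pi>) * (\<Sum>i<2 * n. pairprod om {..<n} (\<lambda>k. (v(i := B (v i))) (\<pi> k))) = of_int (sign \<pi>) *
           (2 * (\<Sum>j<n. pairprod om ({..<n} - {j}) (\<lambda>k. v (\<pi> k)) * \<phi> (v (\<pi> (2 * j))) (v (\<pi> (Suc (2 * j))))))" by simp
      qed
      also have "\<dots> = 2 * (\<Sum>j<n. alternation (2 * n) (\<lambda>v. pairprod om ({..<n} - {j}) v * \<phi> (v (2 * j)) (v (Suc (2 * j)))) v)"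
        unfolding alternation_def by (subst sum.swap) (simp add: sum_distrib_left mult_ac)
      also have "(\<Sum>j<n. alternation (2 * n) (\<lambda>v. pairprod om ({..<n} - {j}) v * \<phi> (v (2 * j)) (v (Suc (2 * j)))) v) = (\<Sum>j<n. ?T)"
        by (intro sum.cong refl alternation_block) auto
      also have "\<dots> = real n * ?T" by simp
      finally show ?thesis .
    qed
    moreover have "alternation (2 * n) (pairprod om {..<n}) (v(i := B (v i))) = c i (B (v i)) * ?A" if "i < 2 * n" for i
      using alternation_update[where f = "pairprod om {..<n}" and N = "2 * n" and i = i and I = "{..<2 * n}" and v = v and c = "\<lambda>j. c j (B (v i))", OF lin that order_refl]
        ex[of "B (v i)"] that by simp
    ultimately have "(\<Sum>i<2 * n. c i (B (v i))) * ?A = 2 * (real n * ?T)"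
      by (simp add: sum_distrib_right)
    moreover have "(\<Sum>i<2 * n. c i (B (v i))) = 2 * (\<Sum>j\<in>J. \<phi> (a j) (b j))"
    proof -
      have "(\<Sum>i<2 * n. c i (B (v i))) = (\<Sum>i<2 * n. \<Sum>j\<in>J. c i (a j) * \<phi> (v i) (b j) - c i (b j) * \<phi> (v i) (a j))"
        unfolding B_def by (simp add: linear_sum[OF clin] linear_diff[OF clin] linear_scale[OF clin] mult.commute)
      also have "\<dots> = (\<Sum>j\<in>J. (\<Sum>i<2 * n. c i (a j) * \<phi> (v i) (b j)) - (\<Sum>i<2 * n. c i (b j) * \<phi> (v i) (a j)))"
        by (subst sum.swap) (simp add: sum_subtractf)
      also have "\<dots> = (\<Sum>j\<in>J. \<phi> (\<Sum>i<2 * n. c i (a j) *\<^sub>R v i) (b j) - \<phi> (\<Sum>i<2 * n. c i (b j) *\<^sub>R v i) (a j))"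
        by (simp add: linear_sum[OF phi(2)] linear_scale[OF phi(2)])
      also have "\<dots> = (\<Sum>j\<in>J. \<phi> (a j) (b j) - \<phi> (b j) (a j))" by (simp flip: ex)
      also have "\<dots> = (\<Sum>j\<in>J. 2 * \<phi> (a j) (b j))" by (rule sum.cong[OF refl]) (simp add: phi(3)[of "b _"])
      finally show ?thesis by (simp add: sum_distrib_left)
    qed
    ultimately show ?thesis by simp
  qed
qed

text \<open>The values of \<open>\<Phi>\<close> lie in an arbitrary vector space; the real case is applied to linear functionals of them.\<close>

theorem wedge_omega_power:
  fixes \<Phi> :: "'v \<Rightarrow> 'v \<Rightarrow> 'w::real_vector"
  assumes phi: "\<And>x. linear (\<Phi> x)" "\<And>y. linear (\<lambda>x. \<Phi> x y)" "\<And>x y. \<Phi> x y = - \<Phi> y x"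
  shows "wedge 2 (2 * (n - 1)) (\<lambda>a r. r *\<^sub>R a) (\<lambda>v. \<Phi> (v 0) (v 1)) (wedge_power (\<lambda>v. om (v 0) (v 1)) (n - 1)) v
    = (wedge_power (\<lambda>v. om (v 0) (v 1)) n v / real n) *\<^sub>R (\<Sum>j\<in>J. \<Phi> (a j) (b j))" (is "?l = ?r")
proof -
  let ?f = "\<lambda>v. pairprod om {1..<n} v *\<^sub>R \<Phi> (v 0) (v 1)"
  have n1: "Suc (n - 1) = n" using n by simp
  have l: "?l = (1 / 2 ^ n) *\<^sub>R alternation (2 * n) ?f v"
    using wedge_pairprod[OF wedge_power_alternation, of "n - 1" \<Phi> om v] unfolding n1 .
  have "real n *\<^sub>R alternation (2 * n) ?f v = alternation (2 * n) (pairprod om {..<n}) v *\<^sub>R (\<Sum>j\<in>J. \<Phi> (a j) (b j))" (is "?x = ?y")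
  proof (rule ccontr)
    assume "?x \<noteq> ?y"
    then have "independent {?x - ?y}" by (simp add: dependent_single)
    then obtain g :: "'w \<Rightarrow> real" where g: "linear g" "g (?x - ?y) = 1"
      using linear_independent_extend[of "{?x - ?y}" "\<lambda>_. 1"] by auto
    have "g ?x = real n * alternation (2 * n) (\<lambda>v. pairprod om {1..<n} v * g (\<Phi> (v 0) (v 1))) v"
      by (simp add: alternation_def linear_sum[OF g(1)] linear_scale[OF g(1)] mult.assoc)
    also have "\<dots> = (\<Sum>j\<in>J. g (\<Phi> (a j) (b j))) * alternation (2 * n) (pairprod om {..<n}) v"
    proof (rule wedge_trace_real)
      show "linear (\<lambda>y. g (\<Phi> x y))" for x using linear_compose[OF phi(1) g(1)] by (simp add: o_def)
      show "linear (\<lambda>x. g (\<Phi> x y))" for y using linear_compose[OF phi(2) g(1)] by (simp add: o_def)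
      show "g (\<Phi> x y) = - g (\<Phi> y x)" for x y
        using linear_neg[OF g(1), of "\<Phi> y x"] by (simp only: flip: phi(3))
    qed
    also have "\<dots> = g ?y" by (simp add: linear_sum[OF g(1)] linear_scale[OF g(1)])
    finally show False using g(2) linear_diff[OF g(1)] by simp
  qed
  then have "alternation (2 * n) ?f v = (alternation (2 * n) (pairprod om {..<n}) v / real n) *\<^sub>R (\<Sum>j\<in>J. \<Phi> (a j) (b j))"
  proof -
    have "alternation (2 * n) ?f v = (1 / real n) *\<^sub>R (real n *\<^sub>R alternation (2 * n) ?f v)" using n by simp
    also have "\<dots> = (1 / real n) *\<^sub>R (alternation (2 * n) (pairprod om {..<n}) v *\<^sub>R (\<Sum>j\<in>J. \<Phi> (a j) (b j)))"
      by (simp only: \<open>?x = ?y\<close>)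
    finally show ?thesis by simp
  qed
  then show ?thesis unfolding l wedge_power_alternation by simp
qed

end

section \<open>Components of type (1,0) and (0,1)\<close>

lemma ex_sum: "ex10 f v + ex01 f v = f v"
  by (simp add: ex10_def ex01_def flip: scaleR_add_right scaleR_2)

lemma ex10_complex_linear:
  assumes "linear f"
  shows "complex_linear (ex10 f)"
proof (rule complex_linearI_ii)
  show "linear (ex10 f)"
    unfolding ex10_def
    by (intro linearI)
       (simp_all add: linear_add[OF assms] scaleC_add_right linear_scale[OF assms] scaleC_scaleR
         scaleR_diff_right scaleR_add_right)
  show "ex10 f (scaleC \<i> x) = scaleC \<i> (ex10 f x)" for x
    by (simp add: ex10_def scaleC_scaleR scaleC_diff_right linear_neg[OF assms] scaleC_minus_right)
qed

lemma ex01_antilinear: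
  assumes "linear f"
  shows "ex01 f (x + y) = ex01 f x + ex01 f y" "ex01 f (scaleC c x) = scaleC (cnj c) (ex01 f x)"
    "linear (ex01 f)"
proof -
  show l: "linear (ex01 f)"
    unfolding ex01_def
    by (intro linearI)
       (simp_all add: linear_add[OF assms] scaleC_add_right linear_scale[OF assms] scaleC_scaleR
         scaleR_add_right)
  have i: "ex01 f (scaleC \<i> x) = - scaleC \<i> (ex01 f x)" for x
    by (simp add: ex01_def scaleC_scaleR scaleC_add_right linear_neg[OF assms] scaleC_minus_right
        flip: scaleR_minus_right)
  show "ex01 f (x + y) = ex01 f x + ex01 f y" by (rule linear_add[OF l])
  show "ex01 f (scaleC c x) = scaleC (cnj c) (ex01 f x)"
    by (subst (1 2) scaleC_eq) (simp add: linear_add[OF l] linear_scale[OF l] i)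
qed

lemma ex_of_complex_linear:
  assumes "complex_linear f"
  shows "ex10 f v = f v" "ex01 f v = 0"
  by (simp_all add: ex10_def ex01_def complex_linearD(2)[OF assms] flip: scaleR_2)

lemma ex_add:
  "ex10 (\<lambda>v. f v + g v) v = ex10 f v + ex10 g v" "ex01 (\<lambda>v. f v + g v) v = ex01 f v + ex01 g v"
  by (simp_all add: ex10_def ex01_def scaleC_add_right scaleR_add_right scaleR_diff_right)

lemma ex_diff:
  "ex10 (\<lambda>v. f v - g v) v = ex10 f v - ex10 g v" "ex01 (\<lambda>v. f v - g v) v = ex01 f v - ex01 g v"
  by (simp_all add: ex10_def ex01_def scaleC_diff_right scaleR_add_right scaleR_diff_right)

lemma ex_minus:
  "ex10 (\<lambda>v. - f v) v = - ex10 f v" "ex01 (\<lambda>v. - f v) v = - ex01 f v"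
  by (simp_all add: ex10_def ex01_def scaleC_minus_right scaleR_diff_right scaleR_add_right)

lemma ex_complex_linear_comp:
  assumes "complex_linear L"
  shows "ex10 (\<lambda>v. L (f v)) v = L (ex10 f v)" "ex01 (\<lambda>v. L (f v)) v = L (ex01 f v)"
  by (simp_all add: ex10_def ex01_def complex_linearD[OF assms])

lemma ex_scaleC:
  "ex10 (\<lambda>v. scaleC c (f v)) v = scaleC c (ex10 f v)" "ex01 (\<lambda>v. scaleC c (f v)) v = scaleC c (ex01 f v)"
  by (rule ex_complex_linear_comp, simp add: complex_linear_def scaleC_add_right scaleC_scaleC mult.commute)+

lemma complex_linear_mult: "complex_linear (\<lambda>z::complex. c * z)"
  by (simp add: complex_linear_def scaleC_complex_def algebra_simps)

lemma ex_mult: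
  fixes f :: "'a::complex_normed_vector \<Rightarrow> complex"
  shows "ex10 (\<lambda>v. c * f v) v = c * ex10 f v" "ex01 (\<lambda>v. c * f v) v = c * ex01 f v"
    "ex10 (\<lambda>v. f v * c) v = ex10 f v * c" "ex01 (\<lambda>v. f v * c) v = ex01 f v * c"
  using ex_scaleC[of c f v] by (simp_all add: scaleC_complex_def mult.commute)

lemma ex_sum_fun:
  "ex10 (\<lambda>v. \<Sum>i\<in>I. f i v) v = (\<Sum>i\<in>I. ex10 (f i) v)" "ex01 (\<lambda>v. \<Sum>i\<in>I. f i v) v = (\<Sum>i\<in>I. ex01 (f i) v)"
  by (simp_all add: ex10_def ex01_def scaleC_sum_right scaleR_sum_right sum.distrib sum_subtractf
      scaleR_add_right scaleR_diff_right)

lemma ex_cnj: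
  "ex10 (\<lambda>v. cnj (f v)) v = cnj (ex01 f v)" "ex01 (\<lambda>v. cnj (f v)) v = cnj (ex10 f v)"
  by (simp_all add: ex10_def ex01_def scaleC_complex_def scaleR_conv_of_real)

lemma ex_zero [simp]: "ex10 (\<lambda>v. 0) v = 0" "ex01 (\<lambda>v. 0) v = 0"
  by (simp_all add: ex10_def ex01_def)

abbreviation D10 :: "('v::complex_normed_vector \<Rightarrow> 'b::complex_normed_vector) \<Rightarrow> 'v \<Rightarrow> 'v \<Rightarrow> 'b" where
  "D10 f p \<equiv> ex10 (dd f p)"

abbreviation D01 :: "('v::complex_normed_vector \<Rightarrow> 'b::complex_normed_vector) \<Rightarrow> 'v \<Rightarrow> 'v \<Rightarrow> 'b" where
  "D01 f p \<equiv> ex01 (dd f p)"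

lemma D_cong_open:
  assumes "open S" "p \<in> S" "\<And>x. x \<in> S \<Longrightarrow> f x = g x"
  shows "D10 f p = D10 g p" "D01 f p = D01 g p"
  by (simp_all add: dd_cong_open[OF assms])

lemma D_diff:
  assumes "f differentiable (at p)" "g differentiable (at p)"
  shows "D10 (\<lambda>x. f x - g x) p u = D10 f p u - D10 g p u" "D01 (\<lambda>x. f x - g x) p u = D01 f p u - D01 g p u"
  by (simp_all add: dd_diff[OF assms, abs_def] ex_diff)

lemma D_const [simp]: "D10 (\<lambda>_. c) p u = 0" "D01 (\<lambda>_. c) p u = 0"
proof -
  have "dd (\<lambda>_. c) p = (\<lambda>_. 0)" by auto
  then show "D10 (\<lambda>_. c) p u = 0" "D01 (\<lambda>_. c) p u = 0" by simp_all
qed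

lemma D_linear:
  assumes "bounded_linear L" "complex_linear L" "f differentiable (at p)"
  shows "D10 (\<lambda>x. L (f x)) p u = L (D10 f p u)" "D01 (\<lambda>x. L (f x)) p u = L (D01 f p u)"
  by (simp_all add: dd_bounded_linear[OF assms(1,3), abs_def] ex_complex_linear_comp[OF assms(2)])

lemma D_cnj:
  assumes "f differentiable (at p)"
  shows "D10 (\<lambda>x. cnj (f x)) p u = cnj (D01 f p u)" "D01 (\<lambda>x. cnj (f x)) p u = cnj (D10 f p u)"
  by (simp_all add: dd_bounded_linear[OF bounded_linear_cnj assms, abs_def] ex_cnj)

lemma D_complex_linear: "f differentiable (at p) \<Longrightarrow> complex_linear (D10 f p)"
  by (rule ex10_complex_linear[OF linear_dd])

lemma D_antilinear:
  assumes "f differentiable (at p)"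
  shows "D01 f p (x + y) = D01 f p x + D01 f p y" "D01 f p (scaleC c x) = scaleC (cnj c) (D01 f p x)"
    "linear (D01 f p)"
  by (rule ex01_antilinear[OF linear_dd[OF assms]])+

lemma smooth_on_D:
  assumes "open S" "smooth_on S f"
  shows "smooth_on S (\<lambda>q. D10 f q a)" "smooth_on S (\<lambda>q. D01 f q a)"
  unfolding ex10_def ex01_def
  by (intro smooth_on_bounded_linear[OF assms(1) bounded_linear_scaleR_right] smooth_on_diff[OF assms(1)]
      smooth_on_add[OF assms(1)] smooth_on_bounded_linear[OF assms(1) bounded_linear_scaleC]
      smooth_on_dd assms(2))+

lemma smooth_mixed:
  assumes "open S" "smooth_on S f" "p \<in> S"
  shows "dd (\<lambda>q. dd f q u) p v = dd (\<lambda>q. dd f q v) p u"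
  by (rule symmetric_mixed_derivatives[OF assms(1,3)])
     (auto intro: smooth_on_differentiable[OF assms(2)] smooth_on_differentiable[OF smooth_on_dd[OF assms(2)] assms(3)])

lemma dd_ex_parameter:
  assumes d: "\<And>u. (\<lambda>q. f q u) differentiable (at p)"
  shows "dd (\<lambda>q. ex10 (f q) a) p b = ex10 (\<lambda>u. dd (\<lambda>q. f q u) p b) a"
    "dd (\<lambda>q. ex01 (f q) a) p b = ex01 (\<lambda>u. dd (\<lambda>q. f q u) p b) a"
    "(\<lambda>q. ex10 (f q) a) differentiable (at p)" "(\<lambda>q. ex01 (f q) a) differentiable (at p)"
proof -
  note dc = differentiable_bounded_linear[OF bounded_linear_scaleC d]
  note ds = differentiable_diff[OF d dc] differentiable_add[OF d dc]
  show "dd (\<lambda>q. ex10 (f q) a) p b = ex10 (\<lambda>u. dd (\<lambda>q. f q u) p b) a"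
    "dd (\<lambda>q. ex01 (f q) a) p b = ex01 (\<lambda>u. dd (\<lambda>q. f q u) p b) a"
    unfolding ex10_def ex01_def
    by (simp_all only: ds[THEN dd_bounded_linear[OF bounded_linear_scaleR_right]]
       dd_add[OF d dc] dd_diff[OF d dc] dd_bounded_linear[OF bounded_linear_scaleC d])
  show "(\<lambda>q. ex10 (f q) a) differentiable (at p)" "(\<lambda>q. ex01 (f q) a) differentiable (at p)"
    unfolding ex10_def ex01_def by (rule differentiable_bounded_linear[OF bounded_linear_scaleR_right]; rule ds)+
qed

lemma dd_ex:
  assumes "open S" "smooth_on S f" "p \<in> S"
  shows "dd (\<lambda>q. D10 f q a) p u = ex10 (\<lambda>a. dd (\<lambda>q. dd f q a) p u) a"
    "dd (\<lambda>q. D01 f q a) p u = ex01 (\<lambda>a. dd (\<lambda>q. dd f q a) p u) a"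
  by (rule dd_ex_parameter smooth_on_differentiable[OF smooth_on_dd[OF assms(2)] assms(3)])+

lemma dd_parameter_complex_linear:
  fixes f :: "'q::real_normed_vector \<Rightarrow> 'a::complex_normed_vector \<Rightarrow> 'b::complex_normed_vector"
  assumes S: "open S" "p \<in> S" and f: "\<And>q. q \<in> S \<Longrightarrow> complex_linear (f q)"
    and d: "\<And>x. (\<lambda>q. f q x) differentiable (at p)"
  shows "complex_linear (\<lambda>x. dd (\<lambda>q. f q x) p u)"
proof (rule complex_linearI_ii)
  show "linear (\<lambda>x. dd (\<lambda>q. f q x) p u)"
    by (rule dd_parameter_linear[OF S complex_linear_linear[OF f] d])
  have "dd (\<lambda>q. f q (scaleC \<i> x)) p = dd (\<lambda>q. scaleC \<i> (f q x)) p" for x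
    by (rule dd_cong_open[OF S]) (rule complex_linearD(2)[OF f])
  then show "dd (\<lambda>q. f q (scaleC \<i> x)) p u = scaleC \<i> (dd (\<lambda>q. f q x) p u)" for x
    by (simp add: dd_bounded_linear[OF bounded_linear_scaleC d])
qed

lemma ex_swap:
  "ex10 (\<lambda>a. ex10 (\<lambda>b. f a b) v) u = ex10 (\<lambda>b. ex10 (\<lambda>a. f a b) u) v"
  "ex10 (\<lambda>a. ex01 (\<lambda>b. f a b) v) u = ex01 (\<lambda>b. ex10 (\<lambda>a. f a b) u) v"
  "ex01 (\<lambda>a. ex01 (\<lambda>b. f a b) v) u = ex01 (\<lambda>b. ex01 (\<lambda>a. f a b) u) v"
  by (simp_all add: ex10_def ex01_def scaleC_add_right scaleC_diff_right scaleC_scaleR algebra_simps)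

lemma D_commute:
  assumes "open S" "smooth_on S f" "p \<in> S"
  shows "D10 (\<lambda>q. D01 f q b) p a = D01 (\<lambda>q. D10 f q a) p b"
    "D10 (\<lambda>q. D10 f q b) p a = D10 (\<lambda>q. D10 f q a) p b"
    "D01 (\<lambda>q. D01 f q b) p a = D01 (\<lambda>q. D01 f q a) p b"
  unfolding dd_ex[OF assms, abs_def]
  by (subst ex_swap, simp add: smooth_mixed[OF assms])+

section \<open>Hermitian metrics\<close>

subsection \<open>Solutions of linear systems depending on a parameter\<close>

lemma vec_axis_sum: "(\<Sum>i\<in>UNIV. axis i (x $ i)) = (x :: complex^'n)"
  by (simp add: vec_eq_iff axis_def if_distrib cong: if_cong)

lemma bounded_linear_axis: "bounded_linear (\<lambda>c. axis i c :: complex^'n)"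
  by (rule findim_linear_bounded[OF findim_euclidean], rule linearI) (simp_all add: axis_def vec_eq_iff)

lemma differentiable_vec:
  fixes f :: "'q::real_normed_vector \<Rightarrow> complex^'n"
  assumes "\<And>i. (\<lambda>q. f q $ i) differentiable (at p)"
  shows "f differentiable (at p)"
proof -
  have "(\<lambda>q. \<Sum>i\<in>UNIV. axis i (f q $ i)) differentiable (at p)"
    by (intro differentiable_sum_fun differentiable_bounded_linear[OF bounded_linear_axis] assms)
  then show ?thesis by (simp add: vec_axis_sum)
qed

lemma differentiable_det:
  fixes A :: "'q::real_normed_vector \<Rightarrow> complex^'n^'n"
  assumes A: "\<And>i j. (\<lambda>q. A q $ i $ j) differentiable (at p)"
  shows "(\<lambda>q. det (A q)) differentiable (at p)"
proof -
  have "(\<lambda>q. \<Prod>i\<in>I. A q $ i $ \<pi> i) differentiable (at p)" if "finite I" for I \<pi>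
    using that by (induction I) (auto intro: differentiable_mult A)
  then show ?thesis unfolding det_def by (intro differentiable_sum_fun differentiable_mult) auto
qed

lemma differentiable_linear_system:
  fixes A :: "'q::real_normed_vector \<Rightarrow> complex^'n^'n" and b :: "'q \<Rightarrow> complex^'n"
  assumes S: "open S" "p \<in> S" and A: "\<And>i j. (\<lambda>q. A q $ i $ j) differentiable (at p)" "\<And>q. q \<in> S \<Longrightarrow> det (A q) \<noteq> 0"
    and b: "\<And>i. (\<lambda>q. b q $ i) differentiable (at p)" and x: "\<And>q. q \<in> S \<Longrightarrow> A q *v x q = b q"
  shows "x differentiable (at p)"
proof -
  let ?x = "\<lambda>q. \<chi> k. det (\<chi> i j. if j = k then b q $ i else A q $ i $ j) / det (A q)"
  have "(\<lambda>q. if j = k then b q $ i else A q $ i $ j) differentiable (at p)" for i j k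
    using A(1) b by (cases "j = k") auto
  then have "(\<lambda>q. det (\<chi> i j. if j = k then b q $ i else A q $ i $ j) / det (A q)) differentiable (at p)" for k
    using A(2)[OF S(2)] by (intro differentiable_divide differentiable_det A(1)) simp_all
  then have "?x differentiable (at p)" by (intro differentiable_vec) simp
  moreover have "x q = ?x q" if "q \<in> S" for q using x[OF that] cramer[OF A(2)[OF that]] by blast
  ultimately show ?thesis using differentiable_cong_open[OF S, of x ?x] by blast
qed

lemma findim_vec: "findim TYPE(complex^'n)"
  by (rule findim_euclidean)

lemma antilinear_eq_by_real_part:
  fixes f g :: "'v::complex_normed_vector \<Rightarrow> complex"
  assumes "\<And>v. f (scaleC \<i> v) = - (\<i> * f v)" "\<And>v. g (scaleC \<i> v) = - (\<i> * g v)"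
    and "\<And>v. Re (f v) = Re (g v)"
  shows "f v = g v"
  using assms(3)[of v] assms(3)[of "scaleC \<i> v"] by (simp add: assms(1,2) complex_eq_iff)

lemma scaleC_scaleR_left: "scaleC (r *\<^sub>R c) (x::'a::complex_normed_vector) = r *\<^sub>R scaleC c x"
  by (simp add: scaleR_conv_of_real flip: scaleC_scaleC) (simp add: scaleC_of_real)

locale hermitian_chart =
  fixes U :: "(complex^'n) set" and m :: "complex^'n \<Rightarrow> complex^'n \<Rightarrow> complex^'n \<Rightarrow> real"
  assumes U: "open U" and m_smooth: "\<And>u v. smooth_on U (\<lambda>q. m q u v)"
    and m_linear: "\<And>q u. q \<in> U \<Longrightarrow> linear (m q u)" and m_sym: "\<And>q u v. q \<in> U \<Longrightarrow> m q u v = m q v u"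
    and m_pos: "\<And>q u. q \<in> U \<Longrightarrow> u \<noteq> 0 \<Longrightarrow> m q u u > 0"
    and m_J: "\<And>q u v. q \<in> U \<Longrightarrow> m q (scaleC \<i> u) (scaleC \<i> v) = m q u v"
begin

abbreviation "J \<equiv> scaleC \<i> :: complex^'n \<Rightarrow> complex^'n"

lemma m_linear_left: "q \<in> U \<Longrightarrow> linear (\<lambda>u. m q u v)"
  using m_linear[of q v] by (simp add: m_sym[of q _ v])

lemma m_J_left: "q \<in> U \<Longrightarrow> m q (J u) v = - m q u (J v)"
  using m_J[of q u "J v"] linear_neg[OF m_linear, of q "J u" v] by simp

text \<open>
  The Hermitian form \<open>g(V, V'\<^sup>*)\<close> of the (1,0)-vectors with components \<open>a\<close> and \<open>b\<close>. The halves come from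
  \<open>V = (a - \<i> J a)/2\<close>, so that the Riemannian metric is twice the real part.
\<close>

definition hm :: "complex^'n \<Rightarrow> complex^'n \<Rightarrow> complex^'n \<Rightarrow> complex" where
  "hm q a b = Complex (m q a b / 2) (m q a (J b) / 2)"

lemma hm_right:
  assumes "q \<in> U"
  shows "hm q a (b + c) = hm q a b + hm q a c" "hm q a (J b) = - (\<i> * hm q a b)" "hm q a (scaleC z b) = cnj z * hm q a b"
    "linear (hm q a)" "hm q a (r *\<^sub>R b) = r *\<^sub>R hm q a b" "hm q a 0 = 0" "hm q a (- b) = - hm q a b"
    "hm q a (sum f I) = (\<Sum>i\<in>I. hm q a (f i))" "hm q a (b - c) = hm q a b - hm q a c"
proof -
  note l = m_linear[OF assms]
  show lin: "linear (hm q a)"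
    by (intro linearI)
       (simp_all add: hm_def complex_eq_iff linear_add[OF l] linear_scale[OF l] scaleC_add_right scaleC_scaleR add_divide_distrib)
  show "hm q a (b + c) = hm q a b + hm q a c" "hm q a (r *\<^sub>R b) = r *\<^sub>R hm q a b" "hm q a 0 = 0" "hm q a (- b) = - hm q a b"
    "hm q a (sum f I) = (\<Sum>i\<in>I. hm q a (f i))" "hm q a (b - c) = hm q a b - hm q a c"
    using lin by (auto simp: linear_add linear_scale linear_0 linear_neg linear_sum linear_diff)
  show J: "hm q a (J b) = - (\<i> * hm q a b)" for b
    by (simp add: hm_def complex_eq_iff linear_neg[OF l])
  show "hm q a (scaleC z b) = cnj z * hm q a b"
    by (subst scaleC_eq) (simp add: linear_add[OF lin] linear_scale[OF lin] J complex_eq_iff)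
qed

lemma hm_cnj: "q \<in> U \<Longrightarrow> cnj (hm q a b) = hm q b a"
  using m_J_left[of q a b] m_sym[of q b "J a"] m_sym[of q b a] by (simp add: hm_def complex_eq_iff)

lemma hm_left:
  assumes "q \<in> U"
  shows "complex_linear (\<lambda>a. hm q a b)" "hm q (a + c) b = hm q a b + hm q c b" "hm q (scaleC z a) b = z * hm q a b"
   "hm q (sum f I) b = (\<Sum>i\<in>I. hm q (f i) b)" "hm q (a - c) b = hm q a b - hm q c b" "hm q (- a) b = - hm q a b" "hm q 0 b = 0"
proof -
  have e: "hm q a b = cnj (hm q b a)" for a using hm_cnj[OF assms, of b a] by simp
  show cl: "complex_linear (\<lambda>a. hm q a b)"
    unfolding complex_linear_def e by (simp add: hm_right[OF assms] scaleC_complex_def)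
  from complex_linearD[OF cl]
  show "hm q (a + c) b = hm q a b + hm q c b" "hm q (scaleC z a) b = z * hm q a b"
   "hm q (sum f I) b = (\<Sum>i\<in>I. hm q (f i) b)" "hm q (a - c) b = hm q a b - hm q c b" "hm q (- a) b = - hm q a b" "hm q 0 b = 0"
    by (simp_all add: scaleC_complex_def)
qed

lemma m_eq_hm: "m q a b = 2 * Re (hm q a b)"
  by (simp add: hm_def)

lemma hm_pos: "q \<in> U \<Longrightarrow> a \<noteq> 0 \<Longrightarrow> Re (hm q a a) > 0"
  by (simp add: hm_def m_pos)

lemma hm_real: "q \<in> U \<Longrightarrow> hm q a a = complex_of_real (Re (hm q a a))"
  using hm_cnj[of q a a] by (simp add: complex_eq_iff)

lemma hm_nondegenerate: "q \<in> U \<Longrightarrow> (\<And>b. hm q a b = 0) \<Longrightarrow> a = 0"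
  using hm_pos[of q a] by fastforce

lemma hm_eqI: "q \<in> U \<Longrightarrow> (\<And>b. hm q a b = hm q c b) \<Longrightarrow> a = c"
  using hm_nondegenerate[of q "a - c"] by (simp add: hm_left)

lemma hm_smooth: "smooth_on U (\<lambda>q. hm q a b)"
proof -
  have "hm q a b = complex_of_real (m q a b / 2) + \<i> * complex_of_real (m q a (J b) / 2)" for q
    by (simp add: hm_def complex_eq_iff)
  moreover have "bounded_linear (\<lambda>x. complex_of_real (x / 2))" "bounded_linear (\<lambda>x. \<i> * complex_of_real (x / 2))"
    by (intro bounded_linear_const_mult bounded_linear_compose[OF bounded_linear_of_real]
        bounded_linear_divide)+
  from smooth_on_add[OF U smooth_on_bounded_linear[OF U this(1) m_smooth] smooth_on_bounded_linear[OF U this(2) m_smooth], of a b a "J b"]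
  show ?thesis by (simp add: calculation)
qed

lemma hm_differentiable: "q \<in> U \<Longrightarrow> (\<lambda>q. hm q a b) differentiable (at q)"
  using smooth_on_differentiable[OF hm_smooth] .

lemma hm_ex: "q \<in> U \<Longrightarrow> ex10 (\<lambda>a. ex01 (\<lambda>b. complex_of_real (m q a b)) b) a = hm q a b"
  by (simp add: ex10_def ex01_def m_J_left m_J linear_neg[OF m_linear] hm_def complex_eq_iff scaleC_complex_def)

lemma wedge_power_continuous: "continuous_on U (\<lambda>q. wedge_power (herm_form m q) k v)"
proof (induction k arbitrary: v)
  case (Suc k)
  have "continuous_on U (\<lambda>q. m q a b)" for a b
    using m_smooth[of a b] unfolding smooth_on_def by (metis Ck_on.simps(1))
  then show ?case
    unfolding wedge_power.simps wedge_def herm_form_def[of m _ "\<lambda>i. v (_ i)"]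
    by (intro continuous_intros Suc) (simp add: herm_form_def)
qed simp

subsection \<open>Unitary frames\<close>

definition unitary :: "complex^'n \<Rightarrow> ('n \<Rightarrow> complex^'n) \<Rightarrow> bool" where
  "unitary q E \<longleftrightarrow> (\<forall>i j. hm q (E i) (E j) = (if i = j then 1 else 0))"

lemma combination_linear: "linear (\<lambda>c::complex^'n. \<Sum>k\<in>S. scaleC (c $ k) (E k :: complex^'n))"
  by (intro linearI) (simp_all add: scaleC_add_left sum.distrib scaleR_sum_right scaleC_scaleR_left)

text \<open>Gram--Schmidt, one index at a time.\<close>

lemma unitary_exists:
  assumes q: "q \<in> U"
  obtains E where "unitary q E"
proof -
  have "\<exists>E. \<forall>i\<in>S. \<forall>j\<in>S. hm q (E i) (E j) = (if i = j then 1 else 0)" for S :: "'n set"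
    using finite[of S]
  proof (induction S rule: finite_induct)
    case empty
    then show ?case by simp
  next
    case (insert s S)
    then obtain E where E: "\<And>i j. i \<in> S \<Longrightarrow> j \<in> S \<Longrightarrow> hm q (E i) (E j) = (if i = j then 1 else 0)" by blast
    let ?T = "\<lambda>c::complex^'n. \<Sum>k\<in>S. scaleC (c $ k) (E k)"
    have "?T (axis s 1) = ?T 0" using insert(2) by (intro sum.cong refl) (auto simp: axis_def)
    moreover have "axis s (1::complex) \<noteq> 0" by (simp add: axis_eq_0_iff)
    ultimately have "\<not> inj ?T" unfolding inj_def by blast
    then have "\<not> surj ?T" using linear_surjective_imp_injective[OF combination_linear] by blast
    then obtain x where x: "x \<notin> range ?T" by blast
    define y where "y = x - ?T (\<chi> k. hm q x (E k))"
    have y0: "y \<noteq> 0"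
    proof
      assume "y = 0"
      then have "x = ?T (\<chi> k. hm q x (E k))" unfolding y_def by (simp only: right_minus_eq)
      then have "x \<in> range ?T" by (rule range_eqI)
      with x show False by contradiction
    qed
    have yE: "hm q y (E l) = 0" if "l \<in> S" for l
      using that insert(1) by (simp add: y_def hm_left[OF q] E if_distrib[of "\<lambda>x. _ * x"] cong: if_cong)
    then have Ey: "hm q (E l) y = 0" if "l \<in> S" for l using hm_cnj[OF q, of y "E l"] that by simp
    define c where "c = complex_of_real (1 / sqrt (Re (hm q y y)))"
    define E' where "E' = E(s := scaleC c y)"
    have "c * (cnj c * hm q y y) = 1"
    proof -
      define r where "r = Re (hm q y y)"
      have r: "r > 0" "hm q y y = complex_of_real r" using hm_pos[OF q y0] hm_real[OF q, of y] by (simp_all add: r_def)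
      have "c * (cnj c * hm q y y) = complex_of_real (1 / sqrt r * (1 / sqrt r * r))"
        by (simp only: c_def r(2) r_def[symmetric] complex_cnj_complex_of_real of_real_mult Re_complex_of_real)
      also have "1 / sqrt r * (1 / sqrt r * r) = 1" using r(1) by (simp add: field_simps)
      finally show ?thesis by simp
    qed
    then have "cnj c * (c * hm q y y) = 1" by (simp add: mult_ac)
    then have "\<forall>i\<in>insert s S. \<forall>j\<in>insert s S. hm q (E' i) (E' j) = (if i = j then 1 else 0)"
      using E yE Ey insert(2) by (auto simp: E'_def hm_left[OF q] hm_right[OF q])
    then show ?case by blast
  qed
  from this[of UNIV] that show thesis unfolding unitary_def by blast
qed

lemma unitary_expand:
  assumes q: "q \<in> U" and E: "unitary q E"
  shows "x = (\<Sum>k\<in>UNIV. scaleC (hm q x (E k)) (E k))"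
proof -
  let ?T = "\<lambda>c::complex^'n. \<Sum>k\<in>UNIV. scaleC (c $ k) (E k)"
  have T: "hm q (?T c) (E l) = c $ l" for c l
    using E unfolding unitary_def by (simp add: hm_left[OF q] if_distrib[of "\<lambda>x. _ * x"] cong: if_cong)
  have "inj ?T"
  proof (rule injI)
    fix c d assume eq: "?T c = ?T d"
    have "c $ l = d $ l" for l using T[of c l] T[of d l] by (simp only: eq)
    then show "c = d" by (simp add: vec_eq_iff)
  qed
  then have "surj ?T" using linear_injective_imp_surjective[OF combination_linear] by blast
  then obtain c where c: "x = ?T c" by blast
  show ?thesis using T[of c] unfolding c by simp
qed

lemma unitary_parseval:
  assumes q: "q \<in> U" and E: "unitary q E"
  shows "hm q x y = (\<Sum>k\<in>UNIV. hm q x (E k) * hm q (E k) y)"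
proof -
  have "hm q x y = hm q (\<Sum>k\<in>UNIV. scaleC (hm q x (E k)) (E k)) y"
    using unitary_expand[OF q E, of x] by simp
  then show ?thesis by (simp add: hm_left[OF q])
qed

lemma unitary_eqI:
  assumes q: "q \<in> U" and E: "unitary q E" and "\<And>k. hm q x (E k) = hm q y (E k)"
  shows "x = y"
  using unitary_expand[OF q E, of x] unitary_expand[OF q E, of y] assms(3) by simp

subsection \<open>Musical isomorphism\<close>

text \<open>The vector of values of \<open>m q w\<close> on the standard basis; surjectivity of this map gives existence of \<open>sharp\<close>.\<close>

definition gram :: "complex^'n \<Rightarrow> complex^'n \<Rightarrow> complex^'n" where
  "gram q w = (\<Sum>b\<in>Basis. m q w b *\<^sub>R b)"

lemma gram_linear: "q \<in> U \<Longrightarrow> linear (gram q)"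
  unfolding gram_def
  by (intro linear_compose_sum ballI linearI)
     (simp_all add: linear_add[OF m_linear_left] linear_scale[OF m_linear_left] scaleR_add_left)

lemma functional_eq_on_Basis:
  fixes f g :: "complex^'n \<Rightarrow> real"
  assumes "linear f" "linear g" "\<And>b. b \<in> Basis \<Longrightarrow> f b = g b"
  shows "f v = g v"
  using linear_eq_on_span[OF assms(1,2), of Basis v] assms(3) by (simp add: span_Basis)

lemma gram_inj: "q \<in> U \<Longrightarrow> inj (gram q)"
proof (rule injI)
  fix x y assume q: "q \<in> U" and eq: "gram q x = gram q y"
  have "m q x b = m q y b" if "b \<in> Basis" for b
    using arg_cong[OF eq, of "\<lambda>z. z \<bullet> b"] that by (simp add: gram_def inner_sum_left inner_Basis if_distrib cong: if_cong)
  then have "m q x v = m q y v" for v using functional_eq_on_Basis[OF m_linear[OF q] m_linear[OF q]] by blast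
  then have "m q (x - y) (x - y) = 0" by (simp add: linear_diff[OF m_linear_left[OF q]])
  then show "x = y" using m_pos[OF q, of "x - y"] by fastforce
qed

lemma sharp_unique:
  assumes q: "q \<in> U" and w: "\<And>v. m q w v = \<alpha> v"
  shows "sharp (m q) \<alpha> = w"
  unfolding sharp_def
proof (rule the_equality)
  fix w' assume "\<forall>v. m q w' v = \<alpha> v"
  then have "m q (w' - w) (w' - w) = 0" using w by (simp add: linear_diff[OF m_linear_left[OF q]])
  then show "w' = w" using m_pos[OF q, of "w' - w"] by fastforce
qed (use w in blast)

lemma sharp_exists:
  assumes q: "q \<in> U" and \<alpha>: "linear \<alpha>"
  shows "m q (sharp (m q) \<alpha>) v = \<alpha> v"
proof -
  have "surj (gram q)" using linear_injective_imp_surjective[OF gram_linear[OF q] gram_inj[OF q]] by simp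
  then obtain w where w: "gram q w = (\<Sum>b\<in>Basis. \<alpha> b *\<^sub>R b)" by (metis surjD)
  have "m q w b = \<alpha> b" if "b \<in> Basis" for b
    using arg_cong[OF w, of "\<lambda>z. z \<bullet> b"] that by (simp add: gram_def inner_sum_left inner_Basis if_distrib cong: if_cong)
  then have "m q w v = \<alpha> v" for v using functional_eq_on_Basis[OF m_linear[OF q] \<alpha>] by blast
  then show ?thesis using sharp_unique[OF q] by metis
qed

text \<open>In complex coordinates \<open>sharp\<close> solves a linear system whose matrix consists of components of the Hermitian form.\<close>

lemma sharp_differentiable:
  assumes p: "p \<in> U" and lin: "\<And>q. q \<in> U \<Longrightarrow> linear (\<alpha> q)" and d: "\<And>v. (\<lambda>q. \<alpha> q v) differentiable (at p)"
  shows "(\<lambda>q. sharp (m q) (\<alpha> q)) differentiable (at p)"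
proof -
  define A :: "complex^'n \<Rightarrow> complex^'n^'n" where "A q = (\<chi> i j. hm q (axis j 1) (axis i 1))" for q
  let ?b = "\<lambda>q. \<chi> i. complex_of_real (\<alpha> q (axis i 1) / 2) + \<i> * complex_of_real (\<alpha> q (J (axis i 1)) / 2) :: complex^'n"
  have axis: "w = (\<Sum>j\<in>UNIV. scaleC (w $ j) (axis j 1))" for w :: "complex^'n"
    by (simp add: vec_eq_iff scaleC_vec_def scaleC_complex_def axis_def if_distrib cong: if_cong)
  have A: "A q *v w = (\<chi> i. hm q w (axis i 1))" if "q \<in> U" for q w
    by (subst (2) axis) (simp add: A_def matrix_vector_mult_def hm_left[OF that] mult.commute)
  have det: "det (A q) \<noteq> 0" if q: "q \<in> U" for q
  proof -
    have "x = y" if "A q *v x = A q *v y" for x y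
    proof (rule hm_eqI[OF q])
      fix b :: "complex^'n"
      have "hm q x (axis i 1) = hm q y (axis i 1)" for i using that by (simp add: A[OF q] vec_eq_iff)
      then have "hm q x (\<Sum>j\<in>UNIV. scaleC (b $ j) (axis j 1)) = hm q y (\<Sum>j\<in>UNIV. scaleC (b $ j) (axis j 1))"
        by (simp add: hm_right[OF q])
      then show "hm q x b = hm q y b" using axis[of b] by simp
    qed
    then show ?thesis
      using matrix_left_invertible_injective[of "A q"] invertible_left_inverse invertible_det_nz by (metis injI)
  qed
  have bl: "bounded_linear (\<lambda>x. complex_of_real (x / 2))" "bounded_linear (\<lambda>x. \<i> * complex_of_real (x / 2))"
    by (intro bounded_linear_const_mult bounded_linear_compose[OF bounded_linear_of_real] bounded_linear_divide)+
  show ?thesis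
  proof (rule differentiable_linear_system[OF U p _ det, where b = ?b])
    show "(\<lambda>q. A q $ i $ j) differentiable (at p)" for i j
      unfolding A_def by (simp add: hm_differentiable[OF p])
    show "(\<lambda>q. ?b q $ i) differentiable (at p)" for i
      using differentiable_add[OF differentiable_bounded_linear[OF bl(1) d] differentiable_bounded_linear[OF bl(2) d]] by simp
    show "A q *v sharp (m q) (\<alpha> q) = ?b q" if "q \<in> U" for q
      by (simp add: A[OF that] vec_eq_iff hm_def complex_eq_iff sharp_exists[OF that lin[OF that]])
  qed
qed

subsection \<open>First derivatives of the metric and the Bismut connection\<close>

abbreviation m1 :: "complex^'n \<Rightarrow> complex^'n \<Rightarrow> complex^'n \<Rightarrow> complex^'n \<Rightarrow> real" where
  "m1 q b c d \<equiv> dd (\<lambda>q. m q c d) q b"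

lemma m_differentiable: "q \<in> U \<Longrightarrow> (\<lambda>q. m q a b) differentiable (at q)"
  using smooth_on_differentiable[OF m_smooth] .

lemma m1_props:
  assumes q: "q \<in> U"
  shows "m1 q b (J c) (J d) = m1 q b c d" "m1 q b (J c) d = - m1 q b c (J d)" "m1 q b c d = m1 q b d c"
    "linear (\<lambda>b. m1 q b c d)" "linear (m1 q b c)" "linear (\<lambda>c. m1 q b c d)"
    "m1 q b c (- d) = - m1 q b c d" "m1 q (- b) c d = - m1 q b c d"
proof -
  note df = m_differentiable[OF q]
  show "m1 q b (J c) (J d) = m1 q b c d"
    using dd_cong_open[OF U q, of "\<lambda>q. m q (J c) (J d)" "\<lambda>q. m q c d"] m_J by simp
  show sym: "m1 q b c d = m1 q b d c" for b c d
    using dd_cong_open[OF U q, of "\<lambda>q. m q c d" "\<lambda>q. m q d c"] m_sym by simp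
  show l1: "linear (\<lambda>b. m1 q b c d)" by (rule linear_dd[OF df])
  show l2: "linear (m1 q b c)" for b c by (rule dd_parameter_linear[OF U q m_linear df])
  have "(\<lambda>c. m1 q b c d) = m1 q b d" using sym by blast
  then show "linear (\<lambda>c. m1 q b c d)" using l2 by simp
  show "m1 q b c (- d) = - m1 q b c d" by (rule linear_neg[OF l2])
  show "m1 q (- b) c d = - m1 q b c d" by (rule linear_neg[OF linear_dd[OF df]])
  show "m1 q b (J c) d = - m1 q b c (J d)"
  proof -
    have "dd (\<lambda>q. m q (J c) d) q = dd (\<lambda>q. - m q c (J d)) q"
      by (rule dd_cong_open[OF U q]) (rule m_J_left)
    then show ?thesis by (simp add: dd_bounded_linear[OF bounded_linear_minus[OF bounded_linear_ident] df])
  qed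
qed

lemma dd_hm: "q \<in> U \<Longrightarrow> dd (\<lambda>q. hm q c d) q b = Complex (m1 q b c d / 2) (m1 q b c (J d) / 2)"
proof -
  assume q: "q \<in> U"
  have "hm q c d = complex_of_real (m q c d / 2) + \<i> * complex_of_real (m q c (J d) / 2)" for q
    by (simp add: hm_def complex_eq_iff)
  moreover have bl: "bounded_linear (\<lambda>x. complex_of_real (x / 2))" "bounded_linear (\<lambda>x. \<i> * complex_of_real (x / 2))"
    by (intro bounded_linear_const_mult bounded_linear_compose[OF bounded_linear_of_real]
        bounded_linear_divide)+
  ultimately have "dd (\<lambda>q. hm q c d) q b = complex_of_real (m1 q b c d / 2) + \<i> * complex_of_real (m1 q b c (J d) / 2)"
    by (simp only: dd_add[OF differentiable_bounded_linear[OF bl(1) m_differentiable[OF q]] differentiable_bounded_linear[OF bl(2) m_differentiable[OF q]]]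
        dd_bounded_linear[OF bl(1) m_differentiable[OF q]] dd_bounded_linear[OF bl(2) m_differentiable[OF q]])
  then show ?thesis by (simp add: complex_eq_iff)
qed

lemma D_hm_vars:
  assumes q: "q \<in> U"
  shows "complex_linear (D10 (\<lambda>q. hm q a b) q)" "D01 (\<lambda>q. hm q a b) q (J c) = - (\<i> * D01 (\<lambda>q. hm q a b) q c)"
    "complex_linear (\<lambda>a. D10 (\<lambda>q. hm q a b) q c)" "complex_linear (\<lambda>a. D01 (\<lambda>q. hm q a b) q c)"
    "D10 (\<lambda>q. hm q a (J b)) q c = - (\<i> * D10 (\<lambda>q. hm q a b) q c)"
    "D01 (\<lambda>q. hm q a (J b)) q c = - (\<i> * D01 (\<lambda>q. hm q a b) q c)"
    "D10 (\<lambda>q. hm q a b) q c = cnj (D01 (\<lambda>q. hm q b a) q c)"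
    "D01 (\<lambda>q. hm q a b) q c = cnj (D10 (\<lambda>q. hm q b a) q c)"
    "linear (\<lambda>b. D10 (\<lambda>q. hm q a b) q c)" "linear (\<lambda>b. D01 (\<lambda>q. hm q a b) q c)"
proof -
  note df = hm_differentiable[OF q]
  show "complex_linear (D10 (\<lambda>q. hm q a b) q)" by (rule D_complex_linear[OF df])
  show "D01 (\<lambda>q. hm q a b) q (J c) = - (\<i> * D01 (\<lambda>q. hm q a b) q c)"
    using D_antilinear(2)[OF df, of a b \<i> c] by (simp add: scaleC_complex_def)
  have c: "complex_linear (\<lambda>a. dd (\<lambda>q. hm q a b) q c)" for b c
    by (rule dd_parameter_complex_linear[OF U q hm_left(1) df])
  show c1: "complex_linear (\<lambda>a. D10 (\<lambda>q. hm q a b) q c)" and c2: "complex_linear (\<lambda>a. D01 (\<lambda>q. hm q a b) q c)" for b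
    unfolding complex_linear_def ex10_def ex01_def complex_linearD(1,2)[OF c]
    by (simp_all add: scaleC_complex_def algebra_simps)
  have cj: "D10 (\<lambda>q. hm q a b) q = D10 (\<lambda>q. cnj (hm q b a)) q" "D01 (\<lambda>q. hm q a b) q = D01 (\<lambda>q. cnj (hm q b a)) q" for a b
    by (rule D_cong_open[OF U q], simp add: hm_cnj)+
  show r1: "D10 (\<lambda>q. hm q a b) q c = cnj (D01 (\<lambda>q. hm q b a) q c)" for a b unfolding cj(1) D_cnj[OF df] ..
  show r2: "D01 (\<lambda>q. hm q a b) q c = cnj (D10 (\<lambda>q. hm q b a) q c)" for a b unfolding cj(2) D_cnj[OF df] ..
  show "D10 (\<lambda>q. hm q a (J b)) q c = - (\<i> * D10 (\<lambda>q. hm q a b) q c)"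
    unfolding r1 complex_linearD(2)[OF c2] by (simp add: scaleC_complex_def)
  show "D01 (\<lambda>q. hm q a (J b)) q c = - (\<i> * D01 (\<lambda>q. hm q a b) q c)"
    unfolding r2 complex_linearD(2)[OF c1] by (simp add: scaleC_complex_def)
  show "linear (\<lambda>b. D10 (\<lambda>q. hm q a b) q c)" unfolding r1[of a]
    by (intro linearI) (simp_all add: complex_linearD[OF c2])
  show "linear (\<lambda>b. D01 (\<lambda>q. hm q a b) q c)" unfolding r2[of a]
    by (intro linearI) (simp_all add: complex_linearD[OF c1])
qed

lemma dc_form_metric:
  assumes q: "q \<in> U"
  shows "dc_form 2 (herm_form_c m) q v = - complex_of_real
    (m1 q (J (v 0)) (J (v 1)) (v 2) - m1 q (J (v 1)) (J (v 0)) (v 2) + m1 q (J (v 2)) (J (v 0)) (v 1))"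
proof -
  have dr: "dd (\<lambda>q. complex_of_real (m q a b)) q = (\<lambda>u. complex_of_real (m1 q u a b))" for a b
    using dd_bounded_linear[OF bounded_linear_of_real m_differentiable[OF q]] by blast
  have d: "\<i> * (ex01 (dd (\<lambda>q. complex_of_real (m q a b)) q) u - ex10 (dd (\<lambda>q. complex_of_real (m q a b)) q) u)
      = - complex_of_real (m1 q (J u) a b)" for a b u
    unfolding dr by (simp add: ex01_def ex10_def scaleC_complex_def complex_eq_iff)
  have "dc_form 2 (herm_form_c m) q v =
      \<i> * (ex01 (dd (\<lambda>q. complex_of_real (m q (J (v 1)) (v 2))) q) (v 0) - ex10 (dd (\<lambda>q. complex_of_real (m q (J (v 1)) (v 2))) q) (v 0))
    - \<i> * (ex01 (dd (\<lambda>q. complex_of_real (m q (J (v 0)) (v 2))) q) (v 1) - ex10 (dd (\<lambda>q. complex_of_real (m q (J (v 0)) (v 2))) q) (v 1))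
    + \<i> * (ex01 (dd (\<lambda>q. complex_of_real (m q (J (v 0)) (v 1))) q) (v 2) - ex10 (dd (\<lambda>q. complex_of_real (m q (J (v 0)) (v 1))) q) (v 2))"
    by (simp add: dc_form_def delbar_form_def del_form_def ext_deriv_def herm_form_def numeral_2_eq_2 algebra_simps)
  then show ?thesis unfolding d by simp
qed

text \<open>
  The Bismut connection with the index lowered by \<open>m\<close>: Christoffel symbols plus the torsion term, the latter
  made explicit by \<open>dc_form_metric\<close>.
\<close>

definition bismut_form :: "complex^'n \<Rightarrow> complex^'n \<Rightarrow> complex^'n \<Rightarrow> complex^'n \<Rightarrow> real" where
  "bismut_form q u v w = (1/2) * (m1 q u v w + m1 q v u w - m1 q w u v
     + m1 q (J u) (J v) w - m1 q (J v) (J u) w + m1 q (J w) (J u) v)"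

lemma bismut_form_linear: "q \<in> U \<Longrightarrow> linear (bismut_form q u v)"
proof -
  assume q: "q \<in> U"
  note l = m1_props(4,5)[OF q]
  have J: "linear (\<lambda>w. m1 q (J w) (J u) v)"
    using linear_compose[OF bounded_linear.linear[OF bounded_linear_scaleC] l(1)] by (simp add: o_def)
  show ?thesis unfolding bismut_form_def
    by (intro linearI) (simp_all add: linear_add[OF J] linear_add[OF l(1)] linear_add[OF l(2)] linear_scale[OF J] linear_scale[OF l(1)] linear_scale[OF l(2)] algebra_simps)
qed

lemma m_bismut: "q \<in> U \<Longrightarrow> m q (bismut m q u v) w = bismut_form q u v w"
proof -
  assume q: "q \<in> U"
  note l = m1_props(4,5)[OF q]
  have J: "linear (\<lambda>w. m1 q (J w) (J u) v)"
    using linear_compose[OF bounded_linear.linear[OF bounded_linear_scaleC] l(1)] by (simp add: o_def)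
  have 1: "linear (\<lambda>w. (1/2) * (m1 q u v w + m1 q v u w - m1 q w u v))"
    by (intro linearI) (simp_all add: linear_add[OF l(1)] linear_add[OF l(2)] linear_scale[OF l(1)] linear_scale[OF l(2)] algebra_simps)
  have 2: "linear (\<lambda>w. Re (dc_form 2 (herm_form_c m) q ((!) [u, v, w])))"
    by (intro linearI) (simp_all add: dc_form_metric[OF q] linear_add[OF J] linear_add[OF l(1)] linear_add[OF l(2)] linear_scale[OF J] linear_scale[OF l(1)] linear_scale[OF l(2)] algebra_simps)
  show ?thesis
    unfolding bismut_def levi_civita_def linear_diff[OF m_linear_left[OF q]] linear_scale[OF m_linear_left[OF q]]
      sharp_exists[OF q 1] sharp_exists[OF q 2]
    by (simp add: dc_form_metric[OF q] bismut_form_def algebra_simps)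
qed

lemma bismut_eq_sharp: "q \<in> U \<Longrightarrow> bismut m q u v = sharp (m q) (bismut_form q u v)"
  using sharp_unique[OF _ m_bismut] by metis

lemma bismut_differentiable:
  assumes p: "p \<in> U"
  shows "(\<lambda>q. bismut m q u v) differentiable (at p)"
proof -
  have "(\<lambda>q. sharp (m q) (bismut_form q u v)) differentiable (at p)"
  proof (rule sharp_differentiable[OF p bismut_form_linear])
    show "(\<lambda>q. bismut_form q u v w) differentiable (at p)" for w
      unfolding bismut_form_def
      by (intro differentiable_mult differentiable_add differentiable_diff
          smooth_on_differentiable[OF smooth_on_dd[OF m_smooth] p]) simp
  qed
  then show ?thesis
    using differentiable_cong_open[OF U p, of "\<lambda>q. bismut m q u v" "\<lambda>q. sharp (m q) (bismut_form q u v)"] bismut_eq_sharp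
    by simp
qed

text \<open>
  The Bismut connection lowered by the Hermitian form. It is complex-linear in the differentiated vector \<open>v\<close>, so
  the connection preserves \<open>J\<close>, and its three terms have definite types.
\<close>

definition bismut_hm :: "complex^'n \<Rightarrow> complex^'n \<Rightarrow> complex^'n \<Rightarrow> complex^'n \<Rightarrow> complex" where
  "bismut_hm q u v w = D10 (\<lambda>q. hm q u w) q v + D01 (\<lambda>q. hm q v w) q u - D01 (\<lambda>q. hm q v u) q w"

lemma hm_bismut:
  assumes q: "q \<in> U"
  shows "hm q (bismut m q u v) w = bismut_hm q u v w"
proof (rule antilinear_eq_by_real_part[where f = "hm q (bismut m q u v)" and g = "bismut_hm q u v"])
  show "hm q (bismut m q u v) (J w) = - (\<i> * hm q (bismut m q u v) w)" for w by (rule hm_right[OF q])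
  show "bismut_hm q u v (J w) = - (\<i> * bismut_hm q u v w)" for w
    by (simp add: bismut_hm_def D_hm_vars(2,5,6)[OF q] algebra_simps)
  fix w
  note p = m1_props[OF q]
  have dh: "dd (\<lambda>q. hm q c d) q = (\<lambda>b. Complex (m1 q b c d / 2) (m1 q b c (J d) / 2))" for c d
    using dd_hm[OF q] by blast
  have "2 * Re (hm q (bismut m q u v) w) = bismut_form q u v w"
    using m_bismut[OF q, of u v w] by (simp add: m_eq_hm)
  also have "\<dots> = 2 * Re (bismut_hm q u v w)"
    unfolding bismut_hm_def bismut_form_def dh
    using p(3)[where b = w and c = u and d = v] p(3)[where b = "J w" and c = "J u" and d = v]
      p(2)[where b = "J w" and c = u and d = v]
    by (simp add: ex10_def ex01_def scaleC_complex_def p(2,7) add_divide_distrib diff_divide_distrib)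
  finally show "Re (hm q (bismut m q u v) w) = Re (bismut_hm q u v w)" by simp
qed

lemma bismut_complex_linear: "q \<in> U \<Longrightarrow> complex_linear (bismut m q u)"
  unfolding complex_linear_def
proof (intro conjI allI)
  fix x y c assume q: "q \<in> U"
  note l = complex_linearD[OF D_hm_vars(1)[OF q]] complex_linearD[OF D_hm_vars(4)[OF q]]
  show "bismut m q u (x + y) = bismut m q u x + bismut m q u y"
    by (rule hm_eqI[OF q]) (simp add: hm_left[OF q] hm_bismut[OF q] bismut_hm_def l)
  show "bismut m q u (scaleC c x) = scaleC c (bismut m q u x)"
    by (rule hm_eqI[OF q]) (simp add: hm_left[OF q] hm_bismut[OF q] bismut_hm_def l scaleC_complex_def algebra_simps)
qed

end

section \<open>Ricci form and pluriclosedness in a unitary frame\<close>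

lemma ex_split_types:
  fixes f :: "'v::complex_normed_vector \<Rightarrow> complex"
  assumes "\<And>v. f v = P v + N v" "\<And>v. P (scaleC \<i> v) = \<i> * P v" "\<And>v. N (scaleC \<i> v) = - (\<i> * N v)"
  shows "ex10 f v = P v" "ex01 f v = N v"
  by (simp_all add: ex10_def ex01_def assms scaleC_complex_def scaleR_conv_of_real algebra_simps)

locale unitary_frame_at = hermitian_chart U m for U :: "(complex^'n) set" and m +
  fixes p :: "complex^'n" and E :: "'n \<Rightarrow> complex^'n"
  assumes p: "p \<in> U" and E: "unitary p E"
begin

lemma hm_E [simp]: "hm p (E i) (E j) = (if i = j then 1 else 0)"
  using E unfolding unitary_def by blast

lemma expand: "x = (\<Sum>k\<in>UNIV. scaleC (hm p x (E k)) (E k))"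
  by (rule unitary_expand[OF p E])

lemma bounded_linear_hm_left: "bounded_linear (\<lambda>x. hm p x b)"
  using complex_linear_linear[OF hm_left(1)[OF p]] linear_conv_bounded_linear by blast

text \<open>
  The derivative along \<open>u\<close> of the complex trace of the Bismut connection form in the direction \<open>v\<close>. Commutators
  have trace zero, so \<open>W u v - W v u\<close> is the trace of the curvature, and \<open>\<i>\<close> times it is the Ricci form. Traces
  are taken with the form at the point \<open>p\<close>, which is the usual trace as \<open>E\<close> is unitary there.
\<close>

definition W :: "complex^'n \<Rightarrow> complex^'n \<Rightarrow> complex" where
  "W u v = dd (\<lambda>q. \<Sum>k\<in>UNIV. hm p (bismut m q v (E k)) (E k)) p u"

lemma dd_hm_expand:
  "dd (\<lambda>q. hm q x b) p u = (\<Sum>t\<in>UNIV. hm p x (E t) * dd (\<lambda>q. hm q (E t) b) p u)"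
proof -
  have "dd (\<lambda>q. hm q x b) p = dd (\<lambda>q. \<Sum>t\<in>UNIV. hm p x (E t) * hm q (E t) b) p"
  proof (rule dd_cong_open[OF U p])
    fix q assume q: "q \<in> U"
    have "hm q x b = hm q (\<Sum>k\<in>UNIV. scaleC (hm p x (E k)) (E k)) b" using expand[of x] by simp
    then show "hm q x b = (\<Sum>t\<in>UNIV. hm p x (E t) * hm q (E t) b)" by (simp add: hm_left[OF q])
  qed
  then show ?thesis
    by (simp only: dd_sum[OF differentiable_bounded_linear[OF bounded_linear_mult_right hm_differentiable[OF p]]]
        dd_bounded_linear[OF bounded_linear_mult_right hm_differentiable[OF p]])
qed

lemma dd_hm_vector:
  assumes X: "X differentiable (at p)"
  shows "dd (\<lambda>q. hm q (X q) b) p u = dd (\<lambda>q. hm q (X p) b) p u + hm p (dd X p u) b"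
proof -
  have "((\<lambda>t. hm t (X t) b) has_derivative
    (\<lambda>u. dd (\<lambda>q. hm q (X p) b) p u + hm p (dd X p u) b)) (at p)"
    by (rule has_derivative_parametrised_linear[OF findim_vec U, where x = "\<lambda>q. q" and G = "\<lambda>q w. hm q w b"])
       (use p hm_differentiable[OF p] complex_linear_linear[OF hm_left(1)] has_derivative_dd[OF X] in auto)
  then show ?thesis by (rule dd_eq)
qed

lemma W_eq: "W u v = (\<Sum>k\<in>UNIV. dd (\<lambda>q. bismut_hm q v (E k) (E k)) p u
    - (\<Sum>t\<in>UNIV. dd (\<lambda>q. hm q (E t) (E k)) p u * bismut_hm p v (E k) (E t)))"
proof -
  have d: "(\<lambda>q. hm p (bismut m q v (E k)) (E k)) differentiable (at p)" for k
    by (rule differentiable_bounded_linear[OF bounded_linear_hm_left bismut_differentiable[OF p]])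
  have "hm p (dd (\<lambda>q. bismut m q v (E k)) p u) (E k) = dd (\<lambda>q. bismut_hm q v (E k) (E k)) p u
    - (\<Sum>t\<in>UNIV. dd (\<lambda>q. hm q (E t) (E k)) p u * bismut_hm p v (E k) (E t))" for k
  proof -
    have "dd (\<lambda>q. bismut_hm q v (E k) (E k)) p = dd (\<lambda>q. hm q (bismut m q v (E k)) (E k)) p"
      by (rule dd_cong_open[OF U p]) (simp add: hm_bismut)
    then show ?thesis
      using dd_hm_vector[OF bismut_differentiable[OF p], of v "E k" "E k" u]
      by (simp add: dd_hm_expand[of "bismut m p v (E k)"] hm_bismut[OF p] mult.commute)
  qed
  then show ?thesis
    unfolding W_def dd_sum[OF d] dd_bounded_linear[OF bounded_linear_hm_left bismut_differentiable[OF p]] by simp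
qed

lemma trace_curvature:
  "(\<Sum>k\<in>UNIV. hm p (vb_curvature (bismut m) p u v (E k)) (E k)) = W u v - W v u"
proof -
  have d: "(\<lambda>q. hm p (bismut m q v (E k)) (E k)) differentiable (at p)" for k v
    by (rule differentiable_bounded_linear[OF bounded_linear_hm_left bismut_differentiable[OF p]])
  have W: "W u v = (\<Sum>k\<in>UNIV. hm p (dd (\<lambda>q. bismut m q v (E k)) p u) (E k))" for u v
    unfolding W_def dd_sum[OF d] dd_bounded_linear[OF bounded_linear_hm_left bismut_differentiable[OF p]] ..
  have comm: "(\<Sum>k\<in>UNIV. hm p (bismut m p u (bismut m p v (E k))) (E k))
    = (\<Sum>k\<in>UNIV. \<Sum>l\<in>UNIV. hm p (bismut m p v (E k)) (E l) * hm p (bismut m p u (E l)) (E k))" for u v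
  proof (rule sum.cong[OF refl])
    fix k
    have "hm p (bismut m p u (bismut m p v (E k))) (E k)
      = hm p (bismut m p u (\<Sum>l\<in>UNIV. scaleC (hm p (bismut m p v (E k)) (E l)) (E l))) (E k)"
      using expand[of "bismut m p v (E k)"] by simp
    also have "\<dots> = (\<Sum>l\<in>UNIV. hm p (bismut m p v (E k)) (E l) * hm p (bismut m p u (E l)) (E k))"
      by (simp add: complex_linearD(2,7)[OF bismut_complex_linear[OF p]] hm_left[OF p])
    finally show "hm p (bismut m p u (bismut m p v (E k))) (E k)
      = (\<Sum>l\<in>UNIV. hm p (bismut m p v (E k)) (E l) * hm p (bismut m p u (E l)) (E k))" .
  qed
  have "(\<Sum>k\<in>UNIV. hm p (bismut m p u (bismut m p v (E k))) (E k))
    = (\<Sum>k\<in>UNIV. hm p (bismut m p v (bismut m p u (E k))) (E k))"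
    unfolding comm by (subst sum.swap) (simp add: mult.commute)
  then show ?thesis
    unfolding vb_curvature_def W
    by (simp add: hm_left[OF p] sum.distrib sum_subtractf)
qed

definition frame_enum :: "nat \<Rightarrow> 'n" where
  "frame_enum = (SOME f. bij_betw f {..<CARD('n)} UNIV)"

lemma frame_enum: "bij_betw frame_enum {..<CARD('n)} UNIV"
proof -
  have "\<exists>f. bij_betw f {..<CARD('n)} (UNIV :: 'n set)"
    using ex_bij_betw_nat_finite[of "UNIV :: 'n set"] by (simp add: atLeast0LessThan)
  then show ?thesis unfolding frame_enum_def by (rule someI_ex)
qed

text \<open>The factor makes the frame orthonormal: \<open>E k\<close> and \<open>J (E k)\<close> have length \<open>sqrt 2\<close> for \<open>m\<close>.\<close>

definition real_frame :: "nat \<Rightarrow> complex^'n" where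
  "real_frame j = (if j < CARD('n) then (1 / sqrt 2) *\<^sub>R E (frame_enum j)
     else (1 / sqrt 2) *\<^sub>R J (E (frame_enum (j - CARD('n)))))"

lemma m_E: "m p (E i) (E j) = (if i = j then 2 else 0)" "m p (J (E i)) (E j) = 0" "m p (E i) (J (E j)) = 0"
  "m p (J (E i)) (J (E j)) = (if i = j then 2 else 0)"
  by (simp_all add: m_eq_hm hm_left[OF p] hm_right[OF p])

lemma m_scale: "m p (r *\<^sub>R x) y = r * m p x y" "m p x (r *\<^sub>R y) = r * m p x y"
  using linear_scale[OF m_linear[OF p]] linear_scale[OF m_linear_left[OF p]] by auto

lemma real_frame_orthonormal: "orthonormal_frame (m p) (2 * CARD('n)) real_frame"
  unfolding orthonormal_frame_def
proof (intro allI impI)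
  fix i j assume ij: "i < 2 * CARD('n)" "j < 2 * CARD('n)"
  have inj: "frame_enum a = frame_enum b \<longleftrightarrow> a = b" if "a < CARD('n)" "b < CARD('n)" for a b
    using frame_enum that by (auto simp: bij_betw_def inj_on_def)
  show "m p (real_frame i) (real_frame j) = (if i = j then 1 else 0)"
    using ij inj[of i j] inj[of "i - CARD('n)" "j - CARD('n)"]
    by (auto simp: real_frame_def m_scale m_E field_simps)
qed

lemma sum_real_frame:
  "(\<Sum>j<2 * CARD('n). f (real_frame j)) = (\<Sum>k\<in>UNIV. f ((1 / sqrt 2) *\<^sub>R E k) + f ((1 / sqrt 2) *\<^sub>R J (E k)))"
  for f :: "complex^'n \<Rightarrow> real"
proof -
  let ?n = "CARD('n)"
  have "(\<Sum>j<2 * ?n. f (real_frame j)) = (\<Sum>j<?n. f (real_frame j)) + (\<Sum>j<?n. f (real_frame (j + ?n)))"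
  proof -
    have "(\<Sum>j<?n + k. f (real_frame j)) = (\<Sum>j<?n. f (real_frame j)) + (\<Sum>j<k. f (real_frame (j + ?n)))" for k
      by (induction k) (simp_all add: add.commute)
    from this[of ?n] show ?thesis by (simp add: mult_2)
  qed
  also have "\<dots> = (\<Sum>j<?n. f ((1 / sqrt 2) *\<^sub>R E (frame_enum j)) + f ((1 / sqrt 2) *\<^sub>R J (E (frame_enum j))))"
    by (simp add: real_frame_def sum.distrib)
  also have "\<dots> = (\<Sum>k\<in>UNIV. f ((1 / sqrt 2) *\<^sub>R E k) + f ((1 / sqrt 2) *\<^sub>R J (E k)))"
    by (rule sum.reindex_bij_betw[OF frame_enum])
  finally show ?thesis .
qed

lemma curvature_bismut_complex_linear: "complex_linear (vb_curvature (bismut m) p u v)"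
proof -
  note l = complex_linearD[OF dd_parameter_complex_linear[OF U p bismut_complex_linear bismut_differentiable[OF p]]]
    complex_linearD[OF bismut_complex_linear[OF p]]
  show ?thesis
    unfolding complex_linear_def vb_curvature_def by (simp add: l scaleC_add_right scaleC_diff_right)
qed

lemma ricci_real_part:
  "bismut_ricci m (2 * CARD('n)) real_frame p u v = Re (\<i> * (W u v - W v u))"
proof -
  let ?R = "vb_curvature (bismut m) p u v"
  note l = complex_linearD[OF curvature_bismut_complex_linear]
  have "bismut_ricci m (2 * CARD('n)) real_frame p u v =
    (1/2) * (\<Sum>k\<in>UNIV. m p (?R (J ((1 / sqrt 2) *\<^sub>R E k))) ((1 / sqrt 2) *\<^sub>R E k)
      + m p (?R (J ((1 / sqrt 2) *\<^sub>R J (E k)))) ((1 / sqrt 2) *\<^sub>R J (E k)))"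
    unfolding bismut_ricci_def by (subst sum_real_frame) simp
  also have "\<dots> = (1/2) * (\<Sum>k\<in>UNIV. (1/2) * m p (J (?R (E k))) (E k) - (1/2) * m p (?R (E k)) (J (E k)))"
    by (simp add: scaleC_scaleR l(2,4,6) m_scale linear_neg[OF m_linear_left[OF p]] power_divide flip: power2_eq_square)
  also have "\<dots> = (\<Sum>k\<in>UNIV. Re (\<i> * hm p (?R (E k)) (E k)))"
    by (simp add: m_eq_hm hm_right[OF p] hm_left(3)[OF p] sum_distrib_left)
  also have "\<dots> = Re (\<i> * (W u v - W v u))"
    unfolding trace_curvature[symmetric] by (simp add: sum_distrib_left)
  finally show ?thesis .
qed

lemma bismut_hm_metric:
  assumes q: "q \<in> U"
  shows "bismut_hm q v a b + cnj (bismut_hm q v b a) = dd (\<lambda>q. hm q a b) q v"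
proof -
  have "dd (\<lambda>q. hm q a b) q v = D10 (\<lambda>q. hm q a b) q v + D01 (\<lambda>q. hm q a b) q v"
    by (simp add: ex_sum)
  then show ?thesis
    using D_hm_vars(7)[OF q, of v a b] D_hm_vars(7)[OF q, of a b v] D_hm_vars(8)[OF q, of a v b] D_hm_vars(7)[OF q, of v b a]
      D_hm_vars(7)[OF q, of a v b] D_hm_vars(8)[OF q, of v b a] D_hm_vars(8)[OF q, of b v a]
    by (simp add: bismut_hm_def)
qed

lemma bismut_hm_differentiable: "(\<lambda>q. bismut_hm q v a b) differentiable (at p)"
  unfolding bismut_hm_def
  by (intro differentiable_add differentiable_diff smooth_on_differentiable[OF smooth_on_D(1)[OF U hm_smooth] p]
      smooth_on_differentiable[OF smooth_on_D(2)[OF U hm_smooth] p])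

text \<open>
  By compatibility with the metric, the real part of \<open>W u v\<close> consists of second derivatives of the metric and a
  product of first ones, both symmetric in \<open>u\<close> and \<open>v\<close>.
\<close>

lemma W_imaginary: "W u v - W v u + cnj (W u v - W v u) = 0"
proof -
  have sym: "W u v + cnj (W u v) = (\<Sum>k\<in>UNIV. dd (\<lambda>q. dd (\<lambda>q. hm q (E k) (E k)) q v) p u)
      - (\<Sum>k\<in>UNIV. \<Sum>t\<in>UNIV. dd (\<lambda>q. hm q (E t) (E k)) p u * dd (\<lambda>q. hm q (E k) (E t)) p v)" for u v
  proof -
    have 1: "dd (\<lambda>q. bismut_hm q v (E k) (E k)) p u + cnj (dd (\<lambda>q. bismut_hm q v (E k) (E k)) p u)
        = dd (\<lambda>q. dd (\<lambda>q. hm q (E k) (E k)) q v) p u" for k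
    proof -
      note d = bismut_hm_differentiable
      have "dd (\<lambda>q. dd (\<lambda>q. hm q (E k) (E k)) q v) p
        = dd (\<lambda>q. bismut_hm q v (E k) (E k) + cnj (bismut_hm q v (E k) (E k))) p"
        by (rule dd_cong_open[OF U p]) (rule bismut_hm_metric[symmetric])
      then show ?thesis
        by (simp add: dd_add[OF d differentiable_bounded_linear[OF bounded_linear_cnj d]] dd_bounded_linear[OF bounded_linear_cnj d])
    qed
    have cj: "cnj (dd (\<lambda>q. hm q a b) p u) = dd (\<lambda>q. hm q b a) p u" for a b
    proof -
      have "dd (\<lambda>q. hm q b a) p = dd (\<lambda>q. cnj (hm q a b)) p"
        by (rule dd_cong_open[OF U p]) (simp add: hm_cnj)
      then show ?thesis by (simp add: dd_bounded_linear[OF bounded_linear_cnj hm_differentiable[OF p]])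
    qed
    have 2: "(\<Sum>k\<in>UNIV. \<Sum>t\<in>UNIV. dd (\<lambda>q. hm q (E t) (E k)) p u * bismut_hm p v (E k) (E t))
        + (\<Sum>k\<in>UNIV. \<Sum>t\<in>UNIV. cnj (dd (\<lambda>q. hm q (E t) (E k)) p u * bismut_hm p v (E k) (E t)))
        = (\<Sum>k\<in>UNIV. \<Sum>t\<in>UNIV. dd (\<lambda>q. hm q (E t) (E k)) p u * dd (\<lambda>q. hm q (E k) (E t)) p v)"
    proof -
      have "(\<Sum>k\<in>UNIV. \<Sum>t\<in>UNIV. cnj (dd (\<lambda>q. hm q (E t) (E k)) p u * bismut_hm p v (E k) (E t)))
        = (\<Sum>k\<in>UNIV. \<Sum>t\<in>UNIV. dd (\<lambda>q. hm q (E t) (E k)) p u * cnj (bismut_hm p v (E t) (E k)))"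
        by (subst sum.swap) (simp add: cj)
      then show ?thesis
        by (simp add: distrib_left flip: sum.distrib bismut_hm_metric[OF p])
    qed
    have "W u v + cnj (W u v) = (\<Sum>k\<in>UNIV. dd (\<lambda>q. bismut_hm q v (E k) (E k)) p u + cnj (dd (\<lambda>q. bismut_hm q v (E k) (E k)) p u))
       - ((\<Sum>k\<in>UNIV. \<Sum>t\<in>UNIV. dd (\<lambda>q. hm q (E t) (E k)) p u * bismut_hm p v (E k) (E t))
        + (\<Sum>k\<in>UNIV. \<Sum>t\<in>UNIV. cnj (dd (\<lambda>q. hm q (E t) (E k)) p u * bismut_hm p v (E k) (E t))))"
      unfolding W_eq by (simp add: sum.distrib sum_subtractf)
    then show ?thesis unfolding 1 2 .
  qed
  have s1: "(\<Sum>k\<in>UNIV. dd (\<lambda>q. dd (\<lambda>q. hm q (E k) (E k)) q v) p u) = (\<Sum>k\<in>UNIV. dd (\<lambda>q. dd (\<lambda>q. hm q (E k) (E k)) q u) p v)"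
    by (simp add: smooth_mixed[OF U hm_smooth p])
  have s2: "(\<Sum>k\<in>UNIV. \<Sum>t\<in>UNIV. dd (\<lambda>q. hm q (E t) (E k)) p u * dd (\<lambda>q. hm q (E k) (E t)) p v)
    = (\<Sum>k\<in>UNIV. \<Sum>t\<in>UNIV. dd (\<lambda>q. hm q (E t) (E k)) p v * dd (\<lambda>q. hm q (E k) (E t)) p u)"
    by (subst sum.swap) (simp add: mult.commute)
  have "W u v + cnj (W u v) = W v u + cnj (W v u)"
    unfolding sym[of u v] sym[of v u] s1 s2 ..
  then show ?thesis by (simp add: algebra_simps)
qed

lemma ricci_eq: "complex_of_real (bismut_ricci m (2 * CARD('n)) real_frame p u v) = \<i> * (W u v - W v u)"
proof -
  have "Re (W u v - W v u) = 0"
    using arg_cong[OF W_imaginary[of u v], of Re] by simp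
  then show ?thesis unfolding ricci_real_part by (simp add: complex_eq_iff)
qed

subsection \<open>Components\<close>

text \<open>
  In the frame \<open>E\<close>, \<open>h1 c k l = \<partial>\<^sub>c h\<^sub>k\<^sub>l\<close> and \<open>hB c d k l = \<partial>\<^sub>c \<partial>\<^sub>d h\<^sub>k\<^sub>l\<close>, while in \<open>hA c d k l\<close> the derivative in the
  direction \<open>c\<close> has type (0,1). The second index of \<open>h\<close> is the conjugate one.
\<close>

definition h1 :: "'n \<Rightarrow> 'n \<Rightarrow> 'n \<Rightarrow> complex" where
  "h1 c k l = D10 (\<lambda>q. hm q (E k) (E l)) p (E c)"

definition hA :: "'n \<Rightarrow> 'n \<Rightarrow> 'n \<Rightarrow> 'n \<Rightarrow> complex" where
  "hA c d k l = D01 (\<lambda>q. D10 (\<lambda>q. hm q (E k) (E l)) q (E d)) p (E c)"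

definition hB :: "'n \<Rightarrow> 'n \<Rightarrow> 'n \<Rightarrow> 'n \<Rightarrow> complex" where
  "hB c d k l = D10 (\<lambda>q. D10 (\<lambda>q. hm q (E k) (E l)) q (E d)) p (E c)"

lemma hB_sym: "hB c d k l = hB d c k l"
  unfolding hB_def by (rule D_commute(2)[OF U hm_smooth p])

lemma hA_alt: "hA c d k l = D10 (\<lambda>q. D01 (\<lambda>q. hm q (E k) (E l)) q (E c)) p (E d)"
  unfolding hA_def by (rule D_commute(1)[OF U hm_smooth p, symmetric])

lemma hb1: "D01 (\<lambda>q. hm q (E k) (E l)) p (E c) = cnj (h1 c l k)"
  unfolding h1_def by (rule D_hm_vars(8)[OF p])

lemma D_hm_differentiable:
  "(\<lambda>q. D10 (\<lambda>q. hm q a b) q c) differentiable (at p)" "(\<lambda>q. D01 (\<lambda>q. hm q a b) q c) differentiable (at p)"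
  by (rule smooth_on_differentiable[OF smooth_on_D(1)[OF U hm_smooth] p],
      rule smooth_on_differentiable[OF smooth_on_D(2)[OF U hm_smooth] p])

lemma dd_scale_i:
  assumes "f differentiable (at p)"
  shows "dd (\<lambda>q. \<i> * f q) p u = \<i> * dd f p u" "dd (\<lambda>q. - (\<i> * f q)) p u = - (\<i> * dd f p u)"
  using dd_bounded_linear[OF bounded_linear_mult_right assms, of \<i> u]
    dd_bounded_linear[OF bounded_linear_minus[OF bounded_linear_mult_right] assms, of \<i> u] by simp_all

lemma bismut_hm_types:
  "ex10 (\<lambda>v. dd (\<lambda>q. bismut_hm q v a b) p u) v = dd (\<lambda>q. D10 (\<lambda>q. hm q v b) q a) p u"
  "ex01 (\<lambda>v. dd (\<lambda>q. bismut_hm q v a b) p u) v = dd (\<lambda>q. D01 (\<lambda>q. hm q a b) q v - D01 (\<lambda>q. hm q a v) q b) p u"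
proof -
  define P where "P v = dd (\<lambda>q. D10 (\<lambda>q. hm q v b) q a) p u" for v
  define N where "N v = dd (\<lambda>q. D01 (\<lambda>q. hm q a b) q v - D01 (\<lambda>q. hm q a v) q b) p u" for v
  note d = D_hm_differentiable
  have s: "dd (\<lambda>q. bismut_hm q v a b) p u = P v + N v" for v
    unfolding bismut_hm_def P_def N_def
    by (simp add: dd_add[OF differentiable_add[OF d(1) d(2)] d(2)] dd_add[OF d(1) d(2)] dd_diff[OF differentiable_add[OF d(1) d(2)] d(2)] dd_diff[OF d(2) d(2)])
  have P: "P (J v) = \<i> * P v" for v
  proof -
    have "dd (\<lambda>q. D10 (\<lambda>q. hm q (J v) b) q a) p = dd (\<lambda>q. \<i> * D10 (\<lambda>q. hm q v b) q a) p"
      by (rule dd_cong_open[OF U p]) (simp add: complex_linearD(2)[OF D_hm_vars(3)] scaleC_complex_def)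
    then show ?thesis unfolding P_def by (simp add: dd_scale_i[OF d(1)])
  qed
  have N: "N (J v) = - (\<i> * N v)" for v
  proof -
    have "dd (\<lambda>q. D01 (\<lambda>q. hm q a b) q (J v) - D01 (\<lambda>q. hm q a (J v)) q b) p
        = dd (\<lambda>q. - (\<i> * (D01 (\<lambda>q. hm q a b) q v - D01 (\<lambda>q. hm q a v) q b))) p"
      by (rule dd_cong_open[OF U p]) (simp add: D_hm_vars(2,6) algebra_simps)
    then show ?thesis unfolding N_def by (simp add: dd_scale_i[OF differentiable_diff[OF d(2) d(2)]])
  qed
  show "ex10 (\<lambda>v. dd (\<lambda>q. bismut_hm q v a b) p u) v = dd (\<lambda>q. D10 (\<lambda>q. hm q v b) q a) p u"
    "ex01 (\<lambda>v. dd (\<lambda>q. bismut_hm q v a b) p u) v = dd (\<lambda>q. D01 (\<lambda>q. hm q a b) q v - D01 (\<lambda>q. hm q a v) q b) p u"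
    unfolding P_def[symmetric] N_def[symmetric] by (rule ex_split_types[where P = P and N = N, OF s P N])+
qed

lemma bismut_hm_types0:
  assumes q: "q \<in> U"
  shows "ex10 (\<lambda>v. bismut_hm q v a b) v = D10 (\<lambda>q. hm q v b) q a"
  "ex01 (\<lambda>v. bismut_hm q v a b) v = D01 (\<lambda>q. hm q a b) q v - D01 (\<lambda>q. hm q a v) q b"
proof -
  have "bismut_hm q v a b = D10 (\<lambda>q. hm q v b) q a + (D01 (\<lambda>q. hm q a b) q v - D01 (\<lambda>q. hm q a v) q b)" for v
    by (simp add: bismut_hm_def)
  moreover have "D10 (\<lambda>q. hm q (J v) b) q a = \<i> * D10 (\<lambda>q. hm q v b) q a" for v
    by (simp add: complex_linearD(2)[OF D_hm_vars(3)[OF q]] scaleC_complex_def)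
  moreover have "D01 (\<lambda>q. hm q a b) q (J v) - D01 (\<lambda>q. hm q a (J v)) q b
      = - (\<i> * (D01 (\<lambda>q. hm q a b) q v - D01 (\<lambda>q. hm q a v) q b))" for v
    by (simp add: D_hm_vars(2,6)[OF q] algebra_simps)
  ultimately show "ex10 (\<lambda>v. bismut_hm q v a b) v = D10 (\<lambda>q. hm q v b) q a"
    "ex01 (\<lambda>v. bismut_hm q v a b) v = D01 (\<lambda>q. hm q a b) q v - D01 (\<lambda>q. hm q a v) q b"
    by (rule ex_split_types[where P = "\<lambda>v. D10 (\<lambda>q. hm q v b) q a"
        and N = "\<lambda>v. D01 (\<lambda>q. hm q a b) q v - D01 (\<lambda>q. hm q a v) q b"]; assumption)+
qed

text \<open>
  Each term of \<open>bismut_hm\<close> has a definite type in the direction argument, by \<open>bismut_hm_types\<close>; the types of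
  derivatives are then read off.
\<close>

lemma W_types:
  "ex10 (\<lambda>u. ex01 (\<lambda>v. W u v) (E l)) (E k) =
    (\<Sum>s\<in>UNIV. hA l k s s - hA s k s l - (\<Sum>t\<in>UNIV. h1 k t s * (cnj (h1 l t s) - cnj (h1 t l s))))"
  "ex10 (\<lambda>u. ex01 (\<lambda>v. W v u) (E l)) (E k) =
    (\<Sum>s\<in>UNIV. hA l s k s - (\<Sum>t\<in>UNIV. cnj (h1 l s t) * h1 s k t))"
  "ex10 (\<lambda>u. ex10 (\<lambda>v. W u v) (E l)) (E k) =
    (\<Sum>s\<in>UNIV. hB k s l s - (\<Sum>t\<in>UNIV. h1 k t s * h1 s l t))"
proof -
  note d = D_hm_differentiable
  have v01: "ex01 (\<lambda>v. W u v) (E l) = (\<Sum>s\<in>UNIV. dd (\<lambda>q. D01 (\<lambda>q. hm q (E s) (E s)) q (E l) - D01 (\<lambda>q. hm q (E s) (E l)) q (E s)) p u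
     - (\<Sum>t\<in>UNIV. dd (\<lambda>q. hm q (E t) (E s)) p u * (cnj (h1 l t s) - cnj (h1 t l s))))" for u l
    unfolding W_eq ex_sum_fun ex_diff bismut_hm_types ex_mult bismut_hm_types0[OF p] hb1 ..
  have v10: "ex10 (\<lambda>v. W u v) (E l) = (\<Sum>s\<in>UNIV. dd (\<lambda>q. D10 (\<lambda>q. hm q (E l) (E s)) q (E s)) p u
     - (\<Sum>t\<in>UNIV. dd (\<lambda>q. hm q (E t) (E s)) p u * h1 s l t))" for u l
    unfolding W_eq ex_sum_fun ex_diff bismut_hm_types ex_mult bismut_hm_types0[OF p] h1_def ..
  have "ex10 (\<lambda>u. ex01 (\<lambda>v. W u v) (E l)) (E k) = (\<Sum>s\<in>UNIV. D10 (\<lambda>q. D01 (\<lambda>q. hm q (E s) (E s)) q (E l) - D01 (\<lambda>q. hm q (E s) (E l)) q (E s)) p (E k)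
     - (\<Sum>t\<in>UNIV. h1 k t s * (cnj (h1 l t s) - cnj (h1 t l s))))"
    unfolding v01 ex_sum_fun ex_diff ex_mult h1_def ..
  then show "ex10 (\<lambda>u. ex01 (\<lambda>v. W u v) (E l)) (E k) =
    (\<Sum>s\<in>UNIV. hA l k s s - hA s k s l - (\<Sum>t\<in>UNIV. h1 k t s * (cnj (h1 l t s) - cnj (h1 t l s))))"
    unfolding D_diff[OF d(2) d(2)] hA_alt[symmetric] .
  show "ex10 (\<lambda>u. ex10 (\<lambda>v. W u v) (E l)) (E k) =
    (\<Sum>s\<in>UNIV. hB k s l s - (\<Sum>t\<in>UNIV. h1 k t s * h1 s l t))"
    unfolding v10 ex_sum_fun ex_diff ex_mult hB_def h1_def ..
  have "ex10 (\<lambda>u. ex01 (\<lambda>v. W v u) (E l)) (E k) = ex01 (\<lambda>v. ex10 (\<lambda>u. W v u) (E k)) (E l)"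
    by (rule ex_swap(2))
  also have "\<dots> = (\<Sum>s\<in>UNIV. D01 (\<lambda>q. D10 (\<lambda>q. hm q (E k) (E s)) q (E s)) p (E l)
     - (\<Sum>t\<in>UNIV. D01 (\<lambda>q. hm q (E t) (E s)) p (E l) * h1 s k t))"
    unfolding v10 ex_sum_fun ex_diff ex_mult ..
  finally show "ex10 (\<lambda>u. ex01 (\<lambda>v. W v u) (E l)) (E k) =
    (\<Sum>s\<in>UNIV. hA l s k s - (\<Sum>t\<in>UNIV. cnj (h1 l s t) * h1 s k t))"
    unfolding hb1 hA_def .
qed

end

definition proj4 :: "('v::complex_normed_vector \<Rightarrow> 'v \<Rightarrow> 'v \<Rightarrow> 'v \<Rightarrow> complex) \<Rightarrow> 'v \<Rightarrow> 'v \<Rightarrow> 'v \<Rightarrow> 'v \<Rightarrow> complex" where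
  "proj4 f a b c d = ex01 (\<lambda>a. ex10 (\<lambda>b. ex10 (\<lambda>c. ex01 (\<lambda>d. f a b c d) d) c) b) a"

lemma proj4_add: "proj4 (\<lambda>a b c d. f a b c d + g a b c d) a b c d = proj4 f a b c d + proj4 g a b c d"
  and proj4_diff: "proj4 (\<lambda>a b c d. f a b c d - g a b c d) a b c d = proj4 f a b c d - proj4 g a b c d"
  and proj4_minus: "proj4 (\<lambda>a b c d. - f a b c d) a b c d = - proj4 f a b c d"
  and proj4_mult: "proj4 (\<lambda>a b c d. z * f a b c d) a b c d = z * proj4 f a b c d"
  unfolding proj4_def by (simp_all add: ex_add ex_diff ex_minus ex_mult)

text \<open>The symmetries of the second derivatives \<open>\<partial>\<^sub>a \<partial>\<^sub>b m(c, d)\<close> of a \<open>J\<close>-invariant metric.\<close>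

locale hermitian_tensor =
  fixes Q :: "'v::complex_normed_vector \<Rightarrow> 'v \<Rightarrow> 'v \<Rightarrow> 'v \<Rightarrow> real"
  assumes neg: "Q (- a) b c d = - Q a b c d" "Q a (- b) c d = - Q a b c d"
      "Q a b (- c) d = - Q a b c d" "Q a b c (- d) = - Q a b c d"
    and sym: "Q a b c d = Q b a c d" "Q a b c d = Q a b d c"
    and JJ: "Q a b (scaleC \<i> c) (scaleC \<i> d) = Q a b c d"
begin

lemma J_move: "Q a b (scaleC \<i> c) d = - Q a b c (scaleC \<i> d)"
  using JJ[of a b c "scaleC \<i> d"] by (simp add: neg)

definition D4 :: "'v \<Rightarrow> 'v \<Rightarrow> 'v \<Rightarrow> 'v \<Rightarrow> complex" where
  "D4 a b c d = ex01 (\<lambda>a. ex10 (\<lambda>b. Complex (Q a b c d / 2) (Q a b c (scaleC \<i> d) / 2)) b) a"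

lemmas proj_simps = proj4_def D4_def ex10_def ex01_def scaleC_complex_def complex_eq_iff neg JJ J_move

abbreviation "J \<equiv> scaleC \<i> :: 'v \<Rightarrow> 'v"

lemma proj_terms:
  "proj4 (\<lambda>a b c d. complex_of_real (Q a (J b) (J c) d)) a b c d = - D4 a b c d"
  "proj4 (\<lambda>a b c d. complex_of_real (Q a (J c) (J b) d)) a b c d = - D4 a c b d"
  "proj4 (\<lambda>a b c d. complex_of_real (Q a (J d) (J b) c)) a b c d = 0"
  "proj4 (\<lambda>a b c d. complex_of_real (Q (J a) b (J c) d)) a b c d = D4 a b c d"
  "proj4 (\<lambda>a b c d. complex_of_real (Q b (J c) (J a) d)) a b c d = 0"
  "proj4 (\<lambda>a b c d. complex_of_real (Q (J d) b c (J a))) a b c d = - D4 d b c a"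
  "proj4 (\<lambda>a b c d. complex_of_real (Q (J a) c (J b) d)) a b c d = D4 a c b d"
  "proj4 (\<lambda>a b c d. complex_of_real (Q c (J b) (J a) d)) a b c d = 0"
  "proj4 (\<lambda>a b c d. complex_of_real (Q (J d) c b (J a))) a b c d = - D4 d c b a"
  "proj4 (\<lambda>a b c d. complex_of_real (Q d (J a) (J b) c)) a b c d = 0"
  "proj4 (\<lambda>a b c d. complex_of_real (Q d (J b) c (J a))) a b c d = D4 d b c a"
  "proj4 (\<lambda>a b c d. complex_of_real (Q d (J c) b (J a))) a b c d = D4 d c b a"
  by (simp_all add: proj_simps, simp_all add: field_simps)

text \<open>
  The left-hand side is \<open>dd\<^sup>c\<omega>\<close> in terms of second derivatives of the metric (see \<open>ddc_eq\<close>); eight of its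
  twelve terms survive the projection, in equal pairs.
\<close>

lemma proj_ddc:
  "proj4 (\<lambda>a b c d. complex_of_real (- (
     (Q a (J b) (J c) d - Q a (J c) (J b) d + Q a (J d) (J b) c)
   - (Q b (J a) (J c) d - Q b (J c) (J a) d + Q b (J d) (J a) c)
   + (Q c (J a) (J b) d - Q c (J b) (J a) d + Q c (J d) (J a) b)
   - (Q d (J a) (J b) c - Q d (J b) (J a) c + Q d (J c) (J a) b)))) a b c d
   = 2 * (D4 a b c d - D4 a c b d - D4 d b c a + D4 d c b a)"
proof -
  have s: "(\<lambda>a b c d. complex_of_real (Q b (J a) (J c) d)) = (\<lambda>a b c d. complex_of_real (Q (J a) b (J c) d))"
    "(\<lambda>a b c d. complex_of_real (Q b (J d) (J a) c)) = (\<lambda>a b c d. complex_of_real (Q (J d) b c (J a)))"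
    "(\<lambda>a b c d. complex_of_real (Q c (J a) (J b) d)) = (\<lambda>a b c d. complex_of_real (Q (J a) c (J b) d))"
    "(\<lambda>a b c d. complex_of_real (Q c (J d) (J a) b)) = (\<lambda>a b c d. complex_of_real (Q (J d) c b (J a)))"
    "(\<lambda>a b c d. complex_of_real (Q d (J b) (J a) c)) = (\<lambda>a b c d. complex_of_real (Q d (J b) c (J a)))"
    "(\<lambda>a b c d. complex_of_real (Q d (J c) (J a) b)) = (\<lambda>a b c d. complex_of_real (Q d (J c) b (J a)))"
    by (intro ext, metis sym)+
  show ?thesis
    unfolding of_real_minus of_real_add of_real_diff proj4_minus proj4_add proj4_diff s proj_terms by simp
qed

end

context unitary_frame_at
begin

definition Qm :: "complex^'n \<Rightarrow> complex^'n \<Rightarrow> complex^'n \<Rightarrow> complex^'n \<Rightarrow> real" where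
  "Qm a b c d = dd (\<lambda>q. m1 q b c d) p a"

lemma m1_differentiable: "(\<lambda>q. m1 q b c d) differentiable (at p)"
  by (rule smooth_on_differentiable[OF smooth_on_dd[OF m_smooth] p])

lemma Qm_tensor: "hermitian_tensor Qm"
proof
  fix a b c d
  note d = m1_differentiable
  have n: "dd (\<lambda>q. - m1 q b c d) p a = - Qm a b c d" for a b c d
    unfolding Qm_def by (simp add: dd_bounded_linear[OF bounded_linear_minus[OF bounded_linear_ident] d])
  show "Qm (- a) b c d = - Qm a b c d" unfolding Qm_def by (rule linear_neg[OF linear_dd[OF d]])
  have "dd (\<lambda>q. m1 q (- b) c d) p = dd (\<lambda>q. - m1 q b c d) p"
    by (rule dd_cong_open[OF U p]) (rule m1_props(8))
  then show "Qm a (- b) c d = - Qm a b c d" using n by (simp add: Qm_def)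
  have cd: "dd (\<lambda>q. m1 q b c d) p = dd (\<lambda>q. m1 q b d c) p" for b c d
    by (rule dd_cong_open[OF U p]) (rule m1_props(3))
  then show s: "Qm a b c d = Qm a b d c" for a b c d by (simp add: Qm_def)
  have "dd (\<lambda>q. m1 q b c (- d)) p = dd (\<lambda>q. - m1 q b c d) p" for b c d
    by (rule dd_cong_open[OF U p]) (rule m1_props(7))
  then show nd: "Qm a b c (- d) = - Qm a b c d" for a b c d using n by (simp add: Qm_def)
  show "Qm a b (- c) d = - Qm a b c d" using nd[of a b d c] s[of a b "- c" d] s[of a b c d] by simp
  show "Qm a b c d = Qm b a c d" unfolding Qm_def by (rule smooth_mixed[OF U m_smooth p])
  have "dd (\<lambda>q. m1 q b (J c) (J d)) p = dd (\<lambda>q. m1 q b c d) p"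
    by (rule dd_cong_open[OF U p]) (rule m1_props(1))
  then show "Qm a b (J c) (J d) = Qm a b c d" by (simp add: Qm_def)
qed

interpretation Qt: hermitian_tensor Qm by (rule Qm_tensor)

lemma hA_eq_D4: "hA c d k l = Qt.D4 (E c) (E d) (E k) (E l)"
proof -
  have "dd (\<lambda>q. dd (\<lambda>q. hm q (E k) (E l)) q b) p a = Complex (Qm a b (E k) (E l) / 2) (Qm a b (E k) (J (E l)) / 2)" for a b
  proof -
    have bl: "bounded_linear (\<lambda>x. complex_of_real (x / 2))" "bounded_linear (\<lambda>x. \<i> * complex_of_real (x / 2))"
      by (intro bounded_linear_const_mult bounded_linear_compose[OF bounded_linear_of_real] bounded_linear_divide)+
    have "dd (\<lambda>q. dd (\<lambda>q. hm q (E k) (E l)) q b) p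
      = dd (\<lambda>q. complex_of_real (m1 q b (E k) (E l) / 2) + \<i> * complex_of_real (m1 q b (E k) (J (E l)) / 2)) p"
      by (rule dd_cong_open[OF U p]) (simp add: dd_hm complex_eq_iff)
    then show ?thesis
      unfolding Qm_def
      by (simp only: dd_add[OF differentiable_bounded_linear[OF bl(1) m1_differentiable] differentiable_bounded_linear[OF bl(2) m1_differentiable]]
        dd_bounded_linear[OF bl(1) m1_differentiable] dd_bounded_linear[OF bl(2) m1_differentiable]) (simp add: complex_eq_iff)
  qed
  then show ?thesis
    unfolding hA_def Qt.D4_def dd_ex[OF U hm_smooth p, abs_def] by simp
qed

lemma ddc_eq:
  "d_form 3 (dc_form 2 (herm_form_c m)) p v = complex_of_real (- (
     (Qm (v 0) (J (v 1)) (J (v 2)) (v 3) - Qm (v 0) (J (v 2)) (J (v 1)) (v 3) + Qm (v 0) (J (v 3)) (J (v 1)) (v 2))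
   - (Qm (v 1) (J (v 0)) (J (v 2)) (v 3) - Qm (v 1) (J (v 2)) (J (v 0)) (v 3) + Qm (v 1) (J (v 3)) (J (v 0)) (v 2))
   + (Qm (v 2) (J (v 0)) (J (v 1)) (v 3) - Qm (v 2) (J (v 1)) (J (v 0)) (v 3) + Qm (v 2) (J (v 3)) (J (v 0)) (v 1))
   - (Qm (v 3) (J (v 0)) (J (v 1)) (v 2) - Qm (v 3) (J (v 1)) (J (v 0)) (v 2) + Qm (v 3) (J (v 2)) (J (v 0)) (v 1))))"
proof -
  have d: "dd (\<lambda>q. dc_form 2 (herm_form_c m) q w) p a = - complex_of_real
    (Qm a (J (w 0)) (J (w 1)) (w 2) - Qm a (J (w 1)) (J (w 0)) (w 2) + Qm a (J (w 2)) (J (w 0)) (w 1))" for w a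
  proof -
    have e: "dd (\<lambda>q. dc_form 2 (herm_form_c m) q w) p = dd (\<lambda>q. - complex_of_real
       (m1 q (J (w 0)) (J (w 1)) (w 2) - m1 q (J (w 1)) (J (w 0)) (w 2) + m1 q (J (w 2)) (J (w 0)) (w 1))) p"
      by (rule dd_cong_open[OF U p]) (rule dc_form_metric)
    have bl: "bounded_linear (\<lambda>x. - complex_of_real x)"
      by (intro bounded_linear_minus bounded_linear_of_real)
    show ?thesis
      unfolding Qm_def e
      by (simp only: dd_bounded_linear[OF bl differentiable_add[OF differentiable_diff[OF m1_differentiable m1_differentiable] m1_differentiable]]
         dd_add[OF differentiable_diff[OF m1_differentiable m1_differentiable] m1_differentiable] dd_diff[OF m1_differentiable m1_differentiable])
  qed
  show ?thesis
    unfolding d_form_def ext_deriv_def d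
    by (simp add: numeral_3_eq_3 numeral_2_eq_2)
qed

text \<open>
  A real form of type (2,2) is determined by its components on vectors of type (0,1), (1,0), (1,0), (0,1); those
  of \<open>dd\<^sup>c\<omega>\<close> are the mixed second derivatives of \<open>h\<close>, antisymmetrised.
\<close>

lemma pluriclosed_types:
  fixes S :: "complex^'n \<Rightarrow> complex^'n \<Rightarrow> complex^'n \<Rightarrow> complex^'n \<Rightarrow> complex"
  assumes "\<And>v. d_form 3 (dc_form 2 (herm_form_c m)) p v + S (v 0) (v 1) (v 2) (v 3) = 0"
  shows "2 * (hA l k i j - hA l i k j - hA j k i l + hA j i k l) + proj4 S (E l) (E k) (E i) (E j) = 0"
proof -
  have "complex_of_real (- (
     (Qm a (J b) (J c) d - Qm a (J c) (J b) d + Qm a (J d) (J b) c)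
   - (Qm b (J a) (J c) d - Qm b (J c) (J a) d + Qm b (J d) (J a) c)
   + (Qm c (J a) (J b) d - Qm c (J b) (J a) d + Qm c (J d) (J a) b)
   - (Qm d (J a) (J b) c - Qm d (J b) (J a) c + Qm d (J c) (J a) b))) + S a b c d = 0" for a b c d
    using assms[of "(!) [a, b, c, d]"] unfolding ddc_eq by (simp add: numeral_3_eq_3 numeral_2_eq_2)
  then have "proj4 (\<lambda>a b c d. complex_of_real (- (
     (Qm a (J b) (J c) d - Qm a (J c) (J b) d + Qm a (J d) (J b) c)
   - (Qm b (J a) (J c) d - Qm b (J c) (J a) d + Qm b (J d) (J a) c)
   + (Qm c (J a) (J b) d - Qm c (J b) (J a) d + Qm c (J d) (J a) b)
   - (Qm d (J a) (J b) c - Qm d (J b) (J a) c + Qm d (J c) (J a) b))) + S a b c d) (E l) (E k) (E i) (E j) = proj4 (\<lambda>a b c d. 0) (E l) (E k) (E i) (E j)"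
    by presburger
  then show ?thesis
    unfolding proj4_add Qt.proj_ddc hA_eq_D4 by (simp add: proj4_def)
qed

subsection \<open>The fundamental form in a unitary frame\<close>

lemma scale_sqrt2: "(1 / sqrt 2) *\<^sub>R (1 / sqrt 2) *\<^sub>R x = (1/2) *\<^sub>R (x :: 'b::real_vector)"
  by (simp add: field_simps)

lemma symplectic: "symplectic_frame (\<lambda>x y. m p (J x) y) (UNIV :: 'n set)
    (\<lambda>k. (1 / sqrt 2) *\<^sub>R E k) (\<lambda>k. (1 / sqrt 2) *\<^sub>R J (E k)) CARD('n)"
proof (rule symplectic_frame.intro)
  show "linear (m p (J x))" for x by (rule m_linear[OF p])
  show "linear (\<lambda>x. m p (J x) y)" for y
    using linear_compose[OF bounded_linear.linear[OF bounded_linear_scaleC] m_linear_left[OF p]] by (simp add: o_def)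
  show "m p (J x) y = - m p (J y) x" for x y using m_J_left[OF p, of x y] m_sym[OF p, of x "J y"] by simp
  show "finite (UNIV :: 'n set)" "card (UNIV :: 'n set) = CARD('n)" "0 < CARD('n)" by simp_all
  show "DIM(complex^'n) = 2 * CARD('n)" by simp
  show "x = (\<Sum>k\<in>UNIV. m p (J x) ((1 / sqrt 2) *\<^sub>R J (E k)) *\<^sub>R (1 / sqrt 2) *\<^sub>R E k
      - m p (J x) ((1 / sqrt 2) *\<^sub>R E k) *\<^sub>R (1 / sqrt 2) *\<^sub>R J (E k))" for x
  proof -
    have "scaleC (hm p x (E k)) (E k) = m p (J x) ((1 / sqrt 2) *\<^sub>R J (E k)) *\<^sub>R (1 / sqrt 2) *\<^sub>R E k
      - m p (J x) ((1 / sqrt 2) *\<^sub>R E k) *\<^sub>R (1 / sqrt 2) *\<^sub>R J (E k)" for k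
      by (subst scaleC_eq)
         (simp add: m_scale m_eq_hm hm_left(3)[OF p] hm_right[OF p] real_sqrt_mult_self field_simps)
    then show ?thesis using expand[of x] by simp
  qed
qed

text \<open>The symplectic basis is \<open>E\<^sub>k\<close>, \<open>J E\<^sub>k\<close> rescaled to unit length, which accounts for the factor 1/2.\<close>

lemma wedge_herm_power:
  fixes \<Phi> :: "complex^'n \<Rightarrow> complex^'n \<Rightarrow> 'w::real_vector"
  assumes "\<And>x. linear (\<Phi> x)" "\<And>y. linear (\<lambda>x. \<Phi> x y)" "\<And>x y. \<Phi> x y = - \<Phi> y x"
  shows "wedge 2 (2 * (CARD('n) - 1)) (\<lambda>a r. r *\<^sub>R a) (\<lambda>v. \<Phi> (v 0) (v 1)) (wedge_power (herm_form m p) (CARD('n) - 1)) v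
    = (wedge_power (herm_form m p) CARD('n) v / real CARD('n)) *\<^sub>R ((1/2) *\<^sub>R (\<Sum>k\<in>UNIV. \<Phi> (E k) (J (E k))))"
proof -
  interpret S: symplectic_frame "\<lambda>x y. m p (J x) y" "UNIV :: 'n set"
    "\<lambda>k. (1 / sqrt 2) *\<^sub>R E k" "\<lambda>k. (1 / sqrt 2) *\<^sub>R J (E k)" "CARD('n)" by (rule symplectic)
  have h: "herm_form m p = (\<lambda>v. m p (J (v 0)) (v 1))" by (auto simp: herm_form_def)
  have "(\<Sum>k\<in>UNIV. \<Phi> ((1 / sqrt 2) *\<^sub>R E k) ((1 / sqrt 2) *\<^sub>R J (E k))) = (1/2) *\<^sub>R (\<Sum>k\<in>UNIV. \<Phi> (E k) (J (E k)))"
    by (simp only: linear_scale[OF assms(1)] linear_scale[OF assms(2)] scale_sqrt2 scaleR_sum_right)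
  then show "wedge 2 (2 * (CARD('n) - 1)) (\<lambda>a r. r *\<^sub>R a) (\<lambda>v. \<Phi> (v 0) (v 1)) (wedge_power (herm_form m p) (CARD('n) - 1)) v
    = (wedge_power (herm_form m p) CARD('n) v / real CARD('n)) *\<^sub>R ((1/2) *\<^sub>R (\<Sum>k\<in>UNIV. \<Phi> (E k) (J (E k))))"
    using S.wedge_omega_power[OF assms, of v] unfolding h by simp
qed

end

lemma wedge_2_2:
  fixes ip :: "'l::real_vector \<Rightarrow> 'l \<Rightarrow> complex" and F :: "'v \<Rightarrow> 'v \<Rightarrow> 'l"
  assumes ip: "\<And>x y. ip x y = ip y x" "\<And>x y. ip (- x) y = - ip x y" and F: "\<And>u v. F u v = - F v u"
  shows "wedge 2 2 ip (\<lambda>v. F (v 0) (v 1)) (\<lambda>v. F (v 0) (v 1)) v =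
    2 * (ip (F (v 0) (v 1)) (F (v 2) (v 3)) - ip (F (v 0) (v 2)) (F (v 1) (v 3)) + ip (F (v 0) (v 3)) (F (v 1) (v 2)))"
proof -
  have f: "finite {0, 1, 2, 3::nat}" "finite {1, 2, 3::nat}" "finite {2, 3::nat}" "finite {3::nat}" "finite ({}::nat set)"
    "0 \<notin> {1, 2, 3::nat}" "1 \<notin> {2, 3::nat}" "2 \<notin> {3::nat}" "3 \<notin> ({}::nat set)" by auto
  have s: "{..<2+2} = {0, 1, 2, 3::nat}" by auto
  have ip2: "ip x (- y) = - ip x y" for x y using ip(1)[of x "- y"] ip(1)[of x y] ip(2)[of y x] by simp
  have n: "F (v 1) (v 0) = - F (v 0) (v 1)" "F (v 2) (v 0) = - F (v 0) (v 2)" "F (v 3) (v 0) = - F (v 0) (v 3)"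
    "F (v 2) (v 1) = - F (v 1) (v 2)" "F (v 3) (v 1) = - F (v 1) (v 3)" "F (v 3) (v 2) = - F (v 2) (v 3)"
    by (rule F)+
  have c: "ip (F (v 2) (v 3)) (F (v 0) (v 1)) = ip (F (v 0) (v 1)) (F (v 2) (v 3))"
    "ip (F (v 1) (v 3)) (F (v 0) (v 2)) = ip (F (v 0) (v 2)) (F (v 1) (v 3))"
    "ip (F (v 1) (v 2)) (F (v 0) (v 3)) = ip (F (v 0) (v 3)) (F (v 1) (v 2))" by (rule ip(1))+
  have e: "{f::nat \<Rightarrow> nat. f permutes {}} = {id}" by auto
  show ?thesis
    unfolding wedge_def s sum_over_permutations_insert[OF f(2) f(6)] sum_over_permutations_insert[OF f(3) f(7)]
      sum_over_permutations_insert[OF f(4) f(8)] sum_over_permutations_insert[OF f(5) f(9)] e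
    by (simp add: sign_compose permutation_compose permutation_swap_id sign_swap_id sign_id Transposition.transpose_def
       fact_numeral n[unfolded One_nat_def] ip ip2 c[unfolded One_nat_def])
       (simp add: scaleR_conv_of_real algebra_simps)
qed

section \<open>Curvature of the principal connection\<close>

text \<open>
  The component of the Bianchi identity in two directions of type (1,0) and one of type (0,1). The third cyclic
  term drops out because the 2-form has no component of type (2,0).
\<close>

lemma bianchi_10:
  fixes B :: "'v::complex_normed_vector \<Rightarrow> 'v \<Rightarrow> 'v \<Rightarrow> 'l::complex_normed_vector"
  assumes cyc: "\<And>a b c. B a b c + B b c a + B c a b = 0" and alt: "\<And>a b c. B a c b = - B a b c"
    and JJ: "\<And>a b c. B a (scaleC \<i> b) (scaleC \<i> c) = B a b c" and neg: "\<And>a b c. B a b (- c) = - B a b c"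
  shows "ex10 (\<lambda>a. ex01 (\<lambda>c. B a b c) c) a = ex10 (\<lambda>b. ex01 (\<lambda>c. B b a c) c) b"
proof -
  let ?J = "scaleC \<i> :: 'v \<Rightarrow> 'v" and ?i = "scaleC \<i> :: 'l \<Rightarrow> 'l"
  have s: "B a b c - B b a c = - B c a b" for a b c
    using cyc[of a b c] alt[of b c a] by (simp add: algebra_simps eq_neg_iff_add_eq_0)
  have mv: "B a (?J b) c = - B a b (?J c)" for a b c
    using JJ[of a b "- ?J c"] by (simp add: neg scaleC_ii scaleC_minus_right)
  have d: "B (?J a) b c - B (?J b) a c = - B (?J c) a b" "B (?J a) b (?J c) - B (?J b) a (?J c) = B c a b"
  proof -
    have "B (?J a) b c = B (?J a) (?J b) (?J c)" "B (?J b) a c = B (?J b) (?J a) (?J c)" by (simp_all add: JJ)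
    then show "B (?J a) b c - B (?J b) a c = - B (?J c) a b" using s[of "?J a" "?J b" "?J c"] by (simp add: JJ)
    have "B (?J a) b (?J c) = - B (?J a) (?J b) c" "B (?J b) a (?J c) = - B (?J b) (?J a) c" by (simp_all add: mv)
    then show "B (?J a) b (?J c) - B (?J b) a (?J c) = B c a b" using s[of "?J a" "?J b" c] by (simp add: JJ algebra_simps)
  qed
  have "ex10 (\<lambda>a. ex01 (\<lambda>c. B a b c) c) a = (1/2) *\<^sub>R (1/2) *\<^sub>R
    (B a b c + ?i (B a b (?J c)) - ?i (B (?J a) b c) + B (?J a) b (?J c))" for a b c
    by (simp add: ex10_def ex01_def scaleC_add_right scaleC_scaleR scaleC_ii algebra_simps)
  moreover have "(B a b c + ?i (B a b (?J c)) - ?i (B (?J a) b c) + B (?J a) b (?J c))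
     - (B b a c + ?i (B b a (?J c)) - ?i (B (?J b) a c) + B (?J b) a (?J c))
     = (B a b c - B b a c) + ?i (B a b (?J c) - B b a (?J c)) - ?i (B (?J a) b c - B (?J b) a c) + (B (?J a) b (?J c) - B (?J b) a (?J c))"
    by (simp add: scaleC_diff_right algebra_simps)
  moreover have "\<dots> = 0" unfolding s d by (simp add: scaleC_minus_right)
  ultimately show ?thesis by simp
qed

text \<open>
  What the problem amounts to over a coordinate domain: a metric, a connection form with values in a real
  form \<open>kk\<close> of a complex Lie algebra with invariant bilinear form, its curvature of type (1,1), and the coupled
  system. The real form enters only through its conjugation.
\<close>

locale gauge_chart = hermitian_chart U m for U :: "(complex^'n) set" and m +
  fixes G :: "'g monoid" and e :: "('g, 'l::complex_normed_vector) chart" and ip :: "'l \<Rightarrow> 'l \<Rightarrow> complex"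
    and kk :: "'l set" and \<alpha> :: "complex^'n \<Rightarrow> complex^'n \<Rightarrow> 'l" and z :: 'l
  assumes fd: "findim TYPE('l)"
    and br_bilinear: "bounded_bilinear (lie_bracket G e)" and br_linear: "\<And>x. complex_linear (lie_bracket G e x)"
    and br_antisym: "\<And>x y. lie_bracket G e x y = - lie_bracket G e y x"
    and br_jacobi: "\<And>w x y. lie_bracket G e w (lie_bracket G e x y)
        = lie_bracket G e (lie_bracket G e w x) y + lie_bracket G e x (lie_bracket G e w y)"
    and ip_bilinear: "bounded_bilinear ip" and ip_linear: "\<And>x. complex_linear (ip x)"
    and ip_sym: "\<And>x y. ip x y = ip y x" and ip_nondegenerate: "\<And>x. (\<And>y. ip x y = 0) \<Longrightarrow> x = 0"
    and ip_br: "\<And>w x y. ip (lie_bracket G e w x) y = - ip x (lie_bracket G e w y)"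
    and cj_add: "\<And>x y. conj_wrt kk (x + y) = conj_wrt kk x + conj_wrt kk y"
    and cj_scaleC: "\<And>c x. conj_wrt kk (scaleC c x) = scaleC (cnj c) (conj_wrt kk x)"
    and cj_cj: "\<And>x. conj_wrt kk (conj_wrt kk x) = x"
    and cj_br: "\<And>x y. conj_wrt kk (lie_bracket G e x y) = lie_bracket G e (conj_wrt kk x) (conj_wrt kk y)"
    and ip_cj: "\<And>x y. ip (conj_wrt kk x) (conj_wrt kk y) = cnj (ip x y)"
    and \<alpha>_smooth: "\<And>u. smooth_on U (\<lambda>q. \<alpha> q u)" and \<alpha>_linear: "\<And>q. q \<in> U \<Longrightarrow> linear (\<alpha> q)"
    and \<alpha>_real: "\<And>q u. q \<in> U \<Longrightarrow> conj_wrt kk (\<alpha> q u) = \<alpha> q u"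
    and br_z: "\<And>x. lie_bracket G e z x = 0"
    and F_J: "\<And>q u v. q \<in> U \<Longrightarrow>
        conn_curvature G e \<alpha> q (scaleC \<i> u) (scaleC \<i> v) = conn_curvature G e \<alpha> q u v"
    and coupled: "\<And>q. q \<in> U \<Longrightarrow> coupled_hermitian_einstein_at ip z m (conn_curvature G e \<alpha>) q"
begin

abbreviation "br \<equiv> lie_bracket G e"
abbreviation "cj \<equiv> conj_wrt kk"
abbreviation "F \<equiv> conn_curvature G e \<alpha>"

lemmas br_simps = bounded_bilinear.add_left[OF br_bilinear] bounded_bilinear.add_right[OF br_bilinear]
  bounded_bilinear.diff_left[OF br_bilinear] bounded_bilinear.diff_right[OF br_bilinear]
  bounded_bilinear.minus_left[OF br_bilinear] bounded_bilinear.minus_right[OF br_bilinear]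
  bounded_bilinear.scaleR_left[OF br_bilinear] bounded_bilinear.scaleR_right[OF br_bilinear]
  bounded_bilinear.zero_left[OF br_bilinear] bounded_bilinear.zero_right[OF br_bilinear]
  bounded_bilinear.sum_left[OF br_bilinear] bounded_bilinear.sum_right[OF br_bilinear]

lemma br_scaleC: "br x (scaleC c y) = scaleC c (br x y)" "br (scaleC c x) y = scaleC c (br x y)"
proof -
  show r: "br x (scaleC c y) = scaleC c (br x y)" for x y by (rule complex_linearD(2)[OF br_linear])
  show "br (scaleC c x) y = scaleC c (br x y)"
    using r[of y x] br_antisym[of "scaleC c x" y] br_antisym[of x y] by (simp add: scaleC_minus_right)
qed

lemma br_linear_left: "complex_linear (\<lambda>x. br x y)"
  by (simp add: complex_linear_def br_simps br_scaleC)

lemmas ip_simps = bounded_bilinear.add_left[OF ip_bilinear] bounded_bilinear.add_right[OF ip_bilinear]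
  bounded_bilinear.diff_left[OF ip_bilinear] bounded_bilinear.diff_right[OF ip_bilinear]
  bounded_bilinear.minus_left[OF ip_bilinear] bounded_bilinear.minus_right[OF ip_bilinear]
  bounded_bilinear.scaleR_left[OF ip_bilinear] bounded_bilinear.scaleR_right[OF ip_bilinear]
  bounded_bilinear.zero_left[OF ip_bilinear] bounded_bilinear.zero_right[OF ip_bilinear]
  bounded_bilinear.sum_left[OF ip_bilinear] bounded_bilinear.sum_right[OF ip_bilinear]

lemma ip_scaleC: "ip x (scaleC c y) = c * ip x y" "ip (scaleC c x) y = c * ip x y"
proof -
  show r: "ip x (scaleC c y) = c * ip x y" for x y
    using complex_linearD(2)[OF ip_linear] by (simp add: scaleC_complex_def)
  show "ip (scaleC c x) y = c * ip x y" using r[of y x] by (simp add: ip_sym)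
qed

lemma ip_linear_left: "complex_linear (\<lambda>x. ip x y)"
  by (simp add: complex_linear_def ip_simps ip_scaleC scaleC_complex_def)

lemma cj_linear: "linear cj"
  by (rule linearI) (simp_all add: cj_add cj_scaleC flip: scaleC_of_real)

lemma cj_bounded_linear: "bounded_linear cj" by (rule findim_linear_bounded[OF fd cj_linear])

lemmas cj_simps = cj_add linear_diff[OF cj_linear] linear_neg[OF cj_linear] linear_0[OF cj_linear]
  linear_scale[OF cj_linear] linear_sum[OF cj_linear] cj_scaleC cj_cj

lemma \<alpha>_differentiable: "q \<in> U \<Longrightarrow> (\<lambda>q. \<alpha> q u) differentiable (at q)"
  by (rule smooth_on_differentiable[OF \<alpha>_smooth])

lemma d\<alpha>_differentiable: "q \<in> U \<Longrightarrow> (\<lambda>q. dd (\<lambda>q. \<alpha> q u) q v) differentiable (at q)"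
  by (rule smooth_on_differentiable[OF smooth_on_dd[OF \<alpha>_smooth]])

lemma d\<alpha>_linear: "q \<in> U \<Longrightarrow> linear (\<lambda>u. dd (\<lambda>q. \<alpha> q u) q v)"
  by (rule dd_parameter_linear[OF U _ \<alpha>_linear \<alpha>_differentiable])

lemma F_alternating: "F q u v = - F q v u"
  unfolding conn_curvature_def using br_antisym[of "\<alpha> q u" "\<alpha> q v"] by simp

lemma F_linear:
  assumes q: "q \<in> U"
  shows "linear (F q u)" "linear (\<lambda>u. F q u v)"
proof -
  have b: "linear (\<lambda>v. br (\<alpha> q u) (\<alpha> q v))" for u
    using linear_compose[OF \<alpha>_linear[OF q] complex_linear_linear[OF br_linear]] by (simp add: o_def)
  show l: "linear (F q u)" for u
    unfolding conn_curvature_def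
    by (intro b linear_compose_add linear_compose_sub d\<alpha>_linear[OF q] linear_dd[OF \<alpha>_differentiable[OF q]])
  have "(\<lambda>u. F q u v) = (\<lambda>u. - F q v u)" by (intro ext F_alternating)
  then show "linear (\<lambda>u. F q u v)" using linear_compose_neg[OF l] by simp
qed

lemma F_J_left: "q \<in> U \<Longrightarrow> F q (J u) v = - F q u (J v)"
  using F_J[of q u "- J v"] by (simp add: scaleC_minus_right scaleC_ii linear_neg[OF F_linear(1)])

lemma F_differentiable: "q \<in> U \<Longrightarrow> (\<lambda>q. F q u v) differentiable (at q)"
  unfolding conn_curvature_def
  by (intro differentiable_add differentiable_diff d\<alpha>_differentiable differentiable_bounded_bilinear[OF br_bilinear] \<alpha>_differentiable)

lemma cj_F:
  assumes q: "q \<in> U"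
  shows "cj (F q u v) = F q u v"
proof -
  note d = \<alpha>_differentiable[OF q]
  have "cj (dd (\<lambda>q. \<alpha> q a) q b) = dd (\<lambda>q. \<alpha> q a) q b" for a b
  proof -
    have "dd (\<lambda>q. cj (\<alpha> q a)) q = dd (\<lambda>q. \<alpha> q a) q" by (rule dd_cong_open[OF U q]) (rule \<alpha>_real)
    then show ?thesis using dd_bounded_linear[OF cj_bounded_linear d, of a b] by simp
  qed
  then show ?thesis unfolding conn_curvature_def by (simp add: cj_simps cj_br \<alpha>_real[OF q])
qed

text \<open>The value of \<open>F\<close> on a vector of type (1,0) and the conjugate of one; this determines \<open>F\<close>, which has type (1,1).\<close>

definition Fc :: "complex^'n \<Rightarrow> complex^'n \<Rightarrow> complex^'n \<Rightarrow> 'l" where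
  "Fc q a b = ex01 (F q a) b"

lemma Fc_right:
  assumes q: "q \<in> U"
  shows "Fc q a (scaleC c b) = scaleC (cnj c) (Fc q a b)" "linear (Fc q a)"
  unfolding Fc_def by (rule ex01_antilinear[OF F_linear(1)[OF q]])+

lemma Fc_left:
  assumes q: "q \<in> U"
  shows "complex_linear (\<lambda>a. Fc q a b)"
proof (rule complex_linearI_ii)
  show "linear (\<lambda>a. Fc q a b)"
    unfolding Fc_def ex01_def
    by (intro linear_compose_scale_right linear_compose_add F_linear(2)[OF q]
        linear_compose[OF F_linear(2)[OF q] bounded_linear.linear[OF bounded_linear_scaleC], unfolded o_def])
  show "Fc q (J x) b = scaleC \<i> (Fc q x b)" for x
    unfolding Fc_def ex01_def by (simp add: F_J_left[OF q] F_J[OF q] scaleC_minus_right scaleC_add_right scaleC_scaleR scaleC_ii linear_neg[OF F_linear(1)[OF q]])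
qed

lemma F_types:
  assumes q: "q \<in> U"
  shows "ex10 (\<lambda>a. ex01 (\<lambda>b. F q a b) w) v = Fc q v w" "ex01 (\<lambda>b. ex10 (\<lambda>k. F q b k) v) w = - Fc q v w"
    "ex10 (\<lambda>a. ex10 (\<lambda>b. F q a b) w) v = 0" "ex01 (\<lambda>a. ex01 (\<lambda>b. F q a b) w) v = 0"
proof -
  show 1: "ex10 (\<lambda>a. ex01 (\<lambda>b. F q a b) w) v = Fc q v w" for v w
    using ex_of_complex_linear(1)[OF Fc_left[OF q]] unfolding Fc_def by simp
  have "ex01 (\<lambda>b. ex10 (\<lambda>k. F q b k) v) w = ex10 (\<lambda>k. ex01 (\<lambda>b. - F q k b) w) v"
    unfolding ex_swap(2)[symmetric] by (subst F_alternating) simp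
  then show "ex01 (\<lambda>b. ex10 (\<lambda>k. F q b k) v) w = - Fc q v w" unfolding ex_minus 1 .
  show "ex10 (\<lambda>a. ex10 (\<lambda>b. F q a b) w) v = 0" "ex01 (\<lambda>a. ex01 (\<lambda>b. F q a b) w) v = 0"
    unfolding ex10_def ex01_def
    by (simp_all add: F_J_left[OF q] F_J[OF q] scaleC_minus_right scaleC_add_right scaleC_diff_right scaleC_scaleR scaleC_ii linear_neg[OF F_linear(1)[OF q]] algebra_simps)
qed

lemma cj_Fc: "q \<in> U \<Longrightarrow> cj (Fc q a b) = - Fc q b a"
  unfolding Fc_def ex01_def
  using F_alternating[of q b a] F_alternating[of q b "J a"]
  by (simp add: cj_simps cj_F F_J_left scaleC_minus_left scaleC_minus_right algebra_simps)

lemma Fc_differentiable: "q \<in> U \<Longrightarrow> (\<lambda>q. Fc q a b) differentiable (at q)"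
  unfolding Fc_def by (rule dd_ex_parameter(4)[OF F_differentiable])

text \<open>A nonzero value of \<open>\<omega>\<^sup>n\<close> may be cancelled in \<open>F \<and> \<omega>\<^sup>n\<^sup>-\<^sup>1 = (\<omega>\<^sup>n/n) z\<close>.\<close>

lemma hermitian_einstein_trace:
  assumes q: "q \<in> U" and v: "wedge_power (herm_form m q) CARD('n) v \<noteq> 0" and E: "unitary q E"
  shows "(\<Sum>k\<in>UNIV. Fc q (E k) (E k)) = scaleC \<i> z"
proof -
  interpret uf: unitary_frame_at U m q E by unfold_locales (rule q, rule E)
  let ?w = "wedge_power (herm_form m q) CARD('n)"
  let ?s = "(1/2) *\<^sub>R (\<Sum>k\<in>UNIV. F q (E k) (J (E k)))"
  have "(?w v / real CARD('n)) *\<^sub>R z = (?w v / real CARD('n)) *\<^sub>R ?s"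
    by (rule trans[OF spec[OF conjunct1[OF coupled[OF q, unfolded coupled_hermitian_einstein_at_def]], of v, symmetric]
       uf.wedge_herm_power[OF F_linear[OF q] F_alternating, of v]])
  then have z: "z = ?s" using v by (simp del: scaleR_scaleR)
  have "F q (E k) (E k) = 0" for k using F_alternating[of q "E k" "E k"] by (simp add: eq_neg_iff_add_eq_0 flip: scaleR_2)
  then have "(\<Sum>k\<in>UNIV. Fc q (E k) (E k)) = (\<Sum>k\<in>UNIV. scaleC \<i> ((1/2) *\<^sub>R F q (E k) (J (E k))))"
    by (simp add: Fc_def ex01_def scaleC_scaleR)
  also have "\<dots> = scaleC \<i> ?s"
    by (simp add: linear_sum[OF bounded_linear.linear[OF bounded_linear_scaleC]] scaleR_sum_right)
  finally show ?thesis using z by simp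
qed

end

section \<open>The coupled system in components\<close>

text \<open>
  The vectors \<open>v0\<close> testify that \<open>\<omega>\<^sup>n \<noteq> 0\<close>. Where no such vectors exist, the theorem is trivial, since
  \<open>\<omega>\<^sup>n\<close> is also a factor of its conclusion.
\<close>

locale gauge_frame_at = gauge_chart U m G e ip kk \<alpha> z + unitary_frame_at U m p E
  for U :: "(complex^'n) set" and m and G :: "'g monoid" and e :: "('g, 'l::complex_normed_vector) chart"
    and ip kk \<alpha> z p and E :: "'n \<Rightarrow> complex^'n" +
  fixes v0 :: "nat \<Rightarrow> complex^'n"
  assumes v0: "wedge_power (herm_form m p) CARD('n) v0 \<noteq> 0"
begin

text \<open>
  Components at the point \<open>p\<close>: \<open>dF\<close> is the (1,0)-derivative of the curvature, \<open>a10\<close> the (1,0)-part of the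
  connection form, and \<open>T\<close> the torsion \<open>\<partial>\<^sub>k h\<^sub>i\<^sub>j - \<partial>\<^sub>i h\<^sub>k\<^sub>j\<close>, that is, \<open>\<partial>\<omega>\<close> up to a constant.
\<close>

definition Fp :: "'n \<Rightarrow> 'n \<Rightarrow> 'l" where "Fp i j = Fc p (E i) (E j)"

definition dF :: "'n \<Rightarrow> 'n \<Rightarrow> 'n \<Rightarrow> 'l" where "dF c i j = D10 (\<lambda>q. Fc q (E i) (E j)) p (E c)"

definition a10 :: "'n \<Rightarrow> 'l" where "a10 i = ex10 (\<alpha> p) (E i)"

definition T :: "'n \<Rightarrow> 'n \<Rightarrow> 'n \<Rightarrow> complex" where "T k i j = h1 k i j - h1 i k j"

definition cov_F :: "complex^'n \<Rightarrow> complex^'n \<Rightarrow> complex^'n \<Rightarrow> 'l" where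
  "cov_F a b c = dd (\<lambda>q. F q b c) p a + br (\<alpha> p a) (F p b c)"

lemma cov_F_cyclic: "cov_F a b c + cov_F b c a + cov_F c a b = 0"
proof -
  note d = \<alpha>_differentiable[OF p] d\<alpha>_differentiable[OF p]
  have dF: "dd (\<lambda>q. F q b c) p a = dd (\<lambda>q. dd (\<lambda>q. \<alpha> q c) q b) p a - dd (\<lambda>q. dd (\<lambda>q. \<alpha> q b) q c) p a
     + (br (dd (\<lambda>q. \<alpha> q b) p a) (\<alpha> p c) + br (\<alpha> p b) (dd (\<lambda>q. \<alpha> q c) p a))" for a b c
    unfolding conn_curvature_def
    by (simp add: dd_add[OF differentiable_diff[OF d(2) d(2)] differentiable_bounded_bilinear[OF br_bilinear d(1) d(1)]]
       dd_diff[OF d(2) d(2)] dd_bounded_bilinear[OF br_bilinear d(1) d(1)])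
  have x: "br x (\<alpha> p b) = - br (\<alpha> p b) x" for x b by (rule br_antisym)
  have cv: "cov_F a b c = dd (\<lambda>q. dd (\<lambda>q. \<alpha> q c) q b) p a - dd (\<lambda>q. dd (\<lambda>q. \<alpha> q b) q c) p a
     + (- br (\<alpha> p c) (dd (\<lambda>q. \<alpha> q b) p a) + br (\<alpha> p b) (dd (\<lambda>q. \<alpha> q c) p a))
     + (br (\<alpha> p a) (dd (\<lambda>q. \<alpha> q c) p b) - br (\<alpha> p a) (dd (\<lambda>q. \<alpha> q b) p c) + br (\<alpha> p a) (br (\<alpha> p b) (\<alpha> p c)))" for a b c
    unfolding cov_F_def dF x[of "dd (\<lambda>q. \<alpha> q b) p a"] by (simp add: conn_curvature_def br_simps)
  have jac: "br (\<alpha> p a) (br (\<alpha> p b) (\<alpha> p c)) + br (\<alpha> p b) (br (\<alpha> p c) (\<alpha> p a)) + br (\<alpha> p c) (br (\<alpha> p a) (\<alpha> p b)) = 0"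
    using br_jacobi[of "\<alpha> p a" "\<alpha> p b" "\<alpha> p c"] br_antisym[of "br (\<alpha> p a) (\<alpha> p b)" "\<alpha> p c"]
      br_antisym[of "\<alpha> p c" "\<alpha> p a"] by (simp add: br_simps)
  have mx: "dd (\<lambda>q. dd (\<lambda>q. \<alpha> q c) q b) p a = dd (\<lambda>q. dd (\<lambda>q. \<alpha> q c) q a) p b" for a b c
    by (rule smooth_mixed[OF U \<alpha>_smooth p])
  show ?thesis
    unfolding cv using jac mx[of c a b] mx[of a b c] mx[of b a c] by (simp add: algebra_simps)
qed

lemma cov_F_props:
  "cov_F a c b = - cov_F a b c" "cov_F a (J b) (J c) = cov_F a b c" "cov_F a b (- c) = - cov_F a b c"
proof -
  note d = F_differentiable[OF p]
  have m: "dd (\<lambda>q. - F q b c) p a = - dd (\<lambda>q. F q b c) p a" for b c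
    by (rule dd_bounded_linear[OF bounded_linear_minus[OF bounded_linear_ident] d])
  have 1: "dd (\<lambda>q. F q c b) p = dd (\<lambda>q. - F q b c) p" by (rule dd_cong_open[OF U p]) (rule F_alternating)
  have 2: "dd (\<lambda>q. F q (J b) (J c)) p = dd (\<lambda>q. F q b c) p" by (rule dd_cong_open[OF U p]) (rule F_J)
  have 3: "dd (\<lambda>q. F q b (- c)) p = dd (\<lambda>q. - F q b c) p"
    by (rule dd_cong_open[OF U p]) (rule linear_neg[OF F_linear(1)])
  show "cov_F a c b = - cov_F a b c"
    unfolding cov_F_def 1 m F_alternating[of p c b] by (simp add: br_simps)
  show "cov_F a (J b) (J c) = cov_F a b c" unfolding cov_F_def 2 F_J[OF p] ..
  show "cov_F a b (- c) = - cov_F a b c"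
    unfolding cov_F_def 3 m linear_neg[OF F_linear(1)[OF p]] by (simp add: br_simps)
qed

lemma cov_F_types: "ex10 (\<lambda>a. ex01 (\<lambda>c. cov_F a b c) c) a = D10 (\<lambda>q. Fc q b c) p a + br (ex10 (\<alpha> p) a) (Fc p b c)"
proof -
  have "ex01 (\<lambda>c. dd (\<lambda>q. F q b c) p a) c = dd (\<lambda>q. Fc q b c) p a" for a
    unfolding Fc_def by (rule dd_ex_parameter(2)[OF F_differentiable[OF p], symmetric])
  then have "ex01 (\<lambda>c. cov_F a b c) c = dd (\<lambda>q. Fc q b c) p a + br (\<alpha> p a) (Fc p b c)" for a
    unfolding cov_F_def ex_add Fc_def ex_complex_linear_comp[OF br_linear] by simp
  then show ?thesis by (simp add: ex_add ex_complex_linear_comp[OF br_linear_left])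
qed

lemma bianchi: "dF i k j + br (a10 i) (Fp k j) = dF k i j + br (a10 k) (Fp i j)"
  using bianchi_10[of cov_F, OF cov_F_cyclic cov_F_props, where a = "E i" and b = "E k" and c = "E j"]
  unfolding cov_F_types dF_def a10_def Fp_def .

text \<open>
  The frame dual to \<open>E\<close> for the metric at \<open>q\<close>. It gives the trace of \<open>F\<close> at all nearby points through one
  differentiable expression, while unitary frames would have to be chosen differentiably.
\<close>

definition dual_frame :: "'n \<Rightarrow> complex^'n \<Rightarrow> complex^'n" where
  "dual_frame k q = sharp (m q) (\<lambda>x. m p x (E k))"

lemma hm_dual_frame:
  assumes q: "q \<in> U"
  shows "hm q x (dual_frame k q) = hm p x (E k)"
proof -
  have s: "m q x (dual_frame k q) = m p x (E k)" for x
    unfolding dual_frame_def using sharp_exists[OF q m_linear_left[OF p], of "E k" x] m_sym[OF q] by simp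
  have "m q x (J (dual_frame k q)) = m p x (J (E k))"
    using s[of "J x"] m_J_left[OF q, of x "dual_frame k q"] m_J_left[OF p, of x "E k"] by simp
  then show ?thesis unfolding hm_def s by simp
qed

lemma dual_frame_p: "dual_frame k p = E k"
  unfolding dual_frame_def by (rule sharp_unique[OF p]) (rule m_sym[OF p])

lemma dual_frame_differentiable: "dual_frame k differentiable (at p)"
  unfolding dual_frame_def[abs_def] by (rule sharp_differentiable[OF p m_linear_left[OF p]]) simp

text \<open>An open neighbourhood of \<open>p\<close> on which the trace of \<open>F\<close> is known, so that it may be differentiated.\<close>

definition U0 :: "(complex^'n) set" where "U0 = {q \<in> U. wedge_power (herm_form m q) CARD('n) v0 \<noteq> 0}"

lemma U0: "open U0" "p \<in> U0"
proof -
  have "U0 = U \<inter> (\<lambda>q. wedge_power (herm_form m q) CARD('n) v0) -` (- {0})" by (auto simp: U0_def)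
  then show "open U0" using continuous_open_preimage[OF wedge_power_continuous U open_Compl[OF closed_singleton]] by simp
  show "p \<in> U0" using p v0 by (simp add: U0_def)
qed

lemma trace_dual_frame:
  assumes q0: "q \<in> U0"
  shows "(\<Sum>k\<in>UNIV. Fc q (E k) (dual_frame k q)) = scaleC \<i> z"
proof -
  have q: "q \<in> U" using q0 by (simp add: U0_def)
  obtain E' where E': "unitary q E'" by (rule unitary_exists[OF q])
  have "Fc q (E k) (dual_frame k q) = (\<Sum>j\<in>UNIV. Fc q (scaleC (hm p (E' j) (E k)) (E k)) (E' j))" for k
  proof -
    have "Fc q (E k) (dual_frame k q) = Fc q (E k) (\<Sum>j\<in>UNIV. scaleC (hm q (dual_frame k q) (E' j)) (E' j))"
      using unitary_expand[OF q E', of "dual_frame k q"] by simp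
    also have "\<dots> = (\<Sum>j\<in>UNIV. scaleC (hm q (E' j) (dual_frame k q)) (Fc q (E k) (E' j)))"
      by (simp add: linear_sum[OF Fc_right(2)[OF q]] Fc_right(1)[OF q] hm_cnj[OF q])
    finally show ?thesis by (simp add: hm_dual_frame[OF q] complex_linearD(2)[OF Fc_left[OF q]])
  qed
  then have "(\<Sum>k\<in>UNIV. Fc q (E k) (dual_frame k q)) = (\<Sum>j\<in>UNIV. \<Sum>k\<in>UNIV. Fc q (scaleC (hm p (E' j) (E k)) (E k)) (E' j))"
    by simp (rule sum.swap)
  also have "\<dots> = (\<Sum>j\<in>UNIV. Fc q (E' j) (E' j))"
    using expand by (simp flip: complex_linearD(7)[OF Fc_left[OF q]])
  finally show ?thesis using hermitian_einstein_trace[OF q _ E', of v0] q0 by (simp add: U0_def)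
qed

lemma dd_dual_frame:
  "dd (dual_frame k) p u = - (\<Sum>l\<in>UNIV. scaleC (cnj (dd (\<lambda>q. hm q (E l) (E k)) p u)) (E l))"
proof (rule unitary_eqI[OF p E])
  fix l
  note d = dual_frame_differentiable
  have "((\<lambda>t. hm t (E l) (dual_frame k t)) has_derivative
    (\<lambda>u. dd (\<lambda>q. hm q (E l) (dual_frame k p)) p u + hm p (E l) (dd (dual_frame k) p u))) (at p)"
    by (rule has_derivative_parametrised_linear[OF findim_vec U, where x = "\<lambda>q. q" and G = "\<lambda>q w. hm q (E l) w"])
       (use p hm_differentiable[OF p] hm_right(4) has_derivative_dd[OF d] in auto)
  then have "dd (\<lambda>t. hm t (E l) (dual_frame k t)) p u = dd (\<lambda>q. hm q (E l) (E k)) p u + hm p (E l) (dd (dual_frame k) p u)"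
    by (simp add: dd_eq dual_frame_p)
  moreover have "dd (\<lambda>t. hm t (E l) (dual_frame k t)) p = dd (\<lambda>t. hm p (E l) (E k)) p"
    by (rule dd_cong_open[OF U p]) (rule hm_dual_frame)
  ultimately have "hm p (E l) (dd (dual_frame k) p u) = - dd (\<lambda>q. hm q (E l) (E k)) p u"
    by (simp add: eq_neg_iff_add_eq_0 add.commute)
  then have "hm p (dd (dual_frame k) p u) (E l) = - cnj (dd (\<lambda>q. hm q (E l) (E k)) p u)"
    using hm_cnj[OF p, of "E l" "dd (dual_frame k) p u"] by simp
  then show "hm p (dd (dual_frame k) p u) (E l) = hm p (- (\<Sum>l\<in>UNIV. scaleC (cnj (dd (\<lambda>q. hm q (E l) (E k)) p u)) (E l))) (E l)"
    by (simp add: hm_left[OF p] if_distrib[where f = "\<lambda>x. _ * x"] cong: if_cong)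
qed

text \<open>The derivative of the constant trace; the right-hand side comes from the derivative of the dual frame.\<close>

lemma trace_derivative: "(\<Sum>k\<in>UNIV. dF c k k) = (\<Sum>k\<in>UNIV. \<Sum>l\<in>UNIV. scaleC (h1 c l k) (Fp k l))"
proof -
  note d = dual_frame_differentiable
  have hd: "((\<lambda>t. Fc t (E k) (dual_frame k t)) has_derivative
    (\<lambda>u. dd (\<lambda>q. Fc q (E k) (dual_frame k p)) p u + Fc p (E k) (dd (dual_frame k) p u))) (at p)" for k
    by (rule has_derivative_parametrised_linear[OF findim_vec U, where x = "\<lambda>q. q" and G = "\<lambda>q w. Fc q (E k) w"])
       (use p Fc_differentiable[OF p] Fc_right(2) has_derivative_dd[OF d] in auto)
  have e: "dd (\<lambda>t. Fc t (E k) (dual_frame k t)) p u = dd (\<lambda>q. Fc q (E k) (E k)) p u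
      - (\<Sum>l\<in>UNIV. scaleC (dd (\<lambda>q. hm q (E l) (E k)) p u) (Fp k l))" for k u
    by (simp add: dd_eq[OF hd] dual_frame_p dd_dual_frame linear_neg[OF Fc_right(2)[OF p]] linear_sum[OF Fc_right(2)[OF p]]
       Fc_right(1)[OF p] Fp_def)
  have "dd (\<lambda>t. \<Sum>k\<in>UNIV. Fc t (E k) (dual_frame k t)) p = dd (\<lambda>t. scaleC \<i> z) p"
    by (rule dd_cong_open[OF U0]) (rule trace_dual_frame)
  then have "(\<Sum>k\<in>UNIV. dd (\<lambda>t. Fc t (E k) (dual_frame k t)) p u) = 0" for u
    using dd_sum[of UNIV "\<lambda>k t. Fc t (E k) (dual_frame k t)" p u] hd by (auto simp: differentiable_def)
  then have "(\<Sum>k\<in>UNIV. dd (\<lambda>q. Fc q (E k) (E k)) p u - (\<Sum>l\<in>UNIV. scaleC (dd (\<lambda>q. hm q (E l) (E k)) p u) (Fp k l))) = 0" for u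
    unfolding e .
  then have "ex10 (\<lambda>u. \<Sum>k\<in>UNIV. dd (\<lambda>q. Fc q (E k) (E k)) p u - (\<Sum>l\<in>UNIV. scaleC (dd (\<lambda>q. hm q (E l) (E k)) p u) (Fp k l))) (E c) = 0"
    by simp
  moreover have cl: "complex_linear (\<lambda>w. scaleC w x)" for x :: 'l
    by (simp add: complex_linear_def scaleC_add_left scaleC_complex_def scaleC_scaleC)
  ultimately show ?thesis
    by (simp add: ex_sum_fun ex_diff ex_complex_linear_comp[OF cl] dF_def h1_def sum_subtractf)
qed

text \<open>
  The Bianchi identity exchanges \<open>i\<close> and \<open>k\<close>, which turns the divergence into the derivative of the trace of \<open>F\<close>;
  the bracket with that trace vanishes as \<open>z\<close> is central.
\<close>

lemma curvature_divergence_identity: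
  "(\<Sum>i\<in>UNIV. dF i k i + br (a10 i) (Fp k i) + (\<Sum>j\<in>UNIV. scaleC (T j k i) (Fp i j)) - (\<Sum>j\<in>UNIV. scaleC (h1 i k j) (Fp j i))) = 0"
proof -
  have tr: "(\<Sum>i\<in>UNIV. Fp i i) = scaleC \<i> z" unfolding Fp_def by (rule hermitian_einstein_trace[OF p v0 E])
  have "(\<Sum>i\<in>UNIV. br (a10 k) (Fp i i)) = br (a10 k) (scaleC \<i> z)" unfolding tr[symmetric] by (simp add: br_simps)
  also have "\<dots> = 0" using br_antisym[of "a10 k" z] by (simp add: br_scaleC br_z)
  finally have b: "(\<Sum>i\<in>UNIV. br (a10 k) (Fp i i)) = 0" .
  have "(\<Sum>i\<in>UNIV. dF i k i + br (a10 i) (Fp k i)) = (\<Sum>i\<in>UNIV. \<Sum>j\<in>UNIV. scaleC (h1 k j i) (Fp i j))"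
    unfolding bianchi[of _ k] sum.distrib b trace_derivative by simp
  moreover have "(\<Sum>i\<in>UNIV. \<Sum>j\<in>UNIV. scaleC (h1 i k j) (Fp j i)) = (\<Sum>i\<in>UNIV. \<Sum>j\<in>UNIV. scaleC (h1 j k i) (Fp i j))"
    by (rule sum.swap)
  ultimately show ?thesis
    by (simp add: T_def sum.distrib sum_subtractf scaleC_diff_left)
qed

lemma ricci_types:
  "ex10 (\<lambda>u. ex10 (\<lambda>v. W u v) (E l)) (E k) = ex10 (\<lambda>u. ex10 (\<lambda>v. W v u) (E l)) (E k)"
  "ex10 (\<lambda>u. ex01 (\<lambda>v. W u v) (E l)) (E k) - ex10 (\<lambda>u. ex01 (\<lambda>v. W v u) (E l)) (E k) = \<i> * ip z (Fp k l)"
proof -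
  have "complex_of_real (bismut_ricci m (2 * CARD('n)) real_frame p u v) + ip z (F p u v) = 0" for u v
    using conjunct1[OF conjunct2[OF coupled[OF p, unfolded coupled_hermitian_einstein_at_def]]] real_frame_orthonormal by blast
  then have r: "\<i> * (W u v - W v u) + ip z (F p u v) = 0" for u v unfolding ricci_eq .
  have "ex10 (\<lambda>u. ex10 (\<lambda>v. \<i> * (W u v - W v u) + ip z (F p u v)) (E l)) (E k) = 0"
       "ex10 (\<lambda>u. ex01 (\<lambda>v. \<i> * (W u v - W v u) + ip z (F p u v)) (E l)) (E k) = 0" unfolding r by simp_all
  then have "\<i> * (ex10 (\<lambda>u. ex10 (\<lambda>v. W u v) (E l)) (E k) - ex10 (\<lambda>u. ex10 (\<lambda>v. W v u) (E l)) (E k)) + ip z 0 = 0"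
    "\<i> * (ex10 (\<lambda>u. ex01 (\<lambda>v. W u v) (E l)) (E k) - ex10 (\<lambda>u. ex01 (\<lambda>v. W v u) (E l)) (E k)) + ip z (Fp k l) = 0"
    unfolding ex_add ex_mult ex_diff ex_complex_linear_comp[OF ip_linear] F_types[OF p] Fp_def by simp_all
  then show "ex10 (\<lambda>u. ex10 (\<lambda>v. W u v) (E l)) (E k) = ex10 (\<lambda>u. ex10 (\<lambda>v. W v u) (E l)) (E k)"
    "ex10 (\<lambda>u. ex01 (\<lambda>v. W u v) (E l)) (E k) - ex10 (\<lambda>u. ex01 (\<lambda>v. W v u) (E l)) (E k) = \<i> * ip z (Fp k l)"
    by (simp_all add: ip_simps) (simp add: complex_eq_iff)
qed

text \<open>
  The (2,0)-part of the Ricci form vanishes with that of \<open>F\<close>; the quadratic terms of \<open>W\<close> that involve no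
  torsion are symmetric in \<open>k\<close> and \<open>l\<close>.
\<close>

lemma ricci_20_identity:
  "(\<Sum>i\<in>UNIV. hB i l k i - hB i k l i - (\<Sum>j\<in>UNIV. h1 i l j * T j k i) - (\<Sum>j\<in>UNIV. h1 i k j * T l j i)) = 0"
proof -
  have "(\<Sum>s\<in>UNIV. hB k s l s - (\<Sum>t\<in>UNIV. h1 k t s * h1 s l t)) = (\<Sum>s\<in>UNIV. hB l s k s - (\<Sum>t\<in>UNIV. h1 l t s * h1 s k t))"
    unfolding W_types(3)[symmetric] ricci_types(1)[of l k] by (rule ex_swap(1))
  moreover have "(\<Sum>i\<in>UNIV. \<Sum>j\<in>UNIV. h1 i l j * h1 j k i) = (\<Sum>i\<in>UNIV. \<Sum>j\<in>UNIV. h1 i k j * h1 j l i)"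
    by (subst sum.swap) (simp add: mult.commute)
  ultimately show ?thesis
    unfolding hB_sym[of _ l] hB_sym[of _ k]
    by (simp add: T_def sum.distrib sum_subtractf algebra_simps)
qed

lemma pluriclosed_components:
  "hA l k i j - hA l i k j - hA j k i l + hA j i k l = ip (Fp k l) (Fp i j) - ip (Fp i l) (Fp k j)"
proof -
  define S where "S a b c d = 2 * (ip (F p a b) (F p c d) - ip (F p a c) (F p b d) + ip (F p a d) (F p b c))" for a b c d
  have "d_form 3 (dc_form 2 (herm_form_c m)) p v + S (v 0) (v 1) (v 2) (v 3) = 0" for v
  proof -
    have "wedge 2 2 ip (\<lambda>v. F p (v 0) (v 1)) (\<lambda>v. F p (v 0) (v 1)) v = S (v 0) (v 1) (v 2) (v 3)"
      unfolding S_def by (rule wedge_2_2) (rule ip_sym, simp add: ip_simps, rule F_alternating)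
    then show ?thesis
      using conjunct2[OF conjunct2[OF coupled[OF p, unfolded coupled_hermitian_einstein_at_def]], rule_format, of v] by simp
  qed
  then have "2 * (hA l k i j - hA l i k j - hA j k i l + hA j i k l) + proj4 S (E l) (E k) (E i) (E j) = 0"
    by (rule pluriclosed_types)
  moreover have "proj4 S a b c d = 2 * (- ip (Fc p b a) (Fc p c d) + ip (Fc p c a) (Fc p b d))" for a b c d
  proof -
    have 1: "proj4 (\<lambda>a b c d. ip (F p a b) (F p c d)) a b c d = - ip (Fc p b a) (Fc p c d)"
      unfolding proj4_def ex_complex_linear_comp[OF ip_linear] ex_complex_linear_comp[OF ip_linear_left] F_types[OF p]
      by (simp add: ip_simps)
    have 2: "proj4 (\<lambda>a b c d. ip (F p a c) (F p b d)) a b c d = - ip (Fc p c a) (Fc p b d)"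
      unfolding proj4_def ex_complex_linear_comp[OF ip_linear]
      apply (subst ex_swap(1))
      unfolding ex_complex_linear_comp[OF ip_linear] ex_complex_linear_comp[OF ip_linear_left] F_types[OF p]
      by (simp add: ip_simps)
    have 3: "proj4 (\<lambda>a b c d. ip (F p a d) (F p b c)) a b c d = 0"
      unfolding proj4_def ex_complex_linear_comp[OF ip_linear_left] ex_complex_linear_comp[OF ip_linear] F_types[OF p]
      by (simp add: ip_simps)
    show ?thesis unfolding S_def proj4_mult proj4_add proj4_diff 1 2 3 by simp
  qed
  ultimately have "2 * ((hA l k i j - hA l i k j - hA j k i l + hA j i k l) - (ip (Fp k l) (Fp i j) - ip (Fp i l) (Fp k j))) = 0"
    unfolding Fp_def by (simp only: right_diff_distrib distrib_left) (simp add: algebra_simps)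
  then have "(hA l k i j - hA l i k j - hA j k i l + hA j i k l) - (ip (Fp k l) (Fp i j) - ip (Fp i l) (Fp k j)) = 0"
    by (simp only: mult_eq_0_iff) simp
  then show ?thesis by simp
qed

text \<open>
  The trace over \<open>i = j\<close> of the equation \<open>dd\<^sup>c\<omega> + \<langle>F \<and> F\<rangle> = 0\<close> contains \<open>\<langle>F, tr F\<rangle> = \<i> \<langle>F, z\<rangle>\<close>. The (1,1)-part of the
  Ricci equation contains the same term together with the other traces of second derivatives of \<open>h\<close>; in
  the difference only \<open>\<Sum>\<^sub>i hA i i k l\<close> remains.
\<close>

lemma ricci_anomaly_identity:
  "(\<Sum>i\<in>UNIV. - hA i i k l + (\<Sum>j\<in>UNIV. h1 i k j * cnj (h1 i l j)) - ip (Fp k i) (Fp i l) - (\<Sum>j\<in>UNIV. T j k i * cnj (T j l i))) = 0"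
proof -
  have tr: "(\<Sum>i\<in>UNIV. Fp i i) = scaleC \<i> z" unfolding Fp_def by (rule hermitian_einstein_trace[OF p v0 E])
  have "(\<Sum>i\<in>UNIV. hA l k i i - hA l i k i - hA i k i l + hA i i k l) = (\<Sum>i\<in>UNIV. ip (Fp k l) (Fp i i)) - (\<Sum>i\<in>UNIV. ip (Fp i l) (Fp k i))"
    unfolding pluriclosed_components by (simp add: sum_subtractf)
  also have "(\<Sum>i\<in>UNIV. ip (Fp k l) (Fp i i)) = \<i> * ip (Fp k l) z"
    using tr by (simp add: ip_scaleC flip: ip_simps)
  finally have 1: "(\<Sum>i\<in>UNIV. hA l k i i - hA l i k i - hA i k i l + hA i i k l) = \<i> * ip z (Fp k l) - (\<Sum>i\<in>UNIV. ip (Fp k i) (Fp i l))"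
    by (simp add: ip_sym)
  have 2: "(\<Sum>s\<in>UNIV. hA l k s s - hA s k s l - (\<Sum>t\<in>UNIV. h1 k t s * (cnj (h1 l t s) - cnj (h1 t l s))))
    - (\<Sum>s\<in>UNIV. hA l s k s - (\<Sum>t\<in>UNIV. cnj (h1 l s t) * h1 s k t)) = \<i> * ip z (Fp k l)"
    using ricci_types(2)[of l k] unfolding W_types .
  have sw: "(\<Sum>i\<in>UNIV. \<Sum>j\<in>UNIV. h1 j k i * cnj (h1 l j i)) = (\<Sum>s\<in>UNIV. \<Sum>t\<in>UNIV. cnj (h1 l s t) * h1 s k t)"
    "(\<Sum>i\<in>UNIV. \<Sum>j\<in>UNIV. h1 j k i * cnj (h1 j l i)) = (\<Sum>i\<in>UNIV. \<Sum>j\<in>UNIV. h1 i k j * cnj (h1 i l j))"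
    by (subst sum.swap, simp add: mult.commute)+
  show ?thesis
    using 1 2 sw by (simp add: T_def sum.distrib sum_subtractf algebra_simps) algebra
qed

end

section \<open>Chern connections\<close>

locale chern_chart =
  fixes U :: "'v::complex_normed_vector set"
    and dbar :: "('v \<Rightarrow> 'w::complex_normed_vector) \<Rightarrow> 'v \<Rightarrow> 'v \<Rightarrow> 'w"
    and H :: "'v \<Rightarrow> 'w \<Rightarrow> 'w \<Rightarrow> complex" and A :: "'v \<Rightarrow> 'v \<Rightarrow> 'w \<Rightarrow> 'w"
  assumes U_open: "open U" and chern: "chern_connection_form U dbar H A"
    and H_left: "\<And>q Y. q \<in> U \<Longrightarrow> complex_linear (\<lambda>X. H q X Y)"
    and H_cnj: "\<And>q X Y. q \<in> U \<Longrightarrow> cnj (H q X Y) = H q Y X"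
begin

lemma A_smooth: "smooth_on U (\<lambda>q. A q u x)"
  and A_linear: "q \<in> U \<Longrightarrow> linear (\<lambda>u. A q u x)" and A_complex_linear: "q \<in> U \<Longrightarrow> complex_linear (A q u)"
  and dbar_A: "smooth_on U s \<Longrightarrow> q \<in> U \<Longrightarrow> ex01 (\<lambda>b. dd s q b + A q b (s q)) u = dbar s q u"
  and compatible: "smooth_on U s \<Longrightarrow> smooth_on U t \<Longrightarrow> q \<in> U \<Longrightarrow> dd (\<lambda>q. H q (s q) (t q)) q u =
      H q (dd s q u + A q u (s q)) (t q) + H q (s q) (dd t q u + A q u (t q))"
  using chern unfolding chern_connection_form_def by blast+

lemma H_simps:
  assumes q: "q \<in> U"
  shows "H q (X + X') Y = H q X Y + H q X' Y" "H q (X - X') Y = H q X Y - H q X' Y" "H q (- X) Y = - H q X Y"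
    "H q (scaleC c X) Y = c * H q X Y" "H q (r *\<^sub>R X) Y = r *\<^sub>R H q X Y" "H q 0 Y = 0"
    "H q (sum f I) Y = (\<Sum>i\<in>I. H q (f i) Y)"
    "H q X (Y + Y') = H q X Y + H q X Y'" "H q X (Y - Y') = H q X Y - H q X Y'" "H q X (- Y) = - H q X Y"
    "H q X (scaleC c Y) = cnj c * H q X Y" "H q X (r *\<^sub>R Y) = r *\<^sub>R H q X Y" "H q X 0 = 0"
    "H q X (sum f I) = (\<Sum>i\<in>I. H q X (f i))"
proof -
  note l = complex_linearD[OF H_left[OF q]]
  show "H q (X + X') Y = H q X Y + H q X' Y" "H q (X - X') Y = H q X Y - H q X' Y" "H q (- X) Y = - H q X Y"
    "H q (r *\<^sub>R X) Y = r *\<^sub>R H q X Y" "H q 0 Y = 0"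
    "H q (sum f I) Y = (\<Sum>i\<in>I. H q (f i) Y)"
    by (rule l)+
  show "H q (scaleC c X) Y = c * H q X Y" using l(2)[of c X Y] by (simp add: scaleC_complex_def)
  have c: "H q X Y = cnj (H q Y X)" for X Y by (rule H_cnj[OF q, symmetric])
  show "H q X (Y + Y') = H q X Y + H q X Y'" "H q X (Y - Y') = H q X Y - H q X Y'" "H q X (- Y) = - H q X Y"
    "H q X (scaleC c Y) = cnj c * H q X Y" "H q X (r *\<^sub>R Y) = r *\<^sub>R H q X Y" "H q X 0 = 0"
    "H q X (sum f I) = (\<Sum>i\<in>I. H q X (f i))"
    unfolding c[of X] by (simp_all add: l scaleC_complex_def)
qed

text \<open>The (1,0)-part \<open>D'\<close> of the connection; the (0,1)-part is \<open>dbar\<close>.\<close>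

definition del :: "('v \<Rightarrow> 'w) \<Rightarrow> 'v \<Rightarrow> 'v \<Rightarrow> 'w" where
  "del s q a = ex10 (\<lambda>u. dd s q u + A q u (s q)) a"

lemma D_H:
  assumes s: "smooth_on U s" and t: "smooth_on U t" and q: "q \<in> U"
  shows "D10 (\<lambda>q. H q (s q) (t q)) q a = H q (del s q a) (t q) + H q (s q) (dbar t q a)"
    "D01 (\<lambda>q. H q (s q) (t q)) q a = H q (dbar s q a) (t q) + H q (s q) (del t q a)"
  unfolding del_def dbar_A[OF s q, symmetric] dbar_A[OF t q, symmetric] ex10_def ex01_def compatible[OF s t q]
  by (simp_all add: H_simps[OF q] scaleC_complex_def algebra_simps)

lemma const_smooth: "smooth_on U (\<lambda>_. s)" by (rule smooth_on_const)

lemma dbar_const: "q \<in> U \<Longrightarrow> dbar (\<lambda>_. s) q a = ex01 (\<lambda>u. A q u s) a"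
  using dbar_A[OF const_smooth, of q s a] by simp

lemma del_const: "del (\<lambda>_. s) q a = ex10 (\<lambda>u. A q u s) a"
  by (simp add: del_def)

lemma ex_A_smooth: "smooth_on U (\<lambda>q. ex10 (\<lambda>u. A q u s) a)" "smooth_on U (\<lambda>q. ex01 (\<lambda>u. A q u s) a)"
  unfolding ex10_def ex01_def
  by (intro smooth_on_bounded_linear[OF U_open bounded_linear_scaleR_right] smooth_on_add[OF U_open] smooth_on_diff[OF U_open]
      smooth_on_bounded_linear[OF U_open bounded_linear_scaleC] A_smooth)+

lemma A_differentiable: "q \<in> U \<Longrightarrow> (\<lambda>q. A q u s) differentiable (at q)"
  by (rule smooth_on_differentiable[OF A_smooth])

text \<open>The curvature on the pair \<open>(V, V\<^sup>*)\<close> for \<open>V = (a - \<i> J a)/2\<close>.\<close>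

definition curv11 :: "'v \<Rightarrow> 'v \<Rightarrow> 'w \<Rightarrow> 'w" where
  "curv11 q a s = scaleC (\<i> / 2) (vb_curvature A q a (scaleC \<i> a) s)"

lemma vb_curvature_alternating: "vb_curvature A q u v s = - vb_curvature A q v u s"
  by (simp add: vb_curvature_def)

lemma curv11_commutator:
  assumes p: "p \<in> U"
  shows "curv11 p a s = del (\<lambda>q. ex01 (\<lambda>u. A q u s) a) p a - dbar (\<lambda>q. ex10 (\<lambda>u. A q u s) a) p a"
proof -
  define N where "N u v = dd (\<lambda>q. A q v s) p u + A p u (A p v s)" for u v
  have R: "vb_curvature A p u v s = N u v - N v u" for u v by (simp add: vb_curvature_def N_def)
  have 1: "del (\<lambda>q. ex01 (\<lambda>u. A q u s) a) p a = ex10 (\<lambda>u. ex01 (\<lambda>v. N u v) a) a"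
    unfolding del_def N_def dd_ex_parameter[OF A_differentiable[OF p]] ex_add ex_complex_linear_comp[OF A_complex_linear[OF p]] ..
  have 2: "dbar (\<lambda>q. ex10 (\<lambda>u. A q u s) a) p a = ex01 (\<lambda>u. ex10 (\<lambda>v. N u v) a) a"
    unfolding dbar_A[OF ex_A_smooth(1) p, symmetric] N_def dd_ex_parameter[OF A_differentiable[OF p]] ex_add ex_complex_linear_comp[OF A_complex_linear[OF p]] ..
  have "R' = - R \<Longrightarrow> (1/2) *\<^sub>R ((1/2) *\<^sub>R scaleC \<i> R - scaleC \<i> ((1/2) *\<^sub>R R')) = scaleC (\<i>/2) (R :: 'w)" for R R'
    by (subst (3) scaleC_eq) (simp add: scaleC_scaleR scaleC_minus_right flip: scaleR_add_left)
  from this[OF vb_curvature_alternating[of p "scaleC \<i> a" a s]]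
  have "curv11 p a s = ex10 (\<lambda>u. ex01 (\<lambda>v. vb_curvature A p u v s) a) a"
    unfolding curv11_def ex10_def ex01_def
    using vb_curvature_alternating[of p a a s] vb_curvature_alternating[of p "scaleC \<i> a" "scaleC \<i> a" s]
    by (simp add: eq_neg_iff_add_eq_0 scaleC_add_right scaleC_scaleR flip: scaleR_2)
  also have "\<dots> = ex10 (\<lambda>u. ex01 (\<lambda>v. N u v) a) a - ex01 (\<lambda>u. ex10 (\<lambda>v. N u v) a) a"
    unfolding R ex_diff ex_swap(2)[of "\<lambda>a b. N b a"] ..
  finally show ?thesis unfolding 1 2 .
qed

lemma H_del_const:
  assumes t: "smooth_on U t" and q: "q \<in> U"
  shows "H q (ex10 (\<lambda>u. A q u s) a) (t q) = D10 (\<lambda>q. H q s (t q)) q a - H q s (dbar t q a)"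
  using D_H(1)[OF const_smooth t q, of s a] by (simp add: del_const)

text \<open>
  The connection form itself is eliminated from the first three terms: metric compatibility replaces \<open>D'\<close> on
  the left of \<open>H\<close> by derivatives of functions and \<open>D''\<close> on the right, and only first-order data of
  \<open>D'\<close> at the point \<open>p\<close> remain in the last term.
\<close>

lemma H_curv11:
  assumes t: "smooth_on U t" and p: "p \<in> U"
  shows "H p (curv11 p a s) (t p) =
    D10 (\<lambda>q. H q (dbar (\<lambda>_. s) q a) (t q)) p a - H p (dbar (\<lambda>_. s) p a) (dbar t p a)
    - D01 (\<lambda>q. D10 (\<lambda>q. H q s (t q)) q a - H q s (dbar t q a)) p a
    + H p (ex10 (\<lambda>u. A p u s) a) (del t p a)"
proof -
  have "D10 (\<lambda>q. H q (dbar (\<lambda>_. s) q a) (t q)) p = D10 (\<lambda>q. H q (ex01 (\<lambda>u. A q u s) a) (t q)) p"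
    by (rule D_cong_open[OF U_open p]) (simp add: dbar_const)
  moreover have "D01 (\<lambda>q. D10 (\<lambda>q. H q s (t q)) q a - H q s (dbar t q a)) p = D01 (\<lambda>q. H q (ex10 (\<lambda>u. A q u s) a) (t q)) p"
    by (rule D_cong_open[OF U_open p]) (simp add: H_del_const[OF t])
  ultimately show ?thesis
    using D_H(1)[OF ex_A_smooth(2) t p, of s a a] D_H(2)[OF ex_A_smooth(1) t p, of s a a]
    by (simp add: curv11_commutator[OF p] H_simps[OF p] dbar_const[OF p])
qed

lemma curv11_complex_linear:
  assumes p: "p \<in> U"
  shows "complex_linear (curv11 p a)"
proof -
  note l = complex_linearD[OF dd_parameter_complex_linear[OF U_open p A_complex_linear A_differentiable[OF p]]]
    complex_linearD[OF A_complex_linear[OF p]]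
  show ?thesis
    unfolding complex_linear_def curv11_def vb_curvature_def
    by (simp add: l scaleC_add_right scaleC_diff_right scaleC_scaleC mult.commute)
qed

lemma vb_curvature_linear:
  assumes p: "p \<in> U"
  shows "linear (\<lambda>u. vb_curvature A p u v s)" "linear (\<lambda>v. vb_curvature A p u v s)"
proof -
  note d = A_differentiable[OF p]
  have 1: "linear (\<lambda>v. dd (\<lambda>q. A q v s) p u)" for u
    by (rule dd_parameter_linear[where f = "\<lambda>q v. A q v s", OF U_open p A_linear d])
  note AA = linear_compose[OF A_linear[OF p] complex_linear_linear[OF A_complex_linear[OF p]], unfolded o_def]
  show "linear (\<lambda>u. vb_curvature A p u v s)" "linear (\<lambda>v. vb_curvature A p u v s)"
    unfolding vb_curvature_def
    by (intro linear_compose_add linear_compose_sub 1 linear_dd[OF d] A_linear[OF p] AA)+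
qed

text \<open>
  The curvature is skew-Hermitian. For constant sections that are orthogonal everywhere the proof only takes
  derivatives of the vanishing function \<open>H s t\<close>.
\<close>

lemma H_curv11_symmetric:
  assumes p: "p \<in> U" and z: "\<And>q. q \<in> U \<Longrightarrow> H q s t = 0"
  shows "H p (curv11 p a s) t = H p s (curv11 p a t)"
proof -
  have 0: "H q (A q v s) t = - H q s (A q v t)" if q: "q \<in> U" for q v
  proof -
    have "dd (\<lambda>q. H q s t) q = dd (\<lambda>_. 0) q" by (rule dd_cong_open[OF U_open q]) (rule z)
    then show ?thesis using compatible[OF const_smooth const_smooth q, of s t v] by (simp add: eq_neg_iff_add_eq_0)
  qed
  have N: "H p (dd (\<lambda>q. A q v s) p u + A p u (A p v s)) t + H p (A p v s) (A p u t)
    + H p (A p u s) (A p v t) + H p s (dd (\<lambda>q. A q v t) p u + A p u (A p v t)) = 0" for u v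
  proof -
    \<comment> \<open>\<open>H s t\<close> vanishes, so this equality of functions carries the derivative of the mixed terms
      without presupposing that they are differentiable one by one.\<close>
    have "dd (\<lambda>q. H q (s + A q v s) (t + A q v t)) p = dd (\<lambda>q. H q (A q v s) (A q v t)) p"
      by (rule dd_cong_open[OF U_open p]) (simp add: H_simps 0 z)
    moreover have "smooth_on U (\<lambda>q. s + A q v s)" for s v
      by (rule smooth_on_add[OF U_open const_smooth A_smooth])
    moreover have "dd (\<lambda>q. s + A q v s) p u = dd (\<lambda>q. A q v s) p u" for s v
      using dd_add[OF _ A_differentiable[OF p], of "\<lambda>_. s" v s u] by simp
    ultimately show ?thesis
      using compatible[OF _ _ p, of "\<lambda>q. s + A q v s" "\<lambda>q. t + A q v t" u] compatible[OF A_smooth A_smooth p, of v s v t u]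
      by (simp add: H_simps[OF p] complex_linearD(1)[OF A_complex_linear[OF p]] 0[OF p] algebra_simps)
  qed
  have "H p (vb_curvature A p u v s) t + H p s (vb_curvature A p u v t) = 0" for u v
    using N[of v u] N[of u v] unfolding vb_curvature_def by (simp add: H_simps[OF p]) algebra
  then have "H p (vb_curvature A p u v s) t = - H p s (vb_curvature A p u v t)" for u v
    by (simp add: eq_neg_iff_add_eq_0)
  then show ?thesis
    unfolding curv11_def by (simp add: H_simps[OF p])
qed

end

section \<open>The metric and the Dolbeault operator of Q\<close>

text \<open>The pairing of components with respect to \<open>dz\<^sub>i\<close> and \<open>\<partial>/\<partial>z\<^sub>i\<close>.\<close>

definition covec :: "complex^'n \<Rightarrow> complex^'n \<Rightarrow> complex" where
  "covec \<xi> v = (\<Sum>i\<in>UNIV. \<xi> $ i * v $ i)"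

lemma covec_linear: "complex_linear (covec \<xi>)" "complex_linear (\<lambda>\<xi>. covec \<xi> v)"
  unfolding complex_linear_def covec_def
  by (simp_all add: scaleC_vec_def scaleC_complex_def sum.distrib algebra_simps sum_distrib_left)

lemmas covec_simps = complex_linearD[OF covec_linear(1)] complex_linearD[OF covec_linear(2)]

lemma covec_eqI: "(\<And>v. covec \<xi> v = covec \<xi>' v) \<Longrightarrow> \<xi> = \<xi>'"
proof -
  assume "\<And>v. covec \<xi> v = covec \<xi>' v"
  then have "covec \<xi> (axis i 1) = covec \<xi>' (axis i 1)" for i by blast
  then show ?thesis by (simp add: covec_def axis_def vec_eq_iff if_distrib cong: if_cong)
qed

lemma complex_linear_axis:
  assumes "complex_linear f"
  shows "covec (\<chi> i. f (axis i 1)) v = f (v :: complex^'n)"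
proof -
  have "v = (\<Sum>i\<in>UNIV. scaleC (v $ i) (axis i 1))"
    by (simp add: vec_eq_iff scaleC_vec_def scaleC_complex_def axis_def if_distrib cong: if_cong)
  then have "f v = (\<Sum>i\<in>UNIV. scaleC (v $ i) (f (axis i 1)))"
    by (metis (no_types, lifting) complex_linearD(2,7)[OF assms] sum.cong)
  then show ?thesis by (simp add: covec_def scaleC_complex_def mult.commute)
qed

context gauge_chart
begin

abbreviation H :: "complex^'n \<Rightarrow> ('n, 'l) Q_fibre \<Rightarrow> ('n, 'l) Q_fibre \<Rightarrow> complex" where
  "H \<equiv> metric_Q ip kk m"

abbreviation dbar where "dbar \<equiv> dolbeault_Q G e ip m \<alpha>"

lemma covec_representation:
  assumes q: "q \<in> U"
  shows "\<exists>X. \<forall>v. covec \<xi> v = hm q v X"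
proof -
  let ?X = "2 *\<^sub>R sharp (m q) (\<lambda>v. Re (covec \<xi> v))"
  have "linear (\<lambda>v. Re (covec \<xi> v))"
    using linear_compose[OF complex_linear_linear[OF covec_linear(1)] bounded_linear.linear[OF bounded_linear_Re]] by (simp add: o_def)
  from sharp_exists[OF q this] have s: "m q (sharp (m q) (\<lambda>v. Re (covec \<xi> v))) v = Re (covec \<xi> v)" for v .
  have "covec \<xi> v = hm q v ?X" for v
  proof -
    have "Re (covec \<xi> v) = Re (hm q v ?X)" for v
      using s[of v] m_sym[OF q, of v] by (simp add: hm_def linear_scale[OF m_linear[OF q]])
    from this[of v] this[of "J v"] show ?thesis
      using complex_linearD(2)[OF covec_linear(1), of \<xi> \<i> v] hm_left(3)[OF q, of \<i> v ?X]
      by (simp add: complex_eq_iff scaleC_complex_def)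
  qed
  then show ?thesis by blast
qed

text \<open>The vector that represents the covector \<open>\<xi>\<close> through the Hermitian form; it depends antilinearly on \<open>\<xi>\<close>.\<close>

definition rep :: "complex^'n \<Rightarrow> complex^'n \<Rightarrow> complex^'n" where
  "rep q \<xi> = (SOME X. \<forall>v. covec \<xi> v = hm q v X)"

lemma covec_rep: "q \<in> U \<Longrightarrow> covec \<xi> v = hm q v (rep q \<xi>)"
  unfolding rep_def using someI_ex[OF covec_representation] by blast

lemma dual_metric_covec:
  assumes q: "q \<in> U"
  shows "dual_metric (m q) (covec \<xi>) (\<lambda>v. cnj (covec \<xi>' v)) = hm q (rep q \<xi>') (rep q \<xi>)"
proof -
  let ?X = "(1/2) *\<^sub>R rep q \<xi>"
  have r: "covec \<xi> v = 2 * hm q v ?X" for v by (simp add: covec_rep[OF q] hm_right[OF q])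
  have re: "sharp (m q) (\<lambda>v. Re (covec \<xi> v)) = ?X"
    by (rule sharp_unique[OF q]) (simp add: r m_eq_hm flip: hm_cnj[OF q, of ?X])
  have im: "sharp (m q) (\<lambda>v. Im (covec \<xi> v)) = J ?X"
    by (rule sharp_unique[OF q]) (simp add: r m_eq_hm hm_left(3)[OF q] flip: hm_cnj[OF q, of ?X])
  have "dual_metric (m q) (covec \<xi>) (\<lambda>v. cnj (covec \<xi>' v)) = cnj (2 * covec \<xi>' ?X)"
    unfolding dual_metric_def re im complex_linearD(2)[OF covec_linear(1)] by (simp add: scaleC_complex_def)
  also have "\<dots> = cnj (covec \<xi>' (rep q \<xi>))" by (simp add: covec_simps)
  also have "\<dots> = hm q (rep q \<xi>') (rep q \<xi>)" by (simp add: covec_rep[OF q] hm_cnj[OF q])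
  finally show ?thesis .
qed

lemma H_eq:
  assumes q: "q \<in> U"
  shows "H q (V, r, \<xi>) (V', r', \<xi>') = hm q V V' + 1/4 * hm q (rep q \<xi>') (rep q \<xi>) - ip r (cj r')"
  using dual_metric_covec[OF q, of \<xi> \<xi>'] by (simp add: metric_Q_def hm_ex[OF q] covec_def[abs_def])

lemma rep_simps:
  assumes q: "q \<in> U"
  shows "rep q (\<xi> + \<xi>') = rep q \<xi> + rep q \<xi>'" "rep q (scaleC c \<xi>) = scaleC (cnj c) (rep q \<xi>)" "rep q 0 = 0"
proof -
  have I: "rep q \<xi> = X" if "\<And>v. covec \<xi> v = hm q v X" for \<xi> X
  proof (rule hm_eqI[OF q])
    fix b show "hm q (rep q \<xi>) b = hm q X b"
      using that[of b] covec_rep[OF q, of \<xi> b] hm_cnj[OF q, of b "rep q \<xi>"] hm_cnj[OF q, of b X] by simp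
  qed
  show "rep q (\<xi> + \<xi>') = rep q \<xi> + rep q \<xi>'" "rep q (scaleC c \<xi>) = scaleC (cnj c) (rep q \<xi>)" "rep q 0 = 0"
    by (rule I, simp add: covec_simps hm_right[OF q] scaleC_complex_def flip: covec_rep[OF q])+
qed

lemma H_linear:
  assumes q: "q \<in> U"
  shows "complex_linear (\<lambda>X. H q X Y)"
  unfolding complex_linear_def
  by (cases Y) (auto simp: scaleC_prod_def H_eq[OF q] rep_simps[OF q] hm_left[OF q] hm_right[OF q] ip_simps ip_scaleC scaleC_complex_def
     algebra_simps split: prod.splits)

lemma H_hermitian:
  assumes q: "q \<in> U"
  shows "cnj (H q X Y) = H q Y X"
proof -
  have "cnj (ip r (cj r')) = ip r' (cj r)" for r r' using ip_cj[of r "cj r'"] by (simp add: cj_cj ip_sym)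
  then show ?thesis by (cases X, cases Y) (simp add: H_eq[OF q] hm_cnj[OF q])
qed

lemma H_covec:
  assumes q: "q \<in> U" and \<sigma>: "\<And>v. covec \<sigma> v = hm q v W"
  shows "H q (V, r, \<xi>) (0, 0, \<sigma>) = 1/4 * covec \<xi> W"
proof -
  have "hm q (rep q \<sigma>) (rep q \<xi>) = hm q W (rep q \<xi>)"
    using covec_rep[OF q, of \<sigma> "rep q \<xi>"] \<sigma>[of "rep q \<xi>"] hm_cnj[OF q] by metis
  then show ?thesis
    by (simp add: H_eq[OF q] hm_right[OF q] linear_0[OF cj_linear] ip_simps covec_rep[OF q])
qed

text \<open>
  The section metrically dual to the constant vector \<open>W\<close>. Its pairing with any section does not involve the metric
  (\<open>H_sigma\<close>), which spares derivatives of the inverse matrix of \<open>h\<close>.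
\<close>

definition sigma :: "complex^'n \<Rightarrow> complex^'n \<Rightarrow> ('n, 'l) Q_fibre" where
  "sigma W q = (0, 0, \<chi> i. hm q (axis i 1) W)"

lemma covec_hm: "q \<in> U \<Longrightarrow> covec (\<chi> i. hm q (axis i 1) W) v = hm q v W"
  by (rule complex_linear_axis[OF hm_left(1)])

lemma H_sigma: "q \<in> U \<Longrightarrow> H q X (sigma W q) = 1/4 * covec (snd (snd X)) W"
  unfolding sigma_def using H_covec[OF _ covec_hm] by (cases X) simp

lemma smooth_vec:
  fixes f :: "complex^'n \<Rightarrow> complex^'n"
  assumes "\<And>i. smooth_on U (\<lambda>q. f q $ i)"
  shows "smooth_on U f"
proof -
  have "smooth_on U (\<lambda>q. \<Sum>i\<in>UNIV. axis i (f q $ i))"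
    by (intro smooth_on_sum[OF U] smooth_on_bounded_linear[OF U bounded_linear_axis] assms)
  then show ?thesis by (simp add: vec_axis_sum)
qed

lemma sigma_smooth: "smooth_on U (sigma W)"
proof -
  have s: "smooth_on U (\<lambda>q. \<chi> i. hm q (axis i 1) W)" by (rule smooth_vec) (simp add: hm_smooth)
  have b: "bounded_linear (\<lambda>\<xi>. (0, 0, \<xi>) :: ('n, 'l) Q_fibre)"
    by (intro bounded_linear_Pair bounded_linear_zero bounded_linear_ident)
  show ?thesis unfolding sigma_def[abs_def] by (rule smooth_on_bounded_linear[OF U b s])
qed

text \<open>Only \<open>\<partial>\<close> in the directions of \<open>V\<close> and \<open>w'\<close> survives, as \<open>\<partial>\<omega>\<close> has type (2,1).\<close>

lemma torsion_term:
  assumes q: "q \<in> U"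
  shows "- 2 * \<i> * ex10 (\<lambda>a. ex01 (\<lambda>b. ex10 (\<lambda>k. del_form 2 (herm_form_c m) q ((!) [a, b, k])) w') w) V
    = 2 * (D10 (\<lambda>q. hm q V w) q w' - D10 (\<lambda>q. hm q w' w) q V)"
proof -
  define d where "d a b c = D10 (\<lambda>q. hm q b c) q a" for a b c
  note df = hm_differentiable[OF q]
  have dJ: "d (J a) b c = \<i> * d a b c" "d a (J b) c = \<i> * d a b c" "d a b (J c) = - (\<i> * d a b c)" for a b c
    unfolding d_def using complex_linearD(2)[OF D_hm_vars(1)[OF q]] complex_linearD(2)[OF D_hm_vars(3)[OF q]] D_hm_vars(5)[OF q]
    by (simp_all add: scaleC_complex_def)
  have om: "D10 (\<lambda>q. complex_of_real (m q (J b) c)) q a = \<i> * d a b c - \<i> * d a c b" for a b c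
  proof -
    have "D10 (\<lambda>q. complex_of_real (m q (J b) c)) q = D10 (\<lambda>q. \<i> * hm q b c - \<i> * hm q c b) q"
    proof (rule D_cong_open(1)[OF U q])
      fix q assume q: "q \<in> U"
      show "complex_of_real (m q (J b) c) = \<i> * hm q b c - \<i> * hm q c b"
        using hm_left(3)[OF q, of \<i> b c] hm_cnj[OF q, of b c] by (simp add: m_eq_hm complex_eq_iff)
    qed
    then show ?thesis
      unfolding d_def
      by (simp add: D_diff[OF differentiable_bounded_linear[OF bounded_linear_mult_right df] differentiable_bounded_linear[OF bounded_linear_mult_right df]]
         D_linear[OF bounded_linear_mult_right complex_linear_mult df])
  qed
  have del: "del_form 2 (herm_form_c m) q ((!) [a, b, k])
    = (\<i> * d a b k - \<i> * d a k b) - (\<i> * d b a k - \<i> * d b k a) + (\<i> * d k a b - \<i> * d k b a)" for a b k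
    unfolding del_form_def ext_deriv_def herm_form_def by (simp add: om numeral_2_eq_2)
  show ?thesis
    unfolding del unfolding d_def[symmetric] unfolding ex10_def ex01_def
    by (simp add: dJ scaleC_complex_def scaleR_conv_of_real algebra_simps)
qed

lemma dbar_formula:
  assumes q: "q \<in> U"
  shows "fst (dbar s q w) = D01 (\<lambda>q. fst (s q)) q w"
    "fst (snd (dbar s q w)) = Fc q (fst (s q)) w + D01 (\<lambda>q. fst (snd (s q))) q w + br (ex01 (\<alpha> q) w) (fst (snd (s q)))"
    "covec (snd (snd (dbar s q w))) w' = covec (D01 (\<lambda>q. snd (snd (s q))) q w) w'
       + 2 * (D10 (\<lambda>q'. hm q' (fst (s q)) w) q w' - D10 (\<lambda>q'. hm q' w' w) q (fst (s q))) - 2 * ip (Fc q w' w) (fst (snd (s q)))"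
proof -
  show "fst (dbar s q w) = D01 (\<lambda>q. fst (s q)) q w" by (simp add: dolbeault_Q_def Let_def)
  show "fst (snd (dbar s q w)) = Fc q (fst (s q)) w + D01 (\<lambda>q. fst (snd (s q))) q w + br (ex01 (\<alpha> q) w) (fst (snd (s q)))"
    by (simp add: dolbeault_Q_def Let_def F_types[OF q] ex_add ex_complex_linear_comp[OF br_linear_left])
  let ?V = "fst (s q)" and ?r = "fst (snd (s q))"
  have 1: "snd (snd (dbar s q w)) = D01 (\<lambda>q. snd (snd (s q))) q w
    + (\<chi> i. 2 * (D10 (\<lambda>q'. hm q' ?V w) q (axis i 1) - D10 (\<lambda>q'. hm q' (axis i 1) w) q ?V) - 2 * ip (Fc q (axis i 1) w) ?r)"
    by (simp add: dolbeault_Q_def Let_def F_types[OF q] vec_eq_iff ip_simps torsion_term[OF q, simplified])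
  have "complex_linear (\<lambda>x. 2 * (D10 (\<lambda>q'. hm q' ?V w) q x - D10 (\<lambda>q'. hm q' x w) q ?V) - 2 * ip (Fc q x w) ?r)"
    using complex_linearD(1,2)[OF D_hm_vars(1)[OF q]] complex_linearD(1,2)[OF D_hm_vars(3)[OF q]]
      complex_linearD(1,2)[OF Fc_left[OF q]]
    by (simp add: complex_linear_def scaleC_complex_def ip_simps ip_scaleC algebra_simps)
  from complex_linear_axis[OF this]
  show "covec (snd (snd (dbar s q w))) w' = covec (D01 (\<lambda>q. snd (snd (s q))) q w) w'
       + 2 * (D10 (\<lambda>q'. hm q' ?V w) q w' - D10 (\<lambda>q'. hm q' w' w) q ?V) - 2 * ip (Fc q w' w) ?r"
    unfolding 1 complex_linearD(1)[OF covec_linear(2)] by simp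
qed

lemma dbar_sigma:
  assumes q: "q \<in> U"
  shows "dbar (sigma W) q w = (0, 0, \<chi> i. D01 (\<lambda>q. hm q (axis i 1) W) q w)"
    "covec (snd (snd (dbar (sigma W) q w))) w' = D01 (\<lambda>q. hm q w' W) q w"
proof -
  have nth: "bounded_linear (\<lambda>x::complex^'n. x $ i)" "complex_linear (\<lambda>x::complex^'n. x $ i)" for i
    by (rule bounded_linear_vec_nth) (simp add: complex_linear_def scaleC_vec_def)
  have d: "(\<lambda>q. snd (snd (sigma W q))) differentiable (at q)"
    using differentiable_bounded_linear[OF bounded_linear_compose[OF bounded_linear_snd bounded_linear_snd] smooth_on_differentiable[OF sigma_smooth q]] by simp
  have c: "D01 (\<lambda>q. snd (snd (sigma W q))) q w $ i = D01 (\<lambda>q. hm q (axis i 1) W) q w" for i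
    using D_linear(2)[OF nth d, of i w] by (simp add: sigma_def)
  then have c': "D01 (\<lambda>q. snd (snd (sigma W q))) q w = (\<chi> i. D01 (\<lambda>q. hm q (axis i 1) W) q w)" by (simp add: vec_eq_iff)
  have z: "D10 (\<lambda>q'. hm q' 0 w) q v = 0" "Fc q 0 w = 0" "D10 f q 0 = 0" if "f differentiable (at q)" for v and f :: "_ \<Rightarrow> complex"
    using complex_linearD(3)[OF D_hm_vars(3)[OF q]] complex_linearD(3)[OF Fc_left[OF q]] complex_linearD(3)[OF D_complex_linear[OF that]] by auto
  have a: "covec (\<chi> i. D01 (\<lambda>q. hm q (axis i 1) W) q w) w' = D01 (\<lambda>q. hm q w' W) q w" for w'
    by (rule complex_linear_axis[OF D_hm_vars(4)[OF q]])
  show b: "covec (snd (snd (dbar (sigma W) q w))) w' = D01 (\<lambda>q. hm q w' W) q w" for w'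
    unfolding dbar_formula(3)[OF q] c' a using z[OF hm_differentiable[OF q]] by (simp add: sigma_def ip_simps)
  have "snd (snd (dbar (sigma W) q w)) = (\<chi> i. D01 (\<lambda>q. hm q (axis i 1) W) q w)"
    by (rule covec_eqI) (simp only: a b)
  then show "dbar (sigma W) q w = (0, 0, \<chi> i. D01 (\<lambda>q. hm q (axis i 1) W) q w)"
    using dbar_formula(1,2)[OF q, of "sigma W" w] z[OF hm_differentiable[OF q]] by (simp add: prod_eq_iff sigma_def br_simps)
qed

lemma dbar_constant:
  assumes q: "q \<in> U"
  shows "fst (dbar (\<lambda>_. (V, r, \<xi>)) q w) = 0"
    "fst (snd (dbar (\<lambda>_. (V, r, \<xi>)) q w)) = Fc q V w + br (ex01 (\<alpha> q) w) r"
    "covec (snd (snd (dbar (\<lambda>_. (V, r, \<xi>)) q w))) w' =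
       2 * (D10 (\<lambda>q'. hm q' V w) q w' - D10 (\<lambda>q'. hm q' w' w) q V) - 2 * ip (Fc q w' w) r"
  unfolding dbar_formula[OF q] by (simp_all add: covec_simps)

end

context unitary_frame_at
begin

lemma hm_frame: "hm p a b = (\<Sum>k\<in>UNIV. hm p a (E k) * cnj (hm p b (E k)))"
  using unitary_parseval[OF p E, of a b] by (simp add: hm_cnj[OF p])

end

context gauge_frame_at
begin

lemma H_frame:
  "H p (V, r, \<xi>) (V', r', \<xi>') = (\<Sum>j\<in>UNIV. hm p V (E j) * cnj (hm p V' (E j)))
    + 1/4 * (\<Sum>j\<in>UNIV. covec \<xi> (E j) * cnj (covec \<xi>' (E j))) - ip r (cj r')"
proof -
  have "hm p (rep p \<xi>') (rep p \<xi>) = (\<Sum>j\<in>UNIV. covec \<xi> (E j) * cnj (covec \<xi>' (E j)))"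
    by (rule trans[OF hm_frame]) (simp add: covec_rep[OF p] hm_cnj[OF p] mult.commute)
  then show ?thesis unfolding H_eq[OF p] hm_frame[of V V'] by simp
qed

end

section \<open>Curvature of Q\<close>

locale Q_frame = gauge_frame_at U m G e ip kk \<alpha> z p E v0
  for U :: "(complex^'n) set" and m and G :: "'g monoid" and e :: "('g, 'l::complex_normed_vector) chart"
    and ip kk \<alpha> z p and E :: "'n \<Rightarrow> complex^'n" and v0 +
  fixes A :: "complex^'n \<Rightarrow> complex^'n \<Rightarrow> ('n, 'l) Q_fibre \<Rightarrow> ('n, 'l) Q_fibre"
  assumes chern_A: "chern_connection_form U (dolbeault_Q G e ip m \<alpha>) (metric_Q ip kk m) A"
begin

sublocale C: chern_chart U dbar H A
  by unfold_locales (rule U chern_A H_linear H_hermitian; assumption?)+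

lemma H_parts:
  assumes q: "q \<in> U"
  shows "H q (V, 0, 0) Y = hm q V (fst Y)" "H q X (V, 0, 0) = hm q (fst X) V"
    "H q (0, r, 0) Y = - ip r (cj (fst (snd Y)))" "H q X (0, r, 0) = - ip (fst (snd X)) (cj r)"
  by (cases X, cases Y; simp add: H_eq[OF q] hm_left[OF q] hm_right[OF q] ip_simps rep_simps(3)[OF q] linear_0[OF cj_linear])+

lemma H_comp: "H p X Y = (\<Sum>j\<in>UNIV. hm p (fst X) (E j) * cnj (hm p (fst Y) (E j)))
    + 1/4 * (\<Sum>j\<in>UNIV. covec (snd (snd X)) (E j) * cnj (covec (snd (snd Y)) (E j))) - ip (fst (snd X)) (cj (fst (snd Y)))"
  using H_frame[of "fst X" "fst (snd X)" "snd (snd X)" "fst Y" "fst (snd Y)" "snd (snd Y)"] by simp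

lemma ad_eqI: "(\<And>r. H p X (0, r, 0) = - ip x (cj r)) \<Longrightarrow> fst (snd X) = x"
proof -
  assume "\<And>r. H p X (0, r, 0) = - ip x (cj r)"
  then have "ip (fst (snd X)) (cj (cj y)) = ip x (cj (cj y))" for y unfolding H_parts[OF p] by simp
  then have "ip (fst (snd X) - x) y = 0" for y by (simp add: cj_cj ip_simps)
  then show ?thesis using ip_nondegenerate[of "fst (snd X) - x"] by simp
qed

lemma Fp_cj: "cj (Fp i j) = - Fp j i" unfolding Fp_def by (rule cj_Fc[OF p])

lemma cnj_ip: "cnj (ip x y) = ip (cj x) (cj y)" by (rule ip_cj[symmetric])

definition a01 :: "'n \<Rightarrow> 'l" where "a01 i = ex01 (\<alpha> p) (E i)"

lemma cj_ex_\<alpha>: "q \<in> U \<Longrightarrow> cj (ex01 (\<alpha> q) v) = ex10 (\<alpha> q) v" "q \<in> U \<Longrightarrow> cj (ex10 (\<alpha> q) v) = ex01 (\<alpha> q) v"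
  unfolding ex10_def ex01_def by (simp_all add: cj_simps \<alpha>_real scaleC_minus_left)

lemma cj_a: "cj (a01 i) = a10 i" "cj (a10 i) = a01 i"
  unfolding a01_def a10_def by (rule cj_ex_\<alpha>[OF p])+

lemma dbar_e:
  "q \<in> U \<Longrightarrow> fst (dbar (\<lambda>_. (V, 0, 0)) q w) = 0"
  "q \<in> U \<Longrightarrow> fst (snd (dbar (\<lambda>_. (V, 0, 0)) q w)) = Fc q V w"
  "q \<in> U \<Longrightarrow> covec (snd (snd (dbar (\<lambda>_. (V, 0, 0)) q w))) w' = 2 * (D10 (\<lambda>q'. hm q' V w) q w' - D10 (\<lambda>q'. hm q' w' w) q V)"
  by (simp_all add: dbar_constant br_simps ip_simps)

lemma zero_vector:
  "q \<in> U \<Longrightarrow> D10 (\<lambda>q'. hm q' 0 w) q v = 0" "q \<in> U \<Longrightarrow> Fc q 0 w = 0" "q \<in> U \<Longrightarrow> D10 (\<lambda>q'. hm q' a b) q 0 = 0"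
  by (rule complex_linearD(3)[OF D_hm_vars(3)], assumption, rule complex_linearD(3)[OF Fc_left], assumption,
      rule complex_linearD(3)[OF D_hm_vars(1)], assumption)

lemma dbar_r:
  "q \<in> U \<Longrightarrow> fst (dbar (\<lambda>_. (0, r, 0)) q w) = 0"
  "q \<in> U \<Longrightarrow> fst (snd (dbar (\<lambda>_. (0, r, 0)) q w)) = br (ex01 (\<alpha> q) w) r"
  "q \<in> U \<Longrightarrow> covec (snd (snd (dbar (\<lambda>_. (0, r, 0)) q w))) w' = - 2 * ip (Fc q w' w) r"
  by (simp_all add: dbar_constant zero_vector)

lemma dbar_x:
  assumes q: "q \<in> U"
  shows "dbar (\<lambda>_. (0, 0, \<xi>)) q w = 0"
proof -
  have "snd (snd (dbar (\<lambda>_. (0, 0, \<xi>)) q w)) = 0"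
    by (rule covec_eqI) (simp add: dbar_constant[OF q] zero_vector[OF q] ip_simps covec_simps)
  then show ?thesis by (simp add: prod_eq_iff dbar_constant[OF q] zero_vector[OF q] br_simps)
qed

lemma dbar_s: "q \<in> U \<Longrightarrow> fst (dbar (sigma b) q w) = 0" "q \<in> U \<Longrightarrow> fst (snd (dbar (sigma b) q w)) = 0"
  "q \<in> U \<Longrightarrow> covec (snd (snd (dbar (sigma b) q w))) w' = D01 (\<lambda>q. hm q w' b) q w"
  by (simp_all add: dbar_sigma(1)) (rule complex_linear_axis[OF D_hm_vars(4)])

lemma dbar_frame:
  "fst (snd (dbar (\<lambda>_. (E k, 0, 0)) p (E i))) = Fp k i"
  "covec (snd (snd (dbar (\<lambda>_. (E k, 0, 0)) p (E i)))) (E j) = 2 * T j k i"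
  "fst (snd (dbar (\<lambda>_. (0, r, 0)) p (E i))) = br (a01 i) r"
  "covec (snd (snd (dbar (\<lambda>_. (0, r, 0)) p (E i)))) (E j) = - 2 * ip (Fp j i) r"
  "covec (snd (snd (dbar (sigma (E l)) p (E i)))) (E j) = cnj (h1 i l j)"
  by (simp_all add: dbar_e[OF p] dbar_r[OF p] dbar_s[OF p] Fp_def a01_def hb1) (simp add: T_def h1_def)

text \<open>
  The (1,0)-part of the connection form at \<open>p\<close>. Its components follow from \<open>H_DA\<close>, which pairs it with test
  sections; those needed below are listed in \<open>DA_e\<close>, \<open>DA_r\<close> and \<open>DA_x\<close>.
\<close>

definition DA :: "'n \<Rightarrow> ('n, 'l) Q_fibre \<Rightarrow> ('n, 'l) Q_fibre" where
  "DA i s = ex10 (\<lambda>u. A p u s) (E i)"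

lemma H_DA:
  assumes t: "smooth_on U t"
  shows "H p (DA i s) (t p) = D10 (\<lambda>q. H q s (t q)) p (E i) - H p s (dbar t p (E i))"
  unfolding DA_def by (rule C.H_del_const[OF t p])

lemma DA_e:
  "hm p (fst (DA i (E k, 0, 0))) (E j) = h1 i k j"
  "fst (snd (DA i (E k, 0, 0))) = 0"
  "covec (snd (snd (DA i (E k, 0, 0)))) (E j) = 0"
proof -
  have "D10 (\<lambda>q. H q (E k, 0, 0) (E j, 0, 0)) p = D10 (\<lambda>q. hm q (E k) (E j)) p"
    by (rule D_cong_open[OF U p]) (simp add: H_parts)
  then show "hm p (fst (DA i (E k, 0, 0))) (E j) = h1 i k j"
    using H_DA[OF C.const_smooth, of i "(E k, 0, 0)" "(E j, 0, 0)"]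
    by (simp add: H_parts[OF p] dbar_e[OF p] hm_right[OF p] h1_def)
  have "D10 (\<lambda>q. H q (E k, 0, 0) (0, r, 0)) p = D10 (\<lambda>q. 0) p" for r
    by (rule D_cong_open[OF U p]) (simp add: H_parts hm_right ip_simps)
  then show "fst (snd (DA i (E k, 0, 0))) = 0"
    by (intro ad_eqI) (simp add: H_DA[OF C.const_smooth] H_parts(1)[OF p] dbar_r[OF p] hm_right[OF p] ip_simps)
  have "D10 (\<lambda>q. H q (E k, 0, 0) (sigma (E j) q)) p = D10 (\<lambda>q. 0) p"
    by (rule D_cong_open[OF U p]) (simp add: H_sigma covec_simps)
  then show "covec (snd (snd (DA i (E k, 0, 0)))) (E j) = 0"
    using H_DA[OF sigma_smooth, of i "(E k, 0, 0)" "E j"]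
    by (simp add: H_parts[OF p] H_sigma[OF p] dbar_s[OF p] hm_right[OF p])
qed

lemma DA_r:
  "hm p (fst (DA i (0, r, 0))) (E j) = - ip r (Fp i j)"
  "fst (snd (DA i (0, r, 0))) = br (a10 i) r"
  "covec (snd (snd (DA i (0, r, 0)))) (E j) = 0"
proof -
  have "D10 (\<lambda>q. H q (0, r, 0) (E j, 0, 0)) p = D10 (\<lambda>q. 0) p"
    by (rule D_cong_open[OF U p]) (simp add: H_parts hm_left)
  then show "hm p (fst (DA i (0, r, 0))) (E j) = - ip r (Fp i j)"
    using H_DA[OF C.const_smooth, of i "(0, r, 0)" "(E j, 0, 0)"]
    by (simp add: H_parts(2,3)[OF p] dbar_frame Fp_cj ip_simps)
  have "D10 (\<lambda>q. H q (0, r, 0) (0, r', 0)) p = D10 (\<lambda>q. - ip r (cj r')) p" for r'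
    by (rule D_cong_open[OF U p]) (simp add: H_parts)
  then show "fst (snd (DA i (0, r, 0))) = br (a10 i) r"
    by (intro ad_eqI) (simp add: H_DA[OF C.const_smooth] H_parts(3)[OF p] dbar_frame cj_br cj_a ip_br)
  have "D10 (\<lambda>q. H q (0, r, 0) (sigma (E j) q)) p = D10 (\<lambda>q. 0) p"
    by (rule D_cong_open[OF U p]) (simp add: H_sigma covec_simps)
  then show "covec (snd (snd (DA i (0, r, 0)))) (E j) = 0"
    using H_DA[OF sigma_smooth, of i "(0, r, 0)" "E j"]
    by (simp add: H_parts[OF p] H_sigma[OF p] dbar_s[OF p] ip_simps linear_0[OF cj_linear])
qed

lemma H_x_left: "H p (sigma (E k) p) Y = 1/4 * cnj (covec (snd (snd Y)) (E k))"
  using H_hermitian[OF p, of Y "sigma (E k) p"] H_sigma[OF p, of Y "E k"] by simp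

lemma H_const_left: "q \<in> U \<Longrightarrow> H q (0, 0, \<xi>) (V, 0, 0) = 0" "q \<in> U \<Longrightarrow> H q (0, 0, \<xi>) (0, r, 0) = 0"
  by (simp_all add: H_parts hm_left ip_simps)

lemma DA_x:
  "hm p (fst (DA i (sigma (E k) p))) (E j) = - 1/2 * cnj (T k j i)"
  "fst (snd (DA i (sigma (E k) p))) = (1/2) *\<^sub>R Fp i k"
proof -
  have "D10 (\<lambda>q. H q (sigma (E k) p) (E j, 0, 0)) p = D10 (\<lambda>q. 0) p"
    by (rule D_cong_open[OF U p]) (simp add: sigma_def H_const_left)
  then show "hm p (fst (DA i (sigma (E k) p))) (E j) = - 1/2 * cnj (T k j i)"
    using H_DA[OF C.const_smooth, of i "sigma (E k) p" "(E j, 0, 0)"]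
    by (simp add: H_parts(2)[OF p] H_x_left dbar_frame)
  have "D10 (\<lambda>q. H q (sigma (E k) p) (0, r, 0)) p = D10 (\<lambda>q. 0) p" for r
    by (rule D_cong_open[OF U p]) (simp add: sigma_def H_const_left)
  then show "fst (snd (DA i (sigma (E k) p))) = (1/2) *\<^sub>R Fp i k"
    by (intro ad_eqI) (simp add: H_DA[OF C.const_smooth] H_x_left dbar_frame cnj_ip Fp_cj ip_simps scaleR_conv_of_real)
qed

text \<open>\<open>D'\<close> of the dual sections; unlike for constant sections, their own derivative contributes.\<close>

definition DS :: "'n \<Rightarrow> 'n \<Rightarrow> ('n, 'l) Q_fibre" where
  "DS i l = C.del (sigma (E l)) p (E i)"

lemma H_DS:
  assumes t: "smooth_on U t"
  shows "H p (DS i l) (t p) = D10 (\<lambda>q. H q (sigma (E l) q) (t q)) p (E i) - H p (sigma (E l) p) (dbar t p (E i))"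
  using C.D_H(1)[OF sigma_smooth t p, of "E l" "E i"] by (simp add: DS_def)

lemma DS:
  "hm p (fst (DS i l)) (E j) = - 1/2 * cnj (T l j i)"
  "fst (snd (DS i l)) = (1/2) *\<^sub>R Fp i l"
  "covec (snd (snd (DS i l))) (E j) = 0"
proof -
  have "D10 (\<lambda>q. H q (sigma (E l) q) (E j, 0, 0)) p = D10 (\<lambda>q. 0) p"
    by (rule D_cong_open[OF U p]) (simp add: sigma_def H_const_left)
  then show "hm p (fst (DS i l)) (E j) = - 1/2 * cnj (T l j i)"
    using H_DS[OF C.const_smooth, of i l "(E j, 0, 0)"]
    by (simp add: H_parts(2)[OF p] H_x_left dbar_frame)
  have "D10 (\<lambda>q. H q (sigma (E l) q) (0, r, 0)) p = D10 (\<lambda>q. 0) p" for r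
    by (rule D_cong_open[OF U p]) (simp add: sigma_def H_const_left)
  then show "fst (snd (DS i l)) = (1/2) *\<^sub>R Fp i l"
    by (intro ad_eqI) (simp add: H_DS[OF C.const_smooth] H_x_left dbar_frame cnj_ip Fp_cj ip_simps scaleR_conv_of_real)
  have "D10 (\<lambda>q. H q (sigma (E l) q) (sigma (E j) q)) p = D10 (\<lambda>q. 1/4 * hm q (E j) (E l)) p"
    by (rule D_cong_open[OF U p]) (simp add: H_sigma, simp add: sigma_def covec_hm)
  then have "D10 (\<lambda>q. H q (sigma (E l) q) (sigma (E j) q)) p (E i) = 1/4 * h1 i j l"
    by (simp only: D_linear[OF bounded_linear_mult_right complex_linear_mult hm_differentiable[OF p]] h1_def)
  then show "covec (snd (snd (DS i l))) (E j) = 0"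
    using H_DS[OF sigma_smooth, of i l "E j"] by (simp add: H_sigma[OF p] H_x_left dbar_frame)
qed

text \<open>
  A form of \<open>C.H_curv11\<close> into which explicit functions for the three pairings can be inserted; \<open>g\<close> is constant for
  most blocks, the summands being orthogonal.
\<close>

lemma curv_block:
  assumes t: "smooth_on U t"
    and 1: "\<And>q. q \<in> U \<Longrightarrow> H q (dbar (\<lambda>_. s) q (E i)) (t q) = f q"
    and 2: "\<And>q. q \<in> U \<Longrightarrow> H q s (t q) = g q"
    and 3: "\<And>q. q \<in> U \<Longrightarrow> D10 g q (E i) - H q s (dbar t q (E i)) = k q"
  shows "H p (C.curv11 p (E i) s) (t p) = D10 f p (E i) - H p (dbar (\<lambda>_. s) p (E i)) (dbar t p (E i))
    - D01 k p (E i) + H p (DA i s) (C.del t p (E i))"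
proof -
  have "D10 (\<lambda>q. H q (dbar (\<lambda>_. s) q (E i)) (t q)) p = D10 f p"
    by (rule D_cong_open[OF U p]) (rule 1)
  moreover have "D01 (\<lambda>q. D10 (\<lambda>q. H q s (t q)) q (E i) - H q s (dbar t q (E i))) p = D01 k p"
  proof (rule D_cong_open[OF U p])
    fix q assume q: "q \<in> U"
    have "D10 (\<lambda>q. H q s (t q)) q = D10 g q" by (rule D_cong_open[OF U q]) (rule 2)
    then show "D10 (\<lambda>q. H q s (t q)) q (E i) - H q s (dbar t q (E i)) = k q" using 3[OF q] by simp
  qed
  ultimately show ?thesis unfolding C.H_curv11[OF t p] DA_def by simp
qed

lemma curv_ee: "H p (C.curv11 p (E i) (E k, 0, 0)) (E l, 0, 0)
  = - hA i i k l + (\<Sum>j\<in>UNIV. h1 i k j * cnj (h1 i l j)) - ip (Fp k i) (Fp i l) - (\<Sum>j\<in>UNIV. T j k i * cnj (T j l i))"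
proof -
  have "H p (C.curv11 p (E i) (E k, 0, 0)) (E l, 0, 0) = D10 (\<lambda>q. 0) p (E i) - H p (dbar (\<lambda>_. (E k, 0, 0)) p (E i)) (dbar (\<lambda>_. (E l, 0, 0)) p (E i))
    - D01 (\<lambda>q. D10 (\<lambda>q. hm q (E k) (E l)) q (E i)) p (E i) + H p (DA i (E k, 0, 0)) (C.del (\<lambda>_. (E l, 0, 0)) p (E i))"
    by (rule curv_block[OF C.const_smooth, where g = "\<lambda>q. hm q (E k) (E l)"])
       (simp_all add: H_parts(1,2) dbar_e hm_left hm_right)
  also have "\<dots> = - hA i i k l + (\<Sum>j\<in>UNIV. h1 i k j * cnj (h1 i l j)) - ip (Fp k i) (Fp i l) - (\<Sum>j\<in>UNIV. T j k i * cnj (T j l i))"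
    unfolding C.del_const DA_def[symmetric] H_comp
    by (simp add: dbar_e(1)[OF p] dbar_frame DA_e hm_left[OF p] Fp_cj ip_simps hA_def mult.assoc flip: sum_distrib_left)
  finally show ?thesis .
qed

lemma curv_er: "H p (C.curv11 p (E i) (E k, 0, 0)) (0, r, 0)
  = - ip (dF i k i + br (a10 i) (Fp k i) + (\<Sum>j\<in>UNIV. scaleC (T j k i) (Fp i j)) - (\<Sum>j\<in>UNIV. scaleC (h1 i k j) (Fp j i))) (cj r)"
proof -
  have bl: "bounded_linear (\<lambda>x. - ip x (cj r))"
    by (rule bounded_linear_minus[OF bounded_bilinear.bounded_linear_left[OF ip_bilinear]])
  have cl: "complex_linear (\<lambda>x. - ip x (cj r))"
    by (simp add: complex_linear_def ip_simps ip_scaleC scaleC_complex_def)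
  have "H p (C.curv11 p (E i) (E k, 0, 0)) (0, r, 0) = D10 (\<lambda>q. - ip (Fc q (E k) (E i)) (cj r)) p (E i)
    - H p (dbar (\<lambda>_. (E k, 0, 0)) p (E i)) (dbar (\<lambda>_. (0, r, 0)) p (E i))
    - D01 (\<lambda>q. 0) p (E i) + H p (DA i (E k, 0, 0)) (C.del (\<lambda>_. (0, r, 0)) p (E i))"
    by (rule curv_block[OF C.const_smooth, where g = "\<lambda>q. 0"])
       (simp_all add: H_parts(1,4) dbar_e dbar_r hm_left hm_right ip_simps)
  also have "D10 (\<lambda>q. - ip (Fc q (E k) (E i)) (cj r)) p (E i) = - ip (dF i k i) (cj r)"
    unfolding dF_def by (rule D_linear[OF bl cl Fc_differentiable[OF p]])
  also have "- ip (dF i k i) (cj r) - H p (dbar (\<lambda>_. (E k, 0, 0)) p (E i)) (dbar (\<lambda>_. (0, r, 0)) p (E i))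
      - D01 (\<lambda>q. 0) p (E i) + H p (DA i (E k, 0, 0)) (C.del (\<lambda>_. (0, r, 0)) p (E i))
    = - ip (dF i k i + br (a10 i) (Fp k i) + (\<Sum>j\<in>UNIV. scaleC (T j k i) (Fp i j)) - (\<Sum>j\<in>UNIV. scaleC (h1 i k j) (Fp j i))) (cj r)"
    unfolding C.del_const DA_def[symmetric] H_comp
    by (simp add: dbar_e(1)[OF p] dbar_frame DA_e DA_r hm_left[OF p] Fp_cj cnj_ip cj_br cj_a ip_br ip_simps ip_scaleC
        ip_sym[of "cj r"] mult.assoc sum_negf flip: sum_distrib_left)
  finally show ?thesis .
qed

lemma curv_es: "H p (C.curv11 p (E i) (E k, 0, 0)) (sigma (E l) p)
  = 1/2 * (hB i l k i - hB i k l i - (\<Sum>j\<in>UNIV. h1 i l j * T j k i) - (\<Sum>j\<in>UNIV. h1 i k j * T l j i))"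
proof -
  note d = D_hm_differentiable(1)
  have "H p (C.curv11 p (E i) (E k, 0, 0)) (sigma (E l) p)
    = D10 (\<lambda>q. 1/2 * (D10 (\<lambda>q'. hm q' (E k) (E i)) q (E l) - D10 (\<lambda>q'. hm q' (E l) (E i)) q (E k))) p (E i)
    - H p (dbar (\<lambda>_. (E k, 0, 0)) p (E i)) (dbar (sigma (E l)) p (E i))
    - D01 (\<lambda>q. 0) p (E i) + H p (DA i (E k, 0, 0)) (C.del (sigma (E l)) p (E i))"
    by (rule curv_block[OF sigma_smooth, where g = "\<lambda>q. 0"])
       (simp_all add: H_parts(1) H_sigma dbar_e dbar_s hm_right covec_simps)
  also have "D10 (\<lambda>q. 1/2 * (D10 (\<lambda>q'. hm q' (E k) (E i)) q (E l) - D10 (\<lambda>q'. hm q' (E l) (E i)) q (E k))) p (E i)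
    = 1/2 * (hB i l k i - hB i k l i)"
    unfolding D_linear[OF bounded_linear_mult_right complex_linear_mult differentiable_diff[OF d d]] D_diff[OF d d] hB_def ..
  finally show ?thesis
    unfolding DS_def[symmetric] H_comp
    by (simp add: dbar_e(1)[OF p] dbar_s(1,2)[OF p] dbar_frame DA_e DS hm_left[OF p] Fp_cj ip_simps linear_0[OF cj_linear] mult.assoc sum_negf algebra_simps
        flip: sum_distrib_left sum_divide_distrib)
qed

lemma Fp_diagonal:
  "Fp i i = D10 (\<lambda>q. ex01 (\<alpha> q) (E i)) p (E i) - D01 (\<lambda>q. ex10 (\<alpha> q) (E i)) p (E i) + br (a10 i) (a01 i)"
proof -
  have "Fp i i = ex10 (\<lambda>a. ex01 (\<lambda>b. F p a b) (E i)) (E i)" by (simp add: Fp_def F_types[OF p])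
  also have "\<dots> = ex10 (\<lambda>a. ex01 (\<lambda>b. dd (\<lambda>q. \<alpha> q b) p a) (E i)) (E i) - ex01 (\<lambda>b. ex10 (\<lambda>a. dd (\<lambda>q. \<alpha> q a) p b) (E i)) (E i)
    + br (a10 i) (a01 i)"
    unfolding conn_curvature_def ex_add ex_diff ex_complex_linear_comp[OF br_linear] ex_complex_linear_comp[OF br_linear_left]
      ex_swap(2)[of "\<lambda>a b. dd (\<lambda>q. \<alpha> q a) p b"] a10_def a01_def ..
  finally show ?thesis unfolding dd_ex_parameter(1,2)[OF \<alpha>_differentiable[OF p]] .
qed

text \<open>
  The terms with \<open>\<alpha>\<close> assemble to the bracket with \<open>Fp i i\<close> by the Jacobi identity; the two sums are the second
  fundamental forms coming from the mixed terms \<open>F\<^sub>h\<close> of the Dolbeault operator.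
\<close>

lemma curv_rr: "H p (C.curv11 p (E i) (0, r, 0)) (0, r', 0)
  = - ip (br (Fp i i) r) (cj r') + (\<Sum>j\<in>UNIV. ip (Fp j i) r * ip (Fp i j) (cj r')) - (\<Sum>j\<in>UNIV. ip (Fp i j) r * ip (Fp j i) (cj r'))"
proof -
  let ?\<rho> = "cj r'"
  let ?x = "D10 (\<lambda>q. ex01 (\<alpha> q) (E i)) p (E i)" and ?y = "D01 (\<lambda>q. ex10 (\<alpha> q) (E i)) p (E i)"
  note d = dd_ex_parameter(4,3)[OF \<alpha>_differentiable[OF p]]
  note bb = bounded_linear_compose[OF bounded_bilinear.bounded_linear_left[OF ip_bilinear] bounded_bilinear.bounded_linear_left[OF br_bilinear]]
    bounded_linear_compose[OF bounded_bilinear.bounded_linear_right[OF ip_bilinear] bounded_bilinear.bounded_linear_left[OF br_bilinear]]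
  have bl: "bounded_linear (\<lambda>x. - ip (br x r) ?\<rho>)" "bounded_linear (\<lambda>x. ip r (br x ?\<rho>))"
    by (rule bounded_linear_minus[OF bb(1)], rule bb(2))
  have cl: "complex_linear (\<lambda>x. - ip (br x r) ?\<rho>)" "complex_linear (\<lambda>x. ip r (br x ?\<rho>))"
    by (simp_all add: complex_linear_def ip_simps br_simps br_scaleC ip_scaleC scaleC_complex_def)
  have "H p (C.curv11 p (E i) (0, r, 0)) (0, r', 0) = D10 (\<lambda>q. - ip (br (ex01 (\<alpha> q) (E i)) r) ?\<rho>) p (E i)
    - H p (dbar (\<lambda>_. (0, r, 0)) p (E i)) (dbar (\<lambda>_. (0, r', 0)) p (E i))
    - D01 (\<lambda>q. ip r (br (ex10 (\<alpha> q) (E i)) ?\<rho>)) p (E i) + H p (DA i (0, r, 0)) (C.del (\<lambda>_. (0, r', 0)) p (E i))"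
    by (rule curv_block[OF C.const_smooth, where g = "\<lambda>q. - ip r ?\<rho>"])
       (simp_all add: H_parts(3,4) dbar_r cj_br cj_ex_\<alpha>)
  also have "\<dots> = - ip (br ?x r) ?\<rho> - H p (dbar (\<lambda>_. (0, r, 0)) p (E i)) (dbar (\<lambda>_. (0, r', 0)) p (E i))
    - ip r (br ?y ?\<rho>) + H p (DA i (0, r, 0)) (C.del (\<lambda>_. (0, r', 0)) p (E i))"
    by (simp add: D_linear[OF bl(1) cl(1) d(1)] D_linear[OF bl(2) cl(2) d(2)])
  also have "\<dots> = - ip (br ?x r) ?\<rho> + (\<Sum>j\<in>UNIV. ip (Fp j i) r * ip (Fp i j) ?\<rho>) + ip (br (a01 i) r) (br (a10 i) ?\<rho>)
    - ip r (br ?y ?\<rho>) - (\<Sum>j\<in>UNIV. ip (Fp i j) r * ip (Fp j i) ?\<rho>) - ip (br (a10 i) r) (br (a01 i) ?\<rho>)"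
    unfolding C.del_const DA_def[symmetric] H_comp
    by (simp add: dbar_r(1)[OF p] dbar_frame DA_r hm_left[OF p] Fp_cj cnj_ip cj_br cj_a ip_simps
        ip_sym[of r "Fp _ _"] ip_sym[of ?\<rho> "Fp _ _"] mult.assoc sum_negf flip: sum_distrib_left)
  also have "ip (br (a01 i) r) (br (a10 i) ?\<rho>) = - ip (br (a10 i) (br (a01 i) r)) ?\<rho>"
    by (simp add: ip_br)
  also have "ip (br (a10 i) r) (br (a01 i) ?\<rho>) = - ip (br (a01 i) (br (a10 i) r)) ?\<rho>"
    by (simp add: ip_br)
  also have "ip r (br ?y ?\<rho>) = - ip (br ?y r) ?\<rho>" by (simp add: ip_br)
  also have "br (a10 i) (br (a01 i) r) = br (br (a10 i) (a01 i)) r + br (a01 i) (br (a10 i) r)"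
    by (rule br_jacobi)
  finally show ?thesis
    unfolding Fp_diagonal[of i] by (simp add: br_simps ip_simps)
qed

lemma curv_rs: "H p (C.curv11 p (E i) (0, r, 0)) (sigma (E l) p)
  = - 1/2 * ip (dF i l i + br (a10 i) (Fp l i) + (\<Sum>j\<in>UNIV. scaleC (T j l i) (Fp i j)) - (\<Sum>j\<in>UNIV. scaleC (h1 i l j) (Fp j i))) r"
proof -
  have bl: "bounded_linear (\<lambda>x. - 1/2 * ip x r)"
    by (rule bounded_linear_compose[OF bounded_linear_mult_right bounded_bilinear.bounded_linear_left[OF ip_bilinear]])
  have cl: "complex_linear (\<lambda>x. - 1/2 * ip x r)"
    by (simp add: complex_linear_def ip_simps ip_scaleC scaleC_complex_def algebra_simps)
  have Tn: "T l j i = - T j l i" for j by (simp add: T_def)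
  have "H p (C.curv11 p (E i) (0, r, 0)) (sigma (E l) p) = D10 (\<lambda>q. - 1/2 * ip (Fc q (E l) (E i)) r) p (E i)
    - H p (dbar (\<lambda>_. (0, r, 0)) p (E i)) (dbar (sigma (E l)) p (E i))
    - D01 (\<lambda>q. 0) p (E i) + H p (DA i (0, r, 0)) (C.del (sigma (E l)) p (E i))"
    by (rule curv_block[OF sigma_smooth, where g = "\<lambda>q. 0"])
       (simp_all add: H_parts(3) H_sigma dbar_r dbar_s covec_simps ip_simps linear_0[OF cj_linear])
  also have "D10 (\<lambda>q. - 1/2 * ip (Fc q (E l) (E i)) r) p (E i) = - 1/2 * ip (dF i l i) r"
    unfolding dF_def by (rule D_linear[OF bl cl Fc_differentiable[OF p]])
  also have "H p (dbar (\<lambda>_. (0, r, 0)) p (E i)) (dbar (sigma (E l)) p (E i)) = - 1/2 * (\<Sum>j\<in>UNIV. h1 i l j * ip (Fp j i) r)"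
    unfolding H_comp
    by (simp add: dbar_r(1)[OF p] dbar_s(1,2)[OF p] dbar_frame hm_left[OF p] linear_0[OF cj_linear] ip_simps
       mult.assoc sum_negf mult.commute[of "ip _ _"] flip: sum_distrib_left)
  also have "H p (DA i (0, r, 0)) (C.del (sigma (E l)) p (E i))
     = - 1/2 * (\<Sum>j\<in>UNIV. T j l i * ip (Fp i j) r) - 1/2 * ip (br (a10 i) (Fp l i)) r"
    unfolding H_comp DS_def[symmetric]
    by (simp add: DA_r DS Fp_cj cj_simps ip_simps ip_br Tn ip_sym[of r] mult.commute[of "ip _ _"]
        mult.assoc sum_negf flip: sum_distrib_left sum_divide_distrib)
  finally show ?thesis
    by (simp add: ip_simps ip_scaleC algebra_simps)
qed

text \<open>
  The covector is the constant value \<open>sigma (E k) p\<close>, which \<open>dbar\<close> annihilates; \<open>\<eta>\<close> is \<open>dbar\<close> of the dual test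
  section, whose covariant derivative is again evaluated by pairing it with a dual section. Up to the factor
  of the metric and conjugation the result is that of \<open>curv_ee\<close>, as expected for a dual bundle.
\<close>

lemma curv_xx: "H p (C.curv11 p (E i) (sigma (E k) p)) (sigma (E l) p)
  = - 1/4 * cnj (- hA i i k l + (\<Sum>j\<in>UNIV. h1 i k j * cnj (h1 i l j)) - ip (Fp k i) (Fp i l) - (\<Sum>j\<in>UNIV. T j k i * cnj (T j l i)))"
proof -
  let ?\<xi> = "sigma (E k) p"
  define \<eta> :: "_ \<Rightarrow> ('n, 'l) Q_fibre" where "\<eta> q = (0, 0, \<chi> j. D01 (\<lambda>q. hm q (axis j 1) (E l)) q (E i))" for q
  have \<eta>: "dbar (sigma (E l)) q (E i) = \<eta> q" if "q \<in> U" for q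
    unfolding \<eta>_def by (rule dbar_sigma(1)[OF that])
  have s: "smooth_on U (\<lambda>q. \<chi> j. D01 (\<lambda>q. hm q (axis j 1) (E l)) q (E i))"
    by (rule smooth_vec) (simp add: smooth_on_D(2)[OF U hm_smooth])
  have b: "bounded_linear (\<lambda>\<xi>. (0, 0, \<xi>) :: ('n, 'l) Q_fibre)"
    by (intro bounded_linear_Pair bounded_linear_zero bounded_linear_ident)
  have \<eta>_smooth: "smooth_on U \<eta>" unfolding \<eta>_def[abs_def] by (rule smooth_on_bounded_linear[OF U b s])
  have dx: "dbar (\<lambda>_. ?\<xi>) q w = 0" "dbar (\<lambda>_. - ?\<xi>) q w = 0" if "q \<in> U" for q w
    unfolding sigma_def by (simp_all add: dbar_x[OF that])
  have "H p (C.curv11 p (E i) ?\<xi>) (sigma (E l) p) = D10 (\<lambda>q. 0) p (E i)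
    - H p (dbar (\<lambda>_. ?\<xi>) p (E i)) (dbar (sigma (E l)) p (E i))
    - D01 (\<lambda>q. H q (- ?\<xi>) (\<eta> q)) p (E i) + H p (DA i ?\<xi>) (C.del (sigma (E l)) p (E i))"
    by (rule curv_block[OF sigma_smooth, where g = "\<lambda>q. 1/4 * covec (snd (snd ?\<xi>)) (E l)"])
       (simp_all add: H_sigma dx C.H_simps \<eta> covec_simps)
  also have "D01 (\<lambda>q. H q (- ?\<xi>) (\<eta> q)) p (E i) = - H p ?\<xi> (C.del \<eta> p (E i))"
    using C.D_H(2)[OF C.const_smooth \<eta>_smooth p, of "- ?\<xi>" "E i"] by (simp add: dx[OF p] C.H_simps[OF p])
  also have "H p ?\<xi> (C.del \<eta> p (E i)) = cnj (H p (C.del \<eta> p (E i)) ?\<xi>)"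
    by (rule H_hermitian[OF p, symmetric])
  also have "H p (C.del \<eta> p (E i)) ?\<xi> = 1/4 * (hA i i k l - (\<Sum>j\<in>UNIV. h1 i k j * cnj (h1 i l j)))"
  proof -
    have "D10 (\<lambda>q. H q (\<eta> q) (sigma (E k) q)) p = D10 (\<lambda>q. 1/4 * D01 (\<lambda>q. hm q (E k) (E l)) q (E i)) p"
      by (rule D_cong_open[OF U p]) (simp add: H_sigma dbar_s(3) flip: \<eta>)
    then have "D10 (\<lambda>q. H q (\<eta> q) (sigma (E k) q)) p (E i) = 1/4 * hA i i k l"
      using D_linear[OF bounded_linear_mult_right complex_linear_mult D_hm_differentiable(2), of "1/4" "E k" "E l" "E i" "E i"]
      by (simp add: hA_alt)
    then show ?thesis
      using C.D_H(1)[OF \<eta>_smooth sigma_smooth p, of "E k" "E i"]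
      unfolding \<eta>[OF p, symmetric] H_comp[of "dbar (sigma (E l)) p (E i)"]
      by (simp add: dbar_s(1,2)[OF p] dbar_frame hm_left[OF p] ip_simps mult.commute[of "cnj _"] algebra_simps)
  qed
  also have "H p (DA i ?\<xi>) (C.del (sigma (E l)) p (E i)) = 1/4 * ((\<Sum>j\<in>UNIV. cnj (T j k i) * T j l i) + ip (Fp i k) (Fp l i))"
  proof -
    have Tn: "T a j i = - T j a i" for a j by (simp add: T_def)
    show ?thesis
      unfolding DS_def[symmetric] H_comp
      by (simp add: DA_x DS cj_simps ip_simps Fp_cj Tn[of k] Tn[of l] scaleR_conv_of_real flip: sum_divide_distrib)
  qed
  also have "H p (dbar (\<lambda>_. ?\<xi>) p (E i)) (dbar (sigma (E l)) p (E i)) = 0"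
    by (simp add: dx[OF p] C.H_simps[OF p])
  finally show ?thesis
    by (simp add: cnj_ip Fp_cj ip_simps add_divide_distrib diff_divide_distrib)
qed

definition mean_curvature :: "('n, 'l) Q_fibre \<Rightarrow> ('n, 'l) Q_fibre" where
  "mean_curvature X = (\<Sum>i\<in>UNIV. C.curv11 p (E i) X)"

lemma mean_curvature_linear: "complex_linear mean_curvature"
  unfolding complex_linear_def mean_curvature_def
  by (simp add: complex_linearD(1,2)[OF C.curv11_complex_linear[OF p]] sum.distrib scaleC_sum_right)

lemma H_mean_curvature: "H p (mean_curvature X) Y = (\<Sum>i\<in>UNIV. H p (C.curv11 p (E i) X) Y)"
  unfolding mean_curvature_def by (rule C.H_simps(7)[OF p])

text \<open>The trace is Hermitian, so a block vanishes once the trace is known to vanish on the other summand.\<close>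

lemma mean_curvature_symmetric:
  assumes "\<And>q. q \<in> U \<Longrightarrow> H q s t = 0" and "mean_curvature t = 0"
  shows "H p (mean_curvature s) t = 0"
proof -
  have "H p (C.curv11 p (E i) s) t = H p s (C.curv11 p (E i) t)" for i
    by (rule C.H_curv11_symmetric[OF p]) (rule assms(1))
  then have "H p (mean_curvature s) t = H p s (mean_curvature t)"
    unfolding H_mean_curvature by (simp add: mean_curvature_def C.H_simps(14)[OF p])
  then show ?thesis by (simp add: assms(2) C.H_simps[OF p])
qed

lemma H_zeroI:
  assumes "\<And>l. H p X (E l, 0, 0) = 0" "\<And>r. H p X (0, r, 0) = 0" "\<And>l. H p X (sigma (E l) p) = 0"
  shows "X = 0"
proof -
  have "fst X = 0" by (rule unitary_eqI[OF p E]) (use assms(1) in \<open>simp add: H_parts[OF p] hm_left[OF p]\<close>)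
  moreover have "fst (snd X) = 0" by (rule ad_eqI) (simp add: assms(2) ip_simps)
  moreover have "snd (snd X) = 0"
  proof (rule covec_eqI)
    fix v
    have "covec (snd (snd X)) (E l) = 0" for l using assms(3)[of l] by (simp add: H_sigma[OF p])
    then have "covec (snd (snd X)) (\<Sum>k\<in>UNIV. scaleC (hm p v (E k)) (E k)) = 0"
      by (simp add: covec_simps scaleC_complex_def)
    then show "covec (snd (snd X)) v = covec 0 v" using expand[of v] by (simp add: covec_simps)
  qed
  ultimately show ?thesis by (simp add: prod_eq_iff)
qed

lemma mean_curvature_tangent: "mean_curvature (E k, 0, 0) = 0"
proof (rule H_zeroI)
  show "H p (mean_curvature (E k, 0, 0)) (E l, 0, 0) = 0" for l
    unfolding H_mean_curvature curv_ee by (rule ricci_anomaly_identity)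
  show "H p (mean_curvature (E k, 0, 0)) (0, r, 0) = 0" for r
    unfolding H_mean_curvature curv_er
    using arg_cong[OF curvature_divergence_identity[of k], of "\<lambda>x. - ip x (cj r)"] by (simp add: ip_simps(11) ip_simps(9) flip: sum_negf)
  show "H p (mean_curvature (E k, 0, 0)) (sigma (E l) p) = 0" for l
    unfolding H_mean_curvature curv_es sum_distrib_left[symmetric] ricci_20_identity by simp
qed

lemma mean_curvature_adjoint: "mean_curvature (0, r, 0) = 0"
proof (rule H_zeroI)
  show "H p (mean_curvature (0, r, 0)) (E l, 0, 0) = 0" for l
    by (rule mean_curvature_symmetric[OF _ mean_curvature_tangent]) (simp add: H_parts hm_left)
  show "H p (mean_curvature (0, r, 0)) (0, r', 0) = 0" for r'
  proof -
    have tr: "(\<Sum>i\<in>UNIV. Fp i i) = scaleC \<i> z" unfolding Fp_def by (rule hermitian_einstein_trace[OF p v0 E])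
    have "(\<Sum>i\<in>UNIV. ip (br (Fp i i) r) (cj r')) = ip (br (\<Sum>i\<in>UNIV. Fp i i) r) (cj r')"
      by (simp add: br_simps ip_simps)
    also have "\<dots> = 0" unfolding tr by (simp add: br_scaleC br_z ip_simps)
    finally have 1: "(\<Sum>i\<in>UNIV. ip (br (Fp i i) r) (cj r')) = 0" .
    have 2: "(\<Sum>i\<in>UNIV. \<Sum>j\<in>UNIV. ip (Fp j i) r * ip (Fp i j) (cj r')) = (\<Sum>i\<in>UNIV. \<Sum>j\<in>UNIV. ip (Fp i j) r * ip (Fp j i) (cj r'))"
      by (rule sum.swap)
    show ?thesis
      unfolding H_mean_curvature curv_rr by (simp add: sum.distrib sum_subtractf sum_negf 1 2)
  qed
  show "H p (mean_curvature (0, r, 0)) (sigma (E l) p) = 0" for l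
    unfolding H_mean_curvature curv_rs
    using arg_cong[OF curvature_divergence_identity[of l], of "\<lambda>x. - 1/2 * ip x r"] by (simp only: ip_simps(11) ip_simps(9) sum_distrib_left) simp
qed

lemma mean_curvature_cotangent: "mean_curvature (sigma (E k) p) = 0"
proof (rule H_zeroI)
  show "H p (mean_curvature (sigma (E k) p)) (E l, 0, 0) = 0" for l
    by (rule mean_curvature_symmetric[OF _ mean_curvature_tangent]) (simp add: sigma_def H_const_left)
  show "H p (mean_curvature (sigma (E k) p)) (0, r, 0) = 0" for r
    by (rule mean_curvature_symmetric[OF _ mean_curvature_adjoint]) (simp add: sigma_def H_const_left)
  show "H p (mean_curvature (sigma (E k) p)) (sigma (E l) p) = 0" for l
    unfolding H_mean_curvature curv_xx sum_distrib_left[symmetric] cnj_sum[symmetric] ricci_anomaly_identity by simp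
qed

lemma mean_curvature_zero: "mean_curvature X = 0"
proof -
  note l = complex_linearD[OF mean_curvature_linear]
  obtain V r \<xi> where X: "X = (V, r, \<xi>)" by (cases X)
  have "(V, 0, 0) = (\<Sum>k\<in>UNIV. scaleC (hm p V (E k)) (E k, 0, 0) :: ('n, 'l) Q_fibre)"
    using expand[of V] by (simp add: prod_eq_iff fst_sum snd_sum scaleC_prod_def)
  then have 1: "mean_curvature (V, 0, 0) = 0" by (simp add: l mean_curvature_tangent)
  have "\<xi> = (\<Sum>k\<in>UNIV. scaleC (covec \<xi> (E k)) (snd (snd (sigma (E k) p))))"
  proof (rule covec_eqI)
    fix v
    have "covec \<xi> v = covec \<xi> (\<Sum>k\<in>UNIV. scaleC (hm p v (E k)) (E k))" using expand[of v] by simp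
    also have "\<dots> = (\<Sum>k\<in>UNIV. hm p v (E k) * covec \<xi> (E k))" by (simp add: covec_simps scaleC_complex_def)
    finally show "covec \<xi> v = covec (\<Sum>k\<in>UNIV. scaleC (covec \<xi> (E k)) (snd (snd (sigma (E k) p)))) v"
      by (simp add: covec_simps scaleC_complex_def sigma_def covec_hm[OF p] mult.commute)
  qed
  then have "(0, 0, \<xi>) = (\<Sum>k\<in>UNIV. scaleC (covec \<xi> (E k)) (sigma (E k) p))"
    by (simp add: prod_eq_iff fst_sum snd_sum scaleC_prod_def) (simp add: sigma_def)
  then have 2: "mean_curvature (0, 0, \<xi>) = 0" by (simp add: l mean_curvature_cotangent)
  have "X = (V, 0, 0) + (0, r, 0) + (0, 0, \<xi>)" by (simp add: X)
  then show ?thesis by (simp only: l 1 2 mean_curvature_adjoint) simp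
qed

lemma curvature_trace_zero: "(\<Sum>k\<in>UNIV. vb_curvature A p (E k) (J (E k)) X) = 0"
proof -
  have "scaleC (\<i> / 2) (\<Sum>k\<in>UNIV. vb_curvature A p (E k) (J (E k)) X) = 0"
    using mean_curvature_zero[of X] unfolding mean_curvature_def C.curv11_def by (simp only: scaleC_sum_right)
  then show ?thesis by simp
qed

end

context gauge_chart
begin

text \<open>Where \<open>\<omega>\<^sup>n\<close> vanishes on the given vectors the claim is trivial; otherwise these vectors serve as \<open>v0\<close>.\<close>

theorem hermitian_einstein_Q:
  assumes A: "chern_connection_form U dbar H A" and p: "p \<in> U"
  shows "wedge 2 (2 * (CARD('n) - 1)) (\<lambda>a r. r *\<^sub>R a) (\<lambda>v. vb_curvature A p (v 0) (v 1) X)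
     (wedge_power (herm_form m p) (CARD('n) - 1)) v = 0"
proof -
  obtain E where E: "unitary p E" by (rule unitary_exists[OF p])
  interpret uf: unitary_frame_at U m p E by unfold_locales (rule p, rule E)
  interpret C: chern_chart U dbar H A
    by unfold_locales (rule U A H_linear H_hermitian; assumption?)+
  have w: "wedge 2 (2 * (CARD('n) - 1)) (\<lambda>a r. r *\<^sub>R a) (\<lambda>v. vb_curvature A p (v 0) (v 1) X)
     (wedge_power (herm_form m p) (CARD('n) - 1)) v
     = (wedge_power (herm_form m p) CARD('n) v / real CARD('n)) *\<^sub>R ((1/2) *\<^sub>R (\<Sum>k\<in>UNIV. vb_curvature A p (E k) (J (E k)) X))"
    by (rule uf.wedge_herm_power[OF C.vb_curvature_linear(2,1)[OF p] C.vb_curvature_alternating])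
  show ?thesis
  proof (cases "wedge_power (herm_form m p) CARD('n) v = 0")
    case True
    then show ?thesis unfolding w by simp
  next
    case False
    interpret Q: Q_frame U m G e ip kk \<alpha> z p E v A
      by unfold_locales (rule False, rule A)
    show ?thesis unfolding w Q.curvature_trace_zero by simp
  qed
qed

end

section \<open>From the principal bundle to local data\<close>

text \<open>A real form \<open>k\<close> as a subspace with \<open>\<gg> = k \<oplus> \<i> k\<close>.\<close>

locale real_form =
  fixes k :: "'l::complex_normed_vector set"
  assumes k_subspace: "subspace k"
    and k_decomposition: "\<And>\<zeta>. \<exists>!x. fst x \<in> k \<and> snd x \<in> k \<and> \<zeta> = fst x + scaleC \<i> (snd x)"
begin

lemma decompose:
  obtains x y where "x \<in> k" "y \<in> k" "\<zeta> = x + scaleC \<i> y"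
  using ex1_implies_ex[OF k_decomposition[of \<zeta>]] by auto

lemma unique:
  assumes "x \<in> k" "y \<in> k" "x' \<in> k" "y' \<in> k" "x + scaleC \<i> y = x' + scaleC \<i> y'"
  shows "x = x'" "y = y'"
proof -
  obtain w where "\<And>v. fst v \<in> k \<and> snd v \<in> k \<and> x + scaleC \<i> y = fst v + scaleC \<i> (snd v) \<Longrightarrow> v = w"
    using k_decomposition[of "x + scaleC \<i> y"] by (elim ex1E) blast
  from this[of "(x, y)"] this[of "(x', y')"] show "x = x'" "y = y'" using assms by auto
qed

lemma conj_eq:
  assumes "x \<in> k" "y \<in> k"
  shows "conj_wrt k (x + scaleC \<i> y) = x - scaleC \<i> y"
  unfolding conj_wrt_def
proof (rule the_equality)
  show "\<exists>\<xi>\<in>k. \<exists>\<eta>\<in>k. x + scaleC \<i> y = \<xi> + scaleC \<i> \<eta> \<and> x - scaleC \<i> y = \<xi> - scaleC \<i> \<eta>"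
    using assms by blast
  fix w assume "\<exists>\<xi>\<in>k. \<exists>\<eta>\<in>k. x + scaleC \<i> y = \<xi> + scaleC \<i> \<eta> \<and> w = \<xi> - scaleC \<i> \<eta>"
  then obtain \<xi> \<eta> where h: "\<xi> \<in> k" "\<eta> \<in> k" "x + scaleC \<i> y = \<xi> + scaleC \<i> \<eta>" "w = \<xi> - scaleC \<i> \<eta>" by blast
  show "w = x - scaleC \<i> y" using unique[OF assms h(1,2,3)] h(4) by simp
qed

lemma conj_fixed: "x \<in> k \<Longrightarrow> conj_wrt k x = x"
  using conj_eq[of x 0] subspace_0[OF k_subspace] by simp

lemma conj_conj: "conj_wrt k (conj_wrt k \<zeta>) = \<zeta>"
proof -
  obtain x y where h: "x \<in> k" "y \<in> k" "\<zeta> = x + scaleC \<i> y" by (rule decompose)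
  have "conj_wrt k (x + scaleC \<i> (- y)) = x - scaleC \<i> (- y)"
    by (rule conj_eq[OF h(1) subspace_neg[OF k_subspace h(2)]])
  then show ?thesis unfolding h(3) conj_eq[OF h(1,2)] by (simp add: scaleC_minus_right)
qed

lemma conj_add: "conj_wrt k (\<zeta> + \<zeta>') = conj_wrt k \<zeta> + conj_wrt k \<zeta>'"
proof -
  obtain x y where h: "x \<in> k" "y \<in> k" "\<zeta> = x + scaleC \<i> y" by (rule decompose)
  obtain x' y' where h': "x' \<in> k" "y' \<in> k" "\<zeta>' = x' + scaleC \<i> y'" by (rule decompose)
  have "conj_wrt k ((x + x') + scaleC \<i> (y + y')) = (x + x') - scaleC \<i> (y + y')"
    by (intro conj_eq subspace_add[OF k_subspace] h h')
  then show ?thesis unfolding h(3) h'(3) conj_eq[OF h(1,2)] conj_eq[OF h'(1,2)]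
    by (simp add: scaleC_add_right algebra_simps)
qed

lemma conj_scaleC: "conj_wrt k (scaleC c \<zeta>) = scaleC (cnj c) (conj_wrt k \<zeta>)"
proof -
  obtain x y where h: "x \<in> k" "y \<in> k" "\<zeta> = x + scaleC \<i> y" by (rule decompose)
  have "conj_wrt k ((Re c *\<^sub>R x - Im c *\<^sub>R y) + scaleC \<i> (Im c *\<^sub>R x + Re c *\<^sub>R y))
    = (Re c *\<^sub>R x - Im c *\<^sub>R y) - scaleC \<i> (Im c *\<^sub>R x + Re c *\<^sub>R y)"
    by (intro conj_eq subspace_add[OF k_subspace] subspace_diff[OF k_subspace] subspace_scale[OF k_subspace] h)
  moreover have "scaleC c \<zeta> = (Re c *\<^sub>R x - Im c *\<^sub>R y) + scaleC \<i> (Im c *\<^sub>R x + Re c *\<^sub>R y)"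
    unfolding h(3) by (subst scaleC_eq) (simp add: scaleC_add_right scaleC_scaleR scaleR_add_right algebra_simps)
  moreover have "scaleC (cnj c) (x - scaleC \<i> y) = (Re c *\<^sub>R x - Im c *\<^sub>R y) - scaleC \<i> (Im c *\<^sub>R x + Re c *\<^sub>R y)"
    by (subst scaleC_eq) (simp add: scaleC_add_right scaleC_diff_right scaleC_scaleR scaleR_diff_right algebra_simps)
  ultimately show ?thesis unfolding h(3) conj_eq[OF h(1,2)] by simp
qed

end

context lie_group_chart
begin

lemma real_form_conj_compatible:
  assumes K: "subgroup K G" "compact K" and rf: "real_form (lie_alg G e K)" and ip: "invariant_form G e ip"
  shows "conj_wrt (lie_alg G e K) (br \<xi> \<eta>) = br (conj_wrt (lie_alg G e K) \<xi>) (conj_wrt (lie_alg G e K) \<eta>)"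
    and "ip (conj_wrt (lie_alg G e K) \<xi>) (conj_wrt (lie_alg G e K) \<eta>) = cnj (ip \<xi> \<eta>)"
proof -
  interpret real_form "lie_alg G e K" by (rule rf)
  let ?k = "lie_alg G e K"
  obtain x y where h: "x \<in> ?k" "y \<in> ?k" "\<xi> = x + scaleC \<i> y" by (rule decompose)
  obtain x' y' where h': "x' \<in> ?k" "y' \<in> ?k" "\<eta> = x' + scaleC \<i> y'" by (rule decompose)
  note l = complex_linearD[OF br_complex_linear(1)] complex_linearD[OF br_complex_linear(2)]
  have "br \<xi> \<eta> = (br x x' - br y y') + scaleC \<i> (br x y' + br y x')"
    unfolding h(3) h'(3) by (simp add: l scaleC_add_right)
  moreover have "conj_wrt ?k ((br x x' - br y y') + scaleC \<i> (br x y' + br y x')) = (br x x' - br y y') - scaleC \<i> (br x y' + br y x')"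
    by (intro conj_eq subspace_add[OF k_subspace] subspace_diff[OF k_subspace] br_lie_alg[OF K] h h')
  ultimately show "conj_wrt ?k (br \<xi> \<eta>) = br (conj_wrt ?k \<xi>) (conj_wrt ?k \<eta>)"
    unfolding h(3) h'(3) conj_eq[OF h(1,2)] conj_eq[OF h'(1,2)] by (simp add: l scaleC_add_right scaleC_diff_right algebra_simps)
  note inv = ip[unfolded invariant_form_def]
  have p: "\<And>\<xi>. complex_linear (ip \<xi>)" "\<And>\<xi> \<eta>. ip \<xi> \<eta> = ip \<eta> \<xi>"
    by (rule conjunct1[OF inv, rule_format], rule conjunct1[OF conjunct2[OF inv], rule_format])
  have re: "\<And>\<xi> \<eta>. \<xi> \<in> ?k \<Longrightarrow> \<eta> \<in> ?k \<Longrightarrow> ip \<xi> \<eta> \<in> \<real>"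
    using conjunct2[OF conjunct2[OF conjunct2[OF conjunct2[OF inv]]]] K by blast
  note r = complex_linearD[OF p(1)]
  have left: "ip (u + scaleC \<i> v) w = ip u w + \<i> * ip v w" "ip (u - scaleC \<i> v) w = ip u w - \<i> * ip v w" for u v w
    unfolding p(2)[of _ w] by (simp_all add: r scaleC_complex_def)
  have c: "cnj (ip a b) = ip a b" if "a \<in> ?k" "b \<in> ?k" for a b using re[OF that] by (simp add: Reals_cnj_iff)
  show "ip (conj_wrt ?k \<xi>) (conj_wrt ?k \<eta>) = cnj (ip \<xi> \<eta>)"
    unfolding h(3) h'(3) conj_eq[OF h(1,2)] conj_eq[OF h'(1,2)] left
    by (simp add: r scaleC_complex_def c[OF h(1) h'(1)] c[OF h(1) h'(2)] c[OF h(2) h'(1)] c[OF h(2) h'(2)] algebra_simps)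
qed

lemma curvature_lie_alg:
  assumes K: "subgroup K G" "compact K" and U: "open U" "p \<in> U"
    and \<alpha>: "\<And>u. (\<lambda>q. \<alpha> q u) differentiable (at p)" "\<And>q u. q \<in> U \<Longrightarrow> \<alpha> q u \<in> lie_alg G e K"
  shows "conn_curvature G e \<alpha> p u v \<in> lie_alg G e K"
proof -
  note S = lie_alg_subspace[OF K]
  have "dd (\<lambda>q. \<alpha> q v) p u \<in> lie_alg G e K" for u v
    by (rule dd_in_subspace[OF fd has_derivative_dd[OF \<alpha>(1)] S U]) (rule \<alpha>(2))
  then show ?thesis
    unfolding conn_curvature_def
    by (intro subspace_add[OF S] subspace_diff[OF S] br_lie_alg[OF K] \<alpha>(2) U(2))
qed

end

lemma gdiv_inverse:
  assumes P: "holomorphic_principal_bundle AX G AG pr act S" and G: "group G" "carrier G = UNIV" and pq: "pr p = pr q"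
  shows "gdiv act q p = inv\<^bsub>G\<^esub> (gdiv act p q)"
proof -
  interpret group G by (rule G)
  note P0 = P[unfolded holomorphic_principal_bundle_def]
  have P: "act p \<one>\<^bsub>G\<^esub> = p" "act (act p a) b = act p (a \<otimes>\<^bsub>G\<^esub> b)" for p a b
    using conjunct1[OF P0] conjunct1[OF conjunct2[OF P0]] by simp_all
  have fibre: "\<exists>!a. q = act p a" if "pr p = pr q" for p q
    by (rule conjunct1[OF conjunct2[OF conjunct2[OF conjunct2[OF P0]]], rule_format, OF that])
  have g: "gdiv act p q = a" if "q = act p a" "pr p = pr q" for p q a
    unfolding gdiv_def by (rule the1_equality[OF fibre[OF that(2)] that(1)])
  obtain a where a: "q = act p a" by (rule ex1E[OF fibre[OF pq]])
  have "p = act q (inv\<^bsub>G\<^esub> a)" unfolding a P(2) using G(2) by (simp add: P(1))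
  from g[OF this pq[symmetric]] g[OF a pq] show ?thesis by simp
qed

text \<open>
  Near the given point \<open>t = s a\<close> with a holomorphic section \<open>s\<close> and \<open>s = t a\<^sup>-\<^sup>1\<close>, so \<open>curvature_02\<close> applies. Its
  conclusion has the form \<open>x + \<i> y = 0\<close> with \<open>x\<close> and \<open>y\<close> in the real form, hence \<open>x = 0\<close>.
\<close>

lemma chern_curvature_11:
  assumes AX: "complex_manifold AX" and lie: "lie_group_chart G AG e"
    and P: "holomorphic_principal_bundle AX G AG pr act S"
    and K: "subgroup K G" "compact K" and rf: "real_form (lie_alg G e K)"
    and \<theta>: "chern_connection_on AX G AG e pr act S K Ph \<theta>"
    and c: "c \<in> AX" and t: "t \<in> local_sections AX AG pr act S Ph" and p: "p \<in> cdom c t"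
  shows "conn_curvature G e (\<theta> c t) p (scaleC \<i> u) (scaleC \<i> v) = conn_curvature G e (\<theta> c t) p u v"
proof -
  interpret lie_group_chart G AG e by (rule lie)
  interpret real_form "lie_alg G e K" by (rule rf)
  note cf = chart_facts[OF AX c]
  let ?\<alpha> = "\<theta> c t"
  have con: "\<And>u. smooth_on (cdom c t) (\<lambda>p. ?\<alpha> p u)" "\<And>p. p \<in> cdom c t \<Longrightarrow> linear (?\<alpha> p)"
    "\<And>p u. p \<in> cdom c t \<Longrightarrow> ?\<alpha> p u \<in> lie_alg G e K"
    using \<theta> c t unfolding chern_connection_on_def connection_on_def by blast+
  obtain W \<sigma> where t_eq: "t = (W, \<sigma>)" by (cases t)
  have W: "open W" "\<And>x. x \<in> W \<Longrightarrow> pr (\<sigma> x) = x"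
    "\<And>V s. (V, s) \<in> S \<Longrightarrow> smooth_map_on AX AG (V \<inter> W) (\<lambda>x. gdiv act (s x) (\<sigma> x))"
    using t unfolding t_eq local_sections_def by blast+
  obtain x where x: "x \<in> fst c" "x \<in> W" "p = snd c x" using p unfolding cdom_def t_eq by auto
  have "x \<in> (\<Union>(V, s)\<in>S. V)" using P unfolding holomorphic_principal_bundle_def by auto
  then obtain V s where s: "(V, s) \<in> S" "x \<in> V" by blast
  have V: "open V" "\<And>x. x \<in> V \<Longrightarrow> pr (s x) = x"
    using P s(1) unfolding holomorphic_principal_bundle_def by blast+
  define f where "f = (\<lambda>x. gdiv act (s x) (\<sigma> x))"
  define a where "a = f \<circ> chart_inv c"
  define b where "b = (\<lambda>q. gdiv act (snd t (chart_inv c q)) (snd (V, s) (chart_inv c q)))"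
  define U where "U = snd c ` (fst c \<inter> (V \<inter> W))"
  have U_open: "open U"
    unfolding U_def by (rule chart_image_open[OF AX c]) (auto intro: open_Int cf(1) V(1) W(1))
  have pU: "p \<in> U" using x s by (auto simp: U_def)
  have U_sub: "U \<subseteq> cdom c t" "U \<subseteq> cdom c (V, s)" unfolding U_def cdom_def t_eq by auto
  note sm = W(3)[OF s(1), folded f_def]
  have "gsmooth U a"
    unfolding gsmooth_def
  proof
    fix d assume d: "d \<in> AG"
    have eq: "U \<inter> a -` fst d = snd c ` (fst c \<inter> (V \<inter> W) \<inter> f -` fst d)"
      unfolding U_def a_def using cf(5) by auto
    have "open ((V \<inter> W) \<inter> f -` fst d)"
      using sm chart_facts(1)[OF mfd d] V(1) W(1) unfolding smooth_map_on_def
      by (intro continuous_open_preimage open_Int) auto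
    then have "open (fst c \<inter> (V \<inter> W) \<inter> f -` fst d)"
      using open_Int[OF cf(1)] by (simp add: Int_assoc)
    then have "open (U \<inter> a -` fst d)"
      unfolding eq by (rule chart_image_open[OF AX c]) auto
    moreover have "smooth_on (U \<inter> a -` fst d) (\<lambda>p. snd d (a p))"
      using sm c d unfolding smooth_map_on_def eq by (auto simp: a_def o_def)
    ultimately show "open (U \<inter> a -` fst d) \<and> smooth_on (U \<inter> a -` fst d) (\<lambda>p. snd d (a p))" by blast
  qed
  moreover have "b q = inv\<^bsub>G\<^esub> (a q)" if "q \<in> U" for q
  proof -
    have "chart_inv c q \<in> V \<inter> W" using that cf(5) unfolding U_def by auto
    then show ?thesis
      unfolding a_def b_def f_def t_eq using gdiv_inverse[OF P grp carrier, of "s (chart_inv c q)" "\<sigma> (chart_inv c q)"] V(2) W(2) by simp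
  qed
  moreover have "complex_linear (gauge G e ?\<alpha> b q)" if "q \<in> U" for q
    using \<theta> c t s(1) U_sub that unfolding chern_connection_on_def b_def by blast
  moreover have "(\<lambda>q. ?\<alpha> q u) differentiable (at p)" for u by (rule smooth_on_differentiable[OF con(1) p])
  moreover have "linear (?\<alpha> q)" if "q \<in> U" for q using con(2) U_sub that by blast
  ultimately have z: "conn_curvature G e ?\<alpha> p u v - conn_curvature G e ?\<alpha> p (scaleC \<i> u) (scaleC \<i> v)
    + scaleC \<i> (conn_curvature G e ?\<alpha> p (scaleC \<i> u) v + conn_curvature G e ?\<alpha> p u (scaleC \<i> v)) = 0"
    using curvature_02[OF _ pU _ U_open] by blast
  have k: "conn_curvature G e ?\<alpha> p u v \<in> lie_alg G e K" for u v
    by (rule curvature_lie_alg[OF K U_open pU smooth_on_differentiable[OF con(1) p]]) (use con(3) U_sub in blast)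
  have "conn_curvature G e ?\<alpha> p u v - conn_curvature G e ?\<alpha> p (scaleC \<i> u) (scaleC \<i> v) = 0"
    by (rule unique(1)[of _ "conn_curvature G e ?\<alpha> p (scaleC \<i> u) v + conn_curvature G e ?\<alpha> p u (scaleC \<i> v)" 0 0])
       (use z in \<open>auto intro: subspace_add[OF k_subspace] subspace_diff[OF k_subspace] k subspace_0[OF k_subspace]\<close>)
  then show ?thesis by simp
qed

theorem proposition5p5:
  fixes AX :: "('x::{t2_space, second_countable_topology}, complex^'n) chart set"
    and G :: "'g::{t2_space, second_countable_topology} monoid"
    and AG :: "('g, 'l::complex_normed_vector) chart set"
    and e :: "('g, 'l) chart"
    and ip :: "'l \<Rightarrow> 'l \<Rightarrow> complex"
    and pr :: "'p \<Rightarrow> 'x" and act :: "'p \<Rightarrow> 'g \<Rightarrow> 'p" and S :: "('x set \<times> ('x \<Rightarrow> 'p)) set"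
    and K :: "'g set" and Ph :: "'p set"
    and g :: "('x, complex^'n) chart \<Rightarrow> complex^'n \<Rightarrow> complex^'n \<Rightarrow> complex^'n \<Rightarrow> real"
    and \<theta> :: "('x, complex^'n) chart \<Rightarrow> ('x set \<times> ('x \<Rightarrow> 'p)) \<Rightarrow> complex^'n \<Rightarrow> complex^'n \<Rightarrow> 'l"
    and z :: 'l
  assumes "complex_manifold AX"
    and "complex_lie_group G AG" and "e \<in> AG" and "\<one>\<^bsub>G\<^esub> \<in> fst e"
    and "complex_reductive G e"
    and "invariant_form G e ip"
    and "holomorphic_principal_bundle AX G AG pr act S"
    and "maximal_compact_subgroup G K"
    and "hermitian_metric AX g"
    and "reduction AX AG pr act S K Ph"
    and "chern_connection_on AX G AG e pr act S K Ph \<theta>"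
    and "z \<in> lie_alg G e K" and "\<forall>\<xi>\<in>lie_alg G e K. lie_bracket G e z \<xi> = 0"
    and "coupled_hermitian_einstein AX G AG e ip pr act S Ph g \<theta> z"
  shows "\<forall>c\<in>AX. \<forall>t\<in>local_sections AX AG pr act S Ph. \<forall>A.
    chern_connection_form (cdom c t) (dolbeault_Q G e ip (g c) (\<theta> c t))
      (metric_Q ip (lie_alg G e K) (g c)) A \<longrightarrow>
    (\<forall>p\<in>cdom c t. \<forall>q v.
      wedge 2 (2 * (CARD('n) - 1)) (\<lambda>a r. r *\<^sub>R a) (\<lambda>v. vb_curvature A p (v 0) (v 1) q)
        (wedge_power (herm_form (g c) p) (CARD('n) - 1)) v = 0)"
proof (intro ballI allI impI)
  fix c t A p X v
  assume c: "c \<in> AX" and t: "t \<in> local_sections AX AG pr act S Ph"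
    and A: "chern_connection_form (cdom c t) (dolbeault_Q G e ip (g c) (\<theta> c t)) (metric_Q ip (lie_alg G e K) (g c)) A"
    and p: "p \<in> cdom c t"
  let ?U = "cdom c t" and ?k = "lie_alg G e K"
  interpret L: lie_group_chart G AG e by unfold_locales (fact assms)+
  have K: "subgroup K G" "compact K" using assms(8) unfolding maximal_compact_subgroup_def by blast+
  have "complexification_of G e K" using assms(5,8) unfolding complex_reductive_def by blast
  then interpret R: real_form ?k
    by unfold_locales (rule L.lie_alg_subspace[OF K], simp add: complexification_of_def)
  have rf: "real_form ?k" by unfold_locales
  note lie = L.lie_group_chart_axioms
  have W: "open (fst t)" using t unfolding local_sections_def by auto
  have U_open: "open ?U"
    unfolding cdom_def by (rule chart_image_open[OF assms(1) c]) (auto intro: open_Int chart_facts(1)[OF assms(1) c] W)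
  have U_sub: "?U \<subseteq> snd c ` fst c" unfolding cdom_def by auto
  have m: "\<And>u v. smooth_on (snd c ` fst c) (\<lambda>p. g c p u v)"
    "\<And>p u. p \<in> snd c ` fst c \<Longrightarrow> linear (g c p u)" "\<And>p u v. p \<in> snd c ` fst c \<Longrightarrow> g c p u v = g c p v u"
    "\<And>p u. p \<in> snd c ` fst c \<Longrightarrow> u \<noteq> 0 \<Longrightarrow> g c p u u > 0"
    "\<And>p u v. p \<in> snd c ` fst c \<Longrightarrow> g c p (scaleC \<i> u) (scaleC \<i> v) = g c p u v"
    using assms(9) c unfolding hermitian_metric_def by blast+
  interpret M: hermitian_chart ?U "g c"
    by (rule hermitian_chart.intro)
       (use U_open smooth_on_subset[OF m(1) U_sub] m(2-5)[OF subsetD[OF U_sub]] in blast)+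
  have con: "\<And>u. smooth_on ?U (\<lambda>p. \<theta> c t p u)" "\<And>p. p \<in> ?U \<Longrightarrow> linear (\<theta> c t p)" "\<And>p u. p \<in> ?U \<Longrightarrow> \<theta> c t p u \<in> ?k"
    using assms(11) c t unfolding chern_connection_on_def connection_on_def by blast+
  note inv = assms(6)[unfolded invariant_form_def]
  have ip: "\<And>\<xi>. complex_linear (ip \<xi>)" "\<And>\<xi> \<eta>. ip \<xi> \<eta> = ip \<eta> \<xi>" "\<And>\<xi>. (\<And>\<eta>. ip \<xi> \<eta> = 0) \<Longrightarrow> \<xi> = 0"
    by (rule conjunct1[OF inv, rule_format], rule conjunct1[OF conjunct2[OF inv], rule_format])
      (use conjunct1[OF conjunct2[OF conjunct2[OF inv]]] in blast)
  have bz: "lie_bracket G e z \<xi> = 0" for \<xi>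
  proof -
    obtain x y where "x \<in> ?k" "y \<in> ?k" "\<xi> = x + scaleC \<i> y" by (rule R.decompose)
    then show ?thesis using assms(13) by (simp add: complex_linearD[OF L.br_complex_linear(2)])
  qed
  have che: "\<And>q. q \<in> ?U \<Longrightarrow> coupled_hermitian_einstein_at ip z (g c) (conn_curvature G e (\<theta> c t)) q"
    using assms(14) c t unfolding coupled_hermitian_einstein_def by blast
  interpret Q: gauge_chart ?U "g c" G e ip ?k "\<theta> c t" z
    by (intro gauge_chart.intro gauge_chart_axioms.intro M.hermitian_chart_axioms L.fd L.br_bounded_bilinear
        L.br_complex_linear(2) L.br_antisym L.br_jacobi L.invariant_form_br[OF assms(6)] ip R.conj_add R.conj_scaleC R.conj_conj
        L.real_form_conj_compatible[OF K rf assms(6)] con(1,2) R.conj_fixed[OF con(3)] bz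
        chern_curvature_11[OF assms(1) lie assms(7) K rf assms(11) c t] che)
  show "wedge 2 (2 * (CARD('n) - 1)) (\<lambda>a r. r *\<^sub>R a) (\<lambda>v. vb_curvature A p (v 0) (v 1) X)
      (wedge_power (herm_form (g c) p) (CARD('n) - 1)) v = 0"
    by (rule Q.hermitian_einstein_Q[OF A p])
qed

end
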